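(* Consider $(\widehat{\bf u},\widetilde p,\widehat T)$, with $\widehat u_3=0$, satisfying the limit system for $0<\ell<1$ given in the context. Define the average velocity and temperature by $${\bf V}_{\rm av}(x')=\int_0^{h_{\max}}\widetilde{\bf u}(x',z_3)\,dz_3,\qquad T_{\rm av}(x')=\int_0^{h_{\max}}\widetilde T(x',z_3)\,dz_3,$$ and the parameter $M=\sqrt{\mu/(K\mu_{\rm eff})}>0$. Then: (i) The average velocity ${\bf V}_{\rm av}$ is given by $${\bf V}_{\rm av}'(x')=-\frac{K}{\mu}A_M\big({\bf f}'(x')-\nabla_{x'}\widetilde p(x')\big),\qquad V_{{\rm av},3}\equiv0,\qquad\text{in }\omega,$$ where $A_M\in\mathbb R^{2\times2}$ is given by $$(A_M)_{ij}=-\int_{Z'}\left(\frac{2}{M}\,\frac{e^{Mh(z')}-e^{-Mh(z')}-2}{e^{Mh(z')}-e^{-Mh(z')}}-h(z')\right)\big(e_i+\nabla_{z'}\pi^i(z')\big)\cdot e_j\,dz',\quad i,j=1,2.$$ Here, $\pi^i\in H^1_\#(Z')$, $i=1,2$, is the unique solution of $$-{\rm div}_{z'}\left\{\left(\frac{2}{M}\,\frac{e^{Mh(z')}-e^{-Mh(z')}-2}{e^{Mh(z')}-e^{-Mh(z')}}-h(z')\right)\big(e_i+\nabla_{z'}\pi^i(z')\big)\right\}=0\quad\text{in }Z'.$$ (ii) The pressure $\widetilde p\in L^2_0(\omega)\cap H^1(\omega)$ is the unique solution of the Reynolds equation $$-{\rm div}_{x'}\left(\frac{K}{\mu}A_M(\nabla_{x'}\widetilde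 p(x')-{\bf f}'(x'))\right)=0\ \text{ in }\omega,\qquad \left(\frac{K}{\mu}A_M(\nabla_{x'}\widetilde p(x')-{\bf f}'(x'))\right)\cdot n=0\ \text{ on }\partial\omega.$$ (iii) The average temperature $T_{\rm av}$ is given by $T_{\rm av}(x')=\int_Z\widehat T(x',z)\,dz$ with $$\begin{aligned}\widehat T(x',z)=\ &-\frac{b}{k}-\frac{\mu}{k\,K}\left(\int_{z_3}^{1}\int_\xi^{1}|\widehat{\bf u}'(x',z',\tau)|^2\,d\tau\,d\xi-z_3\int_0^{1}|\widehat{\bf u}'(x',z',\xi)|^2\,d\xi\right)\\&-\frac{\mu_{\rm eff}}{k}\left(\int_{z_3}^{1}\int_\xi^{1}|\partial_{z_3}\widehat{\bf u}'(x',z',\tau)|^2\,d\tau\,d\xi-z_3\int_0^{1}|\partial_{z_3}\widehat{\bf u}'(x',z',\xi)|^2\,d\xi\right),\end{aligned}$$ where the expression for $\widehat{\bf u}'$ is $$\widehat{\bf u}'(x',z)=\frac{K}{\mu}\sum_{i=1}^2\big(f_i(x')-\partial_{x_i}\widetilde p(x')\big)\Big(A_1^\star(z')e^{Mz_3}+A_2^\star(z')e^{-Mz_3}+1\Big)\big(e_i+\nabla_{z'}\pi^i(z')\big),$$ with $$A_1^\star(z')=-\frac{1-e^{-Mh(z')}}{e^{Mh(z')}-e^{-Mh(z')}},\qquad A_2^\star(z')=\frac{1-e^{Mh(z')}}{e^{Mh(z')}-e^{-Mh(z')}}.$$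
   Context: $\omega\subset\mathbb R^2$ is a connected open set with Lipschitz boundary and outward normal $n$, $Z'=(-1/2,1/2)^2$, $h:\mathbb R^2\to\mathbb R$ is a bounded $Z'$-periodic $W^{1,\infty}$ function with $0<h_{\min}=\min h\le h\le h_{\max}=\max h$. $Z=\{(z',z_3):z'\in Z',\ 0<z_3<h(z')\}$, $\widehat\Gamma_0=Z'\times\{0\}$, $\widehat\Gamma_1=\{(z',h(z')):z'\in Z'\}$. $\mu,\mu_{\rm eff},K,k$ are positive constants (dynamic viscosity, effective viscosity, rescaled permeability, thermal conductivity), ${\bf f}'=(f_1,f_2)\in L^2(\omega)^2$, $b$ is the given (rescaled) heat-flux datum, $q\in(1,3/2)$, and $e_1,e_2$ is the canonical basis of $\mathbb R^2$. The subscript $\#$ means $Z'$-periodic in $z'$; $L^2_0$ means mean-zero; $V^r_{z_3,\#}(\omega\times Z)=\{\varphi\in L^r(\omega;L^r_\#(Z)):\partial_{z_3}\varphi\in L^r(\omega\times Z)\}$. For a vector ${\bf v}$, ${\bf v}'$ denotes its first two components. The functions $\widehat{\bf u}=(\widehat{\bf u}',0)\in V^2_{z_3,\#}(\omega\times Z)^3$, $\widetilde p\in L^2_0(\omega)\cap H^1(\omega)$, $\widehat T\in V^q_{z_3,\#}(\omega\times Z)$ satisfy, for some $\widehat\pi=\widehat\pi(x',z')\in L^2(\omega;L^2_{0,\#}(Z'))$, the limit system for $0<\ell<1$ (where $\varepsilon$ is the film thickness parameter and $\varepsilon^\ell$ the roughness period of a thin-film Darcy–Brinkman flow with viscous dissipation):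 $$\left\{\begin{array}{rl} -\mu_{\rm eff}\,\partial_{z_3}^2\widehat{\bf u}'+\frac{\mu}{K}\widehat{\bf u}'+\nabla_{z'}\widehat\pi={\bf f}'(x')-\nabla_{x'}\widetilde p(x') & \text{in }\omega\times Z,\\ {\rm div}_{z'}\left(\int_0^{h(z')}\widehat{\bf u}'\,dz_3\right)=0 & \text{in }\omega\times Z',\\ -k\,\partial_{z_3}^2\widehat T=\frac{\mu}{K}|\widehat{\bf u}'|^2+\mu_{\rm eff}|\partial_{z_3}\widehat{\bf u}'|^2 & \text{in }\omega\times Z,\\ \widehat{\bf u}'=0 & \text{on }\omega\times(\widehat\Gamma_0\cup\widehat\Gamma_1),\\ \widehat T=0 & \text{on }\omega\times\widehat\Gamma_1,\\ -k\,\partial_{z_3}\widehat T=b & \text{on }\omega\times\widehat\Gamma_0. \end{array}\right.$$ The functions $\widetilde{\bf u},\widetilde T$ on $\omega\times(0,h_{\max})$ are the corresponding macroscopic limits, related to $\widehat{\bf u},\widehat T$ (extended by zero to $h(z')<z_3<h_{\max}$ in these relations) by $$\widetilde{\bf u}(x',z_3)=\int_{Z'}\widehat{\bf u}(x',z',z_3)\,dz',\qquad \widetilde T(x',z_3)=\int_{Z'}\widehat T(x',z',z_3)\,dz',$$ and satisfying $${\rm div}_{x'}\left(\int_0^{h_{\max}}\widetilde{\bf u}'(x',z_3)\,dz_3\right)=0\ \text{ in }\omega,\qquad\left(\int_0^{h_{\max}}\widetilde{\bf u}'(x',z_3)\,dz_3\right)\cdot n=0\ \text{ on }\partial\omeg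a.$$
   Formalization: Corrected: numerator e^{Mh}+e^{-Mh}-2 in A_M and cell problem; V_av' = -(K/μ)A_M(∇p-f'); in T the limits 1 become h(z'), -z_3 becomes -(h-z_3), -b/k becomes -(b/k)(z_3-h); π^i unique up to constants; z'-periodic equations hold across cell faces. *)

theory Defs
  imports "HOL-Analysis.Analysis"
begin

section \<open>Distributions, Lebesgue and Sobolev classes\<close>

text \<open>
  Elements of Lebesgue classes are represented by functions on the whole ambient type that are
  Borel measurable on the set in question; equality of classes is equality almost everywhere.
  Weak derivatives are relations between a function and its derivative, in the style of
  \<^const>\<open>has_derivative\<close>.
\<close>

definition dir_deriv :: "'a::euclidean_space \<Rightarrow> ('a \<Rightarrow> real) \<Rightarrow> 'a \<Rightarrow> real" where
  "dir_deriv v \<psi> x = frechet_derivative \<psi> (at x) v"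

coinductive smooth_fun :: "('a::euclidean_space \<Rightarrow> real) \<Rightarrow> bool" where
  "(\<And>x. \<psi> differentiable (at x)) \<Longrightarrow> (\<And>v. smooth_fun (dir_deriv v \<psi>)) \<Longrightarrow> smooth_fun \<psi>"

definition test_fun :: "'a::euclidean_space set \<Rightarrow> ('a \<Rightarrow> real) set" where
  "test_fun \<Omega> = {\<psi>. smooth_fun \<psi> \<and> compact (closure {x. \<psi> x \<noteq> 0}) \<and> closure {x. \<psi> x \<noteq> 0} \<subseteq> \<Omega>}"

definition grad :: "(real^2 \<Rightarrow> real) \<Rightarrow> real^2 \<Rightarrow> real^2" where
  "grad \<psi> x = (\<chi> i. dir_deriv (axis i 1) \<psi> x)"

definition locally_integrable ::
    "'a::euclidean_space set \<Rightarrow> ('a \<Rightarrow> 'b::euclidean_space) \<Rightarrow> bool" where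
  "locally_integrable \<Omega> f \<longleftrightarrow> (\<forall>C. compact C \<and> C \<subseteq> \<Omega> \<longrightarrow> set_integrable lborel C f)"

definition Lp :: "real \<Rightarrow> 'a::euclidean_space set \<Rightarrow> ('a \<Rightarrow> 'b::euclidean_space) \<Rightarrow> bool" where
  "Lp r S f \<longleftrightarrow> set_borel_measurable lborel S f \<and> set_integrable lborel S (\<lambda>x. norm (f x) powr r)"

definition weak_deriv ::
    "'a::euclidean_space set \<Rightarrow> 'a \<Rightarrow> ('a \<Rightarrow> 'b::euclidean_space) \<Rightarrow> ('a \<Rightarrow> 'b) \<Rightarrow> bool" where
  "weak_deriv \<Omega> v f g \<longleftrightarrow> locally_integrable \<Omega> f \<and> locally_integrable \<Omega> g \<and>
     (\<forall>\<psi>\<in>test_fun \<Omega>. (LINT x:\<Omega>|lborel. dir_deriv v \<psi> x *\<^sub>R f x) = - (LINT x:\<Omega>|lborel. \<psi> x *\<^sub>R g x))"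

definition weak_grad :: "(real^2) set \<Rightarrow> (real^2 \<Rightarrow> real) \<Rightarrow> (real^2 \<Rightarrow> real^2) \<Rightarrow> bool" where
  "weak_grad \<Omega> f G \<longleftrightarrow> (\<forall>i. weak_deriv \<Omega> (axis i 1) f (\<lambda>x. G x $ i))"

definition weak_div :: "(real^2) set \<Rightarrow> (real^2 \<Rightarrow> real^2) \<Rightarrow> (real^2 \<Rightarrow> real) \<Rightarrow> bool" where
  "weak_div \<Omega> v d \<longleftrightarrow> locally_integrable \<Omega> v \<and> locally_integrable \<Omega> d \<and>
     (\<forall>\<psi>\<in>test_fun \<Omega>. (LINT x:\<Omega>|lborel. v x \<bullet> grad \<psi> x) = - (LINT x:\<Omega>|lborel. d x * \<psi> x))"

definition H1 :: "(real^2) set \<Rightarrow> (real^2 \<Rightarrow> real) \<Rightarrow> (real^2 \<Rightarrow> real^2) \<Rightarrow> bool" where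
  "H1 \<Omega> f G \<longleftrightarrow> Lp 2 \<Omega> f \<and> Lp 2 \<Omega> G \<and> weak_grad \<Omega> f G"

definition L2_0 :: "(real^2) set \<Rightarrow> (real^2 \<Rightarrow> real) \<Rightarrow> bool" where
  "L2_0 \<Omega> f \<longleftrightarrow> Lp 2 \<Omega> f \<and> set_integrable lborel \<Omega> f \<and> (LINT x:\<Omega>|lborel. f x) = 0"

text \<open>
  For a continuous representative, membership in \<open>W\<^sup>1\<^sup>,\<^sup>\<infinity>\<close> of the plane.
\<close>

definition W1inf :: "(real^2 \<Rightarrow> real) \<Rightarrow> bool" where
  "W1inf h \<longleftrightarrow> continuous_on UNIV h \<and> bounded (range h) \<and>
     (\<exists>G C. weak_grad UNIV h G \<and> (AE z in lborel. norm (G z) \<le> C))"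

text \<open>
  The normal trace of a field in \<open>L\<^sup>2\<close> with divergence in \<open>L\<^sup>2\<close> is the functional
  \<open>\<phi> \<mapsto> \<integral>\<^sub>\<Omega> v \<bullet> \<nabla>\<phi> + (div v) \<phi>\<close> on \<open>H\<^sup>1(\<Omega>)\<close>.
\<close>

definition normal_trace_zero :: "(real^2) set \<Rightarrow> (real^2 \<Rightarrow> real^2) \<Rightarrow> bool" where
  "normal_trace_zero \<Omega> v \<longleftrightarrow> Lp 2 \<Omega> v \<and>
     (\<exists>d. Lp 2 \<Omega> d \<and> weak_div \<Omega> v d \<and>
       (\<forall>\<phi> G. H1 \<Omega> \<phi> G \<longrightarrow> (LINT x:\<Omega>|lborel. v x \<bullet> G x + d x * \<phi> x) = 0))"

definition lipschitz_boundary :: "(real^2) set \<Rightarrow> bool" where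
  "lipschitz_boundary \<Omega> \<longleftrightarrow>
     (\<forall>x\<in>frontier \<Omega>. \<exists>r>0. \<exists>Q \<gamma> L. orthogonal_transformation Q \<and> L-lipschitz_on (UNIV::real set) \<gamma> \<and>
        \<Omega> \<inter> ball x r = {y \<in> ball x r. \<gamma> (Q y $ 1) < (Q y :: real^2) $ 2})"


section \<open>The periodic cell\<close>

definition cell :: "(real^2) set" where
  "cell = {z. \<forall>i. -1/2 < z $ i \<and> z $ i < 1/2}"

definition periodic :: "(real^2 \<Rightarrow> 'b) \<Rightarrow> bool" where
  "periodic g \<longleftrightarrow> (\<forall>z i. g (z + axis i 1) = g z)"

definition Zcell :: "(real^2 \<Rightarrow> real) \<Rightarrow> ((real^2) \<times> real) set" where
  "Zcell h = {(z, s). z \<in> cell \<and> 0 < s \<and> s < h z}"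

text \<open>
  Functions with the subscript \<open>#\<close> are identified with their periodic extensions to all \<open>z'\<close> in the
  plane, i.e. to the periodic layer \<open>Zper h\<close>.  Norms are taken over one period, while
  equations hold in the periodic layer, hence also across the faces of the cell.
\<close>

definition Zper :: "(real^2 \<Rightarrow> real) \<Rightarrow> ((real^2) \<times> real) set" where
  "Zper h = {(z, s). 0 < s \<and> s < h z}"

definition e3 :: "(real^2) \<times> (real^2) \<times> real" where
  "e3 = (0, 0, 1)"

definition H1_per :: "(real^2 \<Rightarrow> real) \<Rightarrow> (real^2 \<Rightarrow> real^2) \<Rightarrow> bool" where
  "H1_per g G \<longleftrightarrow> periodic g \<and> periodic G \<and> Lp 2 cell g \<and> Lp 2 cell G \<and> weak_grad UNIV g G"

definition V_z3 :: "real \<Rightarrow> (real^2) set \<Rightarrow> (real^2 \<Rightarrow> real) \<Rightarrow>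
    ((real^2) \<times> (real^2) \<times> real \<Rightarrow> 'b::euclidean_space) \<Rightarrow> ((real^2) \<times> (real^2) \<times> real \<Rightarrow> 'b) \<Rightarrow> bool" where
  "V_z3 r \<omega> h g D \<longleftrightarrow>
     (\<forall>x s. periodic (\<lambda>z. g (x, z, s)) \<and> periodic (\<lambda>z. D (x, z, s))) \<and>
     Lp r (\<omega> \<times> Zcell h) g \<and> Lp r (\<omega> \<times> Zcell h) D \<and> weak_deriv (\<omega> \<times> Zper h) e3 g D"

text \<open>
  Traces on the bottom \<open>z\<^sub>3 = 0\<close> and on the top \<open>z\<^sub>3 = h(z')\<close> of a function \<open>g\<close> with \<open>\<partial>\<^sub>3 g = D\<close>, given by
  Green's formula \<open>\<integral> g \<partial>\<^sub>3\<psi> + D \<psi> = \<integral> (g\<psi>)(h(z')) - (g\<psi>)(0)\<close> with \<open>\<psi>\<close> vanishing near the other face.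
\<close>

definition trace_bottom :: "(real^2) set \<Rightarrow> (real^2 \<Rightarrow> real) \<Rightarrow>
    ((real^2) \<times> (real^2) \<times> real \<Rightarrow> 'b::euclidean_space) \<Rightarrow> ((real^2) \<times> (real^2) \<times> real \<Rightarrow> 'b) \<Rightarrow>
    ((real^2) \<times> (real^2) \<Rightarrow> 'b) \<Rightarrow> bool" where
  "trace_bottom \<omega> h g D t \<longleftrightarrow> locally_integrable (\<omega> \<times> UNIV) t \<and>
     (\<forall>\<psi> \<in> test_fun {(x, z, s). x \<in> \<omega> \<and> s < h z}.
        (LINT y:\<omega> \<times> Zper h|lborel. dir_deriv e3 \<psi> y *\<^sub>R g y + \<psi> y *\<^sub>R D y)
        = - (LINT (x, z):\<omega> \<times> UNIV|lborel. \<psi> (x, z, 0) *\<^sub>R t (x, z)))"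

definition trace_top :: "(real^2) set \<Rightarrow> (real^2 \<Rightarrow> real) \<Rightarrow>
    ((real^2) \<times> (real^2) \<times> real \<Rightarrow> 'b::euclidean_space) \<Rightarrow> ((real^2) \<times> (real^2) \<times> real \<Rightarrow> 'b) \<Rightarrow>
    ((real^2) \<times> (real^2) \<Rightarrow> 'b) \<Rightarrow> bool" where
  "trace_top \<omega> h g D t \<longleftrightarrow> locally_integrable (\<omega> \<times> UNIV) t \<and>
     (\<forall>\<psi> \<in> test_fun {(x, z, s). x \<in> \<omega> \<and> 0 < s}.
        (LINT y:\<omega> \<times> Zper h|lborel. dir_deriv e3 \<psi> y *\<^sub>R g y + \<psi> y *\<^sub>R D y)
        = (LINT (x, z):\<omega> \<times> UNIV|lborel. \<psi> (x, z, h z) *\<^sub>R t (x, z)))"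


section \<open>The limit system\<close>

definition horiz :: "real^3 \<Rightarrow> real^2" where
  "horiz v = vector [v $ 1, v $ 2]"

text \<open>The gradient of \<open>\<pi>\<close> is only a distribution, so it is moved onto the test function.\<close>

definition momentum_eq :: "real \<Rightarrow> real \<Rightarrow> real \<Rightarrow> (real^2) set \<Rightarrow> (real^2 \<Rightarrow> real) \<Rightarrow>
    ((real^2) \<times> (real^2) \<times> real \<Rightarrow> real^3) \<Rightarrow> ((real^2) \<times> (real^2) \<times> real \<Rightarrow> real^3) \<Rightarrow>
    ((real^2) \<times> (real^2) \<Rightarrow> real) \<Rightarrow> (real^2 \<Rightarrow> real^2) \<Rightarrow> (real^2 \<Rightarrow> real^2) \<Rightarrow> bool" where
  "momentum_eq \<mu> \<mu>eff K \<omega> h u Du \<pi> f Dp \<longleftrightarrow>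
     (\<forall>i. \<forall>\<psi> \<in> test_fun (\<omega> \<times> Zper h).
        (LINT (x, z, s):\<omega> \<times> Zper h|lborel.
            \<mu>eff * (horiz (Du (x, z, s)) $ i * dir_deriv e3 \<psi> (x, z, s))
          + \<mu> / K * (horiz (u (x, z, s)) $ i * \<psi> (x, z, s))
          - \<pi> (x, z) * dir_deriv (0, axis i 1, 0) \<psi> (x, z, s))
      = (LINT (x, z, s):\<omega> \<times> Zper h|lborel. (f x $ i - Dp x $ i) * \<psi> (x, z, s)))"

definition pressure_L2_0_per :: "(real^2) set \<Rightarrow> ((real^2) \<times> (real^2) \<Rightarrow> real) \<Rightarrow> bool" where
  "pressure_L2_0_per \<omega> \<pi> \<longleftrightarrow> (\<forall>x. periodic (\<lambda>z. \<pi> (x, z))) \<and> Lp 2 (\<omega> \<times> cell) \<pi> \<and>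
     (AE x\<in>\<omega> in lborel. (LINT z:cell|lborel. \<pi> (x, z)) = 0)"

definition cell_div_eq :: "(real^2) set \<Rightarrow> (real^2 \<Rightarrow> real) \<Rightarrow>
    ((real^2) \<times> (real^2) \<times> real \<Rightarrow> real^3) \<Rightarrow> bool" where
  "cell_div_eq \<omega> h u \<longleftrightarrow>
     (\<forall>\<psi> \<in> test_fun (\<omega> \<times> (UNIV :: (real^2) set)).
        (LINT (x, z):\<omega> \<times> UNIV|lborel.
           (LINT s:{0<..<h z}|lborel. horiz (u (x, z, s))) \<bullet>
             (\<chi> i. dir_deriv (0, axis i 1) \<psi> (x, z))) = 0)"

definition dissipation :: "real \<Rightarrow> real \<Rightarrow> real \<Rightarrow> real^3 \<Rightarrow> real^3 \<Rightarrow> real" where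
  "dissipation \<mu> \<mu>eff K v w = \<mu> / K * (norm (horiz v))\<^sup>2 + \<mu>eff * (norm (horiz w))\<^sup>2"

text \<open>
  \<open>Du\<close>, \<open>DT\<close> are the \<open>z\<^sub>3\<close>-derivatives of \<open>u\<close>, \<open>T\<close>, and \<open>Dp\<close> is the gradient of \<open>p\<close>.
\<close>

definition limit_system :: "real \<Rightarrow> real \<Rightarrow> real \<Rightarrow> real \<Rightarrow> real \<Rightarrow> (real^2) set \<Rightarrow> (real^2 \<Rightarrow> real) \<Rightarrow>
    (real^2 \<Rightarrow> real^2) \<Rightarrow> (real^2 \<Rightarrow> real) \<Rightarrow>
    ((real^2) \<times> (real^2) \<times> real \<Rightarrow> real^3) \<Rightarrow> ((real^2) \<times> (real^2) \<times> real \<Rightarrow> real^3) \<Rightarrow>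
    (real^2 \<Rightarrow> real) \<Rightarrow> (real^2 \<Rightarrow> real^2) \<Rightarrow>
    ((real^2) \<times> (real^2) \<times> real \<Rightarrow> real) \<Rightarrow> ((real^2) \<times> (real^2) \<times> real \<Rightarrow> real) \<Rightarrow> bool" where
  "limit_system \<mu> \<mu>eff K k q \<omega> h f b u Du p Dp T DT \<longleftrightarrow>
     V_z3 2 \<omega> h u Du \<and> (AE y\<in>\<omega> \<times> Zcell h in lborel. u y $ 3 = 0) \<and>
     L2_0 \<omega> p \<and> H1 \<omega> p Dp \<and>
     V_z3 q \<omega> h T DT \<and>
     (\<exists>\<pi>. pressure_L2_0_per \<omega> \<pi> \<and> momentum_eq \<mu> \<mu>eff K \<omega> h u Du \<pi> f Dp) \<and>
     cell_div_eq \<omega> h u \<and>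
     weak_deriv (\<omega> \<times> Zper h) e3 DT (\<lambda>y. - (1 / k) * dissipation \<mu> \<mu>eff K (u y) (Du y)) \<and>
     trace_bottom \<omega> h (\<lambda>y. horiz (u y)) (\<lambda>y. horiz (Du y)) (\<lambda>_. 0) \<and>
     trace_top \<omega> h (\<lambda>y. horiz (u y)) (\<lambda>y. horiz (Du y)) (\<lambda>_. 0) \<and>
     trace_top \<omega> h T DT (\<lambda>_. 0) \<and>
     trace_bottom \<omega> h (\<lambda>y. - k * DT y) (\<lambda>y. dissipation \<mu> \<mu>eff K (u y) (Du y)) (\<lambda>(x, z). b x)"

text \<open>The macroscopic limit: the average over the cell of the extension by zero above the graph of \<open>h\<close>.\<close>

definition macroscopic :: "(real^2 \<Rightarrow> real) \<Rightarrow> ((real^2) \<times> (real^2) \<times> real \<Rightarrow> 'b::euclidean_space) \<Rightarrow>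
    real^2 \<Rightarrow> real \<Rightarrow> 'b" where
  "macroscopic h g x s = (LINT z:cell|lborel. (if s < h z then g (x, z, s) else 0))"


section \<open>Effective coefficients and the Reynolds equation\<close>

definition A1star :: "real \<Rightarrow> real \<Rightarrow> real" where
  "A1star M t = - (1 - exp (- M * t)) / (exp (M * t) - exp (- M * t))"

definition A2star :: "real \<Rightarrow> real \<Rightarrow> real" where
  "A2star M t = (1 - exp (M * t)) / (exp (M * t) - exp (- M * t))"

text \<open>
  The profile \<open>A\<^sub>1 e\<^bsup>Ms\<^esup> + A\<^sub>2 e\<^bsup>-Ms\<^esup> + 1\<close> vanishes at \<open>s = 0\<close> and \<open>s = t\<close>, and its integral over \<open>{0..t}\<close>
  is \<open>- mobility M t\<close>; in particular the numerator below carries \<open>+ exp (- M * t)\<close>.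
\<close>

definition mobility :: "real \<Rightarrow> real \<Rightarrow> real" where
  "mobility M t = 2 / M * ((exp (M * t) + exp (- M * t) - 2) / (exp (M * t) - exp (- M * t))) - t"

definition cell_problem :: "(real^2 \<Rightarrow> real) \<Rightarrow> real \<Rightarrow> 2 \<Rightarrow> (real^2 \<Rightarrow> real) \<Rightarrow> (real^2 \<Rightarrow> real^2) \<Rightarrow> bool" where
  "cell_problem h M i \<pi> D\<pi> \<longleftrightarrow> H1_per \<pi> D\<pi> \<and>
     weak_div UNIV (\<lambda>z. mobility M (h z) *\<^sub>R (axis i 1 + D\<pi> z)) (\<lambda>_. 0)"

definition A_mat :: "(real^2 \<Rightarrow> real) \<Rightarrow> real \<Rightarrow> (2 \<Rightarrow> real^2 \<Rightarrow> real^2) \<Rightarrow> real^2^2" where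
  "A_mat h M D\<pi> =
     (\<chi> i j. - (LINT z:cell|lborel. mobility M (h z) * ((axis i 1 + D\<pi> i z) \<bullet> axis j 1)))"

definition reynolds :: "real \<Rightarrow> real \<Rightarrow> (real^2) set \<Rightarrow> real^2^2 \<Rightarrow> (real^2 \<Rightarrow> real^2) \<Rightarrow>
    (real^2 \<Rightarrow> real) \<Rightarrow> (real^2 \<Rightarrow> real^2) \<Rightarrow> bool" where
  "reynolds \<mu> K \<omega> A f p Dp \<longleftrightarrow> L2_0 \<omega> p \<and> H1 \<omega> p Dp \<and>
     weak_div \<omega> (\<lambda>x. (K / \<mu>) *\<^sub>R (A *v (Dp x - f x))) (\<lambda>_. 0) \<and>
     normal_trace_zero \<omega> (\<lambda>x. (K / \<mu>) *\<^sub>R (A *v (Dp x - f x)))"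

end

theory Submission
  imports Defs
begin

text \<open>
  The system is solved in closed form, one variable after the other; what has to be supplied is enough
  of the theory of weak derivatives to make each step legitimate for functions that are only given
  almost everywhere.

  The vertical variable. For almost every \<open>(x, z)\<close> the momentum equation is an ordinary differential
  equation on \<open>0 < s < h z\<close>, because the force minus the pressure gradients does not depend on \<open>s\<close>: the
  velocity is \<open>K / \<mu>\<close> times a force \<open>G (x, z)\<close> times the explicit profile that vanishes at both ends
  (\<open>velocity_profile\<close>). To reach this equation the pressure, of which only the distributional gradient
  occurs, must first be shown to have a weak gradient \<open>R\<close> in \<open>z\<close>: testing with
  products of a function of \<open>(x, z)\<close> and a bump in \<open>s\<close> of mass one expresses \<open>R\<close> through the velocity
  (\<open>pressure_weak\<close>). Weak derivatives are turned into increments along segments and back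
  (\<open>shift_identity_off\<close>, \<open>shift_imp_weak\<close>); increments do not see null sets, which removes the faces
  of the cells, where no measurability of the pressure is known, and they also give the trace
  conditions the form of one-dimensional fundamental theorems (\<open>bottom_FTC\<close>, \<open>top_FTC\<close>).

  The fast variable. The vertical integral of the profile is minus the mobility, so that the
  divergence equation says that \<open>mobility * G\<close> is divergence free in \<open>z\<close>, while \<open>G - (f - Dp)\<close> is minus the
  gradient of a periodic function. Hence \<open>G\<close> and \<open>\<Sum>i. (f - Dp) $ i *\<^sub>R (axis i 1 + D\<pi> i)\<close> differ by a gradient which
  is orthogonal to itself in the weighted inner product, and they coincide (\<open>pressure_structure\<close>). The
  parameter \<open>x\<close> is dealt with by testing against functions of \<open>x\<close>. The same weighted inner product gives
  existence of the cell solutions by the direct method (\<open>minimizer_exists\<close>) and their uniqueness; test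
  functions on the whole plane and periodic test functions are interchangeable by mollification
  (\<open>divfree_orthogonal\<close>) and periodization (\<open>orthogonal_imp_divfree\<close>).

  The slow variable. Integration over the cell gives Darcy's law with the matrix \<open>A_mat\<close>, which
  represents the energy of the correctors and is therefore symmetric and definite (\<open>A_bilinear\<close>,
  \<open>A_definite\<close>); the conditions on the average velocity become the Reynolds equation. Two solutions
  have equal gradients by definiteness, hence differ by a constant on the connected set \<open>\<omega>\<close>
  (\<open>zero_grad_imp_const\<close>), which vanishes by the normalization. The temperature is obtained by
  integrating the dissipation twice from the two faces (\<open>temperature_formula\<close>).
\<close>

section \<open>Notation for Lebesgue integrals\<close>

type_synonym plane = "real^2"
abbreviation ind :: "'a set \<Rightarrow> 'a \<Rightarrow> 'b::zero_neq_one" where "ind \<equiv> indicator"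
abbreviation Borel :: "('a::topological_space \<Rightarrow> 'b::topological_space) set" where "Borel \<equiv> borel_measurable borel"
abbreviation L1 :: "('a::euclidean_space \<Rightarrow> 'b::{banach,second_countable_topology}) \<Rightarrow> bool" where "L1 \<equiv> integrable lborel"
abbreviation L1loc :: "'a::euclidean_space set \<Rightarrow> ('a \<Rightarrow> 'b::euclidean_space) \<Rightarrow> bool" where "L1loc \<equiv> locally_integrable"
abbreviation leb :: "('a::euclidean_space \<Rightarrow> 'b::{banach,second_countable_topology}) \<Rightarrow> 'b" (binder "LI " [60] 60) where "leb f \<equiv> integral\<^sup>L lborel f"
abbreviation nnleb :: "('a::euclidean_space \<Rightarrow> ennreal) \<Rightarrow> ennreal" (binder "NN " [60] 61) where "nnleb f \<equiv> integral\<^sup>N lborel f"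
notation (input) scaleR (infixr "*r" 75)
lemmas L1_bound = Bochner_Integration.integrable_bound and L1_add = Bochner_Integration.integrable_add and L1_diff = Bochner_Integration.integrable_diff
 and LI_cong = Bochner_Integration.integral_cong and LI_add = Bochner_Integration.integral_add and LI_diff = Bochner_Integration.integral_diff
 and LI_nonneg = Bochner_Integration.integral_nonneg and set_LI_def = set_lebesgue_integral_def

section \<open>Smooth functions and test functions\<close>

lemma dir_deriv_eq: "(psi has_derivative D) (at x) ==> dir_deriv v psi x = D v"
 unfolding dir_deriv_def using frechet_derivative_at by force

lemma smooth_funD:
 assumes "smooth_fun psi"
 shows "psi differentiable (at x)" "smooth_fun (dir_deriv v psi)"
 using assms by (auto elim: smooth_fun.cases)

lemma smooth_has_derivative:
 assumes "smooth_fun psi"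
 shows "(psi has_derivative (%v. dir_deriv v psi x)) (at x)"
 using smooth_funD(1)[OF assms, of x] unfolding dir_deriv_def
 by (simp add: frechet_derivative_works)

lemma smooth_continuous: "smooth_fun psi ==> continuous_on S psi"
 by (meson continuous_at_imp_continuous_on differentiable_imp_continuous_within smooth_funD(1))

lemma smooth_borel: "smooth_fun psi ==> psi \<in> Borel"
 by (rule borel_measurable_continuous_onI[OF smooth_continuous])

inductive_set smooth_alg :: "('a::euclidean_space => real) set => ('a => real) set" for X where
 base: "f \<in> X ==> f \<in> smooth_alg X"
| smooth: "smooth_fun f ==> f \<in> smooth_alg X"
| add: "f \<in> smooth_alg X ==> g \<in> smooth_alg X ==> (%x. f x + g x) \<in> smooth_alg X"
| mult: "f \<in> smooth_alg X ==> g \<in> smooth_alg X ==> (%x. f x * g x) \<in> smooth_alg X"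

lemma smooth_alg_deriv:
 assumes X: "!!f x. f \<in> X ==> f differentiable (at x)"
  "!!f v. f \<in> X ==> dir_deriv v f \<in> smooth_alg X"
 assumes "f \<in> smooth_alg X"
 shows "(\<forall>x. f differentiable (at x)) & (\<forall>v. dir_deriv v f \<in> smooth_alg X)"
 using assms(3)
proof induction
 case (base f) then show ?case using X by auto
next
 case (smooth f) then show ?case by (auto intro: smooth_funD smooth_alg.smooth)
next
 case (add f g)
 have "dir_deriv v (%x. f x + g x) = (%x. dir_deriv v f x + dir_deriv v g x)" for v
  using add.IH unfolding dir_deriv_def frechet_derivative_works
  by (auto intro!: ext dir_deriv_eq[unfolded dir_deriv_def] has_derivative_add)
 with add.IH show ?case by (auto intro: smooth_alg.add)
next
 case (mult f g)
 have "dir_deriv v (%x. f x * g x) = (%x. f x * dir_deriv v g x + dir_deriv v f x * g x)" for v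
  using mult.IH unfolding dir_deriv_def frechet_derivative_works
  by (auto intro!: ext dir_deriv_eq[unfolded dir_deriv_def] has_derivative_mult)
 with mult show ?case by (auto intro!: smooth_alg.add smooth_alg.mult)
qed

text \<open>
  Coinduction up to sums and products: it suffices that the derivatives of \<open>X\<close> lie in the
  algebra generated by \<open>X\<close> and the smooth functions.
\<close>

lemma smooth_upto:
 assumes X: "!!f x. f \<in> X ==> f differentiable (at x)"
  "!!f v. f \<in> X ==> dir_deriv v f \<in> smooth_alg X"
 assumes "f \<in> smooth_alg X"
 shows "smooth_fun f"
 using assms(3)
proof (coinduction arbitrary: f)
 case smooth_fun
 show ?case using smooth_alg_deriv[OF X smooth_fun] by auto
qed

lemma smooth_add: "smooth_fun f ==> smooth_fun g ==> smooth_fun (%x. f x + g x)"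
 by (rule smooth_upto[of "{}"]) (auto intro: smooth_alg.intros)

lemma smooth_mult: "smooth_fun f ==> smooth_fun g ==> smooth_fun (%x. f x * g x)"
 by (rule smooth_upto[of "{}"]) (auto intro: smooth_alg.intros)

lemma smooth_const: "smooth_fun (%x. c)"
proof (coinduction arbitrary: c)
 case smooth_fun
 have "dir_deriv v (%x::'a. c) = (%x. 0)" for v
  by (rule ext, rule dir_deriv_eq) simp
 then show ?case by auto
qed

lemma smooth_cmult: "smooth_fun f ==> smooth_fun (%x. c * f x)"
 by (rule smooth_mult[OF smooth_const])

lemma smooth_diff: "smooth_fun f ==> smooth_fun g ==> smooth_fun (%x. f x - g x)"
 using smooth_add[of f "%x. (-1) * g x"] smooth_cmult[of g "-1"] by simp

lemma smooth_prod: "(!!i. i \<in> I ==> smooth_fun (f i)) ==> smooth_fun (%x. \<Prod>i\<in>I. f i x)"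
 by (induction I rule: infinite_finite_induct) (auto intro: smooth_const smooth_mult)

lemma dir_deriv_affine:
 assumes "smooth_fun f" "linear L"
 shows "dir_deriv v (%x. f (c + L x)) x = dir_deriv (L v) f (c + L x)"
proof -
 have bl: "bounded_linear L" using assms(2) by (simp add: linear_conv_bounded_linear)
 have "((%x. c + L x) has_derivative L) (at x)"
  by (auto intro!: derivative_eq_intros bounded_linear_imp_has_derivative bl)
 then have "((%x. f (c + L x)) has_derivative (%v. dir_deriv (L v) f (c + L x))) (at x)"
  by (rule has_derivative_compose) (rule smooth_has_derivative[OF assms(1)])
 then show ?thesis by (rule dir_deriv_eq)
qed

lemma smooth_affine:
 assumes "smooth_fun f" "linear L"
 shows "smooth_fun (%x. f (c + L x))"
 using assms(1)
proof (coinduction arbitrary: f)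
 case smooth_fun
 have "((%x. c + L x) has_derivative L) (at x)" for x
  using assms(2) by (auto intro!: derivative_eq_intros bounded_linear_imp_has_derivative 
    simp: linear_conv_bounded_linear)
 then have "(%x. f (c + L x)) differentiable at x" for x
  using has_derivative_compose smooth_has_derivative[OF smooth_fun] unfolding differentiable_def by blast
 moreover have "dir_deriv v (%x. f (c + L x)) = (%x. dir_deriv (L v) f (c + L x))" for v
  using dir_deriv_affine[OF smooth_fun assms(2)] by blast
 ultimately show ?case using smooth_funD(2)[OF smooth_fun] by blast
qed

lemma smooth_antiderivative:
 assumes "smooth_fun f" "!!x. (F has_real_derivative f x) (at x)"
 shows "smooth_fun F"
proof (rule smooth_fun.intros)
 show "F differentiable at x" for x
  using assms(2) real_differentiable_def by blast
 have "dir_deriv v F = (%x. v * f x)" for v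
  using assms(2)[unfolded has_field_derivative_def] dir_deriv_eq[of F] by (fastforce simp: mult.commute)
 then show "smooth_fun (dir_deriv v F)" for v
  using smooth_cmult[OF assms(1)] by simp
qed

definition flat_exp :: "real => nat => real => real" where
 "flat_exp c n x = (if x > 0 then exp (- c / x) / x ^ n else 0)"

lemma flat_exp_tendsto:
 assumes "c > 0"
 shows "((%x. flat_exp c n x) \<longlongrightarrow> 0) (at 0)"
proof -
 have "((%t. t ^ n / exp t) \<longlongrightarrow> (0::real)) at_top" by (rule tendsto_power_div_exp_0)
 moreover have "filterlim (%x. c * inverse x) at_top (at_right (0::real))"
  using assms filterlim_inverse_at_top_right filterlim_tendsto_pos_mult_at_top tendsto_const by blast
 ultimately have "((%x. (c * inverse x) ^ n / exp (c * inverse x)) \<longlongrightarrow> 0) (at_right 0)"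
  by (rule filterlim_compose)
 then have "((%x. inverse (c^n) * ((c * inverse x) ^ n / exp (c * inverse x))) \<longlongrightarrow> inverse (c^n) * 0) (at_right 0)"
  by (rule tendsto_mult_left)
 moreover have "\<forall>\<^sub>F x in at_right 0. inverse (c^n) * ((c * inverse x) ^ n / exp (c * inverse x)) = flat_exp c n x"
  using assms by (auto simp: eventually_at_right_less flat_exp_def exp_minus field_simps power_mult_distrib
    intro!: eventually_mono[OF eventually_at_right_less])
 ultimately have r: "((%x. flat_exp c n x) \<longlongrightarrow> 0) (at_right 0)"
  using tendsto_cong by fastforce
 have "((%x. flat_exp c n x) \<longlongrightarrow> 0) (at_left 0)"
  by (rule tendsto_eventually) (auto simp: flat_exp_def eventually_at_left_field intro: exI[of _ "-1"])
 with r show ?thesis by (simp add: filterlim_split_at)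
qed

lemma flat_exp_deriv:
 assumes "c > 0"
 shows "(flat_exp c n has_real_derivative (- real n * flat_exp c (Suc n) x + c * flat_exp c (n + 2) x)) (at x)"
proof -
 consider "x > 0" | "x < 0" | "x = 0" by linarith
 then show ?thesis
 proof cases
  case 1
  have "((%x. exp (- c / x) / x ^ n) has_real_derivative
    (- real n * flat_exp c (Suc n) x + c * flat_exp c (n + 2) x)) (at x)"
  proof -
   have *: "real n * x ^ (n - 1) = real n * x ^ n / x" using 1 by (cases n) auto
   have "((%x. exp (- c / x) / x ^ n) has_real_derivative
    (exp (- c / x) * (c / (x * x)) * x ^ n - exp (- c / x) * (real n * x ^ (n - 1))) / (x ^ n * x ^ n)) (at x)"
    using 1 by (auto intro!: derivative_eq_intros)
   also have "(exp (- c / x) * (c / (x * x)) * x ^ n - exp (- c / x) * (real n * x ^ (n - 1))) / (x ^ n * x ^ n)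
    = - real n * flat_exp c (Suc n) x + c * flat_exp c (n + 2) x"
    unfolding * using 1 by (simp add: flat_exp_def field_simps)
   finally show ?thesis .
  qed
  then show ?thesis
   by (rule DERIV_cong_ev[THEN iffD1, rotated 3])
    (use 1 in \<open>auto simp: flat_exp_def intro!: eventually_mono[OF eventually_nhds_in_open[of "{0<..}"]]\<close>)
 next
  case 2
  have "((%x. 0) has_real_derivative 
    (- real n * flat_exp c (Suc n) x + c * flat_exp c (n + 2) x)) (at x)"
   using 2 by (auto simp: flat_exp_def)
  then show ?thesis
   by (rule DERIV_cong_ev[THEN iffD1, rotated 3])
    (use 2 in \<open>auto simp: flat_exp_def intro!: eventually_mono[OF eventually_nhds_in_open[of "{..<0}"]]\<close>)
 next
  case 3
  have "((%h. flat_exp c (Suc n) h) \<longlongrightarrow> 0) (at 0)" using flat_exp_tendsto[OF assms] .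
  moreover have "flat_exp c (Suc n) h = (flat_exp c n (0 + h) - flat_exp c n 0) / h" if "h ~= 0" for h
   using that by (auto simp: flat_exp_def field_simps)
  ultimately have "((%h. (flat_exp c n (0 + h) - flat_exp c n 0) / h) \<longlongrightarrow> 0) (at 0)"
   by (smt (verit, ccfv_threshold) LIM_cong)
  then show ?thesis using 3 by (simp add: DERIV_def flat_exp_def)
 qed
qed

lemma smooth_flat_exp:
 assumes "c > 0"
 shows "smooth_fun (flat_exp c n)"
proof (rule smooth_upto[of "range (flat_exp c)"])
 show "f differentiable at x" if "f \<in> range (flat_exp c)" for f x
  using that flat_exp_deriv[OF assms] real_differentiable_def by blast
 show "dir_deriv v f \<in> smooth_alg (range (flat_exp c))" if f: "f \<in> range (flat_exp c)" for f v
 proof -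
  obtain m where m: "f = flat_exp c m" using f by auto
  have "dir_deriv v f = (%x. v * (- real m * flat_exp c (Suc m) x + c * flat_exp c (m + 2) x))"
   unfolding m using dir_deriv_eq[OF flat_exp_deriv[OF assms, unfolded has_field_derivative_def]]
   by (auto simp: mult.commute)
  moreover have "\<dots> \<in> smooth_alg (range (flat_exp c))"
   by (intro smooth_alg.add smooth_alg.mult smooth_alg.smooth[OF smooth_const] smooth_alg.base) auto
  ultimately show ?thesis by simp
 qed
qed (auto intro: smooth_alg.base)

definition bump :: "real => real => real => real => real" where
 "bump a b c t = flat_exp c 0 (t - a) * flat_exp c 0 (b - t)"

lemma smooth_bump: "c > 0 ==> smooth_fun (bump a b c)"
 using smooth_mult[OF smooth_affine[OF smooth_flat_exp, of c "%x. x" 0 "-a"]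
   smooth_affine[OF smooth_flat_exp, of c "%x. - x" 0 "b"]]
 by (simp add: bump_def[abs_def] linear_iff)

lemma bump_bounds: "c > 0 ==> 0 <= bump a b c t & bump a b c t <= 1"
 by (auto simp: bump_def flat_exp_def intro!: mult_le_one)

lemma bump_zero: "t <= a \<or> b <= t ==> bump a b c t = 0"
 by (auto simp: bump_def flat_exp_def)

lemma bump_pos: "a < t ==> t < b ==> bump a b c t > 0"
 by (auto simp: bump_def flat_exp_def)

lemma bump_tendsto: "(%n. bump a b (1 / real (Suc n)) t) \<longlonglongrightarrow> ind {a<..<b} t"
proof (cases "a < t & t < b")
 case True
 have "(%n. exp (- (1 / real (Suc n)) / (t - a)) * exp (- (1 / real (Suc n)) / (b - t))) \<longlonglongrightarrow> exp (- 0 / (t - a)) * exp (- 0 / (b - t))"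
  using True by (intro tendsto_intros lim_1_over_n LIMSEQ_Suc) (auto simp: )
 then show ?thesis using True by (simp add: bump_def flat_exp_def)
next
 case False
 then show ?thesis by (auto simp: bump_zero)
qed

lemma test_funI:
 assumes "smooth_fun psi" "compact K" "K \<subseteq> \<Omega>" "!!y. y \<notin> K ==> psi y = 0"
 shows "psi \<in> test_fun \<Omega>"
proof -
 have sub: "closure {x. psi x ~= 0} \<subseteq> K"
  by (rule closure_minimal) (use assms(4) in blast, rule compact_imp_closed[OF assms(2)])
 have "compact (K \<inter> closure {x. psi x ~= 0})"
  by (rule compact_Int_closed[OF assms(2) closed_closure])
 then have "compact (closure {x. psi x ~= 0})"
  using sub by (simp only: Int_absorb1)
 then show ?thesis
  unfolding test_fun_def using assms(1,3) sub by (simp only: mem_Collect_eq) blast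
qed

lemma test_funD:
 assumes "psi \<in> test_fun \<Omega>"
 obtains K where "smooth_fun psi" "compact K" "K \<subseteq> \<Omega>" "!!y. y \<notin> K ==> psi y = 0" "!!y v. y \<notin> K ==> dir_deriv v psi y = 0"
proof -
 define K where "K = closure {x. psi x ~= 0}"
 have 1: "y \<notin> K ==> psi y = 0" for y unfolding K_def using closure_subset[of "{x. psi x ~= 0}"] by blast
 have "dir_deriv v psi y = 0" if "y \<notin> K" for y v
 proof (rule dir_deriv_eq)
  show "(psi has_derivative (%v. 0)) (at y)"
  proof (rule has_derivative_transform_within_open)
   show "((%_. 0) has_derivative (%v. 0::real)) (at y)" by (rule has_derivative_const)
   show "open (- K)" unfolding K_def by (rule open_Compl[OF closed_closure])
   show "y \<in> - K" using that by blast
   show "0 = psi x" if "x \<in> - K" for x using 1[of x] that by simp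
  qed
 qed
 moreover have "smooth_fun psi" "compact K" "K \<subseteq> \<Omega>"
  using assms unfolding test_fun_def K_def by blast+
 ultimately show thesis using that[of K] 1 by blast
qed

lemma test_fun_mono: "psi \<in> test_fun S ==> S \<subseteq> T ==> psi \<in> test_fun T"
 by (auto simp: test_fun_def)

definition boxbump :: "'a::euclidean_space => 'a => real => 'a => real" where
 "boxbump a b c y = (\<Prod>j\<in>Basis. bump (a \<bullet> j) (b \<bullet> j) c (y \<bullet> j))"

lemma smooth_inner_comp:
 assumes "smooth_fun (f::real => real)" shows "smooth_fun (%y::'a::euclidean_space. f (y \<bullet> j))"
 using smooth_affine[OF assms, of "%y. y \<bullet> j" 0] by (simp add: linear_iff inner_simps)

lemma smooth_boxbump: "c > 0 ==> smooth_fun (boxbump a b c)"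
 unfolding boxbump_def[abs_def] by (intro smooth_prod smooth_inner_comp smooth_bump)

lemma boxbump_bounds: "c > 0 ==> 0 <= boxbump a b c y & boxbump a b c y <= 1"
 unfolding boxbump_def by (auto intro!: prod_nonneg prod_le_1 simp: bump_bounds)

lemma boxbump_zero: "y \<notin> box a b ==> boxbump a b c y = 0"
 unfolding boxbump_def box_def by (force intro!: prod_zero bump_zero)

lemma boxbump_tendsto: "(%n. boxbump a b (1 / real (Suc n)) y) \<longlonglongrightarrow> ind (box a b) y"
proof -
 have "(%n. boxbump a b (1 / real (Suc n)) y) \<longlonglongrightarrow> (\<Prod>j\<in>Basis. ind {a \<bullet> j<..<b \<bullet> j} (y \<bullet> j))"
  unfolding boxbump_def by (intro tendsto_prod bump_tendsto)
 moreover have "(\<Prod>j\<in>Basis. ind {a \<bullet> j<..<b \<bullet> j} (y \<bullet> j)) = (ind (box a b) y :: real)"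
  by (auto simp: box_def indicator_def intro!: prod_zero)
 ultimately show ?thesis by simp
qed

lemma boxbump_test: "c > 0 ==> cbox a b \<subseteq> \<Omega> ==> boxbump a b c \<in> test_fun \<Omega>"
 by (rule test_funI[of _ "cbox a b"]) (auto intro: smooth_boxbump boxbump_zero dest: subsetD[OF box_subset_cbox])

lemma AE_lborel_cbox_box: "AE y in lborel. y \<in> cbox a b --> y \<in> box a (b::'a::euclidean_space)"
proof -
 have "negligible (cbox a b - box a b)" by (rule negligible_frontier_interval)
 then have "cbox a b - box a b \<in> null_sets lborel"
  by (metis negligible_iff_null_sets null_sets_completion_iff borel_closed borel_open closed_cbox open_box sets.Diff sets_lborel)
 then show ?thesis using AE_not_in[of "cbox a b - box a b" lborel] by auto
qed

lemma box_integrals_zero_imp_AE_zero: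
 fixes g :: "'a::euclidean_space => real"
 assumes [measurable]: "g \<in> Borel" and int: "set_integrable lborel (cbox A B) g"
  and zero: "!!a b. box a b \<subseteq> box A B ==> (LINT y:box a b|lborel. g y) = 0"
 shows "AE y in lborel. y \<in> box A B --> g y = 0"
proof -
 define G where "G = (%y. ind (box A B) y * g y)"
 have [measurable]: "G \<in> Borel" unfolding G_def by measurable
 have "set_integrable lborel (box A B) g"
  by (rule set_integrable_subset[OF int]) (auto simp: box_subset_cbox)
 then have iG: "L1 G" unfolding G_def set_integrable_def by simp
 let ?P = "%y. ennreal (max 0 (G y))" and ?N = "%y. ennreal (max 0 (- G y))"
 have iP: "L1 (%y. max 0 (G y))" "L1 (%y. max 0 (- G y))"
  using iG by auto
 have fin: "(NN y. ?P y) ~= \<infinity>" "(NN y. ?N y) ~= \<infinity>"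
  using integrable_iff_bounded[of lborel "%y. max 0 (G y)"] integrable_iff_bounded[of lborel "%y. max 0 (- G y)"] iP 
  by auto
 have eq: "emeasure (density lborel ?P) (box l u) = emeasure (density lborel ?N) (box l u)" for l u
 proof -
  have bx: "box l u \<inter> box A B \<subseteq> box A B" "\<exists>a b. box l u \<inter> box A B = box a b"
   by (rule Int_lower2) (rule exI, rule exI, rule box_Int_box)
  then have z: "(LINT y:box l u \<inter> box A B|lborel. g y) = 0" using zero by metis
  have "(LI y. max 0 (G y) * ind (box l u) y) - (LI y. max 0 (- G y) * ind (box l u) y)
   = (LI y. max 0 (G y) * ind (box l u) y - max 0 (- G y) * ind (box l u) y)"
   using iP by (intro LI_diff[symmetric] integrable_real_mult_indicator) auto
  also have "\<dots> = (LINT y:box l u \<inter> box A B|lborel. g y)"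
   unfolding set_LI_def G_def
   by (intro LI_cong) (auto simp: indicator_def max_def)
  finally have "(LI y. max 0 (G y) * ind (box l u) y) = (LI y. max 0 (- G y) * ind (box l u) y)"
   using z by simp
  moreover have "emeasure (density lborel (%y. ennreal (max 0 (k y)))) (box l u) = ennreal (LI y. max 0 (k y) * ind (box l u) y)"
   if "L1 (%y. max 0 (k y))" "k \<in> Borel" for k
  proof -
   have "L1 (%y. max 0 (k y) * ind (box l u) y)"
    using that(1) by (intro integrable_real_mult_indicator) auto
   then have "(NN y. ennreal (max 0 (k y) * ind (box l u) y)) = ennreal (LI y. max 0 (k y) * ind (box l u) y)"
    by (intro nn_integral_eq_integral) auto
   then show ?thesis using that(2)
    by (simp add: emeasure_density ennreal_mult'' ennreal_indicator)
  qed
  ultimately show ?thesis using iP by (simp)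
 qed
 have "density lborel ?P = density lborel ?N"
 proof (rule measure_eqI_generator_eq)
  let ?E = "range (%(a, b). box a b::'a set)"
  show "Int_stable ?E" by (auto simp: Int_stable_def box_Int_box)
  show "?E \<subseteq> Pow UNIV" "sets (density lborel ?P) = sigma_sets UNIV ?E" "sets (density lborel ?N) = sigma_sets UNIV ?E"
   by (simp_all add: borel_eq_box)
  let ?A = "%n::nat. box (- (real n *r One)) (real n *r One) :: 'a set"
  show "range ?A \<subseteq> ?E" "(\<Union>i. ?A i) = UNIV" unfolding UN_box_eq_UNIV by auto
  show "emeasure (density lborel ?P) (?A i) ~= \<infinity>" for i
  proof -
   have "emeasure (density lborel ?P) (?A i) <= (NN y. ?P y)"
    by (subst emeasure_density) (auto intro!: nn_integral_mono simp: indicator_def)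
   then show ?thesis using fin by (auto simp: top_unique)
  qed
  show "emeasure (density lborel ?P) X = emeasure (density lborel ?N) X" if "X \<in> ?E" for X
   using that eq by auto
 qed
 then have "AE y in lborel. ?P y = ?N y"
  by (subst (asm) finite_density_unique) (use fin in auto)
 then show ?thesis
  by eventually_elim (auto simp: G_def max_def split: if_splits)
qed

text \<open>
  The bumps converge to the indicator of the box, so the integrals over all boxes vanish, and boxes
  generate the Borel sets.
\<close>

theorem fundamental_lemma:
 fixes g :: "'a::euclidean_space => real"
 assumes [measurable]: "g \<in> Borel" and "open \<Omega>"
  and int: "!!a b. cbox a b \<subseteq> \<Omega> ==> set_integrable lborel (cbox a b) g"
  and zero: "!!a b c. c > 0 ==> cbox a b \<subseteq> \<Omega> ==> (LI y. boxbump a b c y * g y) = 0"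
 shows "AE y in lborel. y \<in> \<Omega> --> g y = 0"
proof -
 have bz: "(LINT y:box a b|lborel. g y) = 0" if ab: "cbox a b \<subseteq> \<Omega>" for a b
 proof -
  have "(%n. LI y. boxbump a b (1 / real (Suc n)) y * g y) \<longlonglongrightarrow> (LI y. ind (box a b) y * g y)"
  proof (rule integral_dominated_convergence[where w="%y. norm (ind (cbox a b) y * g y)"])
   show "L1 (%y. norm (ind (cbox a b) y * g y))"
    using int[OF ab] by (auto simp: set_integrable_def)
   show "AE y in lborel. (%n. boxbump a b (1 / real (Suc n)) y * g y) \<longlonglongrightarrow> ind (box a b) y * g y"
    by (intro AE_I2 tendsto_mult_right boxbump_tendsto)
   show "(%y. boxbump a b (1 / real (Suc n)) y * g y) \<in> borel_measurable lborel" for n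
    using smooth_borel[OF smooth_boxbump, of "1 / real (Suc n)" a b] by simp
   show "AE y in lborel. norm (boxbump a b (1 / real (Suc n)) y * g y) <= norm (ind (cbox a b) y * g y)" for n
   proof (rule AE_I2)
    fix y
    show "norm (boxbump a b (1 / real (Suc n)) y * g y) <= norm (ind (cbox a b) y * g y)"
    proof (cases "y \<in> cbox a b")
     case True
     have "\<bar>boxbump a b (1 / real (Suc n)) y\<bar> <= 1"
      using boxbump_bounds[of "1 / real (Suc n)" a b y] by auto
     with True show ?thesis by (simp add: abs_mult mult_left_le_one_le)
    next
     case False
     then have "y \<notin> box a b" using box_subset_cbox by auto
     then show ?thesis by (simp add: boxbump_zero)
    qed
   qed
  qed simp
  moreover have "(%n. LI y. boxbump a b (1 / real (Suc n)) y * g y) = (%n. 0)"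
   by (rule ext, rule zero) (use ab in auto)
  ultimately show ?thesis
   using LIMSEQ_unique[OF _ tendsto_const] unfolding set_LI_def by (simp add: LIMSEQ_const_iff)
 qed
 have loc: "AE y in lborel. y \<in> cbox A B --> g y = 0" if AB: "cbox A B \<subseteq> \<Omega>" for A B
 proof -
  have "AE y in lborel. y \<in> box A B --> g y = 0"
  proof (rule box_integrals_zero_imp_AE_zero[OF _ int[OF AB]])
   fix a b assume s: "box a b \<subseteq> box A B"
   show "(LINT y:box a b|lborel. g y) = 0"
   proof (cases "box a b = {}")
    case False
    then have "cbox a b \<subseteq> cbox A B"
     using s by (metis closure_box closure_mono box_subset_cbox closed_cbox closure_closed subset_trans)
    then show ?thesis using bz AB by blast
   qed (simp add: set_LI_def)
  qed simp
  with AE_lborel_cbox_box[of A B] show ?thesis by eventually_elim auto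
 qed
 obtain D where D: "countable D" "D \<subseteq> Pow \<Omega>" "!!X. X \<in> D ==> \<exists>a b. X = cbox a b" "\<Union>D = \<Omega>"
  using open_countable_Union_open_cbox[OF \<open>open \<Omega>\<close>] by metis
 have "AE y in lborel. \<forall>X\<in>D. y \<in> X --> g y = 0"
  using D loc by (subst AE_ball_countable) (auto, metis Pow_iff subsetD)
 then show ?thesis by eventually_elim (use D in auto)
qed

section \<open>Weak derivatives and increments along lines\<close>

lemma nn_integral_lborel_shift:
 fixes c :: "'a::euclidean_space"
 assumes [measurable]: "f \<in> Borel"
 shows "(NN y. f (y + c)) = (NN y. f y)"
proof -
 have "(NN y. f y) = (\<integral>\<^sup>+y. f y \<partial>distr lborel borel ((+) c))" by (simp add: lborel_distr_plus)
 also have "\<dots> = (NN y. f (c + y))" by (rule nn_integral_distr) auto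
 finally show ?thesis by (simp add: add.commute)
qed

lemma integrable_lborel_shift:
 fixes c :: "'a::euclidean_space" and f :: "'a => 'b::{banach, second_countable_topology}"
 assumes "L1 f"
 shows "L1 (%y. f (y + c))"
proof -
 have "integrable (distr lborel borel ((+) c)) f" using assms by (simp add: lborel_distr_plus)
 then have "L1 (%y. f (c + y))"
  by (subst (asm) integrable_distr_eq) (use assms in auto)
 then show ?thesis by (simp add: add.commute)
qed

lemma integral_lborel_shift:
 fixes c :: "'a::euclidean_space" and f :: "'a => 'b::{banach, second_countable_topology}"
 assumes [measurable]: "f \<in> Borel"
 shows "(LI y. f (y + c)) = (LI y. f y)"
proof -
 have "(LI y. f y) = (LINT y|distr lborel borel ((+) c). f y)" by (simp add: lborel_distr_plus)
 also have "\<dots> = (LI y. f (c + y))" by (rule integral_distr) auto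
 finally show ?thesis by (simp add: add.commute)
qed

lemma continuous_antiderivative:
 fixes f :: "real => real"
 assumes "continuous_on UNIV f"
 obtains F where "!!x. (F has_real_derivative f x) (at x)"
proof -
 have "\<exists>F. \<forall>x. - \<infinity> < ereal x --> ereal x < \<infinity> --> (F has_vector_derivative f x) (at x)"
  using assms by (intro einterval_antiderivative) (auto simp: continuous_on_eq_continuous_at)
 then show thesis using that by (auto simp: has_real_derivative_iff_has_vector_derivative)
qed

lemma LINT_FTC:
 fixes F :: "real => real"
 assumes "a <= b" "!!x. a <= x ==> x <= b ==> (F has_real_derivative f x) (at x)" "continuous_on {a..b} f"
 shows "(LINT x:{a..b}|lborel. f x) = F b - F a"
proof -
 have "(LI x. ind {a .. b} x *r f x) = F b - F a"
  using assms by (intro integral_FTC_Icc) (auto simp: has_real_derivative_iff_has_vector_derivative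
   intro: has_vector_derivative_at_within)
 then show ?thesis by (simp add: set_LI_def)
qed

lemma boxbump_split:
 assumes "e \<in> Basis"
 shows "boxbump a b c (y + r *r e) = bump (a \<bullet> e) (b \<bullet> e) c (y \<bullet> e + r) * (\<Prod>j\<in>Basis - {e}. bump (a \<bullet> j) (b \<bullet> j) c (y \<bullet> j))"
proof -
 have "boxbump a b c (y + r *r e) = bump (a \<bullet> e) (b \<bullet> e) c ((y + r *r e) \<bullet> e) * (\<Prod>j\<in>Basis - {e}. bump (a \<bullet> j) (b \<bullet> j) c ((y + r *r e) \<bullet> j))"
  unfolding boxbump_def using assms by (intro prod.remove) auto
 also have "(y + r *r e) \<bullet> e = y \<bullet> e + r" using assms by (simp add: inner_simps)
 also have "(\<Prod>j\<in>Basis - {e}. bump (a \<bullet> j) (b \<bullet> j) c ((y + r *r e) \<bullet> j)) = (\<Prod>j\<in>Basis - {e}. bump (a \<bullet> j) (b \<bullet> j) c (y \<bullet> j))"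
  by (intro prod.cong) (auto simp: inner_simps inner_Basis assms)
 finally show ?thesis .
qed

text \<open>
  The average of a bump along a segment in a coordinate direction is again smooth, and its derivative
  in that direction is a difference of two bumps. This is the test function that turns a weak
  derivative into an increment.
\<close>

lemma line_average_bump:
 fixes a b e :: "'a::euclidean_space"
 assumes e: "e \<in> Basis" and c: "c > 0" and \<tau>: "\<tau> >= 0"
 obtains \<Theta> where "smooth_fun \<Theta>"
  "!!y. dir_deriv e \<Theta> y = boxbump a b c y - boxbump a b c (y - \<tau> *r e)"
  "!!y. \<Theta> y = (LINT r:{0..\<tau>}|lborel. boxbump a b c (y - r *r e))"
proof -
 let ?f = "bump (a \<bullet> e) (b \<bullet> e) c"
 have sf: "smooth_fun ?f" by (rule smooth_bump[OF c])
 obtain F where F: "!!x. (F has_real_derivative ?f x) (at x)"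
  using continuous_antiderivative[OF smooth_continuous[OF sf]] by blast
 have sF: "smooth_fun F" by (rule smooth_antiderivative[OF sf F])
 define P where "P = (%y. \<Prod>j\<in>Basis - {e}. bump (a \<bullet> j) (b \<bullet> j) c (y \<bullet> j))"
 have sP: "smooth_fun P" unfolding P_def by (intro smooth_prod smooth_inner_comp smooth_bump c)
 define B where "B = (%t. F t - F (- \<tau> + t))"
 have sB: "smooth_fun B" unfolding B_def
  by (intro smooth_diff sF smooth_affine[OF sF, of "%x. x"]) (auto simp: linear_iff)
 define \<Theta> where "\<Theta> = (%y. B (y \<bullet> e) * P y)"
 have "smooth_fun \<Theta>" unfolding \<Theta>_def by (intro smooth_mult smooth_inner_comp sB sP)
 have Pe: "P (y + r *r e) = P y" for y r
  unfolding P_def by (intro prod.cong) (auto simp: inner_simps inner_Basis e)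
 have dP: "dir_deriv e P y = 0" for y
 proof -
  have "((%r. P (y + r *r e)) has_derivative (%r. dir_deriv (r *r e) P (y + 0 *r e))) (at 0)"
   by (rule has_derivative_compose[of "%r. y + r *r e"]) (auto intro!: derivative_eq_intros smooth_has_derivative[OF sP])
  moreover have "((%r. P (y + r *r e)) has_derivative (%r. 0)) (at (0::real))" unfolding Pe by simp
  ultimately have "(%r. dir_deriv (r *r e) P (y + 0 *r e)) = (%r::real. 0)" by (rule has_derivative_unique)
  from fun_cong[OF this, of 1] show ?thesis by simp
 qed
 have dB: "(B has_real_derivative (?f t - ?f (t - \<tau>))) (at t)" for t
  unfolding B_def by (auto intro!: derivative_eq_intros F DERIV_chain'[where g=F])
 have "dir_deriv e \<Theta> y = boxbump a b c y - boxbump a b c (y - \<tau> *r e)" for y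
 proof -
  have "((%y. B (y \<bullet> e)) has_derivative (%v. (?f (y \<bullet> e) - ?f (y \<bullet> e - \<tau>)) * (v \<bullet> e))) (at y)"
   by (rule has_derivative_compose[OF _ dB[unfolded has_field_derivative_def]])
    (auto intro!: derivative_eq_intros)
  then have "(\<Theta> has_derivative (%v. B (y \<bullet> e) * dir_deriv v P y + (?f (y \<bullet> e) - ?f (y \<bullet> e - \<tau>)) * (v \<bullet> e) * P y)) (at y)"
   unfolding \<Theta>_def by (rule has_derivative_mult[OF _ smooth_has_derivative[OF sP]])
  then have "dir_deriv e \<Theta> y = (?f (y \<bullet> e) - ?f (y \<bullet> e - \<tau>)) * P y"
   using dir_deriv_eq[of \<Theta> _ y e] dP e by (simp add: inner_Basis)
  then show ?thesis
   using boxbump_split[OF e, of a b c y 0] boxbump_split[OF e, of a b c y "-\<tau>"] by (simp add: P_def algebra_simps)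
 qed
 moreover have "\<Theta> y = (LINT r:{0..\<tau>}|lborel. boxbump a b c (y - r *r e))" for y
 proof -
  have "(LINT r:{0..\<tau>}|lborel. ?f (y \<bullet> e - r) * P y) = - F (y \<bullet> e - \<tau>) * P y - - F (y \<bullet> e - 0) * P y"
  proof (rule LINT_FTC[OF \<tau>])
   show "((%r. - F (y \<bullet> e - r) * P y) has_real_derivative ?f (y \<bullet> e - x) * P y) (at x)" for x
    by (auto intro!: derivative_eq_intros DERIV_chain'[where g=F] F)
   show "continuous_on {0..\<tau>} (%r. ?f (y \<bullet> e - r) * P y)"
    by (intro continuous_intros continuous_on_compose2[OF smooth_continuous[OF sf, of UNIV]]) auto
  qed
  also have "\<dots> = \<Theta> y" unfolding \<Theta>_def B_def by (simp add: algebra_simps)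
  finally show ?thesis
   using boxbump_split[OF e, of a b c y "- r" for r] by (simp add: P_def)
 qed
 ultimately show thesis using that \<open>smooth_fun \<Theta>\<close> by blast
qed

lemma compact_segment_sum:
 fixes e :: "'a::euclidean_space"
 assumes "compact C" shows "compact {y + r *r e |y r. y \<in> C & r \<in> {\<alpha>..\<beta>::real}}"
proof -
 have "compact ((%(y, r). y + r *r e) ` (C \<times> {\<alpha>..\<beta>}))"
  by (intro compact_continuous_image compact_Times assms) (auto intro!: continuous_intros simp: split_beta)
 moreover have "(%(y, r). y + r *r e) ` (C \<times> {\<alpha>..\<beta>}) = {y + r *r e |y r. y \<in> C & r \<in> {\<alpha>..\<beta>}}" by (auto; blast)
 ultimately show ?thesis by simp
qed

lemma open_segments_in:
 fixes e :: "'a::euclidean_space"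
 assumes "open \<Omega>" shows "open {y. \<forall>r\<in>{\<alpha>..\<beta>::real}. y + r *r e \<in> \<Omega>}"
proof -
 have "closed (\<Union>x\<in>-\<Omega>. \<Union>y\<in>(%r. r *r e) ` {\<alpha>..\<beta>}. {x - y})"
  by (rule closed_compact_differences)
   (use assms in \<open>auto intro!: compact_continuous_image continuous_intros\<close>)
 moreover have "(\<Union>x\<in>-\<Omega>. \<Union>y\<in>(%r. r *r e) ` {\<alpha>..\<beta>}. {x - y}) = - {y. \<forall>r\<in>{\<alpha>..\<beta>}. y + r *r e \<in> \<Omega>}"
 proof (intro set_eqI iffI)
  fix x assume "x \<in> (\<Union>x\<in>-\<Omega>. \<Union>y\<in>(%r. r *r e) ` {\<alpha>..\<beta>}. {x - y})"
  then obtain w r where "w \<notin> \<Omega>" "r \<in> {\<alpha>..\<beta>}" "x = w - r *r e" by blast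
  then show "x \<in> - {y. \<forall>r\<in>{\<alpha>..\<beta>}. y + r *r e \<in> \<Omega>}" by force
 next
  fix x assume "x \<in> - {y. \<forall>r\<in>{\<alpha>..\<beta>}. y + r *r e \<in> \<Omega>}"
  then obtain r where "r \<in> {\<alpha>..\<beta>}" "x + r *r e \<notin> \<Omega>" by blast
  then show "x \<in> (\<Union>x\<in>-\<Omega>. \<Union>y\<in>(%r. r *r e) ` {\<alpha>..\<beta>}. {x - y})"
   by (intro UN_I[of "x + r *r e"] UN_I[of "r *r e"]) auto
 qed
 ultimately have "closed (- {y. \<forall>r\<in>{\<alpha>..\<beta>}. y + r *r e \<in> \<Omega>})" by (simp only:)
 then show ?thesis by (simp only: closed_def double_complement)
qed

lemma integrable_indicator_Icc: "L1 (%r. ind {a..b::real} r * c :: real)"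
proof -
 have "L1 (ind {a..b} :: real => real)"
  by (rule integrable_real_indicator) (auto simp: emeasure_lborel_Icc_eq)
 then show ?thesis by simp
qed

lemma integrable_line_pair:
 fixes D :: "'a::euclidean_space => real"
 assumes [measurable]: "D \<in> Borel" "C \<in> sets borel"
  and K: "set_integrable lborel K D" and sub: "!!y r. y \<in> C ==> r \<in> {0..\<tau>} ==> y + r *r e \<in> K"
 shows "integrable (lborel \<Otimes>\<^sub>M lborel) (%(r, y). ind {0..\<tau>} r * (ind C y * D (y + r *r e)))"
proof -
 have iK: "L1 (%y. ind K y * D y)" using K by (simp add: set_integrable_def)
 have 1: "L1 (%y. ind C y * D (y + r *r e))" if "r \<in> {0..\<tau>}" for r
  by (rule L1_bound[OF integrable_lborel_shift[OF iK, of "r *r e"]])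
   (use sub that in \<open>auto simp: indicator_def\<close>)
 have 2: "(LI y. norm (ind C y * D (y + r *r e))) <= (LI y. norm (ind K y * D y))" if "r \<in> {0..\<tau>}" for r
 proof -
  have "(LI y. norm (ind C y * D (y + r *r e))) <= (LI y. norm (ind K (y + r *r e) * D (y + r *r e)))"
   by (intro integral_mono integrable_norm 1 that integrable_lborel_shift[OF iK, of "r *r e"])
    (use sub that in \<open>auto simp: indicator_def\<close>)
  also have "\<dots> = (LI y. norm (ind K y * D y))"
   using integral_lborel_shift[of "%y. norm (ind K y * D y)" "r *r e"] iK by simp
  finally show ?thesis .
 qed
 show ?thesis
 proof (rule lborel_pair.Fubini_integrable)
  show "(%(r, y). ind {0..\<tau>} r * (ind C y * D (y + r *r e))) \<in> borel_measurable (lborel \<Otimes>\<^sub>M lborel)"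
   by measurable
  show "AE r in lborel. L1 (%y. case (r, y) of (r, y) => ind {0..\<tau>} r * (ind C y * D (y + r *r e)))"
  proof (rule AE_I2)
   fix r show "L1 (%y. case (r, y) of (r, y) => ind {0..\<tau>} r * (ind C y * D (y + r *r e)))"
    using 1[of r] by (cases "r \<in> {0..\<tau>}") auto
  qed
  have "L1 (%r. ind {0..\<tau>} r * (LI y. norm (ind K y * D y)))"
   by (rule integrable_indicator_Icc)
  then show "L1 (%r. LI y. norm (case (r, y) of (r, y) => ind {0..\<tau>} r * (ind C y * D (y + r *r e))))"
  proof (rule L1_bound)
   show "AE r in lborel. norm (LI y. norm (case (r, y) of (r, y) => ind {0..\<tau>} r * (ind C y * D (y + r *r e))))
    <= norm (ind {0..\<tau>} r * (LI y. norm (ind K y * D y)))"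
    using 2 by (intro AE_I2) (auto simp: indicator_def)
  qed measurable
 qed
qed

lemma test_fun_dir: "psi \<in> test_fun \<Omega> ==> dir_deriv v psi \<in> test_fun \<Omega>"
 by (erule test_funD) (rule test_funI[of "dir_deriv v psi"], auto intro: smooth_funD)

lemma test_fun_bound:
 assumes "psi \<in> test_fun \<Omega>"
 obtains K M where "compact K" "K \<subseteq> \<Omega>" "!!y. y \<notin> K ==> psi y = 0" "!!y. \<bar>psi y\<bar> <= M * ind K y" "M >= 0"
proof -
 obtain K where K: "smooth_fun psi" "compact K" "K \<subseteq> \<Omega>" "!!y. y \<notin> K ==> psi y = 0"
  using test_funD[OF assms] by metis
 have "compact (psi ` K)" by (intro compact_continuous_image smooth_continuous K)
 then obtain M where "!!y. y \<in> K ==> \<bar>psi y\<bar> <= M" using compact_imp_bounded bounded_real by (metis imageI)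
 then have "\<bar>psi y\<bar> <= max M 0 * ind K y" for y using K(4)[of y] by (cases "y \<in> K") (auto simp: le_max_iff_disj)
 then show thesis using that[of K "max M 0"] K by auto
qed

lemma test_fun_borel [measurable_dest]: "psi \<in> test_fun \<Omega> ==> psi \<in> Borel"
 by (erule test_funD) (rule smooth_borel)

lemma smooth_line_FTC:
 assumes "smooth_fun eta" "\<tau> >= 0"
 shows "eta (y + \<tau> *r e) - eta y = (LINT r:{0..\<tau>}|lborel. dir_deriv e eta (y + r *r e))"
proof -
 have "(LINT r:{0..\<tau>}|lborel. dir_deriv e eta (y + r *r e)) = eta (y + \<tau> *r e) - eta (y + 0 *r e)"
 proof (rule LINT_FTC[OF assms(2)])
  fix s :: real
  have "((%t. eta (y + t *r e)) has_derivative (%v. dir_deriv (v *r e) eta (y + s *r e))) (at s)"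
   by (rule has_derivative_compose[of "%r. y + r *r e"]) (auto intro!: derivative_eq_intros smooth_has_derivative[OF assms(1)])
  moreover have "dir_deriv (v *r e) eta (y + s *r e) = v * dir_deriv e eta (y + s *r e)" for v
   using linear_cmul[OF has_derivative_linear[OF smooth_has_derivative[OF assms(1)]]] by simp
  then have "(%v. dir_deriv (v *r e) eta (y + s *r e)) = (*) (dir_deriv e eta (y + s *r e))"
   by (auto simp: fun_eq_iff)
  ultimately show "((%t. eta (y + t *r e)) has_field_derivative dir_deriv e eta (y + s *r e)) (at s)"
   by (simp only: has_field_derivative_def)
 next
  show "continuous_on {0..\<tau>} (%r. dir_deriv e eta (y + r *r e))"
   by (intro continuous_on_compose2[OF smooth_continuous[OF smooth_funD(2)[OF assms(1)], of UNIV]] continuous_intros) auto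
 qed
 then show ?thesis by simp
qed

text \<open>
  Fubini for integration along segments, in the form in which a translation has moved the shift from
  \<open>D\<close> to the weight.
\<close>

lemma line_swap:
 fixes \<beta> D :: "'a::euclidean_space => real"
 assumes [measurable]: "\<beta> \<in> Borel" "D \<in> Borel" "C \<in> sets borel"
  and \<beta>: "!!y. \<bar>\<beta> y\<bar> <= M * ind C y"
  and K: "set_integrable lborel K D" and sub: "!!y r. y \<in> C ==> r \<in> {0..\<tau>} ==> y + r *r e \<in> K"
 shows "L1 (%y. \<beta> y * (LINT r:{0..\<tau>}|lborel. D (y + r *r e)))"
  and "(LI y. \<beta> y * (LINT r:{0..\<tau>}|lborel. D (y + r *r e))) = (LINT r:{0..\<tau>}|lborel. LI y. \<beta> y * D (y + r *r e))"
  and "(LI y. (LINT r:{0..\<tau>}|lborel. \<beta> (y - r *r e)) * D y) = (LINT r:{0..\<tau>}|lborel. LI y. \<beta> y * D (y + r *r e))"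
  and "set_integrable lborel {0..\<tau>} (%r. LI y. \<beta> y * D (y + r *r e))"
proof -
 let ?f = "%r y. ind {0..\<tau>} r * (\<beta> y * D (y + r *r e))" and ?g = "%r y. ind {0..\<tau>} r * (\<beta> (y - r *r e) * D y)"
 have f: "integrable (lborel \<Otimes>\<^sub>M lborel) (%(r, y). ?f r y)"
 proof (rule L1_bound[OF integrable_mult_right[OF integrable_line_pair[OF _ _ K sub], of M]])
  show "AE x in lborel \<Otimes>\<^sub>M lborel. norm (case x of (r, y) => ?f r y) <= norm (M * (case x of (r, y) => ind {0..\<tau>} r * (ind C y * D (y + r *r e))))"
  proof (intro AE_I2, clarify)
   fix r y
   have "\<bar>\<beta> y\<bar> * \<bar>D (y + r *r e)\<bar> <= (\<bar>M\<bar> * ind C y) * \<bar>D (y + r *r e)\<bar>"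
    using \<beta>[of y] by (intro mult_right_mono) (auto simp: indicator_def)
   then show "norm (?f r y) <= norm (M * (ind {0..\<tau>} r * (ind C y * D (y + r *r e))))"
    by (simp add: abs_mult indicator_def)
  qed
 qed measurable
 have sh: "L1 (?g r) \<longleftrightarrow> L1 (?f r)" for r
  using integrable_lborel_shift[of "?g r" "r *r e"] integrable_lborel_shift[of "?f r" "- r *r e"] by auto
 have e: "(LI y. \<beta> (y - r *r e) * D y) = (LI y. \<beta> y * D (y + r *r e))" for r
  using integral_lborel_shift[of "%y. \<beta> (y - r *r e) * D y" "r *r e"] by simp
 have g: "integrable (lborel \<Otimes>\<^sub>M lborel) (%(r, y). ?g r y)"
 proof (rule lborel_pair.Fubini_integrable)
  show "(%(r, y). ?g r y) \<in> borel_measurable (lborel \<Otimes>\<^sub>M lborel)" by measurable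
  have "(LI y. norm (?g r y)) = (LI y. norm (?f r y))" for r
   using integral_lborel_shift[of "%y. norm (?g r y)" "r *r e"] by simp
  then show "L1 (%r. LI y. norm (case (r, y) of (r, y) => ?g r y))"
   using lborel_pair.integrable_fst'[OF integrable_norm[OF f]] by simp
  show "AE r in lborel. L1 (%y. case (r, y) of (r, y) => ?g r y)"
   unfolding prod.case sh by (rule lborel_pair.AE_integrable_fst[OF f])
 qed
 have I: "(LI r. ?f r y) = \<beta> y * (LINT r:{0..\<tau>}|lborel. D (y + r *r e))" for y
  unfolding set_LI_def by (simp flip: integral_mult_right_zero add: ac_simps)
 have J: "(LI y. ?f r y) = ind {0..\<tau>} r *r (LI y. \<beta> y * D (y + r *r e))" for r by simp
 show "L1 (%y. \<beta> y * (LINT r:{0..\<tau>}|lborel. D (y + r *r e)))"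
  using lborel_pair.integrable_snd[OF f] unfolding I .
 show "set_integrable lborel {0..\<tau>} (%r. LI y. \<beta> y * D (y + r *r e))"
  unfolding set_integrable_def using lborel_pair.integrable_fst[OF f] unfolding J .
 show "(LI y. \<beta> y * (LINT r:{0..\<tau>}|lborel. D (y + r *r e))) = (LINT r:{0..\<tau>}|lborel. LI y. \<beta> y * D (y + r *r e))"
  using lborel_pair.Fubini_integral[OF f] unfolding I J by (simp add: set_LI_def)
 have "(LI y. (LINT r:{0..\<tau>}|lborel. \<beta> (y - r *r e)) * D y) = (LI y. LI r. ?g r y)"
  unfolding set_LI_def by (simp flip: integral_mult_left_zero add: mult.assoc)
 then show "(LI y. (LINT r:{0..\<tau>}|lborel. \<beta> (y - r *r e)) * D y) = (LINT r:{0..\<tau>}|lborel. LI y. \<beta> y * D (y + r *r e))"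
  using lborel_pair.Fubini_integral[OF g] by (simp add: e set_LI_def)
qed

text \<open>
  The increment form of the weak derivative. It is equivalent to the weak form on open sets, but
  speaks about almost every segment instead of test functions, so it is insensitive to what happens on
  a null set.
\<close>

definition shift_deriv :: "'a::euclidean_space set => 'a => real => ('a => real) => ('a => real) => bool" where
 "shift_deriv \<Omega> e \<tau> g D \<longleftrightarrow> (AE y in lborel. (\<forall>r\<in>{0..\<tau>}. y + r *r e \<in> \<Omega>) -->
   g (y + \<tau> *r e) - g y = (LINT r:{0..\<tau>}|lborel. D (y + r *r e)))"

text \<open>
  The set \<open>N\<close> is a closed set on which the weak identity need not be tested: it suffices
  to know it for test functions whose derivative vanishes there. The averages of bumps have this
  property as soon as the two end positions of the box avoid \<open>N\<close>, even if the segments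
  between them cross it.
\<close>

theorem shift_identity_off:
 fixes g D :: "'a::euclidean_space => real"
 assumes e: "e \<in> Basis" and \<tau>: "\<tau> >= 0" and "open \<Omega>" and "closed N"
  and [measurable]: "g \<in> Borel" "D \<in> Borel"
  and lg: "L1loc \<Omega> g" and lD: "L1loc \<Omega> D"
  and weak: "!!\<Theta>. \<Theta> \<in> test_fun \<Omega> ==> (!!y. y \<in> N ==> dir_deriv e \<Theta> y = 0) ==>
   (LI y. dir_deriv e \<Theta> y * g y) = - (LI y. \<Theta> y * D y)"
 shows "AE y in lborel. (\<forall>r\<in>{0..\<tau>}. y + r *r e \<in> \<Omega>) & y \<notin> N & y + \<tau> *r e \<notin> N -->
   g (y + \<tau> *r e) - g y = (LINT r:{0..\<tau>}|lborel. D (y + r *r e))"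
proof -
 define I where "I y = (LINT r:{0..\<tau>}|lborel. D (y + r *r e))" for y
 have [measurable]: "I \<in> Borel" unfolding I_def set_LI_def by measurable
 define \<Omega>' where "\<Omega>' = {y. \<forall>r\<in>{0..\<tau>}. y + r *r e \<in> \<Omega>} \<inter> (- N \<inter> (%y. y + \<tau> *r e) -` (- N))"
 have "open \<Omega>'" unfolding \<Omega>'_def
  by (intro open_Int open_segments_in \<open>open \<Omega>\<close> open_Compl \<open>closed N\<close> open_vimage continuous_intros)
 have "AE y in lborel. y \<in> \<Omega>' --> g (y + \<tau> *r e) - g y - I y = 0"
 proof (rule fundamental_lemma[OF _ \<open>open \<Omega>'\<close>])
  fix a b :: 'a assume ab: "cbox a b \<subseteq> \<Omega>'"
  define K where "K = {y + r *r e |y r. y \<in> cbox a b & r \<in> {0..\<tau>}}"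
  have K: "compact K" "K \<subseteq> \<Omega>" "!!y r. y \<in> cbox a b ==> r \<in> {0..\<tau>} ==> y + r *r e \<in> K"
   unfolding K_def using compact_segment_sum[OF compact_cbox] ab by (auto simp: \<Omega>'_def)
  have abK: "cbox a b \<subseteq> K" using K(3)[of _ 0] \<tau> by auto
  have gK: "set_integrable lborel K g" and DK: "set_integrable lborel K D"
   using lg lD K unfolding locally_integrable_def by auto
  have ig: "set_integrable lborel (cbox a b) g"
   using set_integrable_subset[OF gK] abK by auto
  have igs: "set_integrable lborel (cbox a b) (%y. g (y + \<tau> *r e))"
   unfolding set_integrable_def
   by (rule L1_bound[OF integrable_lborel_shift[OF gK[unfolded set_integrable_def], of "\<tau> *r e"]])
    (use K(3)[of _ \<tau>] \<tau> in \<open>auto simp: indicator_def\<close>)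
  have iI: "set_integrable lborel (cbox a b) I"
   using line_swap(1)[where \<beta>="ind (cbox a b)" and M=1 and C="cbox a b" and \<tau>=\<tau>, OF _ _ _ _ DK K(3)] by (simp add: set_integrable_def I_def)
  show "set_integrable lborel (cbox a b) (%y. g (y + \<tau> *r e) - g y - I y)"
   by (intro set_integral_diff ig igs iI)
  fix c :: real assume c: "c > 0"
  let ?psi = "boxbump a b c"
  have [measurable]: "?psi \<in> Borel" by (rule smooth_borel[OF smooth_boxbump[OF c]])
  have psi0: "?psi y = 0" if "y \<notin> cbox a b" for y
   using that boxbump_zero[of y a b c] box_subset_cbox by blast
  have psi1: "\<bar>?psi y\<bar> <= 1" for y using boxbump_bounds[OF c, of a b y] by simp
  have cut: "L1 (%y. ?psi y * k y)" if "set_integrable lborel (cbox a b) k" and [measurable]: "k \<in> Borel" for k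
  proof (rule L1_bound[OF that(1)[unfolded set_integrable_def]])
   show "AE y in lborel. norm (?psi y * k y) <= norm (ind (cbox a b) y *r k y)"
    using psi0 psi1 by (intro AE_I2) (auto simp: indicator_def abs_mult mult_left_le_one_le)
  qed measurable
  obtain \<Theta> where \<Theta>: "smooth_fun \<Theta>" "!!y. dir_deriv e \<Theta> y = ?psi y - ?psi (y - \<tau> *r e)"
   "!!y. \<Theta> y = (LINT r:{0..\<tau>}|lborel. ?psi (y - r *r e))"
   using line_average_bump[OF e c \<tau>] by blast
  have "\<Theta> \<in> test_fun \<Omega>"
  proof (rule test_funI[OF \<Theta>(1) K(1,2)])
   fix y assume "y \<notin> K"
   then have "y - r *r e \<notin> cbox a b" if "r \<in> {0..\<tau>}" for r using K(3)[of "y - r *r e" r] that by auto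
   then have "(%r. ind {0..\<tau>} r *r ?psi (y - r *r e)) = (%r. 0)"
    using psi0 by (auto simp: indicator_def fun_eq_iff)
   then show "\<Theta> y = 0" unfolding \<Theta>(3) set_LI_def by (simp only: Bochner_Integration.integral_zero)
  qed
  moreover have "dir_deriv e \<Theta> y = 0" if "y \<in> N" for y
  proof -
   have "y \<notin> cbox a b" "y - \<tau> *r e \<notin> cbox a b" using that ab unfolding \<Omega>'_def by (auto dest!: subsetD)
   then show ?thesis by (simp add: \<Theta>(2) psi0)
  qed
  ultimately have w: "(LI y. dir_deriv e \<Theta> y * g y) = - (LI y. \<Theta> y * D y)" by (rule weak)
  have s1: "L1 (%y. ?psi (y - \<tau> *r e) * g y)"
   using integrable_lborel_shift[OF cut[OF igs], of "- \<tau> *r e"] by simp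
  have s2: "(LI y. ?psi (y - \<tau> *r e) * g y) = (LI y. ?psi y * g (y + \<tau> *r e))"
   using integral_lborel_shift[of "%y. ?psi (y - \<tau> *r e) * g y" "\<tau> *r e"] by simp
  have d1: "(LI y. dir_deriv e \<Theta> y * g y) = (LI y. ?psi y * g y) - (LI y. ?psi y * g (y + \<tau> *r e))"
   unfolding \<Theta>(2) left_diff_distrib s2[symmetric]
   by (rule LI_diff[OF cut[OF ig] s1]) simp
  have "\<bar>?psi y\<bar> <= 1 * ind (cbox a b) y" for y using psi0[of y] psi1[of y] by (simp add: indicator_def)
  then have d2: "(LI y. \<Theta> y * D y) = (LI y. ?psi y * I y)"
   unfolding \<Theta>(3) I_def using line_swap(2,3)[where \<beta>="?psi" and M=1 and C="cbox a b" and \<tau>=\<tau>, OF _ _ _ _ DK K(3)] by simp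
  have "(LI y. ?psi y * (g (y + \<tau> *r e) - g y - I y)) = (LI y. ?psi y * g (y + \<tau> *r e) - ?psi y * g y - ?psi y * I y)"
   by (simp add: algebra_simps)
  also have "\<dots> = (LI y. ?psi y * g (y + \<tau> *r e)) - (LI y. ?psi y * g y) - (LI y. ?psi y * I y)"
   using cut[OF ig] cut[OF igs] cut[OF iI] by simp
  also have "\<dots> = 0" using w d1 d2 by simp
  finally show "(LI y. ?psi y * (g (y + \<tau> *r e) - g y - I y)) = 0" .
 qed measurable
 then show ?thesis by eventually_elim (auto simp: \<Omega>'_def I_def)
qed

text \<open>
  Put \<open>A r = \<integral> \<partial>\<psi> g(\<cdot> + r e)\<close> and \<open>B r = \<integral>
  \<psi> D(\<cdot> + r e)\<close>. Increments of \<open>g\<close> are integrals of \<open>D\<close>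
  and increments of \<open>\<psi>\<close> are integrals of \<open>\<partial>\<psi>\<close>; the first
  fact with \<open>\<partial>\<psi>\<close> and the second with \<open>D\<close> show that \<open>A +
  B\<close> is constant on \<open>[0, d]\<close>, the first with \<open>\<psi>\<close> and the second
  with \<open>g\<close> that its integral is zero.
\<close>

lemma shift_imp_weak:
 fixes g D :: "'a::euclidean_space => real"
 assumes "open \<Omega>"
  and [measurable]: "g \<in> Borel" "D \<in> Borel"
  and lg: "L1loc \<Omega> g" and lD: "L1loc \<Omega> D"
  and shift: "!!\<tau>. \<tau> > 0 ==> shift_deriv \<Omega> e \<tau> g D"
  and psi: "psi \<in> test_fun \<Omega>"
 shows "(LI y. dir_deriv e psi y * g y) = - (LI y. psi y * D y)"
proof -
 obtain K where K: "smooth_fun psi" "compact K" "K \<subseteq> \<Omega>" "!!y. y \<notin> K ==> psi y = 0" "!!y v. y \<notin> K ==> dir_deriv v psi y = 0"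
  using test_funD[OF psi] by metis
 have [measurable]: "psi \<in> Borel" "dir_deriv e psi \<in> Borel"
  using K(1) smooth_funD(2) smooth_borel by blast+
 obtain \<delta> where \<delta>: "\<delta> > 0" "(\<Union>x\<in>K. ball x \<delta>) \<subseteq> \<Omega>"
  using compact_subset_open_imp_ball_epsilon_subset[OF K(2) \<open>open \<Omega>\<close> K(3)] by blast
 define d where "d = (\<delta> / 2) / (norm e + 1)"
 have d: "d > 0" "d * norm e < \<delta>"
 proof -
  have n: "norm e + 1 > 0" using norm_ge_zero[of e] by linarith
  show "d > 0" unfolding d_def using \<delta>(1) n by simp
  have "d * norm e <= d * (norm e + 1)" using \<open>d > 0\<close> by (intro mult_left_mono) auto
  also have "\<dots> = \<delta> / 2" using n unfolding d_def by (metis less_irrefl nonzero_eq_divide_eq)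
  finally show "d * norm e < \<delta>" using \<delta>(1) by simp
 qed
 define K' where "K' = {y + r *r e |y r. y \<in> K & r \<in> {0..d}}"
 have K': "compact K'" "K' \<subseteq> \<Omega>" "!!y r. y \<in> K ==> r \<in> {0..d} ==> y + r *r e \<in> K'" "K \<subseteq> K'"
 proof -
  show "compact K'" unfolding K'_def by (rule compact_segment_sum[OF K(2)])
  show i: "!!y r. y \<in> K ==> r \<in> {0..d} ==> y + r *r e \<in> K'" unfolding K'_def by auto
  show "K \<subseteq> K'" using i[of _ 0] d by auto
  show "K' \<subseteq> \<Omega>"
  proof
   fix w assume "w \<in> K'"
   then obtain y r where w: "w = y + r *r e" "y \<in> K" "r \<in> {0..d}" unfolding K'_def by auto
   have "dist y w = r * norm e" using w by (simp add: dist_norm)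
   also have "\<dots> <= d * norm e" using w by (intro mult_right_mono) auto
   finally show "w \<in> \<Omega>" using \<delta>(2) w(2) d by force
  qed
 qed
 have ig: "set_integrable lborel K' g" and iD: "set_integrable lborel K' D"
  using lg lD K' unfolding locally_integrable_def by auto
 have [measurable]: "K' \<in> sets borel" "K \<in> sets borel" using K'(1) K(2) by (auto intro: borel_compact)
 have bd: "\<exists>M. \<forall>y. \<bar>\<beta> y\<bar> <= M * ind K y" if p1: "\<beta> \<in> test_fun \<Omega>" and p2: "!!y. y \<notin> K ==> \<beta> y = 0" for \<beta> :: "'a => real"
 proof -
  obtain J M where M: "!!y. \<bar>\<beta> y\<bar> <= M * ind J y" "M >= 0" using test_fun_bound[OF p1] by metis
  have "\<bar>\<beta> y\<bar> <= M * ind K y" for y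
   using M(1)[of y] M(2) p2[of y] by (cases "y \<in> K"; cases "y \<in> J") auto
  then show ?thesis by blast
 qed
 obtain M M' where M: "!!y. \<bar>psi y\<bar> <= M * ind K y" "!!y. \<bar>dir_deriv e psi y\<bar> <= M' * ind K y"
  using bd[OF psi K(4)] bd[OF test_fun_dir[OF psi] K(5)] by metis
 have sh: "L1 (%y. \<beta> y * k (y + r *r e))"
  if \<beta>: "!!y. \<bar>\<beta> y\<bar> <= N * ind K y" and k: "set_integrable lborel K' k" and r: "r \<in> {0..d}"
   and [measurable]: "\<beta> \<in> Borel" "k \<in> Borel" for \<beta> k :: "'a => real" and N r
 proof -
  have "L1 (%y. N * (ind K' (y + r *r e) * k (y + r *r e)))"
   using integrable_lborel_shift[OF k[unfolded set_integrable_def], of "r *r e"] by simp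
  then show ?thesis
  proof (rule L1_bound)
   show "AE y in lborel. norm (\<beta> y * k (y + r *r e)) <= norm (N * (ind K' (y + r *r e) * k (y + r *r e)))" (is "AE y in _. ?P y")
   proof (intro AE_I2)
    fix y
    have "\<bar>\<beta> y\<bar> <= \<bar>N\<bar> * ind K' (y + r *r e)" using \<beta>[of y] K'(3)[of y r] r by (cases "y \<in> K") auto
    then show "?P y"
     using mult_right_mono[of "\<bar>\<beta> y\<bar>" _ "\<bar>k (y + r *r e)\<bar>"] by (fastforce simp: abs_mult mult.assoc)
   qed
  qed measurable
 qed
 have sub: "y + s *r e \<in> K'" if "y \<in> K" "s \<in> {0..r}" "r \<in> {0..d}" for y s r using K'(3)[of y s] that by auto
 have X: "(LI y. \<beta> y * g (y + r *r e)) - (LI y. \<beta> y * g (y + 0 *r e)) = (LINT s:{0..r}|lborel. LI y. \<beta> y * D (y + s *r e))"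
  if \<beta>: "!!y. \<bar>\<beta> y\<bar> <= N * ind K y" and [measurable]: "\<beta> \<in> Borel" and r: "r \<in> {0..d}" for \<beta> :: "'a => real" and N r
 proof (cases "r = 0")
  case False
  have m [measurable]: "(%y. LINT s:{0..r}|lborel. D (y + s *r e)) \<in> Borel" unfolding set_LI_def by measurable
  have 0: "0 \<in> {0..d}" using d by simp
  have "(LI y. \<beta> y * g (y + r *r e)) - (LI y. \<beta> y * g (y + 0 *r e)) = (LI y. \<beta> y * g (y + r *r e) - \<beta> y * g (y + 0 *r e))"
   by (rule LI_diff[symmetric, OF sh[OF \<beta> ig r] sh[OF \<beta> ig 0]]) measurable
  also have "\<dots> = (LI y. \<beta> y * (LINT s:{0..r}|lborel. D (y + s *r e)))"
  proof (rule integral_cong_AE)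
   have "r > 0" using r False by auto
   from shift[OF this] show "AE y in lborel. \<beta> y * g (y + r *r e) - \<beta> y * g (y + 0 *r e) = \<beta> y * (LINT s:{0..r}|lborel. D (y + s *r e))"
    unfolding shift_deriv_def
   proof eventually_elim
    case (elim y)
    show ?case
    proof (cases "y \<in> K")
     case True
     then show ?thesis using elim sub[OF True _ r] K'(2) by (simp add: subset_iff flip: right_diff_distrib)
    next
     case False
     then have "\<beta> y = 0" using \<beta>[of y] by simp
     then show ?thesis by simp
    qed
   qed
  qed measurable
  also have "\<dots> = (LINT s:{0..r}|lborel. LI y. \<beta> y * D (y + s *r e))"
   by (rule line_swap(2)[OF _ _ _ \<beta> iD]) (use sub[OF _ _ r] in auto)
  finally show ?thesis .
 next
  case True
  have "AE s in lborel. ind {0} s * (LI y. \<beta> y * D (y + s *r e)) = 0"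
   using AE_lborel_singleton[of 0] by eventually_elim simp
  then show ?thesis using True by (simp add: set_LI_def integral_eq_zero_AE)
 qed
 have neg: "dir_deriv (- e) psi w = - dir_deriv e psi w" for w
  using linear_neg[OF has_derivative_linear[OF smooth_has_derivative[OF K(1)]]] by simp
 have FT: "(LI y. psi y * k (y + 0 *r e)) - (LI y. psi y * k (y + r *r e)) = (LINT s:{0..r}|lborel. LI y. dir_deriv e psi y * k (y + s *r e))"
  if k: "set_integrable lborel K' k" and [measurable]: "k \<in> Borel" and r: "r \<in> {0..d}" for k :: "'a => real" and r
 proof -
  have 0: "0 \<in> {0..d}" using d by simp
  have i0: "L1 (%y. psi y * k y)" using sh[OF M(1) k 0] by simp
  have ir: "L1 (%y. psi (y - r *r e) * k y)"
   using integrable_lborel_shift[OF sh[OF M(1) k r], of "- r *r e"] by simp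
  have "(LI y. psi y * k (y + r *r e)) = (LI y. psi (y - r *r e) * k y)"
   using integral_lborel_shift[of "%y. psi (y - r *r e) * k y" "r *r e"] by simp
  then have "(LI y. psi y * k (y + 0 *r e)) - (LI y. psi y * k (y + r *r e)) = (LI y. (psi y - psi (y - r *r e)) * k y)"
   using LI_diff[OF i0 ir] by (simp add: left_diff_distrib)
  also have "\<dots> = (LI y. (LINT s:{0..r}|lborel. dir_deriv e psi (y - s *r e)) * k y)"
  proof -
   have "psi (y - r *r e) - psi y = - (LINT s:{0..r}|lborel. dir_deriv e psi (y - s *r e))" for y
    using smooth_line_FTC[OF K(1), of r y "- e"] r by (simp add: neg set_LI_def)
   then have "psi y - psi (y - r *r e) = (LINT s:{0..r}|lborel. dir_deriv e psi (y - s *r e))" for y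
    by (metis minus_diff_eq minus_minus)
   then show ?thesis by simp
  qed
  also have "\<dots> = (LINT s:{0..r}|lborel. LI y. dir_deriv e psi y * k (y + s *r e))"
   by (rule line_swap(3)[OF _ _ _ M(2) k]) (use sub[OF _ _ r] in auto)
  finally show ?thesis .
 qed
 let ?A = "%r. LI y. dir_deriv e psi y * g (y + r *r e)" and ?B = "%r. LI y. psi y * D (y + r *r e)"
 have const: "?A r + ?B r = ?A 0 + ?B 0" if r: "r \<in> {0..d}" for r
  using X[OF M(2) _ r] FT[OF iD _ r] by simp
 have dd: "d \<in> {0..d}" using d by simp
 have "(LINT r:{0..d}|lborel. ?A r + ?B r) = (LINT r:{0..d}|lborel. ?A r) + (LINT r:{0..d}|lborel. ?B r)"
  by (rule set_integral_add(2)[OF line_swap(4)[OF _ _ _ M(2) ig] line_swap(4)[OF _ _ _ M(1) iD]]) (use K'(3) in auto)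
 also have "\<dots> = 0" using X[OF M(1) _ dd] FT[OF ig _ dd] by simp
 also have "(LINT r:{0..d}|lborel. ?A r + ?B r) = (LINT r:{0..d}|lborel. ?A 0 + ?B 0)"
  by (rule set_lebesgue_integral_cong) (use const in auto)
 finally have "d * (?A 0 + ?B 0) = 0" using d by (simp add: set_LI_def mult.commute)
 then show ?thesis using d by simp
qed

section \<open>Traces and vertical integration\<close>

lemma borel_fst [measurable (raw)]:
 fixes f :: "'m => 'a::second_countable_topology \<times> 'b::second_countable_topology"
 shows "f \<in> borel_measurable M ==> (%x. fst (f x)) \<in> borel_measurable M"
 by (rule measurable_compose[of f M borel fst]) (auto intro!: borel_measurable_continuous_onI continuous_intros)

lemma borel_snd [measurable (raw)]:
 fixes f :: "'m => 'a::second_countable_topology \<times> 'b::second_countable_topology"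
 shows "f \<in> borel_measurable M ==> (%x. snd (f x)) \<in> borel_measurable M"
 by (rule measurable_compose[of f M borel snd]) (auto intro!: borel_measurable_continuous_onI continuous_intros)

lemma box_Pair_eq: "box (a, b) (c, d) = box a c \<times> box b d"
 by (force simp: box_def Basis_prod_def)

lemma AE_lborel_shift:
 fixes c :: "'a::euclidean_space"
 assumes "AE y in lborel. P y"
 shows "AE y in lborel. P (y + c)"
proof -
 obtain N where N: "{y. \<not> P y} \<subseteq> N" "N \<in> null_sets lborel"
  using assms by (auto elim!: AE_E simp: null_sets_def)
 have [measurable]: "N \<in> sets borel" using N(2) by auto
 have "emeasure lborel ((%y. y + c) -` N) = (NN y. ind N (y + c))"
  by (subst nn_integral_indicator[symmetric]) (auto intro!: nn_integral_cong measurable_sets_borel[of "%y. y + c" borel] simp: indicator_def)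
 also have "\<dots> = 0" using nn_integral_lborel_shift[of "ind N" c] N(2) by (simp add: null_setsD1)
 finally have "(%y. y + c) -` N \<in> null_sets lborel"
  by (auto simp: null_sets_def intro!: measurable_sets_borel[of "%y. y + c" borel])
 then show ?thesis by (rule AE_I') (use N(1) in auto)
qed

lemma locally_integrable_borel:
 fixes f :: "'a::euclidean_space => 'b::euclidean_space"
 assumes "L1loc \<Omega> f" "open \<Omega>"
 shows "(%x. ind \<Omega> x *r f x) \<in> Borel"
proof -
 obtain D where D: "countable D" "D \<subseteq> Pow \<Omega>" "!!X. X \<in> D ==> \<exists>a b. X = cbox a b" "\<Union>D = \<Omega>"
  using open_countable_Union_open_cbox[OF \<open>open \<Omega>\<close>] by metis
 have bx: "(%x. ind (cbox a b) x *r f x) \<in> Borel" if "cbox a b \<subseteq> \<Omega>" for a b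
 proof -
  have "set_integrable lborel (cbox a b) f" using assms(1) that compact_cbox unfolding locally_integrable_def by blast
  then have "(%x. ind (cbox a b) x *r f x) \<in> borel_measurable lborel"
   unfolding set_integrable_def by (rule borel_measurable_integrable)
  then show ?thesis by simp
 qed
 show ?thesis
 proof (rule measurable_piecewise_restrict[where C="insert (- \<Omega>) D"])
  show "\<Omega>' \<inter> space borel \<in> sets borel" if "\<Omega>' \<in> insert (- \<Omega>) D" for \<Omega>'
   using that assms(2) by (auto dest!: D(3))
  show "(%x. ind \<Omega> x *r f x) \<in> borel_measurable (restrict_space borel \<Omega>')" if X: "\<Omega>' \<in> insert (- \<Omega>) D" for \<Omega>'
  proof (cases "\<Omega>' = - \<Omega>")
   case True
   have "(%x. ind \<Omega> x *r f x) \<in> borel_measurable (restrict_space borel \<Omega>') \<longleftrightarrow> (%x. 0::'b) \<in> borel_measurable (restrict_space borel \<Omega>')"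
    by (rule measurable_cong) (use True in \<open>auto simp: space_restrict_space\<close>)
   then show ?thesis by simp
  next
   case False
   with X D obtain a b where ab: "\<Omega>' = cbox a b" "cbox a b \<subseteq> \<Omega>" by blast
   have "(%x. ind \<Omega> x *r f x) \<in> borel_measurable (restrict_space borel \<Omega>') \<longleftrightarrow> (%x. ind (cbox a b) x *r f x) \<in> borel_measurable (restrict_space borel \<Omega>')"
    by (rule measurable_cong) (use ab in \<open>auto simp: space_restrict_space indicator_def\<close>)
   then show ?thesis using bx[OF ab(2)] by (simp add: measurable_restrict_space1)
  qed
 qed (use D in auto)
qed

lemma locally_integrable_cut:
 assumes "L1loc \<Omega> f"
 shows "L1loc \<Omega> (%x. ind \<Omega> x *r f x)"
 unfolding locally_integrable_def
proof (intro allI impI)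
 fix C assume C: "compact C & C \<subseteq> \<Omega>"
 then have "set_integrable lborel C f" using assms by (auto simp: locally_integrable_def)
 then show "set_integrable lborel C (%x. ind \<Omega> x *r f x)"
  by (rule set_integrable_cong[THEN iffD1, rotated 3]) (use C in \<open>auto simp: indicator_def\<close>)
qed

lemma weak_deriv_shift:
 fixes g :: "'a::euclidean_space => real"
 assumes "weak_deriv \<Omega> e g D" "open \<Omega>" "e \<in> Basis" "\<tau> >= 0"
 shows "shift_deriv \<Omega> e \<tau> g D"
proof -
 let ?g = "%y. ind \<Omega> y * g y" and ?D = "%y. ind \<Omega> y * D y"
 have l: "L1loc \<Omega> g" "L1loc \<Omega> D" using assms by (auto simp: weak_deriv_def)
 have "AE y in lborel. (\<forall>r\<in>{0..\<tau>}. y + r *r e \<in> \<Omega>) & y \<notin> {} & y + \<tau> *r e \<notin> {} -->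
   ?g (y + \<tau> *r e) - ?g y = (LINT r:{0..\<tau>}|lborel. ?D (y + r *r e))"
 proof (rule shift_identity_off[OF assms(3,4,2)])
  show "(LI y. dir_deriv e \<Theta> y * ?g y) = - (LI y. \<Theta> y * ?D y)" if "\<Theta> \<in> test_fun \<Omega>" for \<Theta>
   using assms(1) that unfolding weak_deriv_def set_LI_def
   by (auto simp: ac_simps)
 qed (use locally_integrable_borel[OF l(1) assms(2)] locally_integrable_borel[OF l(2) assms(2)]
   locally_integrable_cut[OF l(1)] locally_integrable_cut[OF l(2)] in simp_all)
 then show ?thesis unfolding shift_deriv_def
 proof eventually_elim
  case (elim y)
  show ?case
  proof
   assume *: "\<forall>r\<in>{0..\<tau>}. y + r *r e \<in> \<Omega>"
   have "(LINT r:{0..\<tau>}|lborel. ?D (y + r *r e)) = (LINT r:{0..\<tau>}|lborel. D (y + r *r e))"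
    by (rule set_lebesgue_integral_cong) (use * in auto)
   then show "g (y + \<tau> *r e) - g y = (LINT r:{0..\<tau>}|lborel. D (y + r *r e))"
    using elim * bspec[OF *, of 0] bspec[OF *, of \<tau>] \<open>\<tau> >= 0\<close> by simp
  qed
 qed
qed

lemma shift_weak_deriv:
 fixes g D :: "'a::euclidean_space => real"
 assumes "open \<Omega>" "g \<in> Borel" "D \<in> Borel"
  and "L1loc \<Omega> g" "L1loc \<Omega> D"
  and "!!\<tau>. \<tau> > 0 ==> shift_deriv \<Omega> e \<tau> g D"
 shows "weak_deriv \<Omega> e g D"
 unfolding weak_deriv_def
proof (intro conjI ballI assms(4,5))
 fix psi assume psi: "psi \<in> test_fun \<Omega>"
 obtain K where K: "K \<subseteq> \<Omega>" "!!y. y \<notin> K ==> psi y = 0" "!!y v. y \<notin> K ==> dir_deriv v psi y = 0"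
  using test_funD[OF psi] by metis
 have "(LINT x:\<Omega>|lborel. dir_deriv e psi x *r g x) = (LI x. dir_deriv e psi x * g x)"
  "(LINT x:\<Omega>|lborel. psi x *r D x) = (LI x. psi x * D x)"
 proof -
  have "dir_deriv e psi x = 0" "psi x = 0" if "x \<notin> \<Omega>" for x using K that by blast+
  then show "(LINT x:\<Omega>|lborel. dir_deriv e psi x *r g x) = (LI x. dir_deriv e psi x * g x)"
   "(LINT x:\<Omega>|lborel. psi x *r D x) = (LI x. psi x * D x)"
   unfolding set_LI_def by (auto intro!: LI_cong simp: indicator_def)
 qed
 then show "(LINT x:\<Omega>|lborel. dir_deriv e psi x *r g x) = - (LINT x:\<Omega>|lborel. psi x *r D x)"
  using shift_imp_weak[OF assms psi] by simp
qed

lemma LINT_Icc_shift: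
 fixes f :: "real => real"
 assumes [measurable]: "(%r. ind {a..b} r * f r) \<in> Borel"
 shows "(LINT r:{a - c..b - c}|lborel. f (c + r)) = (LINT r:{a..b}|lborel. f r)"
proof -
 have "(LI r. ind {a..b} r * f r) = (LI r. ind {a..b} (r + c) * f (r + c))"
  using integral_lborel_shift[OF assms, of c] by simp
 also have "(%r. ind {a..b} (r + c) * f (r + c)) = (%r. ind {a - c..b - c} r * f (c + r))"
  by (auto simp: fun_eq_iff indicator_def add.commute)
 finally show ?thesis by (simp add: set_LI_def)
qed

lemma e3_Basis: "e3 \<in> Basis"
 by (auto simp: e3_def Basis_prod_def)

lemma e3_add: "(x, z, s) + r *r e3 = (x, z, s + r)"
 by (simp add: e3_def)

lemma open_bottom:
 fixes \<omega> :: "plane set" and h :: "plane => real"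
 assumes "open \<omega>" "continuous_on UNIV h"
 shows "open {(x, z, s). x \<in> \<omega> & s < h z}"
proof -
 have "open (\<omega> \<times> {q :: (real^2) \<times> real. snd q < h (fst q)})"
  by (intro open_Times assms(1) open_Collect_less continuous_intros continuous_on_compose2[OF assms(2)]) auto
 moreover have "\<omega> \<times> {q :: (real^2) \<times> real. snd q < h (fst q)} = {(x, z, s). x \<in> \<omega> & s < h z}"
  by auto
 ultimately show ?thesis by simp
qed

lemma open_top:
 fixes \<omega> :: "plane set"
 assumes "open \<omega>"
 shows "open {(x, z::real^2, s::real). x \<in> \<omega> & 0 < s}"
proof -
 have "open (\<omega> \<times> (UNIV :: plane set) \<times> {0::real<..})"
  by (intro open_Times assms) auto
 moreover have "\<omega> \<times> (UNIV :: plane set) \<times> {0::real<..} = {(x, z::real^2, s::real). x \<in> \<omega> & 0 < s}"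
  by auto
 ultimately show ?thesis by simp
qed

lemma open_layer:
 fixes \<omega> :: "plane set" and h :: "plane => real"
 assumes "open \<omega>" "continuous_on UNIV h"
 shows "open (\<omega> \<times> Zper h)"
proof -
 have "\<omega> \<times> Zper h = {(x, z, s). x \<in> \<omega> & s < h z} \<inter> {(x, z, s). x \<in> \<omega> & 0 < s}"
  by (auto simp: Zper_def)
 then show ?thesis using open_Int[OF open_bottom[OF assms] open_top[OF assms(1)]] by simp
qed

text \<open>
  Integrability up to the top and the bottom of the layer. A weak derivative in the open layer gives
  it only away from the two faces; the \<open>L\<^sup>p\<close> bounds and periodicity provide the
  rest.
\<close>

definition loc_int_up :: "plane set => (plane => real) => (plane \<times> plane \<times> real => 'b::euclidean_space) => bool" where
 "loc_int_up \<omega> h g \<longleftrightarrow> (\<forall>C. compact C --> set_integrable lborel (C \<inter> (\<omega> \<times> Zper h)) g)"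

definition assoc3 :: "(plane \<times> plane) \<times> real => plane \<times> plane \<times> real" where
 "assoc3 q = (fst (fst q), snd (fst q), snd q)"

lemma assoc3_borel [measurable]: "assoc3 \<in> borel \<rightarrow>\<^sub>M borel"
 unfolding assoc3_def by measurable

lemma emeasure_lborel_Times:
 "A \<in> sets borel ==> B \<in> sets borel ==> emeasure lborel (A \<times> B) = emeasure lborel A * emeasure lborel B"
 by (simp add: lborel_prod[symmetric] lborel.emeasure_pair_measure_Times)

lemma distr_assoc3: "distr lborel borel assoc3 = lborel"
proof (rule lborel_eqI[symmetric])
 fix l u :: "plane \<times> plane \<times> real"
 assume le: "!!b. b \<in> Basis ==> l \<bullet> b <= u \<bullet> b"
 obtain l1 l2 l3 u1 u2 u3 where lu: "l = (l1, l2, l3)" "u = (u1, u2, u3)" by (metis prod.exhaust)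
 have A: "assoc3 -` box l u = box ((l1, l2), l3) ((u1, u2), u3)"
  by (auto simp: assoc3_def lu box_Pair_eq)
 have b: "l1 \<bullet> b <= u1 \<bullet> b" "l2 \<bullet> b <= u2 \<bullet> b" if "b \<in> Basis" for b
  using le[of "(b, 0)"] le[of "(0, b, 0)"] that by (auto simp: lu Basis_prod_def)
 have c: "l3 <= u3" using le[of "(0, 0, 1)"] by (auto simp: lu Basis_prod_def)
 have "emeasure lborel (box ((l1, l2), l3) ((u1, u2), u3)) = emeasure lborel (box l1 u1) * emeasure lborel (box l2 u2) * emeasure lborel (box l3 u3)"
  by (simp add: box_Pair_eq emeasure_lborel_Times borel_Times del: box_real)
 moreover have "emeasure lborel (box l u) = emeasure lborel (box l1 u1) * emeasure lborel (box l2 u2) * emeasure lborel (box l3 u3)"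
  by (simp add: lu box_Pair_eq emeasure_lborel_Times borel_Times mult.assoc del: box_real)
 moreover have "emeasure lborel (box l u) = (\<Prod>b\<in>Basis. (u - l) \<bullet> b)"
  using le by (subst emeasure_lborel_box_eq) auto
 ultimately show "emeasure (distr lborel borel assoc3) (box l u) = (\<Prod>b\<in>Basis. (u - l) \<bullet> b)"
  by (subst emeasure_distr) (auto simp: A)
qed simp

lemma integrable_assoc3:
 fixes F :: "plane \<times> plane \<times> real => 'b::{banach, second_countable_topology}"
 assumes [measurable]: "F \<in> Borel"
 shows "L1 F \<longleftrightarrow> integrable (lborel \<Otimes>\<^sub>M lborel) (%q. F (assoc3 q))"
 unfolding lborel_prod by (subst distr_assoc3[symmetric], subst integrable_distr_eq) auto

lemma triple_integral:
 fixes F :: "plane \<times> plane \<times> real => 'b::euclidean_space"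
 assumes "L1 F"
 shows "(LI y. F y) = (LI p. LI s. F (fst p, snd p, s))"
  and "L1 (%p. LI s. F (fst p, snd p, s))"
  and "AE p in lborel. L1 (%s. F (fst p, snd p, s))"
proof -
 have [measurable]: "F \<in> Borel" using assms by auto
 have i: "integrable (lborel \<Otimes>\<^sub>M lborel) (%q. F (assoc3 q))"
  using assms integrable_assoc3[of F] by simp
 have "(LI y. F y) = (LI q. F (assoc3 q))"
  by (subst distr_assoc3[symmetric], subst integral_distr) auto
 also have "\<dots> = (LI p. LI s. F (assoc3 (p, s)))"
  using lborel_pair.integral_fst'[OF i] by (simp add: lborel_prod)
 finally show "(LI y. F y) = (LI p. LI s. F (fst p, snd p, s))" by (simp add: assoc3_def)
 show "L1 (%p. LI s. F (fst p, snd p, s))"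
  using lborel_pair.integrable_fst'[OF i] by (simp add: assoc3_def)
 have "AE p in lborel. L1 (%s. F (assoc3 (p, s)))"
  using lborel_pair.AE_integrable_fst'[OF i] by simp
 then show "AE p in lborel. L1 (%s. F (fst p, snd p, s))"
  by (simp add: assoc3_def)
qed

lemma integrable_triple_product:
 fixes k :: "plane \<times> plane => real" and v :: "real => real"
 assumes k: "L1 k" and v: "L1 v"
 shows "L1 (%y. k (fst y, fst (snd y)) * v (snd (snd y)))"
proof -
 have [measurable]: "k \<in> Borel" "v \<in> Borel" using k v by auto
 have "integrable (lborel \<Otimes>\<^sub>M lborel) (%(p, s). k p * v s)"
 proof (rule lborel_pair.Fubini_integrable)
  show "L1 (%x. LI y. norm (case (x, y) of (p, s) => k p * v s))"
   using k by (simp add: abs_mult)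
 qed (use v in auto)
 then show ?thesis
  by (subst integrable_assoc3) (simp_all add: assoc3_def split_beta')
qed

lemma test_times_integrable:
 fixes g :: "'a::euclidean_space => real"
 assumes psi: "psi \<in> test_fun \<Omega>" and [measurable]: "g \<in> Borel"
  and loc: "L1loc \<Omega> g"
 shows "L1 (%y. psi y * g y)"
proof -
 obtain K M where K: "compact K" "K \<subseteq> \<Omega>" "!!y. y \<notin> K ==> psi y = 0" "!!y. \<bar>psi y\<bar> <= M * ind K y" "M >= 0"
  using test_fun_bound[OF psi] by metis
 have [measurable]: "psi \<in> Borel" using psi by measurable
 have "L1 (%y. M * (ind K y * g y))"
  using loc K by (auto simp: locally_integrable_def set_integrable_def)
 then show ?thesis
 proof (rule L1_bound)
  show "AE y in lborel. norm (psi y * g y) <= norm (M * (ind K y * g y))" (is "AE y in _. ?P y")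
  proof (intro AE_I2)
   fix y
   have "\<bar>psi y\<bar> * \<bar>g y\<bar> <= (M * ind K y) * \<bar>g y\<bar>" by (intro mult_right_mono K) auto
   then show "?P y" using K(5) by (simp add: abs_mult)
  qed
 qed measurable
qed

lemma smooth_vertical_deriv:
 assumes "smooth_fun psi"
 shows "((%s. psi (x, z, s)) has_real_derivative dir_deriv e3 psi (x, z, s)) (at s)"
proof -
 have "((%t. psi ((x, z, 0) + t *r e3)) has_derivative (%v. dir_deriv (v *r e3) psi ((x, z, 0) + s *r e3))) (at s)"
  by (rule has_derivative_compose[of "%r. (x, z, 0) + r *r e3"]) (auto intro!: derivative_eq_intros smooth_has_derivative[OF assms])
 moreover have "dir_deriv (v *r e3) psi ((x, z, 0) + s *r e3) = v * dir_deriv e3 psi (x, z, s)" for v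
  using linear_cmul[OF has_derivative_linear[OF smooth_has_derivative[OF assms]]] by (simp add: e3_add)
 then have "(%v. dir_deriv (v *r e3) psi ((x, z, 0) + s *r e3)) = (*) (dir_deriv e3 psi (x, z, s))"
  by (auto simp: fun_eq_iff)
 ultimately show ?thesis by (simp add: has_field_derivative_def e3_add)
qed

lemma LINT_vertical:
 assumes "smooth_fun psi" "a <= b"
 shows "(LI s. ind {a..b} s * dir_deriv e3 psi (x, z, s)) = psi (x, z, b) - psi (x, z, a)"
proof -
 have "(LINT s:{a..b}|lborel. dir_deriv e3 psi (x, z, s)) = psi (x, z, b) - psi (x, z, a)"
 proof (rule LINT_FTC[OF assms(2)])
  show "continuous_on {a..b} (%s. dir_deriv e3 psi (x, z, s))"
   by (intro continuous_on_compose2[OF smooth_continuous[OF smooth_funD(2)[OF assms(1)], of UNIV]] continuous_intros) auto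
 qed (rule smooth_vertical_deriv[OF assms(1)])
 then show ?thesis by (simp add: set_LI_def)
qed

lemma loc_int_up_cut:
 assumes g: "loc_int_up \<omega> h (g :: _ => real)" and "open \<omega>" "continuous_on UNIV h"
 shows "(%y. ind (\<omega> \<times> Zper h) y * g y) \<in> Borel"
  and "L1loc UNIV (%y. ind (\<omega> \<times> Zper h) y * g y)"
  and "L1loc (\<omega> \<times> Zper h) g"
proof -
 show l: "L1loc (\<omega> \<times> Zper h) g"
  using g unfolding loc_int_up_def locally_integrable_def by (metis Int_absorb2)
 show "(%y. ind (\<omega> \<times> Zper h) y * g y) \<in> Borel"
  using locally_integrable_borel[OF l open_layer[OF assms(2,3)]] by simp
 show "L1loc UNIV (%y. ind (\<omega> \<times> Zper h) y * g y)"
  unfolding locally_integrable_def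
 proof (intro allI impI)
  fix C :: "(plane \<times> plane \<times> real) set" assume "compact C & C \<subseteq> UNIV"
  then have "set_integrable lborel (C \<inter> (\<omega> \<times> Zper h)) g" using g by (auto simp: loc_int_up_def)
  then show "set_integrable lborel C (%y. ind (\<omega> \<times> Zper h) y * g y)"
   unfolding set_integrable_def
   by (rule Bochner_Integration.integrable_cong[THEN iffD1, OF refl, rotated]) (auto simp: indicator_def)
 qed
qed

lemma bounded_slab:
 assumes "compact (C :: (plane \<times> plane \<times> real) set)"
 obtains N P where "N > 0" "compact P" "!!x z s. (x, z, s) \<in> C ==> (x, z) \<in> P & \<bar>s\<bar> < N" "P = (%y. (fst y, fst (snd y))) ` C"
proof -
 let ?P = "(%y. (fst y, fst (snd y))) ` C"
 have cP: "compact ?P" by (intro compact_continuous_image assms continuous_intros)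
 have "compact ((%y. snd (snd y)) ` C)" by (intro compact_continuous_image assms continuous_intros)
 then obtain N where N: "!!s. s \<in> (%y. snd (snd y)) ` C ==> \<bar>s\<bar> <= N"
  using compact_imp_bounded bounded_real by metis
 have "(x, z) \<in> ?P & \<bar>s\<bar> < \<bar>N\<bar> + 1" if "(x, z, s) \<in> C" for x z s
  using that N[of s] by force
 then show thesis using that[of "\<bar>N\<bar> + 1" ?P] cP by auto
qed

lemma outer_integral:
 fixes t' :: "plane \<times> plane => real" and U :: "(plane \<times> plane \<times> real) set"
 assumes \<omega>: "open \<omega>" and [measurable]: "t' \<in> Borel" "U \<in> sets borel"
  and t: "L1loc (\<omega> \<times> UNIV) t'"
  and \<Omega>: "\<Omega> \<subseteq> \<omega> \<times> UNIV"
 shows "L1loc \<Omega> (%y. ind U y * t' (fst y, fst (snd y)))"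
  and "psi \<in> test_fun \<Omega> ==> (!!x z N. N > 0 ==> (!!s. \<bar>s\<bar> >= N ==> psi (x, z, s) = 0) ==>
    (LI s. ind {-N..N} s * (ind U (x, z, s) * dir_deriv e3 psi (x, z, s))) = k (x, z)) ==>
   (LI y. dir_deriv e3 psi y * (ind U y * t' (fst y, fst (snd y)))) = (LI p. k p * t' p)"
proof -
 show l: "L1loc \<Omega> (%y. ind U y * t' (fst y, fst (snd y)))"
  unfolding locally_integrable_def set_integrable_def
 proof (intro allI impI)
  fix C assume C: "compact C & C \<subseteq> \<Omega>"
  obtain N P where N: "N > 0" "compact P" "!!x z s. (x, z, s) \<in> C ==> (x, z) \<in> P & \<bar>s\<bar> < N" "P = (%y. (fst y, fst (snd y))) ` C"
   by (rule bounded_slab[OF conjunct1[OF C]], rule that)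
  have [measurable]: "C \<in> sets borel" using C by (auto intro: borel_compact)
  have "P \<subseteq> \<omega> \<times> UNIV" using C \<Omega> N(4) by fastforce
  then have "L1 (%p. ind P p * t' p)"
   using t N(2) unfolding locally_integrable_def set_integrable_def by simp
  moreover have "L1 (%s. ind {-N..N} s * 1 :: real)" by (rule integrable_indicator_Icc)
  ultimately have "L1 (%y. (ind P (fst y, fst (snd y)) * t' (fst y, fst (snd y))) * (ind {-N..N} (snd (snd y)) * 1))"
   by (rule integrable_triple_product)
  then show "L1 (%y. ind C y *r (ind U y * t' (fst y, fst (snd y))))"
  proof (rule L1_bound)
   show "AE y in lborel. norm (ind C y *r (ind U y * t' (fst y, fst (snd y)))) <= norm ((ind P (fst y, fst (snd y)) * t' (fst y, fst (snd y))) * (ind {-N..N} (snd (snd y)) * 1))" (is "AE y in _. ?P y")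
   proof (intro AE_I2)
    fix y :: "plane \<times> plane \<times> real"
    obtain x z s where y: "y = (x, z, s)" by (metis prod.exhaust)
    show "?P y"
     using N(3)[of x z s] unfolding y by (cases "(x, z, s) \<in> C") (auto simp: indicator_def)
   qed
  qed measurable
 qed
 assume psi: "psi \<in> test_fun \<Omega>" and in_k: "!!x z N. N > 0 ==> (!!s. \<bar>s\<bar> >= N ==> psi (x, z, s) = 0) ==>
    (LI s. ind {-N..N} s * (ind U (x, z, s) * dir_deriv e3 psi (x, z, s))) = k (x, z)"
 obtain K where K: "compact K" "K \<subseteq> \<Omega>" "!!y. y \<notin> K ==> psi y = 0" "!!y v. y \<notin> K ==> dir_deriv v psi y = 0"
  using test_funD[OF psi] by metis
 obtain N P where N: "N > 0" "compact P" "!!x z s. (x, z, s) \<in> K ==> (x, z) \<in> P & \<bar>s\<bar> < N"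
  by (rule bounded_slab[OF K(1)], rule that)
 have i: "L1 (%y. dir_deriv e3 psi y * (ind U y * t' (fst y, fst (snd y))))"
  by (rule test_times_integrable[OF test_fun_dir[OF psi] _ l]) measurable
 have "(LI y. dir_deriv e3 psi y * (ind U y * t' (fst y, fst (snd y))))
  = (LI p. LI s. (ind {-N..N} s * (ind U (fst p, snd p, s) * dir_deriv e3 psi (fst p, snd p, s))) * t' p)"
  unfolding triple_integral(1)[OF i]
 proof (intro LI_cong refl)
  fix p s
  show "dir_deriv e3 psi (fst p, snd p, s) * (ind U (fst p, snd p, s) * t' (fst (fst p, snd p, s), fst (snd (fst p, snd p, s))))
   = ind {- N..N} s * (ind U (fst p, snd p, s) * dir_deriv e3 psi (fst p, snd p, s)) * t' p"
   using N(3)[of "fst p" "snd p" s] K(4)[of "(fst p, snd p, s)" e3]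
   by (cases "(fst p, snd p, s) \<in> K") (auto simp: indicator_def)
 qed
 also have "\<dots> = (LI p. k p * t' p)"
 proof (intro LI_cong refl)
  fix p
  have "psi (fst p, snd p, s) = 0" if "\<bar>s\<bar> >= N" for s
   using N(3)[of "fst p" "snd p" s] K(3)[of "(fst p, snd p, s)"] that by fastforce
  then show "(LI s. (ind {-N..N} s * (ind U (fst p, snd p, s) * dir_deriv e3 psi (fst p, snd p, s))) * t' p) = k p * t' p"
   using in_k[OF N(1), of "fst p" "snd p"] by simp
 qed
 finally show "(LI y. dir_deriv e3 psi y * (ind U y * t' (fst y, fst (snd y)))) = (LI p. k p * t' p)" .
qed

text \<open>
  Extended by the trace below the bottom, the function has a weak vertical derivative across \<open>s
  = 0\<close>, namely \<open>D\<close> extended by zero; this is the content of the trace formula. Its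
  increments from a point below the bottom are the claim.
\<close>

theorem bottom_FTC:
 fixes g D :: "plane \<times> plane \<times> real => real"
 assumes \<omega>: "open \<omega>" and h: "continuous_on UNIV h" "!!z. 0 < h z" "!!z. h z <= H"
  and g: "loc_int_up \<omega> h g" and D: "loc_int_up \<omega> h D" and t: "L1loc (\<omega> \<times> UNIV) t"
  and trace: "!!psi. psi \<in> test_fun {(x, z, s). x \<in> \<omega> & s < h z} ==>
    (LINT y:\<omega> \<times> Zper h|lborel. dir_deriv e3 psi y * g y + psi y * D y)
    = - (LINT (x, z):\<omega> \<times> UNIV|lborel. psi (x, z, 0) * t (x, z))"
 shows "AE y in lborel. y \<in> \<omega> \<times> Zper h --> g y = t (fst y, fst (snd y)) +
  (LINT r:{0..snd (snd y)}|lborel. ind (\<omega> \<times> Zper h) (fst y, fst (snd y), r) * D (fst y, fst (snd y), r))"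
proof -
 let ?S = "\<omega> \<times> Zper h" and ?\<Omega> = "{(x, z, s). x \<in> \<omega> & s < h z}"
 define g' where "g' = (%y. ind ?S y * g y)"
 define D' where "D' = (%y. ind ?S y * D y)"
 define t' where "t' = (%p. ind (\<omega> \<times> UNIV) p * t p)"
 define U where "U = {y :: plane \<times> plane \<times> real. snd (snd y) <= 0}"
 have [measurable]: "U \<in> sets borel" unfolding U_def by measurable
 have o\<omega>: "open (\<omega> \<times> (UNIV :: plane set))" by (intro open_Times \<omega> open_UNIV)
 have [measurable]: "g' \<in> Borel" "D' \<in> Borel" "t' \<in> Borel"
  using loc_int_up_cut[OF g \<omega> h(1)] loc_int_up_cut[OF D \<omega> h(1)] locally_integrable_borel[OF t o\<omega>]
  by (simp_all add: g'_def D'_def t'_def)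
 have lg: "L1loc UNIV g'" and lD: "L1loc UNIV D'" and lt: "L1loc (\<omega> \<times> UNIV) t'"
  using loc_int_up_cut[OF g \<omega> h(1)] loc_int_up_cut[OF D \<omega> h(1)] locally_integrable_cut[OF t]
  by (simp_all add: g'_def D'_def t'_def)
 have mono: "L1loc ?\<Omega> k" if "L1loc UNIV k" for k :: "_ => real"
  using that by (auto simp: locally_integrable_def)
 define G where "G = (%y. g' y + ind U y * t' (fst y, fst (snd y)))"
 have [measurable]: "G \<in> Borel" unfolding G_def by measurable
 have sub: "?\<Omega> \<subseteq> \<omega> \<times> UNIV" by auto
 note outer = outer_integral[OF \<omega> _ _ lt sub, of U]
 have lG: "L1loc ?\<Omega> G"
  using mono[OF lg] outer(1) unfolding locally_integrable_def G_def
  by (auto intro!: set_integral_add)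
 have "AE y in lborel. (\<forall>r\<in>{0..H}. y + r *r e3 \<in> ?\<Omega>) & y \<notin> {} & y + H *r e3 \<notin> {} -->
   G (y + H *r e3) - G y = (LINT r:{0..H}|lborel. D' (y + r *r e3))"
 proof (rule shift_identity_off[OF e3_Basis _ open_bottom[OF \<omega> h(1)] closed_empty])
  show "0 <= H" using h(2,3)[of 0] by linarith
  show "L1loc ?\<Omega> G" by (rule lG)
  show "L1loc ?\<Omega> D'" by (rule mono[OF lD])
  fix psi assume psi: "psi \<in> test_fun ?\<Omega>"
  then have sm: "smooth_fun psi" using test_funD by blast
  have i1: "L1 (%y. dir_deriv e3 psi y * g' y)" "L1 (%y. psi y * D' y)"
   "L1 (%y. dir_deriv e3 psi y * (ind U y * t' (fst y, fst (snd y))))"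
   by (rule test_times_integrable[OF test_fun_dir[OF psi] _ mono[OF lg]] test_times_integrable[OF psi _ mono[OF lD]]
    test_times_integrable[OF test_fun_dir[OF psi] _ outer(1)]; measurable)+
  have "(LI y. dir_deriv e3 psi y * (ind U y * t' (fst y, fst (snd y)))) = (LI p. psi (fst p, snd p, 0) * t' p)"
  proof (rule outer(2)[OF _ _ psi])
   fix x z N assume N: "N > 0" "!!s. \<bar>s\<bar> >= N ==> psi (x, z, s) = 0"
   have "(%s. ind {-N..N} s * (ind U (x, z, s) * dir_deriv e3 psi (x, z, s))) = (%s. ind {-N..0} s * dir_deriv e3 psi (x, z, s))"
    using N(1) by (auto simp: fun_eq_iff indicator_def U_def)
   then show "(LI s. ind {-N..N} s * (ind U (x, z, s) * dir_deriv e3 psi (x, z, s))) = psi (fst (x, z), snd (x, z), 0)"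
    using LINT_vertical[OF sm, of "-N" 0 x z] N(1) N(2)[of "-N"] by simp
  qed measurable
  also have "\<dots> = (LINT (x, z):\<omega> \<times> UNIV|lborel. psi (x, z, 0) * t (x, z))"
   unfolding set_LI_def by (simp add: t'_def split_beta ac_simps)
  also have "\<dots> = - (LI y. dir_deriv e3 psi y * g' y + psi y * D' y)"
   using trace[OF psi] unfolding set_LI_def by (simp add: g'_def D'_def algebra_simps)
  also have "\<dots> = - (LI y. dir_deriv e3 psi y * g' y) - (LI y. psi y * D' y)"
   using i1 by simp
  finally show "(LI y. dir_deriv e3 psi y * G y) = - (LI y. psi y * D' y)"
   using i1 by (simp add: G_def distrib_left)
 qed measurable
 from AE_lborel_shift[OF this, of "- H *r e3"] show ?thesis
 proof eventually_elim
  case (elim y)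
  obtain x z s where y: "y = (x, z, s)" by (metis prod.exhaust)
  show ?case
  proof
   assume "y \<in> ?S"
   then have s: "x \<in> \<omega>" "0 < s" "s < h z" by (auto simp: y Zper_def)
   have "(\<forall>r\<in>{0..H}. y + - H *r e3 + r *r e3 \<in> ?\<Omega>)" using s by (auto simp: y e3_def)
   with elim have "G (x, z, s) - G (x, z, s - H) = (LINT r:{0..H}|lborel. D' (x, z, s - H + r))"
    by (simp add: y e3_def)
   also have "G (x, z, s) = g y" using s by (simp add: G_def g'_def U_def y Zper_def)
   also have "G (x, z, s - H) = t (x, z)" using s h(3)[of z] by (simp add: G_def g'_def t'_def U_def Zper_def)
   also have "(LINT r:{0..H}|lborel. D' (x, z, s - H + r)) = (LINT r:{s - H..s}|lborel. D' (x, z, r))"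
    using LINT_Icc_shift[of "s - H" s "%r. D' (x, z, r)" "s - H"] by simp
   also have "\<dots> = (LINT r:{0..s}|lborel. D' (x, z, r))"
    unfolding set_LI_def using s h(3)[of z]
    by (intro LI_cong) (auto simp: indicator_def D'_def Zper_def)
   finally show "g y = t (fst y, fst (snd y)) + (LINT r:{0..snd (snd y)}|lborel. ind ?S (fst y, fst (snd y), r) * D (fst y, fst (snd y), r))"
    by (simp add: D'_def y)
  qed
 qed
qed

text \<open>
  The mirror image of the previous theorem: the function is extended by its trace above the graph of
  \<open>h\<close>.
\<close>

theorem top_FTC:
 fixes g D :: "plane \<times> plane \<times> real => real"
 assumes \<omega>: "open \<omega>" and h: "continuous_on UNIV h" "!!z. 0 < h z" "!!z. h z <= H"
  and g: "loc_int_up \<omega> h g" and D: "loc_int_up \<omega> h D" and t: "L1loc (\<omega> \<times> UNIV) t"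
  and trace: "!!psi. psi \<in> test_fun {(x, z, s). x \<in> \<omega> & 0 < s} ==>
    (LINT y:\<omega> \<times> Zper h|lborel. dir_deriv e3 psi y * g y + psi y * D y)
    = (LINT (x, z):\<omega> \<times> UNIV|lborel. psi (x, z, h z) * t (x, z))"
 shows "AE y in lborel. y \<in> \<omega> \<times> Zper h --> g y = t (fst y, fst (snd y)) -
  (LINT r:{snd (snd y)..h (fst (snd y))}|lborel. ind (\<omega> \<times> Zper h) (fst y, fst (snd y), r) * D (fst y, fst (snd y), r))"
proof -
 let ?S = "\<omega> \<times> Zper h" and ?\<Omega> = "{(x::real^2, z::real^2, s::real). x \<in> \<omega> & 0 < s}"
 define g' where "g' = (%y. ind ?S y * g y)"
 define D' where "D' = (%y. ind ?S y * D y)"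
 define t' where "t' = (%p. ind (\<omega> \<times> UNIV) p * t p)"
 define U where "U = {y :: plane \<times> plane \<times> real. h (fst (snd y)) <= snd (snd y)}"
 have [measurable]: "h \<in> Borel" by (rule borel_measurable_continuous_onI[OF h(1)])
 have [measurable]: "U \<in> sets borel" unfolding U_def by measurable
 have o\<omega>: "open (\<omega> \<times> (UNIV :: plane set))" by (intro open_Times \<omega> open_UNIV)
 have [measurable]: "g' \<in> Borel" "D' \<in> Borel" "t' \<in> Borel"
  using loc_int_up_cut[OF g \<omega> h(1)] loc_int_up_cut[OF D \<omega> h(1)] locally_integrable_borel[OF t o\<omega>]
  by (simp_all add: g'_def D'_def t'_def)
 have lg: "L1loc UNIV g'" and lD: "L1loc UNIV D'" and lt: "L1loc (\<omega> \<times> UNIV) t'"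
  using loc_int_up_cut[OF g \<omega> h(1)] loc_int_up_cut[OF D \<omega> h(1)] locally_integrable_cut[OF t]
  by (simp_all add: g'_def D'_def t'_def)
 have mono: "L1loc ?\<Omega> k" if "L1loc UNIV k" for k :: "_ => real"
  using that by (auto simp: locally_integrable_def)
 define G where "G = (%y. g' y + ind U y * t' (fst y, fst (snd y)))"
 have [measurable]: "G \<in> Borel" unfolding G_def by measurable
 have sub: "?\<Omega> \<subseteq> \<omega> \<times> UNIV" by auto
 note outer = outer_integral[OF \<omega> _ _ lt sub, of U]
 have lG: "L1loc ?\<Omega> G"
  using mono[OF lg] outer(1) unfolding locally_integrable_def G_def
  by (auto intro!: set_integral_add)
 have "AE y in lborel. (\<forall>r\<in>{0..H}. y + r *r e3 \<in> ?\<Omega>) & y \<notin> {} & y + H *r e3 \<notin> {} -->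
   G (y + H *r e3) - G y = (LINT r:{0..H}|lborel. D' (y + r *r e3))"
 proof (rule shift_identity_off[OF e3_Basis _ open_top[OF \<omega>] closed_empty])
  show "0 <= H" using h(2,3)[of 0] by linarith
  show "L1loc ?\<Omega> G" by (rule lG)
  show "L1loc ?\<Omega> D'" by (rule mono[OF lD])
  fix psi assume psi: "psi \<in> test_fun ?\<Omega>"
  then have sm: "smooth_fun psi" using test_funD by blast
  have i1: "L1 (%y. dir_deriv e3 psi y * g' y)" "L1 (%y. psi y * D' y)"
   "L1 (%y. dir_deriv e3 psi y * (ind U y * t' (fst y, fst (snd y))))"
   by (rule test_times_integrable[OF test_fun_dir[OF psi] _ mono[OF lg]] test_times_integrable[OF psi _ mono[OF lD]]
    test_times_integrable[OF test_fun_dir[OF psi] _ outer(1)]; measurable)+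
  have "(LI y. dir_deriv e3 psi y * (ind U y * t' (fst y, fst (snd y)))) = (LI p. - psi (fst p, snd p, h (snd p)) * t' p)"
  proof (rule outer(2)[OF _ _ psi])
   fix x z N assume N: "N > 0" "!!s. \<bar>s\<bar> >= N ==> psi (x, z, s) = 0"
   have "(%s. ind {-N..N} s * (ind U (x, z, s) * dir_deriv e3 psi (x, z, s))) = (%s. ind {h z..N} s * dir_deriv e3 psi (x, z, s))"
    using N(1) h(2)[of z] by (auto simp: fun_eq_iff indicator_def U_def)
   moreover have "(LI s. ind {h z..N} s * dir_deriv e3 psi (x, z, s)) = - psi (x, z, h z)"
   proof (cases "h z <= N")
    case True
    then show ?thesis using LINT_vertical[OF sm True, of x z] N(1) N(2)[of "N"] by simp
   next
    case False
    then show ?thesis using N(2)[of "h z"] by simp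
   qed
   ultimately show "(LI s. ind {-N..N} s * (ind U (x, z, s) * dir_deriv e3 psi (x, z, s))) = - psi (fst (x, z), snd (x, z), h (snd (x, z)))"
    by simp
  qed measurable
  also have "\<dots> = - (LINT (x, z):\<omega> \<times> UNIV|lborel. psi (x, z, h z) * t (x, z))"
   unfolding set_LI_def by (simp add: t'_def split_beta ac_simps)
  also have "\<dots> = - (LI y. dir_deriv e3 psi y * g' y + psi y * D' y)"
   using trace[OF psi] unfolding set_LI_def by (simp add: g'_def D'_def algebra_simps)
  also have "\<dots> = - (LI y. dir_deriv e3 psi y * g' y) - (LI y. psi y * D' y)"
   using i1 by simp
  finally show "(LI y. dir_deriv e3 psi y * G y) = - (LI y. psi y * D' y)"
   using i1 by (simp add: G_def distrib_left)
 qed measurable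
 then show ?thesis
 proof eventually_elim
  case (elim y)
  obtain x z s where y: "y = (x, z, s)" by (metis prod.exhaust)
  show ?case
  proof
   assume "y \<in> ?S"
   then have s: "x \<in> \<omega>" "0 < s" "s < h z" by (auto simp: y Zper_def)
   have "(\<forall>r\<in>{0..H}. y + r *r e3 \<in> ?\<Omega>)" using s by (auto simp: y e3_def)
   with elim have "G (x, z, s + H) - G (x, z, s) = (LINT r:{0..H}|lborel. D' (x, z, s + r))"
    by (simp add: y e3_def)
   also have "G (x, z, s) = g y" using s by (simp add: G_def g'_def U_def y Zper_def)
   also have "G (x, z, s + H) = t (x, z)" using s h(3)[of z] by (simp add: G_def g'_def t'_def U_def Zper_def)
   also have "(LINT r:{0..H}|lborel. D' (x, z, s + r)) = (LINT r:{s..s + H}|lborel. D' (x, z, r))"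
    using LINT_Icc_shift[of s "s + H" "%r. D' (x, z, r)" s] by simp
   also have "\<dots> = (LINT r:{s..h z}|lborel. D' (x, z, r))"
    unfolding set_LI_def using s h(3)[of z]
    by (intro LI_cong) (auto simp: indicator_def D'_def Zper_def)
   finally show "g y = t (fst y, fst (snd y)) - (LINT r:{snd (snd y)..h (fst (snd y))}|lborel. ind ?S (fst y, fst (snd y), r) * D (fst y, fst (snd y), r))"
    by (simp add: D'_def y)
  qed
 qed
qed

section \<open>Periodic square integrable functions\<close>

definition lattice_vec :: "int \<times> int => plane" where
 "lattice_vec k = of_int (fst k) *r axis 1 1 + of_int (snd k) *r axis 2 1"

lemma lattice_vec_nth [simp]: "lattice_vec k $ 1 = of_int (fst k)" "lattice_vec k $ 2 = of_int (snd k)"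
 by (simp_all add: lattice_vec_def axis_def)

lemma periodic_int:
 assumes "periodic g" shows "g (z + of_int n *r axis i 1) = g z"
proof (induction n arbitrary: z rule: int_induct[of _ 0])
 case (step1 n)
 have "g (z + of_int (n + 1) *r axis i 1) = g ((z + axis i 1) + of_int n *r axis i 1)"
  by (simp add: scaleR_left_distrib add_ac)
 then show ?case using step1 assms by (simp add: periodic_def)
next
 case (step2 n)
 have "z + of_int (n - 1) *r axis i 1 = (z - axis i 1) + of_int n *r axis i 1"
  by (simp add: algebra_simps)
 then have "g (z + of_int (n - 1) *r axis i 1) = g ((z - axis i 1) + of_int n *r axis i 1)" by (simp only:)
 also have "\<dots> = g (z - axis i 1)" using step2 by blast
 also have "\<dots> = g z" using assms[unfolded periodic_def, rule_format, of "z - axis i 1" i] by simp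
 finally show ?case .
qed simp

lemma periodic_lattice: "periodic g ==> g (z + lattice_vec k) = g z"
 unfolding lattice_vec_def by (metis add.assoc periodic_int)

lemma periodic_shift: "periodic g ==> periodic (%z. g (z + t))"
 by (simp add: periodic_def add_ac) (metis add.commute add.assoc)

lemma periodic_comp: "periodic g ==> periodic (%z. F (g z))"
 by (simp add: periodic_def)

lemma periodic_comp2: "periodic f ==> periodic g ==> periodic (%z. F (f z) (g z))"
 by (simp add: periodic_def)

definition cellh :: "plane set" where
 "cellh = {z. \<forall>i. -1/2 <= z $ i & z $ i < 1/2}"

lemma cell_box: "cell = box (vec (-1/2)) (vec (1/2))"
 by (auto simp: cell_def mem_box_cart)

lemma cell_cellh: "cell \<subseteq> cellh" and cellh_cbox: "cellh \<subseteq> cbox (vec (-1/2)) (vec (1/2))"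
 by (auto simp: cell_def cellh_def mem_box_cart less_imp_le)

lemma cell_borel [measurable]: "cell \<in> sets borel" by (simp add: cell_box)

lemma cellh_borel [measurable]: "cellh \<in> sets borel"
proof -
 have "cellh = {z. -1/2 <= z $ 1} \<inter> {z. z $ 1 < 1/2} \<inter> {z. -1/2 <= z $ 2} \<inter> {z. z $ 2 < 1/2}"
  by (auto simp: cellh_def forall_2)
 also have "\<dots> \<in> sets borel"
  by (intro sets.Int borel_closed borel_open closed_Collect_le open_Collect_less continuous_intros)
 finally show ?thesis .
qed

lemma AE_cellh: "AE z in lborel. z \<in> cellh \<longleftrightarrow> z \<in> cell"
 using AE_lborel_cbox_box[of "vec (-1/2)" "vec (1/2) :: real^2"] cell_cellh cellh_cbox
 by (auto simp: cell_box)

lemma cellh_unique: "\<exists>k0. \<forall>k. z - lattice_vec k \<in> cellh \<longleftrightarrow> k = k0"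
proof (intro exI allI iffI)
 let ?k0 = "(\<lfloor>z $ 1 + 1/2\<rfloor>, \<lfloor>z $ 2 + 1/2\<rfloor>)"
 fix k
 {
  assume "z - lattice_vec k \<in> cellh"
  then have "of_int (fst k) <= z $ 1 + 1/2" "z $ 1 + 1/2 < of_int (fst k) + 1" "of_int (snd k) <= z $ 2 + 1/2" "z $ 2 + 1/2 < of_int (snd k) + 1"
   by (auto simp: cellh_def forall_2)
  then have "\<lfloor>z $ 1 + 1/2\<rfloor> = fst k" "\<lfloor>z $ 2 + 1/2\<rfloor> = snd k"
   by (intro floor_unique; linarith)+
  then show "k = ?k0" by (simp add: prod_eq_iff)
 }
 assume "k = ?k0"
 then show "z - lattice_vec k \<in> cellh"
  using floor_correct[of "z $ 1 + 1/2"] floor_correct[of "z $ 2 + 1/2"]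
  unfolding cellh_def mem_Collect_eq forall_2 vector_minus_component lattice_vec_nth
  by (simp only: fst_conv snd_conv) (intro conjI; linarith)
qed

text \<open>
  The translates of the half-open cell by lattice vectors tile the plane.
\<close>

lemma nn_integral_unfold:
 fixes \<Phi> :: "plane => ennreal"
 assumes [measurable]: "\<Phi> \<in> Borel"
 shows "(NN z. \<Phi> z) = (NN z. ind cellh z * (\<integral>\<^sup>+k. \<Phi> (z + lattice_vec k) \<partial>count_space UNIV))"
proof -
 have one: "(\<integral>\<^sup>+k. ind cellh (z - lattice_vec k) \<partial>count_space UNIV) = 1" for z
 proof -
  obtain k0 where k0: "!!k. z - lattice_vec k \<in> cellh \<longleftrightarrow> k = k0" using cellh_unique by metis
  have "(%k. ind cellh (z - lattice_vec k) :: ennreal) = ind {k0}"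
   using k0 by (auto simp: indicator_def fun_eq_iff)
  then show ?thesis by simp
 qed
 have "(NN z. \<Phi> z) = (NN z. \<integral>\<^sup>+k. \<Phi> z * ind cellh (z - lattice_vec k) \<partial>count_space UNIV)"
  by (simp add: nn_integral_cmult one)
 also have "\<dots> = (\<integral>\<^sup>+k. NN z. \<Phi> z * ind cellh (z - lattice_vec k) \<partial>count_space UNIV)"
  by (rule nn_integral_count_space_nn_integral) auto
 also have "\<dots> = (\<integral>\<^sup>+k. NN z. ind cellh z * \<Phi> (z + lattice_vec k) \<partial>count_space UNIV)"
 proof (rule nn_integral_cong)
  fix k
  show "(NN z. \<Phi> z * ind cellh (z - lattice_vec k)) = (NN z. ind cellh z * \<Phi> (z + lattice_vec k))"
   using nn_integral_lborel_shift[of "%z. \<Phi> z * ind cellh (z - lattice_vec k)" "lattice_vec k"]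
   by (simp add: mult.commute)
 qed
 also have "\<dots> = (NN z. \<integral>\<^sup>+k. ind cellh z * \<Phi> (z + lattice_vec k) \<partial>count_space UNIV)"
  by (rule nn_integral_count_space_nn_integral[symmetric]) auto
 finally show ?thesis by (simp add: nn_integral_cmult)
qed

lemma nn_integral_cellh: 
 assumes [measurable]: "F \<in> Borel"
 shows "(NN z. ind cellh z * F z) = (NN z. ind cell z * F z)"
 by (rule nn_integral_cong_AE, use AE_cellh in eventually_elim) (auto simp: indicator_def)

lemma nn_integral_cell_shift:
 fixes F :: "plane => ennreal"
 assumes [measurable]: "F \<in> Borel" and F: "periodic F"
 shows "(NN z. ind cell z * F (z + t)) = (NN z. ind cell z * F z)"
proof -
 have one: "(\<integral>\<^sup>+k. ind cellh (z - t + lattice_vec k) \<partial>count_space UNIV) = 1" for z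
 proof -
  obtain k0 where k0: "!!k. z - t - lattice_vec k \<in> cellh \<longleftrightarrow> k = k0" using cellh_unique by metis
  have m: "lattice_vec k = - lattice_vec (- fst k, - snd k)" for k
   by (simp add: lattice_vec_def scaleR_minus_left)
  have "z - t + lattice_vec k \<in> cellh \<longleftrightarrow> k = (- fst k0, - snd k0)" for k
  proof -
   have "z - t + lattice_vec k = z - t - lattice_vec (- fst k, - snd k)" unfolding m[of k] by simp
   then have "z - t + lattice_vec k \<in> cellh \<longleftrightarrow> (- fst k, - snd k) = k0" by (simp only: k0)
   then show ?thesis by (auto simp: prod_eq_iff)
  qed
  then have "(%k. ind cellh (z - t + lattice_vec k) :: ennreal) = ind {(- fst k0, - snd k0)}"
   by (simp add: indicator_def fun_eq_iff)
  then show ?thesis by simp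
 qed
 have "(NN z. ind cellh z * F (z + t)) = (NN z. ind cellh (z - t) * F z)"
  using nn_integral_lborel_shift[of "%z. ind cellh (z - t) * F z" t] by simp
 also have "\<dots> = (NN z. ind cellh z * (\<integral>\<^sup>+k. ind cellh (z + lattice_vec k - t) * F (z + lattice_vec k) \<partial>count_space UNIV))"
  by (rule nn_integral_unfold) measurable
 also have "\<dots> = (NN z. ind cellh z * F z)"
  using one by (simp add: periodic_lattice[OF F] nn_integral_multc diff_add_eq)
 finally show ?thesis by (simp add: nn_integral_cellh)
qed

text \<open>
  A bounded set is covered by finitely many translates of the cell; the constant is uniform in the
  integrand, so that norms over one period control norms over compact sets.
\<close>

lemma nn_integral_bounded_periodic:
 fixes F :: "plane => ennreal"
 assumes [measurable]: "F \<in> Borel" "B \<in> sets borel" and F: "periodic F" and B: "bounded B"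
 obtains c :: real where "c >= 0" "!!F. F \<in> Borel ==> periodic F ==> (NN z. ind B z * F z) <= c * (NN z. ind cell z * F z)"
proof -
 obtain N0 where N0: "!!z. z \<in> B ==> norm z <= N0" using B by (auto simp: bounded_iff)
 define N where "N = \<lceil>N0 + 1\<rceil>"
 define S where "S = {-N..N} \<times> {-N..N}"
 have S: "finite S" unfolding S_def by simp
 have in_S: "k \<in> S" if "z \<in> cellh" "z + lattice_vec k \<in> B" for z k
 proof -
  have "\<bar>z $ 1\<bar> <= 1" "\<bar>z $ 2\<bar> <= 1" using that(1) by (auto simp: cellh_def forall_2)
  moreover have "\<bar>(z + lattice_vec k) $ 1\<bar> <= N0" "\<bar>(z + lattice_vec k) $ 2\<bar> <= N0"
   using N0[OF that(2)] component_le_norm_cart order_trans by blast+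
  ultimately have "\<bar>real_of_int (fst k)\<bar> <= N0 + 1" "\<bar>real_of_int (snd k)\<bar> <= N0 + 1" by auto
  then have "\<bar>fst k\<bar> <= N" "\<bar>snd k\<bar> <= N" unfolding N_def by linarith+
  then show ?thesis unfolding S_def by (auto simp: mem_Times_iff)
 qed
 show thesis
 proof (rule that[of "real (card S)"])
  fix F :: "plane => ennreal" assume [measurable]: "F \<in> Borel" and F: "periodic F"
  have "(NN z. ind B z * F z) = (NN z. ind cellh z * (\<integral>\<^sup>+k. ind B (z + lattice_vec k) * F (z + lattice_vec k) \<partial>count_space UNIV))"
   by (rule nn_integral_unfold) measurable
  also have "\<dots> <= (NN z. ind cellh z * (of_nat (card S) * F z))"
  proof (rule nn_integral_mono)
   fix z :: plane
   show "ind cellh z * (\<integral>\<^sup>+k. ind B (z + lattice_vec k) * F (z + lattice_vec k) \<partial>count_space UNIV) <= ind cellh z * (of_nat (card S) * F z)"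
   proof (cases "z \<in> cellh")
    case True
    have "(\<integral>\<^sup>+k. ind B (z + lattice_vec k) * F (z + lattice_vec k) \<partial>count_space UNIV) <= (\<integral>\<^sup>+k. ind S k * F z \<partial>count_space UNIV)"
     using in_S[OF True] by (intro nn_integral_mono) (auto simp: periodic_lattice[OF F] indicator_def)
    also have "\<dots> = of_nat (card S) * F z"
     using S by (simp add: nn_integral_multc emeasure_count_space)
    finally show ?thesis using True by simp
   qed simp
  qed
  also have "\<dots> = of_nat (card S) * (NN z. ind cell z * F z)"
  proof -
   have "(NN z. ind cellh z * (of_nat (card S) * F z)) = (NN z. of_nat (card S) * (ind cellh z * F z))"
    by (simp only: mult.left_commute)
   also have "\<dots> = of_nat (card S) * (NN z. ind cellh z * F z)"
    by (rule nn_integral_cmult) measurable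
   finally show ?thesis by (simp only: nn_integral_cellh[OF \<open>F \<in> Borel\<close>])
  qed
  finally show "(NN z. ind B z * F z) <= ennreal (real (card S)) * (NN z. ind cell z * F z)"
   by (simp add: ennreal_of_nat_eq_real_of_nat)
 qed simp
qed

definition L2per :: "(plane => 'b::euclidean_space) => bool" where
 "L2per g \<longleftrightarrow> g \<in> Borel & periodic g & L1 (%z. ind cell z * (norm (g z))^2)"

definition ip :: "(plane => 'b::euclidean_space) => (plane => 'b) => real" where
 "ip f g = (LI z. ind cell z * (f z \<bullet> g z))"

abbreviation ip2 :: "(plane => 'b::euclidean_space) => real" where "ip2 f \<equiv> ip f f"

lemma L2per_iff: "L2per g \<longleftrightarrow> g \<in> Borel & periodic g &
 (NN z. ind cell z * ennreal ((norm (g z))^2)) < \<infinity>"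
proof -
 have "L1 (%z. ind cell z * (norm (g z))^2) \<longleftrightarrow> (NN z. ind cell z * ennreal ((norm (g z))^2)) < \<infinity>"
  if [measurable]: "g \<in> Borel"
  unfolding integrable_iff_bounded by (auto simp: ennreal_mult' ennreal_indicator)
 then show ?thesis unfolding L2per_def by blast
qed

lemma L2per_D: "L2per g ==> g \<in> Borel" "L2per g ==> periodic g"
 "L2per g ==> L1 (%z. ind cell z * (norm (g z))^2)"
 by (auto simp: L2per_def)

declare L2per_D(1)[measurable_dest]

lemma cell_integrable_mult:
 assumes f: "L2per f" and g: "L2per g"
 shows "L1 (%z. ind cell z * (norm (f z) * norm (g z)))"
proof (rule L1_bound)
 show "L1 (%z. ind cell z * (norm (f z))^2 + ind cell z * (norm (g z))^2)"
  using f g by (auto simp: L2per_def)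
 have [measurable]: "f \<in> Borel" "g \<in> Borel" using f g by (auto simp: L2per_def)
 show "(%z. ind cell z * (norm (f z) * norm (g z))) \<in> borel_measurable lborel" by measurable
 show "AE z in lborel. norm (ind cell z * (norm (f z) * norm (g z))) <= norm (ind cell z * (norm (f z))^2 + ind cell z * (norm (g z))^2)" (is "AE z in _. ?P z")
 proof (intro AE_I2)
  fix z
  have "norm (f z) * norm (g z) <= (norm (f z))^2 + (norm (g z))^2"
  proof -
   have "0 <= norm (f z) * norm (g z)" by simp
   then show ?thesis using sum_squares_bound[of "norm (f z)" "norm (g z)"] by linarith
  qed
  then show "?P z"
   by (auto simp: indicator_def)
 qed
qed

lemma cell_integrable_inner:
 assumes f: "L2per f" and g: "L2per g"
 shows "L1 (%z. ind cell z * (f z \<bullet> g z))"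
proof (rule L1_bound[OF cell_integrable_mult[OF f g]])
 have [measurable]: "f \<in> Borel" "g \<in> Borel" using f g by (auto simp: L2per_def)
 show "(%z. ind cell z * (f z \<bullet> g z)) \<in> borel_measurable lborel" by measurable
 show "AE z in lborel. norm (ind cell z * (f z \<bullet> g z)) <= norm (ind cell z * (norm (f z) * norm (g z)))"
  by (intro AE_I2) (auto simp: indicator_def Cauchy_Schwarz_ineq2)
qed

lemma L2per_add:
 assumes f: "L2per f" and g: "L2per g" shows "L2per (%z. f z + g z)"
 unfolding L2per_def
proof (intro conjI)
 have [measurable]: "f \<in> Borel" "g \<in> Borel" using f g by (auto simp: L2per_def)
 show "(%z. f z + g z) \<in> Borel" by measurable
 show "periodic (%z. f z + g z)" using f g by (auto simp: L2per_def intro: periodic_comp2)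
 have "(%z. ind cell z * (norm (f z + g z))^2) = (%z. ind cell z * (norm (f z))^2 + 2 * (ind cell z * (f z \<bullet> g z)) + ind cell z * (norm (g z))^2)"
  by (auto simp: fun_eq_iff indicator_def power2_norm_eq_inner inner_simps inner_commute)
 then show "L1 (%z. ind cell z * (norm (f z + g z))^2)"
  using L2per_D(3)[OF f] L2per_D(3)[OF g] cell_integrable_inner[OF f g] by simp
qed

lemma L2per_mult_bounded:
 assumes f: "L2per f" and [measurable]: "a \<in> Borel" and "periodic a" and a: "!!z. \<bar>a z\<bar> <= C"
 shows "L2per (%z. a z *r f z)"
 unfolding L2per_def
proof (intro conjI)
 have [measurable]: "f \<in> Borel" using f by (auto simp: L2per_def)
 show "(%z. a z *r f z) \<in> Borel" by measurable
 show "periodic (%z. a z *r f z)" using f assms by (auto simp: L2per_def intro: periodic_comp2)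
 show "L1 (%z. ind cell z * (norm (a z *r f z))^2)"
 proof (rule L1_bound)
  show "L1 (%z. C^2 * (ind cell z * (norm (f z))^2))" using L2per_D(3)[OF f] by simp
  show "AE z in lborel. norm (ind cell z * (norm (a z *r f z))^2) <= norm (C^2 * (ind cell z * (norm (f z))^2))" (is "AE z in _. ?P z")
  proof (intro AE_I2)
   fix z have "\<bar>a z\<bar>^2 <= C^2" by (rule power_mono[OF a]) simp
   then show "?P z"
    by (auto simp: indicator_def power_mult_distrib intro!: mult_right_mono)
  qed
 qed measurable
qed

lemma L2per_scale: "L2per f ==> L2per (%z. c *r f z)"
 by (rule L2per_mult_bounded[where C="\<bar>c\<bar>"]) (auto simp: periodic_def)

lemma L2per_diff: "L2per f ==> L2per g ==> L2per (%z. f z - g z)"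
 using L2per_add[of f "%z. (-1) *r g z"] L2per_scale[of g "-1"] by simp

lemma finite_cell: "emeasure lborel cell < \<infinity>" by (simp add: cell_box emeasure_lborel_box_eq)

lemma measure_cell: "measure lborel cell = 1"
proof -
 have "measure lborel (box (vec (-1/2)) (vec (1/2) :: real^2)) = 1"
  by (subst measure_lborel_box_eq) (auto simp: Basis_vec_def inner_axis intro!: prod.neutral)
 then show ?thesis by (simp add: cell_box)
qed

lemma integrable_cell_const: "L1 (%z. ind cell z * (c::real))"
 using finite_cell by (intro integrable_mult_left integrable_real_indicator) auto

lemma integral_cell_const: "(LI z. ind cell z * (c::real)) = c"
 using measure_cell by simp

lemma L2per_const: "L2per (%z. c)"
 unfolding L2per_def by (intro conjI integrable_cell_const) (auto simp: periodic_def)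

lemma L2per_shift: assumes "L2per f" shows "L2per (%z. f (z + t))"
proof -
 have [measurable]: "f \<in> Borel" and p: "periodic f" using assms by (auto simp: L2per_def)
 show ?thesis
  unfolding L2per_iff
 proof (intro conjI periodic_shift p)
  have "(NN z. ind cell z * ennreal ((norm (f (z + t)))^2)) = (NN z. ind cell z * ennreal ((norm (f z))^2))"
   by (rule nn_integral_cell_shift[of "%z. ennreal ((norm (f z))^2)" t]) (measurable, rule periodic_comp[OF p])
  then show "(NN z. ind cell z * ennreal ((norm (f (z + t)))^2)) < \<infinity>"
   using assms by (simp only: L2per_iff)
 qed measurable
qed

lemma integral_cell_shift:
 fixes F :: "plane => real"
 assumes i: "L1 (%z. ind cell z * F z)" and [measurable]: "F \<in> Borel" and F: "periodic F"
 shows "(LI z. ind cell z * F (z + t)) = (LI z. ind cell z * F z)"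
  and "L1 (%z. ind cell z * F (z + t))"
proof -
 have n: "(NN z. ennreal (k (ind cell z * F (z + t)))) = (NN z. ennreal (k (ind cell z * F z)))"
  if [measurable]: "k \<in> Borel" and "k 0 = 0" for k :: "real => real"
 proof -
  have "(NN z. ind cell z * ennreal (k (F (z + t)))) = (NN z. ind cell z * ennreal (k (F z)))"
   by (rule nn_integral_cell_shift) (auto intro: periodic_comp F)
  moreover have "ennreal (k (ind cell z * c)) = ind cell z * ennreal (k c)" for z c
   using that by (auto simp: indicator_def)
  ultimately show ?thesis by simp
 qed
 show i2: "L1 (%z. ind cell z * F (z + t))"
  using i n[of norm] unfolding integrable_iff_bounded by simp
 show "(LI z. ind cell z * F (z + t)) = (LI z. ind cell z * F z)"
  unfolding real_lebesgue_integral_def[OF i] real_lebesgue_integral_def[OF i2]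
  using n[of "%x. x"] n[of uminus] by simp
qed

lemma ip_shift:
 assumes "L2per f" "L2per g"
 shows "ip (%z. f (z + t)) (%z. g (z + t)) = ip f g"
proof -
 have [measurable]: "f \<in> Borel" "g \<in> Borel" using assms by (auto simp: L2per_def)
 have "periodic (%z. f z \<bullet> g z)" using assms by (auto simp: L2per_def intro: periodic_comp2)
 from integral_cell_shift(1)[OF cell_integrable_inner[OF assms] _ this] show ?thesis by (simp add: ip_def)
qed

lemma ip_add_left: "L2per f ==> L2per g ==> L2per k ==> ip (%z. f z + g z) k = ip f k + ip g k"
 unfolding ip_def inner_add_left distrib_left by (intro LI_add cell_integrable_inner)

lemma ip_commute: "ip f g = ip g f" by (simp add: ip_def inner_commute)

lemma ip_add_right: "L2per f ==> L2per g ==> L2per k ==> ip k (%z. f z + g z) = ip k f + ip k g"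
 by (subst (1 2 3) ip_commute) (rule ip_add_left)

lemma ip_scale_left: "ip (%z. c *r f z) k = c * ip f k"
 unfolding ip_def by (simp add: mult.left_commute)

lemma ip_scale_right: "ip k (%z. c *r f z) = c * ip k f"
 unfolding ip_def by (simp add: mult.left_commute)

lemma ip_diff_left: "L2per f ==> L2per g ==> L2per k ==> ip (%z. f z - g z) k = ip f k - ip g k"
 using ip_add_left[of f "%z. (-1) *r g z" k] ip_scale_left[of "-1" g k] L2per_scale[of g "-1"] by simp

lemma ip_diff_right: "L2per f ==> L2per g ==> L2per k ==> ip k (%z. f z - g z) = ip k f - ip k g"
 by (subst (1 2 3) ip_commute) (rule ip_diff_left)

lemma ip_nonneg: "ip2 f >= 0"
 unfolding ip_def by (rule integral_nonneg_AE) auto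

lemma ip_zero_imp: "L2per f ==> ip2 f = 0 ==> AE z in lborel. f z = 0"
proof -
 assume f: "L2per f" and z: "ip2 f = 0"
 have [measurable]: "f \<in> Borel" and p: "periodic f" using f by (auto simp: L2per_def)
 have "AE z in lborel. ind cell z * (f z \<bullet> f z) = 0"
  using integral_nonneg_eq_0_iff_AE[OF cell_integrable_inner[OF f f]] z by (auto simp: ip_def)
 then have "(NN z. ind cell z * ennreal (norm (f z))) = 0"
  by (subst nn_integral_0_iff_AE) (auto simp: indicator_def elim!: eventually_mono)
 then have c0: "(NN z. ind cellh z * ennreal (norm (f z))) = 0" by (simp add: nn_integral_cellh)
 then have "AE z in lborel. ind cellh z * ennreal (norm (f z)) = 0"
  by (subst (asm) nn_integral_0_iff_AE) auto
 then have "AE z in lborel. ind cellh z * (\<integral>\<^sup>+k. ennreal (norm (f (z + lattice_vec k))) \<partial>count_space UNIV) = 0"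
  by eventually_elim (auto simp: periodic_lattice[OF p] indicator_def)
 then have "(NN z. ind cellh z * (\<integral>\<^sup>+k. ennreal (norm (f (z + lattice_vec k))) \<partial>count_space UNIV)) = 0"
  by (subst nn_integral_cong_AE[where v="%_. 0"]) auto
 then have "(NN z. ennreal (norm (f z))) = 0"
  using nn_integral_unfold[of "%z. ennreal (norm (f z))"] by simp
 then show ?thesis by (subst (asm) nn_integral_0_iff_AE) auto
qed

text \<open>
  The discriminant of a nonnegative quadratic polynomial, without a case distinction on the leading
  coefficient.
\<close>

lemma nonneg_quadratic:
 fixes a b c :: real
 assumes "!!t. a + 2 * t * b + t^2 * c >= 0" "a >= 0" "c >= 0"
 shows "b^2 <= a * c"
proof (cases "c = 0")
 case True
 have "b = 0"
 proof (rule ccontr)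
  assume b: "b ~= 0"
  have "2 * (- (a + 1) / (2 * b)) * b = - (a + 1)" using b by (simp add: field_simps)
  with assms(1)[of "- (a + 1) / (2 * b)"] True show False by simp
 qed
 then show ?thesis using assms by simp
next
 case False
 have "a + 2 * (- b / c) * b + (- b / c)^2 * c >= 0" by (rule assms(1))
 then have "(a + 2 * (- b / c) * b + (- b / c)^2 * c) * c >= 0" using assms by simp
 moreover have "(a + 2 * (- b / c) * b + (- b / c)^2 * c) * c = a * c - b^2"
  using False by (simp add: field_simps power2_eq_square)
 ultimately show ?thesis by simp
qed

lemma ip_Cauchy_Schwarz:
 assumes "L2per f" "L2per g" shows "(ip f g)^2 <= ip2 f * ip2 g"
proof (rule nonneg_quadratic)
 fix t
 have g: "L2per (%z. t *r g z)" by (rule L2per_scale[OF assms(2)])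
 have "0 <= ip2 (%z. f z + t *r g z)" by (rule ip_nonneg)
 also have "\<dots> = ip2 f + 2 * t * ip f g + t^2 * ip2 g"
  by (simp add: ip_add_left ip_add_right L2per_add g assms ip_scale_left ip_scale_right ip_commute[of g f] power2_eq_square algebra_simps)
 finally show "0 <= ip2 f + 2 * t * ip f g + t^2 * ip2 g" .
qed (auto intro: ip_nonneg)

lemma L2per_set_integrable:
 fixes f :: "plane => real"
 assumes f: "L2per f" and B: "bounded B" and [measurable]: "B \<in> sets borel"
 shows "L1 (%z. ind B z * (f z)^2)" "L1 (%z. ind B z * f z)"
proof -
 have [measurable]: "f \<in> Borel" and p: "periodic f" using f by (auto simp: L2per_def)
 obtain c :: real where "c >= 0" and c: "!!F. F \<in> Borel ==> periodic F ==> (NN z. ind B z * F z) <= c * (NN z. ind cell z * F z)"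
  using nn_integral_bounded_periodic[of "%_. 0" B] B by (auto simp: periodic_def)
 have "(NN z. ind B z * ennreal ((norm (f z))^2)) <= c * (NN z. ind cell z * ennreal ((norm (f z))^2))"
  by (rule c) (auto intro: periodic_comp p)
 also have "\<dots> < \<infinity>" using f by (auto simp: L2per_iff ennreal_mult_less_top)
 finally have fin: "(NN z. ind B z * ennreal ((norm (f z))^2)) < \<infinity>" .
 then show sq: "L1 (%z. ind B z * (f z)^2)"
  unfolding integrable_iff_bounded by (auto simp: ennreal_mult' ennreal_indicator)
 have "emeasure lborel B < \<infinity>" using B emeasure_bounded_finite by blast
 then have iB: "L1 (%z. ind B z :: real)" by (intro integrable_real_indicator) auto
 show "L1 (%z. ind B z * f z)"
 proof (rule L1_bound[OF L1_add[OF iB sq]])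
  show "AE z in lborel. norm (ind B z * f z) <= norm (ind B z + ind B z * (f z)^2)" (is "AE z in _. ?P z")
  proof (intro AE_I2)
   fix z have "\<bar>f z\<bar> <= 1 + (f z)^2" using sum_squares_bound[of 1 "\<bar>f z\<bar>"] by auto
   then show "?P z"
    by (auto simp: indicator_def)
  qed
 qed measurable
qed

lemma L2per_locally_integrable:
 fixes f :: "plane => real"
 assumes "L2per f" shows "L1loc S f"
 unfolding locally_integrable_def set_integrable_def
 using L2per_set_integrable(2)[OF assms] by (auto intro: compact_imp_bounded borel_compact)

lemma integral_Cauchy_Schwarz:
 fixes f g :: "'a => real"
 assumes [measurable]: "f \<in> borel_measurable M" "g \<in> borel_measurable M"
  and f: "integrable M (%x. (f x)^2)" and g: "integrable M (%x. (g x)^2)"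
 shows "integrable M (%x. f x * g x)" "(LINT x|M. f x * g x)^2 <= (LINT x|M. (f x)^2) * (LINT x|M. (g x)^2)"
proof -
 have "integrable M (%x. (f x)^2 + (g x)^2)" using f g by simp
 then show i: "integrable M (%x. f x * g x)"
 proof (rule L1_bound)
  show "AE x in M. norm (f x * g x) <= norm ((f x)^2 + (g x)^2)" (is "AE x in _. ?P x")
  proof (intro AE_I2)
   fix x
   have "2 * (\<bar>f x\<bar> * \<bar>g x\<bar>) <= (f x)^2 + (g x)^2" using sum_squares_bound[of "\<bar>f x\<bar>" "\<bar>g x\<bar>"] by simp
   moreover have "0 <= \<bar>f x\<bar> * \<bar>g x\<bar>" by simp
   ultimately have "\<bar>f x\<bar> * \<bar>g x\<bar> <= (f x)^2 + (g x)^2" by linarith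
   then show "?P x" by (simp add: abs_mult)
  qed
 qed measurable
 show "(LINT x|M. f x * g x)^2 <= (LINT x|M. (f x)^2) * (LINT x|M. (g x)^2)"
 proof (rule nonneg_quadratic)
  fix t
  have "0 <= (LINT x|M. (f x + t * g x)^2)" by (rule LI_nonneg) simp
  also have "\<dots> = (LINT x|M. (f x)^2 + 2 * t * (f x * g x) + t^2 * (g x)^2)"
   by (intro LI_cong refl) (simp add: power2_eq_square algebra_simps)
  also have "\<dots> = (LINT x|M. (f x)^2) + 2 * t * (LINT x|M. f x * g x) + t^2 * (LINT x|M. (g x)^2)"
   using f g i by simp
  finally show "0 <= (LINT x|M. (f x)^2) + 2 * t * (LINT x|M. f x * g x) + t^2 * (LINT x|M. (g x)^2)" .
 qed (auto intro!: LI_nonneg)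
qed

lemma nn_Cauchy_Schwarz:
 fixes f g :: "'a => real"
 assumes [measurable]: "f \<in> borel_measurable M" "g \<in> borel_measurable M"
  and f: "integrable M (%x. (f x)^2)" and C: "(LINT x|M. (f x)^2) <= C" "C > 0"
 shows "ennreal ((LINT x|M. f x * g x)^2) <= ennreal C * (\<integral>\<^sup>+x. ennreal ((g x)^2) \<partial>M)"
proof (cases "(\<integral>\<^sup>+x. ennreal ((g x)^2) \<partial>M) = \<infinity>")
 case True
 then show ?thesis using C(2) by (simp add: ennreal_mult_eq_top_iff)
next
 case False
 then have g: "integrable M (%x. (g x)^2)" by (simp add: integrable_iff_bounded less_top)
 have n: "(LINT x|M. (g x)^2) >= 0" by (rule LI_nonneg) simp
 have "(LINT x|M. f x * g x)^2 <= C * (LINT x|M. (g x)^2)"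
  using integral_Cauchy_Schwarz(2)[OF assms(1,2) f g] mult_right_mono[OF C(1) n] by linarith
 then have "ennreal ((LINT x|M. f x * g x)^2) <= ennreal (C * (LINT x|M. (g x)^2))" by (rule ennreal_leI)
 also have "\<dots> = ennreal C * (\<integral>\<^sup>+x. ennreal ((g x)^2) \<partial>M)"
  using C(2) n by (simp add: ennreal_mult nn_integral_eq_integral[OF g])
 finally show ?thesis .
qed

lemma square_null: "(%n. (x n :: real)^2) \<longlonglongrightarrow> 0 ==> x \<longlonglongrightarrow> 0"
 using tendsto_real_sqrt[of "%n. (x n)^2" 0 sequentially] by (simp add: tendsto_rabs_zero_iff)

lemma L2per_limit_test:
 fixes f :: "plane => real"
 assumes fn: "!!n. L2per (fn n)" and f: "L2per f" and lim: "(%n. ip2 (%z. fn n z - f z)) \<longlonglongrightarrow> 0"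
  and psi: "psi \<in> test_fun UNIV"
 shows "(%n. LI z. psi z * fn n z) \<longlonglongrightarrow> (LI z. psi z * f z)"
proof -
 obtain B M where B: "compact B" "!!y. \<bar>psi y\<bar> <= M * ind B y" "M >= 0"
  using test_fun_bound[OF psi] by metis
 have [measurable]: "B \<in> sets borel" "psi \<in> Borel" using B psi by (auto intro: borel_compact test_fun_borel)
 have bB: "bounded B" using B compact_imp_bounded by auto
 obtain c :: real where c0: "c >= 0" and c: "!!F. F \<in> Borel ==> periodic F ==> (NN z. ind B z * F z) <= c * (NN z. ind cell z * F z)"
  using nn_integral_bounded_periodic[of "%_. 0" B] bB by (auto simp: periodic_def)
 define d where "d n = (%z. fn n z - f z)" for n
 have d: "L2per (d n)" for n unfolding d_def by (rule L2per_diff[OF fn f])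
 have [measurable]: "d n \<in> Borel" for n using d by (auto simp: L2per_def)
 have iB: "L1 (%z. (ind B z :: real)^2)"
 proof -
  have "L1 (ind B :: _ => real)" using emeasure_bounded_finite[OF bB] by (intro integrable_real_indicator) auto
  moreover have "(ind B z :: real)^2 = ind B z" for z by (simp add: indicator_def)
  ultimately show ?thesis by simp
 qed
 define C where "C = (LI z. (ind B z :: real)^2) + 1"
 have "0 <= (LI z. (ind B z :: real)^2)" by (rule LI_nonneg) simp
 then have C: "C > 0" "(LI z. (ind B z :: real)^2) <= C" unfolding C_def by linarith+
 have est: "(LI z. psi z * d n z)^2 <= C * (M^2 * (c * ip2 (d n)))" for n
 proof -
  have e: "ind B z * (psi z * d n z) = psi z * d n z" for z using B(2)[of z] by (cases "z \<in> B") auto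
  have "ennreal ((LI z. psi z * d n z)^2) <= ennreal C * (NN z. ennreal ((psi z * d n z)^2))"
   using nn_Cauchy_Schwarz[OF _ _ iB C(2,1), of "%z. psi z * d n z"] by (simp add: e)
  also have "\<dots> <= ennreal C * (NN z. ennreal (M^2) * (ind B z * ennreal ((norm (d n z))^2)))"
  proof (intro mult_left_mono nn_integral_mono)
   fix z
   have "\<bar>psi z\<bar>^2 * (d n z)^2 <= (M * ind B z)^2 * (d n z)^2" by (intro mult_right_mono power_mono B) auto
   then show "ennreal ((psi z * d n z)^2) <= ennreal (M^2) * (ind B z * ennreal ((norm (d n z))^2))"
    using B(2)[of z] by (cases "z \<in> B") (auto simp: power_mult_distrib simp flip: ennreal_mult' intro!: ennreal_leI)
  qed simp
  also have "\<dots> <= ennreal C * (ennreal (M^2) * (ennreal c * (NN z. ind cell z * ennreal ((norm (d n z))^2))))"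
   by (subst nn_integral_cmult, measurable, intro mult_left_mono c) (use d[of n] in \<open>auto simp: L2per_def intro: periodic_comp\<close>)
  also have "(NN z. ind cell z * ennreal ((norm (d n z))^2)) = ennreal (ip2 (d n))"
   unfolding ip_def by (subst nn_integral_eq_integral[symmetric])
    (use cell_integrable_inner[OF d d, of n n] in \<open>auto simp: ennreal_mult' ennreal_indicator power2_eq_square\<close>)
  also have "ennreal C * (ennreal (M^2) * (ennreal c * ennreal (ip2 (d n)))) = ennreal (C * (M^2 * (c * ip2 (d n))))"
   using C(1) c0 ip_nonneg[of "d n"] by (simp add: ennreal_mult)
  finally show ?thesis using C(1) c0 ip_nonneg[of "d n"] by (simp add: ennreal_le_iff)
 qed
 have "(%n. (LI z. psi z * d n z)^2) \<longlonglongrightarrow> 0"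
 proof (rule tendsto_sandwich[of "%n. 0"])
  show "(%n. C * (M^2 * (c * ip2 (d n)))) \<longlonglongrightarrow> 0"
   using tendsto_mult_left[OF lim, of "C * (M^2 * c)"] by (simp add: d_def mult.assoc)
 qed (use est in auto)
 then have "(%n. LI z. psi z * d n z) \<longlonglongrightarrow> 0" by (rule square_null)
 moreover have "L1 (%z. psi z * k z)" if "L2per k" for k
  by (rule test_times_integrable[OF psi _ L2per_locally_integrable[OF that]]) (use that in \<open>auto simp: L2per_def\<close>)
 then have "(LI z. psi z * d n z) = (LI z. psi z * fn n z) - (LI z. psi z * f z)" for n
  using fn f by (simp add: d_def right_diff_distrib)
 ultimately have "(%n. (LI z. psi z * fn n z) - (LI z. psi z * f z)) \<longlonglongrightarrow> 0" by (simp only:)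
 then show ?thesis by (rule LIM_zero_cancel)
qed

text \<open>
  Consecutive differences are summable in \<open>L\<^sup>1\<close> of the cell, so the sequence
  converges almost everywhere; Fatou then bounds the distance to the limit.
\<close>

lemma L2per_complete:
 fixes fn :: "nat => plane => real"
 assumes fn: "!!n. L2per (fn n)"
  and Cauchy: "!!n m. n <= m ==> ip2 (%z. fn n z - fn m z) <= C * (1/4) ^ n"
 obtains f where "L2per f" "(%n. ip2 (%z. fn n z - f z)) \<longlonglongrightarrow> 0"
proof -
 have [measurable]: "fn n \<in> Borel" for n using fn by (auto simp: L2per_def)
 define d where "d n = (%z. fn n z - fn (Suc n) z)" for n
 have d: "L2per (d n)" for n unfolding d_def by (rule L2per_diff[OF fn fn])
 have [measurable]: "d n \<in> Borel" for n unfolding d_def by measurable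
 have nn_ip: "(NN z. ind cell z * ennreal ((g z)^2)) = ennreal (ip2 g)" if "L2per g" for g :: "plane => real"
  unfolding ip_def by (subst nn_integral_eq_integral[symmetric])
    (use cell_integrable_inner[OF that that] that in \<open>auto simp: ennreal_mult' ennreal_indicator power2_eq_square L2per_def\<close>)
 have b: "(NN z. ind cell z * ennreal \<bar>d n z\<bar>) <= ennreal ((1 + C) * (1/2)^n)" for n
 proof -
  have "\<bar>d n z\<bar> <= (1/2)^n + 2^n * (d n z)^2" for z
  proof -
   have "2 * (1/2)^n * \<bar>d n z\<bar> <= ((1/2)^n)^2 + (d n z)^2" using sum_squares_bound[of "(1/2)^n" "\<bar>d n z\<bar>"] by simp
   then have "2^n * (2 * (1/2)^n * \<bar>d n z\<bar>) <= 2^n * (((1/2)^n)^2 + (d n z)^2)" by (intro mult_left_mono) auto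
   moreover have "2^n * (2 * (1/2)^n * \<bar>d n z\<bar>) = 2 * \<bar>d n z\<bar>" by (simp add: power_one_over)
   moreover have "2^n * (((1/2)^n)^2 + (d n z)^2) = (1/2)^n + 2^n * (d n z)^2"
    by (simp add: power_one_over power2_eq_square distrib_left)
   ultimately show ?thesis by linarith
  qed
  then have "(NN z. ind cell z * ennreal \<bar>d n z\<bar>) <= (NN z. ennreal ((1/2)^n) * ind cell z + ennreal (2^n) * (ind cell z * ennreal ((d n z)^2)))"
   by (intro nn_integral_mono) (auto simp: indicator_def ennreal_mult'[symmetric] simp flip: ennreal_plus intro!: ennreal_leI)
  also have "\<dots> = ennreal ((1/2)^n) * emeasure lborel cell + ennreal (2^n) * ennreal (ip2 (d n))"
   by (subst nn_integral_add) (auto simp: nn_integral_cmult nn_ip[OF d])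
  also have "emeasure lborel cell = 1" using measure_cell finite_cell by (simp add: emeasure_eq_ennreal_measure)
  also have "ennreal ((1/2)^n) * 1 + ennreal (2^n) * ennreal (ip2 (d n)) = ennreal ((1/2)^n + 2^n * ip2 (d n))"
   by (simp add: ennreal_mult'[symmetric] ip_nonneg flip: ennreal_plus)
  also have "\<dots> <= ennreal ((1 + C) * (1/2)^n)"
  proof (rule ennreal_leI)
   have "2^n * ip2 (d n) <= 2^n * (C * (1/4)^n)" unfolding d_def using Cauchy[of n "Suc n"] by (intro mult_left_mono) auto
   also have "2^n * (C * (1/4)^n) = C * (2 * (1/4))^n" unfolding power_mult_distrib by simp
   finally show "(1/2)^n + 2^n * ip2 (d n) <= (1 + C) * (1/2)^n" by (simp add: algebra_simps)
  qed
  finally show ?thesis .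
 qed
 have C0: "C >= 0" using Cauchy[of 0 0] ip_nonneg[of "%z. fn 0 z - fn 0 z"] by simp
 have "(NN z. ind cell z * (\<Sum>n. ennreal \<bar>d n z\<bar>)) = (\<Sum>n. NN z. ind cell z * ennreal \<bar>d n z\<bar>)"
  by (subst nn_integral_suminf[symmetric]) (auto simp: ennreal_suminf_cmult)
 also have "\<dots> <= (\<Sum>n. ennreal ((1 + C) * (1/2)^n))" by (intro suminf_le b) auto
 also have "\<dots> = ennreal (\<Sum>n. (1 + C) * (1/2)^n)"
  using C0 by (intro suminf_ennreal2) (auto intro!: summable_mult summable_geometric)
 finally have "(NN z. ind cell z * (\<Sum>n. ennreal \<bar>d n z\<bar>)) ~= \<infinity>" by (auto simp: top_unique)
 then have ae: "AE z in lborel. ind cell z * (\<Sum>n. ennreal \<bar>d n z\<bar>) ~= \<infinity>"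
  by (intro nn_integral_PInf_AE) auto
 define f where "f = (%z. lim (%n. fn n z))"
 have [measurable]: "f \<in> Borel" unfolding f_def by measurable
 have pf: "periodic f" unfolding f_def using fn by (auto simp: L2per_def periodic_def)
 have conv: "AE z in lborel. z \<in> cell --> (%n. fn n z) \<longlonglongrightarrow> f z"
  using ae
 proof eventually_elim
  case (elim z)
  show ?case
  proof
   assume "z \<in> cell"
   then have "(\<Sum>n. ennreal \<bar>d n z\<bar>) ~= top" using elim by simp
   then have "summable (%n. \<bar>d n z\<bar>)" by (intro summable_suminf_not_top) auto
   then have "summable (%n. d n z)" by (rule summable_rabs_cancel)
   then have s: "summable (%n. fn (Suc n) z - fn n z)" using summable_minus[of "%n. d n z"] by (simp add: d_def)
   then have "(%n. fn (Suc n) z - fn n z) sums (\<Sum>n. fn (Suc n) z - fn n z)" by (rule summable_sums)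
   then have "(%n. fn n z - fn 0 z) \<longlonglongrightarrow> (\<Sum>n. fn (Suc n) z - fn n z)" by (simp only: sums_def sum_lessThan_telescope[of "%n. fn n z"])
   then have "(%n. fn n z - fn 0 z + fn 0 z) \<longlonglongrightarrow> (\<Sum>n. fn (Suc n) z - fn n z) + fn 0 z" by (intro tendsto_intros)
   then have "convergent (%n. fn n z)" by (auto simp: convergent_def)
   then show "(%n. fn n z) \<longlonglongrightarrow> f z" by (simp add: f_def convergent_LIMSEQ_iff)
  qed
 qed
 have fat: "(NN z. ind cell z * ennreal ((fn n z - f z)^2)) <= ennreal (C * (1/4)^n)" for n
 proof -
  have "(NN z. ind cell z * ennreal ((fn n z - f z)^2)) = (NN z. liminf (%m. ind cell z * ennreal ((fn n z - fn m z)^2)))"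
  proof (rule nn_integral_cong_AE, use conv in eventually_elim)
   case (elim z)
   show ?case
   proof (cases "z \<in> cell")
    case True
    then have "(%m. ennreal ((fn n z - fn m z)^2)) \<longlonglongrightarrow> ennreal ((fn n z - f z)^2)"
     using elim by (intro tendsto_ennrealI tendsto_intros) auto
    then have "liminf (%m. ennreal ((fn n z - fn m z)^2)) = ennreal ((fn n z - f z)^2)"
     by (rule lim_imp_Liminf[OF sequentially_bot])
    then show ?thesis using True by simp
   next
    case False
    then show ?thesis by (simp add: lim_imp_Liminf[OF sequentially_bot tendsto_const])
   qed
  qed
  also have "\<dots> <= liminf (%m. NN z. ind cell z * ennreal ((fn n z - fn m z)^2))"
   by (rule nn_integral_liminf) measurable
  also have "\<dots> <= ennreal (C * (1/4)^n)"
  proof (rule Liminf_le)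
   show "\<forall>\<^sub>F m in sequentially. (NN z. ind cell z * ennreal ((fn n z - fn m z)^2)) <= ennreal (C * (1/4)^n)"
    using eventually_ge_at_top[of n]
    by eventually_elim (use nn_ip[OF L2per_diff[OF fn fn]] Cauchy in \<open>auto intro!: ennreal_leI\<close>)
  qed (rule sequentially_bot)
  finally show ?thesis .
 qed
 have df: "L2per (%z. fn n z - f z)" for n
  unfolding L2per_iff
 proof (intro conjI)
  show "periodic (%z. fn n z - f z)" using fn[of n] pf by (auto simp: L2per_def intro: periodic_comp2)
  show "(NN z. ind cell z * ennreal ((norm (fn n z - f z))^2)) < \<infinity>"
   using le_less_trans[OF fat[of n]] by simp
 qed measurable
 show thesis
 proof (rule that)
  show "L2per f" using L2per_diff[OF fn[of 0] df[of 0]] by simp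
  show "(%n. ip2 (%z. fn n z - f z)) \<longlonglongrightarrow> 0"
  proof (rule tendsto_sandwich[of "%n. 0"])
   show "\<forall>\<^sub>F n in sequentially. ip2 (%z. fn n z - f z) <= C * (1/4)^n"
    using fat nn_ip[OF df] C0 by (intro always_eventually) (simp add: ennreal_le_iff)
   have "(%n. C * (1/4::real)^n) \<longlonglongrightarrow> C * 0" by (intro tendsto_intros LIMSEQ_power_zero) auto
   then show "(%n. C * (1/4::real)^n) \<longlonglongrightarrow> 0" by simp
  qed (auto intro: ip_nonneg always_eventually)
 qed
qed

section \<open>Periodic Sobolev functions\<close>

lemma axis_Basis2: "axis i (1::real) \<in> (Basis :: plane set)"
 by (simp add: axis_in_Basis_iff)

lemma borel_vec2:
 fixes G :: "'a => plane"
 assumes "!!i. (%z. G z $ i) \<in> borel_measurable M"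
 shows "G \<in> borel_measurable M"
 unfolding borel_measurable_euclidean_space[of G]
 using assms by (auto simp: Basis_vec_def inner_axis)

lemma borel_nth [measurable (raw)]:
 fixes G :: "'a => real^'n"
 shows "G \<in> borel_measurable M ==> (%z. G z $ i) \<in> borel_measurable M"
 by (rule measurable_compose[of G M borel "%v. v $ i"]) (auto intro!: borel_measurable_continuous_onI continuous_intros)

lemma powr_two: "x >= 0 ==> x powr 2 = x^2" for x :: real
 by (cases "x = 0") auto

lemma Lp2_iff: "Lp 2 S f \<longleftrightarrow> set_borel_measurable lborel S f & set_integrable lborel S (%x. (norm (f x))^2)"
 by (simp add: Lp_def powr_two)

lemma H1_per_iff: "H1_per g G \<longleftrightarrow> L2per g & L2per G & weak_grad UNIV g G"
proof
 assume H: "H1_per g G"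
 then have w: "weak_deriv UNIV (axis i 1) g (%z. G z $ i)" for i by (auto simp: H1_per_def weak_grad_def)
 have "g \<in> Borel" using w[of 1] locally_integrable_borel[of UNIV g] by (auto simp: weak_deriv_def)
 moreover have "(%z. G z $ i) \<in> Borel" for i
  using w[of i] locally_integrable_borel[of UNIV "%z. G z $ i"] by (auto simp: weak_deriv_def)
 then have "G \<in> Borel" by (rule borel_vec2)
 ultimately show "L2per g & L2per G & weak_grad UNIV g G"
  using H by (auto simp: H1_per_def L2per_def Lp2_iff set_integrable_def)
next
 assume a: "L2per g & L2per G & weak_grad UNIV g G"
 then have [measurable]: "g \<in> Borel" "G \<in> Borel" by (auto simp: L2per_def)
 show "H1_per g G" using a
  by (auto simp: H1_per_def L2per_def Lp2_iff set_integrable_def set_borel_measurable_def)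
qed

lemma L2per_component: "L2per G ==> L2per (%z. G z $ i)" for G :: "plane => plane"
 unfolding L2per_def
proof (intro conjI)
 assume G: "G \<in> Borel & periodic G & L1 (%z. ind cell z * (norm (G z))^2)"
 then have [measurable]: "G \<in> Borel" by auto
 show "(%z. G z $ i) \<in> Borel" by measurable
 show "periodic (%z. G z $ i)" using G by (auto simp: periodic_def)
 show "L1 (%z. ind cell z * (norm (G z $ i))^2)"
 proof (rule L1_bound[OF conjunct2[OF conjunct2[OF G]]])
  show "AE z in lborel. norm (ind cell z * (norm (G z $ i))^2) <= norm (ind cell z * (norm (G z))^2)" (is "AE z in _. ?P z")
  proof (intro AE_I2)
   fix z
   have "(norm (G z $ i))^2 <= (norm (G z))^2" by (rule power_mono) (auto simp: component_le_norm_cart)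
   then show "?P z"
    by (auto simp: indicator_def)
  qed
 qed measurable
qed

lemma H1_perD:
 assumes "H1_per g G"
 shows "L2per g" "L2per G" "L2per (%z. G z $ i)" "\<tau> >= 0 ==> shift_deriv UNIV (axis i 1) \<tau> g (%z. G z $ i)"
  "psi \<in> test_fun UNIV ==> (LI z. dir_deriv (axis i 1) psi z * g z) = - (LI z. psi z * G z $ i)"
proof -
 show "L2per g" and G: "L2per G" using assms by (auto simp: H1_per_iff)
 have w: "weak_deriv UNIV (axis i 1) g (%z. G z $ i)" using assms by (auto simp: H1_per_iff weak_grad_def)
 show "L2per (%z. G z $ i)" by (rule L2per_component[OF G])
 show "\<tau> >= 0 ==> shift_deriv UNIV (axis i 1) \<tau> g (%z. G z $ i)"
  by (rule weak_deriv_shift[OF w]) (auto simp: axis_Basis2)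
 show "psi \<in> test_fun UNIV ==> (LI z. dir_deriv (axis i 1) psi z * g z) = - (LI z. psi z * G z $ i)"
  using w by (auto simp: weak_deriv_def set_LI_def)
qed

lemma L2per_vec2:
 fixes G :: "plane => plane"
 assumes "!!i. L2per (%z. G z $ i)" shows "L2per G"
 unfolding L2per_def
proof (intro conjI)
 show "G \<in> Borel" by (rule borel_vec2) (use assms in \<open>auto simp: L2per_def\<close>)
 show "periodic G" using assms by (auto simp: L2per_def periodic_def vec_eq_iff)
 have "(norm v)^2 = (v $ 1)^2 + (v $ 2)^2" for v :: plane
  by (simp add: power2_norm_eq_inner inner_vec_def sum_2 flip: power2_eq_square)
 then have "(%z. ind cell z * (norm (G z))^2) = (%z. ind cell z * (norm (G z $ 1))^2 + ind cell z * (norm (G z $ 2))^2)"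
  by (simp add: distrib_left)
 then show "L1 (%z. ind cell z * (norm (G z))^2)"
  using assms[of 1] assms[of 2] by (simp add: L2per_def)
qed

lemma ip_vec2:
 fixes F G :: "plane => plane"
 assumes "L2per F" "L2per G"
 shows "ip F G = ip (%z. F z $ 1) (%z. G z $ 1) + ip (%z. F z $ 2) (%z. G z $ 2)"
proof -
 have "ip F G = (LI z. ind cell z * (F z $ 1 \<bullet> G z $ 1) + ind cell z * (F z $ 2 \<bullet> G z $ 2))"
  unfolding ip_def by (simp add: inner_vec_def sum_2 distrib_left)
 also have "\<dots> = ip (%z. F z $ 1) (%z. G z $ 1) + ip (%z. F z $ 2) (%z. G z $ 2)"
  unfolding ip_def by (intro LI_add cell_integrable_inner L2per_component assms)
 finally show ?thesis .
qed

lemma ip_sum_le: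
 assumes "L2per f" "L2per g"
 shows "ip2 (%z. f z + g z) <= 2 * ip2 f + 2 * ip2 g"
proof -
 have "0 <= ip2 (%z. f z - g z)" by (rule ip_nonneg)
 then show ?thesis
  by (simp add: ip_add_left ip_add_right ip_diff_left ip_diff_right L2per_add L2per_diff assms ip_commute[of g f])
qed

lemma interval_Cauchy_Schwarz:
 fixes f :: "real => real"
 assumes [measurable]: "f \<in> Borel" and \<tau>: "0 <= \<tau>" "\<tau> <= 1"
 shows "ennreal ((LINT r:{0..\<tau>}|lborel. f r)^2) <= (NN r. ind {0..1} r * ennreal ((f r)^2))"
proof -
 let ?g = "%r. ind {0..1} r * f r"
 have e: "ind {0..\<tau>} r * ?g r = ind {0..\<tau>} r *r f r" and sq: "(ind {0..\<tau>} r :: real)^2 = ind {0..\<tau>} r * 1"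
  and g: "ennreal ((?g r)^2) = ind {0..1} r * ennreal ((f r)^2)" for r
  using \<tau> by (auto simp: indicator_def)
 have i: "L1 (%r. (ind {0..\<tau>} r :: real)^2)" unfolding sq by (rule integrable_indicator_Icc)
 have le: "(LI r. (ind {0..\<tau>} r :: real)^2) <= 1" unfolding sq using \<tau> by simp
 have "ennreal ((LI r. ind {0..\<tau>} r * ?g r)^2) <= ennreal 1 * (NN r. ennreal ((?g r)^2))"
  by (rule nn_Cauchy_Schwarz[OF _ _ i le zero_less_one]) measurable
 then show ?thesis unfolding e g set_LI_def by simp
qed

lemma nn_ip: "L2per g ==> (NN z. ind cell z * ennreal ((g z)^2)) = ennreal (ip2 g)" for g :: "plane => real"
 unfolding ip_def by (subst nn_integral_eq_integral[symmetric])
  (use cell_integrable_inner[of g g] in \<open>auto simp: ennreal_mult' ennreal_indicator power2_eq_square L2per_def\<close>)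

text \<open>
  Translating a function costs at most the norm of its derivative: Cauchy-Schwarz on the segment, then
  the translation invariance of integrals over one period.
\<close>

lemma shift_L2_bound:
 fixes g D :: "plane => real"
 assumes g: "L2per g" and D: "L2per D" and sh: "shift_deriv UNIV e \<tau> g D" and \<tau>: "0 <= \<tau>" "\<tau> <= 1"
 shows "ip2 (%z. g (z + \<tau> *r e) - g z) <= ip2 D"
proof -
 have [measurable]: "D \<in> Borel" "g \<in> Borel" using D g by (auto simp: L2per_def)
 have pD: "periodic (%z. ennreal ((D z)^2))" using D by (auto simp: L2per_def intro: periodic_comp)
 have "ennreal (ip2 (%z. g (z + \<tau> *r e) - g z)) = (NN z. ind cell z * ennreal ((g (z + \<tau> *r e) - g z)^2))"
  by (rule nn_ip[symmetric]) (intro L2per_diff L2per_shift g)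
 also have "\<dots> <= (NN z. NN r. ind {0..1} r * (ind cell z * ennreal ((D (z + r *r e))^2)))"
 proof (rule nn_integral_mono_AE, use sh[unfolded shift_deriv_def] in eventually_elim)
  case (elim z)
  have "ennreal ((g (z + \<tau> *r e) - g z)^2) <= (NN r. ind {0..1} r * ennreal ((D (z + r *r e))^2))"
   using elim interval_Cauchy_Schwarz[of "%r. D (z + r *r e)", OF _ \<tau>] by simp
  then have "ind cell z * ennreal ((g (z + \<tau> *r e) - g z)^2) <= ind cell z * (NN r. ind {0..1} r * ennreal ((D (z + r *r e))^2))"
   by (rule mult_left_mono) simp
  also have "\<dots> = (NN r. ind cell z * (ind {0..1} r * ennreal ((D (z + r *r e))^2)))"
   by (rule nn_integral_cmult[symmetric]) measurable
  finally show ?case by (simp add: mult.left_commute)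
 qed
 also have "\<dots> = (NN r. NN z. ind {0..1} r * (ind cell z * ennreal ((D (z + r *r e))^2)))"
  by (rule lborel_pair.Fubini') measurable
 also have "\<dots> = (NN r. ind {0..1::real} r * ennreal (ip2 D))"
  by (simp add: nn_integral_cmult nn_integral_cell_shift[OF _ pD] nn_ip[OF D])
 also have "\<dots> = ennreal (ip2 D)" by (simp add: nn_integral_multc)
 finally show ?thesis by (simp add: ennreal_le_iff ip_nonneg)
qed

lemma conv_integrable:
 fixes f k :: "plane => real"
 assumes f: "L2per f" and k: "L2per k" and psi: "L1 psi"
 shows "integrable (lborel \<Otimes>\<^sub>M lborel) (%(t, z). psi t * (ind cell z * (f z * k (z + t))))"
proof (rule lborel_pair.Fubini_integrable)
 have [measurable]: "f \<in> Borel" "k \<in> Borel" "psi \<in> Borel"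
  using f k psi by (auto simp: L2per_def)
 show "(%(t, z). psi t * (ind cell z * (f z * k (z + t)))) \<in> borel_measurable (lborel \<Otimes>\<^sub>M lborel)" by measurable
 have i: "L1 (%z. ind cell z * (f z * k (z + t)))" for t
  using cell_integrable_inner[OF f L2per_shift[OF k, of t]] by simp
 show "AE t in lborel. L1 (%z. case (t, z) of (t, z) => psi t * (ind cell z * (f z * k (z + t))))"
  using i by simp
 have b: "(LI z. norm (ind cell z * (f z * k (z + t)))) <= ip2 f + ip2 k" for t
 proof -
  have "(LI z. norm (ind cell z * (f z * k (z + t)))) <= (LI z. ind cell z * (f z \<bullet> f z) + ind cell z * (k (z + t) \<bullet> k (z + t)))"
  proof (rule integral_mono)
   show "L1 (%z. ind cell z * (f z \<bullet> f z) + ind cell z * (k (z + t) \<bullet> k (z + t)))"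
    by (intro L1_add cell_integrable_inner f L2per_shift k)
   fix z
   have "0 <= \<bar>f z\<bar> * \<bar>k (z + t)\<bar>" by simp
   moreover have "2 * (\<bar>f z\<bar> * \<bar>k (z + t)\<bar>) <= (f z)^2 + (k (z + t))^2"
    using sum_squares_bound[of "\<bar>f z\<bar>" "\<bar>k (z + t)\<bar>"] by (simp add: mult.assoc)
   ultimately have "\<bar>f z\<bar> * \<bar>k (z + t)\<bar> <= (f z)^2 + (k (z + t))^2" by linarith
   then show "norm (ind cell z * (f z * k (z + t))) <= ind cell z * (f z \<bullet> f z) + ind cell z * (k (z + t) \<bullet> k (z + t))"
    by (auto simp: indicator_def abs_mult power2_eq_square)
  qed (use i in auto)
  also have "\<dots> = ip2 f + ip2 k"
   unfolding ip_shift[OF k k, of t, symmetric] unfolding ip_def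
   by (intro LI_add cell_integrable_inner f L2per_shift k)
  finally show ?thesis .
 qed
 have "L1 (%t. norm (psi t) * (ip2 f + ip2 k))" using psi by simp
 then show "L1 (%t. LI z. norm (case (t, z) of (t, z) => psi t * (ind cell z * (f z * k (z + t)))))"
 proof (rule L1_bound)
  show "AE t in lborel. norm (LI z. norm (case (t, z) of (t, z) => psi t * (ind cell z * (f z * k (z + t))))) <= norm (norm (psi t) * (ip2 f + ip2 k))" (is "AE t in _. ?P t")
  proof (intro AE_I2)
   fix t
   have "(LI z. norm (psi t * (ind cell z * (f z * k (z + t))))) = norm (psi t) * (LI z. norm (ind cell z * (f z * k (z + t))))"
    by (subst integral_mult_right_zero[symmetric]) (simp add: abs_mult)
   also have "\<dots> <= norm (psi t) * (ip2 f + ip2 k)" by (intro mult_left_mono b) simp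
   finally show "?P t"
    using ip_nonneg[of f] ip_nonneg[of k] by (simp add: integral_nonneg_AE)
  qed
 qed measurable
qed

lemma conv_swap:
 fixes f k :: "plane => real"
 assumes "L2per f" "L2per k" "L1 psi"
 shows "(LI t. psi t * ip f (%z. k (z + t))) = (LI z. ind cell z * (f z * (LI t. psi t * k (z + t))))"
  and "L1 (%t. psi t * ip f (%z. k (z + t)))"
proof -
 note i = conv_integrable[OF assms]
 have "(LI t. psi t * ip f (%z. k (z + t))) = (LI t. LI z. psi t * (ind cell z * (f z * k (z + t))))"
  by (simp add: ip_def)
 also have "\<dots> = (LI z. LI t. psi t * (ind cell z * (f z * k (z + t))))"
  using lborel_pair.Fubini_integral[OF i] by simp
 also have "\<dots> = (LI z. ind cell z * (f z * (LI t. psi t * k (z + t))))"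
 proof (intro LI_cong refl)
  fix z
  have "(%t. psi t * (ind cell z * (f z * k (z + t)))) = (%t. ind cell z * (f z * (psi t * k (z + t))))"
   by (simp add: ac_simps)
  then show "(LI t. psi t * (ind cell z * (f z * k (z + t)))) = ind cell z * (f z * (LI t. psi t * k (z + t)))"
   by simp
 qed
 finally show "(LI t. psi t * ip f (%z. k (z + t))) = (LI z. ind cell z * (f z * (LI t. psi t * k (z + t))))" .
 show "L1 (%t. psi t * ip f (%z. k (z + t)))"
  using lborel_pair.integrable_fst'[OF i] by (simp add: ip_def)
qed

text \<open>
  For mean zero, \<open>2 ip g g\<close> is the average over all translations \<open>t\<close> in the
  cell of the squared distance of \<open>g\<close> and its translate, and a translation is made of two
  coordinate translations, each controlled by one partial derivative.
\<close>

theorem Poincare_per: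
 assumes H: "H1_per g G" and mean: "(LI z. ind cell z * g z) = 0"
 shows "ip2 g <= ip2 G"
proof -
 have g: "L2per g" and G: "L2per G" and Gi: "!!i. L2per (%z. G z $ i)" using H1_perD[OF H] by auto
 have [measurable]: "g \<in> Borel" using g by (auto simp: L2per_def)
 define c :: plane where "c = vec (1/2)"
 have bound: "2 * ip2 g - 2 * ip g (%z. g (z + (t + c))) <= 2 * ip2 G" if t: "t \<in> cell" for t
 proof -
  define a b where "a = (t + c) $ 1" and "b = (t + c) $ 2"
  have ab: "0 <= a" "a <= 1" "0 <= b" "b <= 1" using t by (auto simp: a_def b_def c_def cell_def forall_2)
  have tc: "t + c = a *r axis 1 1 + b *r axis 2 1"
   by (simp add: vec_eq_iff forall_2 a_def b_def axis_def)
  let ?d1 = "%z. g (z + a *r axis 1 1) - g z" and ?d2 = "%z. g (z + b *r axis 2 1) - g z"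
  have d: "L2per ?d1" "L2per ?d2" by (intro L2per_diff L2per_shift g)+
  have d2s: "L2per (%z. ?d2 (z + a *r axis 1 1))" by (rule L2per_shift[OF d(2)])
  have gs: "L2per (%z. g (z + (t + c)))" by (rule L2per_shift[OF g])
  have "2 * ip2 g - 2 * ip g (%z. g (z + (t + c))) = ip (%z. g (z + (t + c)) - g z) (%z. g (z + (t + c)) - g z)"
   using ip_shift[OF g g, of "t + c"]
   by (simp add: ip_diff_left[OF gs g] ip_diff_right[OF gs g] L2per_diff[OF gs g] g gs ip_commute[of "%z. g (z + (t + c))" g])
  also have "(%z. g (z + (t + c)) - g z) = (%z. ?d1 z + ?d2 (z + a *r axis 1 1))"
   by (simp add: tc add.assoc)
  also have "ip2 (%z. ?d1 z + ?d2 (z + a *r axis 1 1))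
   <= 2 * ip ?d1 ?d1 + 2 * ip2 (%z. ?d2 (z + a *r axis 1 1))"
   by (rule ip_sum_le[OF d(1) d2s])
  also have "ip2 (%z. ?d2 (z + a *r axis 1 1)) = ip ?d2 ?d2"
   by (rule ip_shift[OF d(2) d(2)])
  also have "2 * ip ?d1 ?d1 + 2 * ip ?d2 ?d2 <= 2 * ip2 (%z. G z $ 1) + 2 * ip2 (%z. G z $ 2)"
   using shift_L2_bound[OF g Gi H1_perD(4)[OF H ab(1)] ab(1,2), of 1] shift_L2_bound[OF g Gi H1_perD(4)[OF H ab(3)] ab(3,4), of 2]
   by linarith
  also have "\<dots> = 2 * ip2 G" by (simp add: ip_vec2[OF G G])
  finally show ?thesis .
 qed
 have ic: "L1 (%t. ind cell t :: real)" using integrable_cell_const[of 1] by simp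
 have z: "(LI t. ind cell t * ip g (%z. g ((z + c) + t))) = 0"
 proof -
  have gc: "L2per (%z. g (z + c))" by (rule L2per_shift[OF g])
  have "(LI t. ind cell t * ip g (%z. g ((z + t) + c))) = (LI z. ind cell z * (g z * (LI t. ind cell t * g ((z + t) + c))))"
   by (rule conv_swap(1)[OF g gc ic])
  moreover have "(LI t. ind cell t * g ((z + t) + c)) = 0" for z
  proof -
   have "L1 (%t. ind cell t * g t)"
    by (rule L2per_set_integrable(2)[OF g]) (auto simp: cell_box)
   then have "(LI t. ind cell t * g (t + (z + c))) = (LI t. ind cell t * g t)"
    by (rule integral_cell_shift(1)) (use g in \<open>auto simp: L2per_def\<close>)
   then show ?thesis using mean by (simp add: add_ac)
  qed
  ultimately show ?thesis by (simp add: add_ac)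
 qed
 have i2: "L1 (%t. ind cell t * ip g (%z. g ((z + c) + t)))"
  using conv_swap(2)[OF g L2per_shift[OF g, of c] ic] by (simp add: add_ac)
 have "(LI t. ind cell t * (2 * ip2 g) - 2 * (ind cell t * ip g (%z. g ((z + c) + t)))) <= (LI t. ind cell t * (2 * ip2 G))"
 proof (rule integral_mono)
  show "L1 (%t. ind cell t * (2 * ip2 g) - 2 * (ind cell t * ip g (%z. g ((z + c) + t))))"
   by (intro L1_diff integrable_cell_const integrable_mult_right i2)
  show "ind cell t * (2 * ip2 g) - 2 * (ind cell t * ip g (%z. g ((z + c) + t))) <= ind cell t * (2 * ip2 G)" for t
   using bound[of t] by (cases "t \<in> cell") (auto simp: add_ac)
 qed (rule integrable_cell_const)
 also have "(LI t. ind cell t * (2 * ip2 g) - 2 * (ind cell t * ip g (%z. g ((z + c) + t)))) = 2 * ip2 g"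
  unfolding LI_diff[OF integrable_cell_const integrable_mult_right[OF i2]]
   integral_mult_right_zero z integral_cell_const by simp
 finally show ?thesis by (simp only: integral_cell_const)
qed

lemma continuous_L2_approx:
 fixes f :: "plane => real"
 assumes [measurable]: "f \<in> Borel" and i: "L1 (%z. ind Q z * (f z)^2)"
  and Q: "bounded Q" "Q \<in> sets borel" and \<epsilon>: "\<epsilon> > 0"
 obtains g where "continuous_on UNIV g" "L1 (%z. ind Q z * (f z - g z)^2)"
  "(LI z. ind Q z * (f z - g z)^2) < \<epsilon>"
proof -
 note Q(2)[measurable]
 have iQ: "L1 (%z. ind Q z * c)" for c :: real
  using emeasure_bounded_finite[OF Q(1)] Q(2) by (intro integrable_mult_left integrable_real_indicator) auto
 define cl where "cl M x = max (- M) (min M x)" for M x :: real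
 have cl_le: "\<bar>cl M x\<bar> <= M" if "M >= 0" for M x using that by (auto simp: cl_def)
 have cl_d: "\<bar>x - cl M x\<bar> <= \<bar>x\<bar>" if "M >= 0" for M x using that by (auto simp: cl_def)
 have [measurable]: "(%x. cl M (k x)) \<in> borel_measurable N" if "k \<in> borel_measurable N" for k :: "'z => real" and N M
  using that unfolding cl_def by measurable
 have "(%n. LI z. ind Q z * (f z - cl (real n) (f z))^2) \<longlonglongrightarrow> integral\<^sup>L lborel (%z::real^2. 0)"
 proof (rule integral_dominated_convergence[where w="%z. ind Q z * (f z)^2"])
  show "L1 (%z. ind Q z * (f z)^2)" by (rule i)
  show "AE z in lborel. (%n. ind Q z * (f z - cl (real n) (f z))^2) \<longlonglongrightarrow> 0"
  proof (intro AE_I2 tendsto_eventually)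
   fix z
   obtain n0 :: nat where "\<bar>f z\<bar> <= real n0" using real_arch_simple by blast
   then have "\<forall>n\<ge>n0. ind Q z * (f z - cl (real n) (f z))^2 = 0" by (auto simp: cl_def)
   then show "\<forall>\<^sub>F n in sequentially. ind Q z * (f z - cl (real n) (f z))^2 = 0"
    unfolding eventually_sequentially by blast
  qed
  show "AE z in lborel. norm (ind Q z * (f z - cl (real n) (f z))^2) <= ind Q z * (f z)^2" for n
   using cl_d[of "real n"] by (intro AE_I2) (auto simp: indicator_def abs_le_square_iff)
 qed measurable
 then have "(%n. LI z. ind Q z * (f z - cl (real n) (f z))^2) \<longlonglongrightarrow> 0" by simp
 from LIMSEQ_D[OF this, of "\<epsilon>/4"] \<epsilon> obtain M :: nat where M: "(LI z. ind Q z * (f z - cl (real M) (f z))^2) < \<epsilon>/4"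
  by fastforce
 have "f measurable_on UNIV"
  by (rule lebesgue_measurable_imp_measurable_on) (auto intro: measurable_completion)
 then obtain N g where Ng: "negligible N" "!!n. continuous_on UNIV (g n)" "!!x. x \<notin> N ==> (%n. g n x) \<longlonglongrightarrow> f x"
  unfolding measurable_on_def by auto
 have cg: "continuous_on UNIV (%z. cl (real M) (g n z))" for n
  unfolding cl_def by (intro continuous_intros Ng)
 have [measurable]: "g n \<in> Borel" for n using Ng(2) by (rule borel_measurable_continuous_onI)
 have aeN: "AE z in lborel. z \<notin> N"
 proof -
  have "AE z in lebesgue. z \<notin> N" using Ng(1) by (auto simp: negligible_iff_null_sets AE_not_in)
  then show ?thesis by (simp add: AE_completion_iff)
 qed
 have "(%n. LI z. ind Q z * (cl (real M) (f z) - cl (real M) (g n z))^2) \<longlonglongrightarrow> integral\<^sup>L lborel (%z::real^2. 0)"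
 proof (rule integral_dominated_convergence[where w="%z. ind Q z * (2 * real M)^2"])
  show "L1 (%z. ind Q z * (2 * real M)^2)" by (rule iQ)
  show "AE z in lborel. (%n. ind Q z * (cl (real M) (f z) - cl (real M) (g n z))^2) \<longlonglongrightarrow> 0"
   using aeN
  proof eventually_elim
   case (elim z)
   have "(%n. ind Q z * (cl (real M) (f z) - cl (real M) (g n z))^2) \<longlonglongrightarrow> ind Q z * (cl (real M) (f z) - cl (real M) (f z))^2"
    unfolding cl_def by (intro tendsto_intros Ng(3) elim)
   then show ?case by simp
  qed
  show "AE z in lborel. norm (ind Q z * (cl (real M) (f z) - cl (real M) (g n z))^2) <= ind Q z * (2 * real M)^2" for n
  proof (intro AE_I2)
   fix z
   have "\<bar>cl (real M) (f z) - cl (real M) (g n z)\<bar> <= 2 * real M"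
    using cl_le[of "real M" "f z"] cl_le[of "real M" "g n z"] by linarith
   then have "(cl (real M) (f z) - cl (real M) (g n z))^2 <= (2 * real M)^2"
    by (metis abs_ge_zero power2_abs power_mono)
   then show "norm (ind Q z * (cl (real M) (f z) - cl (real M) (g n z))^2) <= ind Q z * (2 * real M)^2"
    by (auto simp: indicator_def)
  qed
 qed measurable
 then have "(%n. LI z. ind Q z * (cl (real M) (f z) - cl (real M) (g n z))^2) \<longlonglongrightarrow> 0" by simp
 from LIMSEQ_D[OF this, of "\<epsilon>/4"] \<epsilon> obtain n where n: "(LI z. ind Q z * (cl (real M) (f z) - cl (real M) (g n z))^2) < \<epsilon>/4"
  by fastforce
 define k where "k z = cl (real M) (g n z)" for z
 have [measurable]: "k \<in> Borel" unfolding k_def by measurable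
 have i1: "L1 (%z. ind Q z * (f z - cl (real M) (f z))^2)"
  by (rule L1_bound[OF i]) (use cl_d[of "real M"] in \<open>auto simp: indicator_def abs_le_square_iff\<close>)
 have i2: "L1 (%z. ind Q z * (cl (real M) (f z) - k z)^2)"
 proof (rule L1_bound[OF iQ[of "(2 * real M)^2"]])
  show "AE z in lborel. norm (ind Q z * (cl (real M) (f z) - k z)^2) <= norm (ind Q z * (2 * real M)^2)" (is "AE z in _. ?P z")
  proof (intro AE_I2)
   fix z
   have "\<bar>cl (real M) (f z) - k z\<bar> <= 2 * real M"
    using cl_le[of "real M" "f z"] cl_le[of "real M" "g n z"] unfolding k_def by linarith
   then have "(cl (real M) (f z) - k z)^2 <= (2 * real M)^2"
    by (metis abs_ge_zero power2_abs power_mono)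
   then show "?P z"
    by (auto simp: indicator_def)
  qed
 qed measurable
 have pt: "ind Q z * (f z - k z)^2 <= 2 * (ind Q z * (f z - cl (real M) (f z))^2) + 2 * (ind Q z * (cl (real M) (f z) - k z)^2)" for z
 proof -
  have "(a + b)^2 <= 2 * a^2 + 2 * b^2" for a b :: real
   using sum_squares_bound[of a b] by (simp add: power2_sum)
  from this[of "f z - cl (real M) (f z)" "cl (real M) (f z) - k z"] show ?thesis by (auto simp: indicator_def)
 qed
 have i12: "L1 (%z. 2 * (ind Q z * (f z - cl (real M) (f z))^2) + 2 * (ind Q z * (cl (real M) (f z) - k z)^2))"
  using i1 i2 by simp
 have i3: "L1 (%z. ind Q z * (f z - k z)^2)"
  by (rule L1_bound[OF i12])
   (use pt in \<open>auto intro: order_trans[OF _ abs_ge_self]\<close>)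
 show thesis
 proof (rule that[of k])
  show "continuous_on UNIV k" using cg[of n] by (simp add: k_def[abs_def])
  show "L1 (%z. ind Q z * (f z - k z)^2)" by (rule i3)
  have "(LI z. ind Q z * (f z - k z)^2) <= (LI z. 2 * (ind Q z * (f z - cl (real M) (f z))^2) + 2 * (ind Q z * (cl (real M) (f z) - k z)^2))"
   by (rule integral_mono[OF i3 i12 pt])
  also have "\<dots> < \<epsilon>" using M n i1 i2 by (simp add: k_def)
  finally show "(LI z. ind Q z * (f z - k z)^2) < \<epsilon>" .
 qed
qed

text \<open>
  Approximation by continuous functions, for which translation is uniformly continuous on compact
  sets.
\<close>

lemma translation_continuous:
 fixes f :: "plane => real"
 assumes f: "L2per f" and \<epsilon>: "\<epsilon> > 0"
 obtains \<delta> where "\<delta> > 0" "!!t. norm t < \<delta> ==> ip2 (%z. f (z + t) - f z) < \<epsilon>"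
proof -
 have [measurable]: "f \<in> Borel" using f by (auto simp: L2per_def)
 define Q :: "plane set" where "Q = cbox (vec (-1)) (vec 1)"
 have Q: "bounded Q" "Q \<in> sets borel" "compact Q" by (auto simp: Q_def)
 note Q(2)[measurable]
 have cQ: "z + t \<in> Q" if "z \<in> cell" "norm t < 1/2" for z t :: plane
 proof -
  have "\<bar>t $ i\<bar> < 1/2" for i using component_le_norm_cart[of t i] that(2) by simp
  then show ?thesis using that(1) unfolding Q_def cell_def mem_box_cart
   by (auto simp: abs_less_iff) (smt (verit) field_sum_of_halves)+
 qed
 obtain g where g: "continuous_on UNIV g" "L1 (%z. ind Q z * (f z - g z)^2)"
  "(LI z. ind Q z * (f z - g z)^2) < \<epsilon>/12"
  using continuous_L2_approx[OF _ L2per_set_integrable(1)[OF f Q(1,2)] Q(1,2), of "\<epsilon>/12"] \<epsilon> by auto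
 have [measurable]: "g \<in> Borel" by (rule borel_measurable_continuous_onI[OF g(1)])
 have "uniformly_continuous_on Q g" by (rule compact_uniformly_continuous[OF continuous_on_subset[OF g(1)] Q(3)]) auto
 then obtain d where d: "d > 0" "!!x y. x \<in> Q ==> y \<in> Q ==> dist y x < d ==> dist (g y) (g x) < sqrt (\<epsilon>/12)"
  unfolding uniformly_continuous_on_def using \<epsilon> by (metis divide_pos_pos real_sqrt_gt_zero zero_less_numeral)
 show thesis
 proof (rule that[of "min (1/2) d"])
  fix t :: plane assume t: "norm t < min (1/2) d"
  let ?k1 = "%z. ind Q (z + t) * (f (z + t) - g (z + t))^2" and ?k3 = "%z. ind Q z * (f z - g z)^2"
  have ik1: "L1 ?k1" by (rule integrable_lborel_shift[OF g(2)])
  have e1: "(LI z. ?k1 z) = (LI z. ?k3 z)"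
   using integral_lborel_shift[of ?k3 t] by simp
  have pt: "ind cell z * ((f (z + t) - f z) \<bullet> (f (z + t) - f z)) <= 3 * ?k1 z + 3 * ?k3 z + ind cell z * (\<epsilon>/4)" for z
  proof (cases "z \<in> cell")
   case True
   have zQ: "z \<in> Q" "z + t \<in> Q" using cQ[OF True, of 0] cQ[OF True, of t] t by auto
   have "dist (g (z + t)) (g z) < sqrt (\<epsilon>/12)" using d(2)[OF zQ] t by (simp add: dist_norm)
   then have "\<bar>g (z + t) - g z\<bar>^2 <= (sqrt (\<epsilon>/12))^2" by (intro power_mono) (auto simp: dist_real_def)
   then have g2: "(g (z + t) - g z)^2 <= \<epsilon>/12" using \<epsilon> by simp
   have "(a + b + c)^2 <= 3 * a^2 + 3 * b^2 + 3 * c^2" for a b c :: real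
    using sum_squares_bound[of a b] sum_squares_bound[of a c] sum_squares_bound[of b c]
    by (simp add: power2_eq_square algebra_simps)
   from this[of "f (z + t) - g (z + t)" "g (z + t) - g z" "g z - f z"] g2
   have "(f (z + t) - f z)^2 <= 3 * (f (z + t) - g (z + t))^2 + 3 * (f z - g z)^2 + \<epsilon>/4"
    by (simp add: power2_commute[of "g z" "f z"])
   then show ?thesis using True zQ by (simp add: power2_eq_square)
  next
   case False
   have "0 <= ?k1 z" "0 <= ?k3 z" by auto
   with False show ?thesis by simp
  qed
  have "ip2 (%z. f (z + t) - f z) <= (LI z. 3 * ?k1 z + 3 * ?k3 z + ind cell z * (\<epsilon>/4))"
   unfolding ip_def
   by (rule integral_mono[OF cell_integrable_inner _ pt])
    (intro L2per_diff L2per_shift f L1_add integrable_mult_right ik1 g(2) integrable_cell_const)+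
  also have "\<dots> = 3 * (LI z. ?k1 z) + 3 * (LI z. ?k3 z) + \<epsilon>/4"
   by (subst LI_add, intro L1_add integrable_mult_right ik1 g(2), rule integrable_cell_const,
    subst LI_add, intro integrable_mult_right ik1, intro integrable_mult_right g(2))
    (simp only: integral_cell_const integral_mult_right_zero)
  also have "\<dots> < \<epsilon>" using e1 g(3) \<epsilon> by simp
  finally show "ip2 (%z. f (z + t) - f z) < \<epsilon>" .
 qed (use d in auto)
qed

section \<open>Divergence-free fields, gradients and the weighted variational problem\<close>

lemma AE_open_ex:
 fixes S :: "'a::euclidean_space set"
 assumes "AE t in lborel. P t" "open S" "S ~= {}"
 shows "\<exists>t\<in>S. P t"
proof (rule ccontr)
 assume neg: "\<not> (\<exists>t\<in>S. P t)"
 obtain N where N: "{t. \<not> P t} \<subseteq> N" "N \<in> null_sets lborel"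
  using assms(1) by (auto elim!: AE_E simp: null_sets_def)
 have "S \<subseteq> N" using N(1) neg by auto
 moreover have "N \<in> null_sets lebesgue" using N(2) by (rule null_sets_completionI)
 then have "negligible N" by (simp add: negligible_iff_null_sets)
 ultimately have "negligible S" by (rule negligible_subset[rotated])
 then show False using open_not_negligible assms(2,3) by blast
qed

lemma integral_lborel_reflect:
 fixes f :: "'a::euclidean_space => real"
 assumes [measurable]: "f \<in> Borel"
 shows "(LI y. f (- y)) = (LI y. f y)"
proof -
 have "lborel = distr lborel borel (%x::'a. - x)"
  using lborel_affine[of "-1" "0::'a"] by (simp add: density_1)
 then have "(LI y. f y) = (LINT y|distr lborel borel (%x::'a. - x). f y)" by simp
 also have "\<dots> = (LI y. f (- y))" by (rule integral_distr) auto
 finally show ?thesis by simp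
qed

lemma test_affine:
 assumes eta: "eta \<in> test_fun (UNIV :: 'a::euclidean_space set)" and L: "linear L" "!!x. L (L x) = (x::'a)"
 shows "(%y. eta (c + L y)) \<in> test_fun UNIV"
proof -
 obtain K where K: "smooth_fun eta" "compact K" "!!y. y \<notin> K ==> eta y = 0" using test_funD[OF eta] by metis
 have bl: "bounded_linear L" using L(1) by (simp add: linear_conv_bounded_linear)
 have "continuous_on K (%y. L (y - c))"
  by (rule continuous_on_compose2[OF linear_continuous_on[OF bl, of UNIV]]) (intro continuous_intros, rule subset_UNIV)
 then have "compact ((%y. L (y - c)) ` K)" by (rule compact_continuous_image[OF _ K(2)])
 then show ?thesis
 proof (rule test_funI[OF smooth_affine[OF K(1) L(1)]])
  fix y assume y: "y \<notin> (%y. L (y - c)) ` K"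
  have "c + L y \<notin> K"
  proof
   assume "c + L y \<in> K"
   moreover have "y = L ((c + L y) - c)" using L(2) by simp
   ultimately show False using y by blast
  qed
  then show "eta (c + L y) = 0" by (rule K(3))
 qed auto
qed

lemma test_integrable: "eta \<in> test_fun (UNIV :: 'a::euclidean_space set) ==> L1 eta"
proof -
 assume eta: "eta \<in> test_fun UNIV"
 have "L1loc UNIV (%y::'a. 1::real)"
  unfolding locally_integrable_def set_integrable_def
  by (auto intro!: integrable_real_indicator emeasure_compact_finite borel_compact)
 from test_times_integrable[OF eta _ this] show ?thesis by simp
qed

lemma grad_inner: "v \<bullet> grad eta z = v $ 1 * dir_deriv (axis 1 1) eta z + v $ 2 * dir_deriv (axis 2 1) eta z"
 by (simp add: grad_def inner_vec_def sum_2)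

text \<open>
  The function \<open>t \<mapsto> ip b (\<lambda>z. G (z + t))\<close> integrates to zero against
  every test function: the average of translates of \<open>G\<close> puts the derivative on the test
  function, and after an exchange of integrals this is the divergence identity for \<open>b\<close>.
  So the function vanishes almost everywhere, and at \<open>t = 0\<close> by continuity of
  translations.
\<close>

theorem divfree_orthogonal:
 fixes b G :: "plane => plane"
 assumes b: "L2per b" and div: "!!eta. eta \<in> test_fun UNIV ==> (LI z. b z \<bullet> grad eta z) = 0"
  and H: "H1_per g G"
 shows "ip b G = 0"
proof -
 have g: "L2per g" and G: "L2per G" and Gi: "!!i. L2per (%z. G z $ i)" using H1_perD[OF H] by auto
 have bi: "L2per (%z. b z $ i)" for i by (rule L2per_component[OF b])
 have [measurable]: "g \<in> Borel" "G \<in> Borel" "b \<in> Borel"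
  using g G b by (auto simp: L2per_def)
 define c where "c t = ip b (%z. G (z + t))" for t
 have c_vec: "c t = ip (%z. b z $ 1) (%z. G (z + t) $ 1) + ip (%z. b z $ 2) (%z. G (z + t) $ 2)" for t
  unfolding c_def by (rule ip_vec2[OF b L2per_shift[OF G]])
 have [measurable]: "c \<in> Borel" unfolding c_def ip_def by measurable
 have test0: "(LI t. eta t * c t) = 0" if eta: "eta \<in> test_fun UNIV" for eta
 proof -
  let ?d = "%i. dir_deriv (axis i 1) eta"
  have sm: "smooth_fun eta" using eta test_funD by blast
  have dt: "?d i \<in> test_fun UNIV" for i by (rule test_fun_dir[OF eta])
  have [measurable]: "eta \<in> Borel" "?d i \<in> Borel" for i
   using eta dt[of i] by (auto intro: test_fun_borel)
  have ieta: "L1 eta" by (rule test_integrable[OF eta])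
  have id': "L1 (%t. ?d i (- t))" for i
  proof -
   have "(%t. ?d i (0 + - t)) \<in> test_fun UNIV" by (rule test_affine[OF dt, where L=uminus]) (auto simp: linear_iff)
   then show ?thesis using test_integrable by fastforce
  qed
  have id: "L1 (?d i)" for i by (rule test_integrable[OF dt])
  define q where "q i z = (LI t. ?d i (- t) * b (z + t) $ i)" for i z
  have [measurable]: "q i \<in> Borel" for i unfolding q_def by measurable
  have part: "(LI t. eta t * ip (%z. b z $ i) (%z. G (z + t) $ i)) = - (LI z. ind cell z * (g z * q i z))" for i
  proof -
   have in1: "(LI t. eta t * G (z + t) $ i) = - (LI t. ?d i t * g (z + t))" for z
   proof -
    have te: "(%y. eta (- z + y)) \<in> test_fun UNIV" by (rule test_affine[OF eta, where L="%y. y"]) (auto simp: linear_iff)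
    have de: "dir_deriv (axis i 1) (%y. eta (- z + y)) y = ?d i (- z + y)" for y
     by (rule dir_deriv_affine[OF sm, of "%y. y"]) (auto simp: linear_iff)
    have "(LI y. ?d i (- z + y) * g y) = - (LI y. eta (- z + y) * G y $ i)"
     using H1_perD(5)[OF H te, of i] by (simp only: de)
    moreover have "(LI t. ?d i t * g (z + t)) = (LI y. ?d i (- z + y) * g y)"
     using integral_lborel_shift[of "%y. ?d i (- z + y) * g y" z] by (simp add: add.commute)
    moreover have "(LI t. eta t * G (z + t) $ i) = (LI y. eta (- z + y) * G y $ i)"
     using integral_lborel_shift[of "%y. eta (- z + y) * G y $ i" z] by (simp add: add.commute)
    ultimately show ?thesis by simp
   qed
   have sh: "ip (%z. b z $ i) (%z. g (z + t)) = ip g (%z. b (z + - t) $ i)" for t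
    using ip_shift[OF bi[of i] L2per_shift[OF g, of t], of "- t"] by (simp add: ip_commute)
   have "(LI t. eta t * ip (%z. b z $ i) (%z. G (z + t) $ i)) = (LI z. ind cell z * (b z $ i * (LI t. eta t * G (z + t) $ i)))"
    by (rule conv_swap(1)[OF bi Gi ieta])
   also have "\<dots> = - (LI z. ind cell z * (b z $ i * (LI t. ?d i t * g (z + t))))"
    by (simp add: in1)
   also have "(LI z. ind cell z * (b z $ i * (LI t. ?d i t * g (z + t)))) = (LI t. ?d i t * ip (%z. b z $ i) (%z. g (z + t)))"
    by (rule conv_swap(1)[OF bi g id, symmetric])
   also have "\<dots> = (LI t. ?d i t * ip g (%z. b (z + - t) $ i))" by (simp only: sh)
   also have "\<dots> = (LI t. ?d i (- t) * ip g (%z. b (z + t) $ i))"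
   proof -
    have "(%t. ?d i t * ip g (%z. b (z + - t) $ i)) \<in> Borel"
     unfolding ip_def by measurable
    from integral_lborel_reflect[OF this] show ?thesis by simp
   qed
   also have "\<dots> = (LI z. ind cell z * (g z * q i z))"
    unfolding q_def by (rule conv_swap(1)[OF g bi id'])
   finally show ?thesis .
  qed
  have q0: "q 1 z + q 2 z = 0" for z
  proof -
   have sh: "q i z = (LI y. ?d i (z - y) * b y $ i)" for i
    using integral_lborel_shift[of "%y. ?d i (z - y) * b y $ i" z] by (simp add: q_def add.commute)
   let ?e = "%y. eta (z + - y)"
   have te: "?e \<in> test_fun UNIV" by (rule test_affine[OF eta, where L=uminus]) (auto simp: linear_iff)
   have de: "dir_deriv (axis i 1) ?e y = - ?d i (z - y)" for y i
   proof -
    have "dir_deriv (axis i 1) ?e y = dir_deriv (- axis i 1) eta (z + - y)"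
     by (rule dir_deriv_affine[OF sm, of uminus]) (auto simp: linear_iff)
    also have "\<dots> = - ?d i (z + - y)"
     using linear_neg[OF has_derivative_linear[OF smooth_has_derivative[OF sm]]] by simp
    finally show ?thesis by simp
   qed
   have te': "(%y. ?d i (z + - y)) \<in> test_fun UNIV" for i by (rule test_affine[OF dt, where L=uminus]) (auto simp: linear_iff)
   have ii: "L1 (%y. ?d i (z - y) * b y $ i)" for i
    using test_times_integrable[OF te'[of i] _ L2per_locally_integrable[OF bi[of i]]] bi[of i] by (simp add: L2per_def)
   have "q 1 z + q 2 z = (LI y. ?d 1 (z - y) * b y $ 1 + ?d 2 (z - y) * b y $ 2)"
    unfolding sh using ii by simp
   also have "\<dots> = - (LI y. b y \<bullet> grad ?e y)"
    unfolding grad_inner de Bochner_Integration.integral_minus[symmetric]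
    by (intro LI_cong refl) (simp add: mult.commute)
   finally show ?thesis using div[OF te] by simp
  qed
  have il: "L1 (%t. eta t * ip (%z. b z $ i) (%z. G (z + t) $ i))" for i
   by (rule conv_swap(2)[OF bi Gi ieta])
  have "(LI t. eta t * c t) = - (LI z. ind cell z * (g z * q 1 z)) - (LI z. ind cell z * (g z * q 2 z))"
   unfolding c_vec distrib_left using il by (simp add: part)
  also have "(LI z. ind cell z * (g z * q 2 z)) = (LI z. - (ind cell z * (g z * q 1 z)))"
  proof (intro LI_cong refl)
   fix z have "q 2 z = - q 1 z" using q0[of z] by simp
   then show "ind cell z * (g z * q 2 z) = - (ind cell z * (g z * q 1 z))" by simp
  qed
  finally show ?thesis by simp
 qed
 have cb: "\<bar>c t\<bar> <= sqrt (ip2 b * ip2 G)" for t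
  using ip_Cauchy_Schwarz[OF b L2per_shift[OF G, of t]] ip_shift[OF G G, of t]
  by (intro real_le_rsqrt) (simp add: c_def)
 have "AE t in lborel. t \<in> UNIV --> c t = 0"
 proof (rule fundamental_lemma)
  fix l u :: plane
  have "L1 (%t. ind (cbox l u) t * sqrt (ip2 b * ip2 G))"
   by (intro integrable_mult_left integrable_real_indicator) (auto simp: emeasure_lborel_cbox_eq)
  then show "set_integrable lborel (cbox l u) c"
   unfolding set_integrable_def
   by (rule L1_bound) (use cb in \<open>auto simp: indicator_def intro: order_trans[OF _ abs_ge_self]\<close>)
 qed (use test0 boxbump_test[of _ _ _ UNIV] in auto)
 then have c0: "AE t in lborel. c t = 0" by simp
 show ?thesis
 proof (rule ccontr)
  assume ne: "ip b G ~= 0"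
  define \<epsilon> where "\<epsilon> = (ip b G)^2 / (4 * (ip2 b + 1))"
  have bb: "ip2 b + 1 > 0" using ip_nonneg[of b] by linarith
  have \<epsilon>: "\<epsilon> > 0" unfolding \<epsilon>_def using ne bb by simp
  obtain d1 where d1: "d1 > 0" "!!t. norm t < d1 ==> ip2 (%z. G (z + t) $ 1 - G z $ 1) < \<epsilon>"
   using translation_continuous[OF Gi[of 1] \<epsilon>] by blast
  obtain d2 where d2: "d2 > 0" "!!t. norm t < d2 ==> ip2 (%z. G (z + t) $ 2 - G z $ 2) < \<epsilon>"
   using translation_continuous[OF Gi[of 2] \<epsilon>] by blast
  have "\<exists>t\<in>ball 0 (min d1 d2). c t = 0"
   by (rule AE_open_ex[OF c0 open_ball]) (use d1(1) d2(1) in simp)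
  then obtain t where t: "norm t < min d1 d2" "c t = 0" by (auto simp del: min_less_iff_conj)
  let ?\<Delta> = "%z. G (z + t) - G z"
  have \<Delta>: "L2per ?\<Delta>" by (intro L2per_diff L2per_shift G)
  have "(ip b G)^2 = (ip b ?\<Delta>)^2"
   using t(2) by (simp add: ip_diff_right[OF L2per_shift[OF G] G b] c_def)
  also have "\<dots> <= ip2 b * ip ?\<Delta> ?\<Delta>" by (rule ip_Cauchy_Schwarz[OF b \<Delta>])
  also have "ip ?\<Delta> ?\<Delta> <= 2 * \<epsilon>" using d1(2)[of t] d2(2)[of t] t(1) by (simp add: ip_vec2[OF \<Delta> \<Delta>])
  then have "ip2 b * ip ?\<Delta> ?\<Delta> <= (ip2 b + 1) * (2 * \<epsilon>)"
   using ip_nonneg[of b] ip_nonneg[of ?\<Delta>] \<epsilon> by (intro mult_mono) auto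
  also have "\<dots> = (ip b G)^2 / 2" unfolding \<epsilon>_def using bb by (simp add: field_simps)
  finally show False using ne by simp
 qed
qed

lemma H1_perI:
 assumes g: "L2per g" and G: "L2per G"
  and w: "!!i psi. psi \<in> test_fun UNIV ==> (LI z. dir_deriv (axis i 1) psi z * g z) = - (LI z. psi z * G z $ i)"
 shows "H1_per g G"
 unfolding H1_per_iff weak_grad_def weak_deriv_def
 using assms L2per_locally_integrable[OF g] L2per_locally_integrable[OF L2per_component[OF G]]
 by (auto simp: set_LI_def)

lemma test_L2_integrable: "psi \<in> test_fun UNIV ==> L2per k ==> L1 (%z. psi z * k z)" for k :: "plane => real"
 by (rule test_times_integrable[OF _ _ L2per_locally_integrable]) (auto simp: L2per_def)

lemma H1_per_lin:
 assumes a: "H1_per g G" and b: "H1_per k K"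
 shows "H1_per (%z. g z + c * k z) (%z. G z + c *r K z)"
proof (rule H1_perI)
 note A = H1_perD[OF a] and B = H1_perD[OF b]
 show "L2per (%z. g z + c * k z)" using L2per_add[OF A(1) L2per_scale[OF B(1), of c]] by simp
 show "L2per (%z. G z + c *r K z)" by (intro L2per_add L2per_scale A B)
 fix i psi assume psi: "psi \<in> test_fun (UNIV :: plane set)"
 note d = test_fun_dir[OF psi, of "axis i 1"]
 show "(LI z. dir_deriv (axis i 1) psi z * (g z + c * k z)) = - (LI z. psi z * (G z + c *r K z) $ i)"
  using A(5)[OF psi, of i] B(5)[OF psi, of i] test_L2_integrable[OF d A(1)] test_L2_integrable[OF d B(1)]
   test_L2_integrable[OF psi A(3)[of i]] test_L2_integrable[OF psi B(3)[of i]]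
  by (simp add: distrib_left mult.left_commute[of _ c])
qed

lemma test_deriv_integral_zero:
 assumes "psi \<in> test_fun (UNIV :: 'a::euclidean_space set)"
 shows "(LI z. dir_deriv e psi z) = 0"
proof -
 have l: "L1loc UNIV (%z::'a. c::real)" for c
  unfolding locally_integrable_def set_integrable_def
  by (auto intro!: integrable_mult_left integrable_real_indicator emeasure_compact_finite borel_compact simp del: integrable_mult_left_iff)
 have "(LI z. dir_deriv e psi z * 1) = - (LI z. psi z * 0)"
  by (rule shift_imp_weak[OF open_UNIV _ _ l l _ assms]) (auto simp: shift_deriv_def set_LI_def)
 then show ?thesis by simp
qed

lemma H1_per_const: "H1_per (%z. c) (%z. 0)"
 using test_deriv_integral_zero by (intro H1_perI L2per_const) auto

lemma mean_grad_zero: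
 assumes "H1_per g G" shows "ip (%z. v) G = 0"
proof (rule divfree_orthogonal[OF L2per_const _ assms])
 fix eta assume eta: "eta \<in> test_fun (UNIV :: plane set)"
 have "(LI z. v \<bullet> grad eta z) = v $ 1 * (LI z. dir_deriv (axis 1 1) eta z) + v $ 2 * (LI z. dir_deriv (axis 2 1) eta z)"
  unfolding grad_inner using test_integrable[OF test_fun_dir[OF eta]] by simp
 then show "(LI z. v \<bullet> grad eta z) = 0" by (simp add: test_deriv_integral_zero[OF eta])
qed

lemma Poincare_per':
 assumes "H1_per g G"
 shows "ip2 (%z. g z - (LI z. ind cell z * g z)) <= ip2 G"
  and "H1_per (%z. g z - (LI z. ind cell z * g z)) G"
  and "(LI z. ind cell z * (g z - (LI z. ind cell z * g z))) = 0"
proof -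
 let ?m = "LI z. ind cell z * g z"
 show H: "H1_per (%z. g z - ?m) G"
  using H1_per_lin[OF assms H1_per_const[of 1], of "- ?m"] by simp
 have "L1 (%z. ind cell z * g z)"
  by (rule L2per_set_integrable(2)[OF H1_perD(1)[OF assms]]) (auto simp: cell_box)
 then show z: "(LI z. ind cell z * (g z - ?m)) = 0"
  unfolding right_diff_distrib by (subst LI_diff[OF _ integrable_cell_const]) (simp_all only: integral_cell_const)
 show "ip2 (%z. g z - ?m) <= ip2 G" by (rule Poincare_per[OF H z])
qed

lemma H1_per_zero_grad:
 assumes H: "H1_per g G" and z: "AE z in lborel. G z = 0"
 shows "AE z in lborel. g z = (LI z. ind cell z * g z)"
proof -
 let ?m = "LI z. ind cell z * g z"
 have "ip2 G = 0" unfolding ip_def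
  by (rule integral_eq_zero_AE) (use z in eventually_elim, simp)
 then have "ip2 (%z. g z - ?m) = 0"
  using Poincare_per'(1)[OF H] ip_nonneg[of "%z. g z - ?m"] by linarith
 from ip_zero_imp[OF H1_perD(1)[OF Poincare_per'(2)[OF H]] this] show ?thesis by eventually_elim simp
qed

lemma finite_lattice_hits:
 assumes "bounded K"
 obtains S where "finite S" "!!z k. norm z <= R ==> z + lattice_vec k \<in> K ==> k \<in> S"
proof -
 obtain N0 where N0: "!!z. z \<in> K ==> norm z <= N0" using assms by (auto simp: bounded_iff)
 define N where "N = \<lceil>N0 + R\<rceil>"
 show thesis
 proof (rule that[of "{-N..N} \<times> {-N..N}"])
  fix z k assume zk: "norm z <= R" "z + lattice_vec k \<in> K"
  have "norm (lattice_vec k) <= N0 + R"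
   using norm_triangle_ineq4[of "z + lattice_vec k" z] N0[OF zk(2)] zk(1) by simp
  then have "\<bar>lattice_vec k $ 1\<bar> <= N0 + R" "\<bar>lattice_vec k $ 2\<bar> <= N0 + R"
   using component_le_norm_cart order_trans by blast+
  then have "\<bar>fst k\<bar> <= N" "\<bar>snd k\<bar> <= N" unfolding N_def by simp_all linarith+
  then show "k \<in> {-N..N} \<times> {-N..N}" by (auto simp: mem_Times_iff)
 qed simp
qed

definition periodize :: "plane set => (plane => real) => plane => real" where
 "periodize K psi z = (\<Sum>k | z + lattice_vec k \<in> K. psi (z + lattice_vec k))"

lemma periodize_eq:
 assumes "!!y. y \<notin> K ==> psi y = 0" "finite S" "!!k. z + lattice_vec k \<in> K ==> k \<in> S"
 shows "periodize K psi z = (\<Sum>k\<in>S. psi (z + lattice_vec k))"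
 unfolding periodize_def by (rule sum.mono_neutral_left) (use assms in auto)

lemma lattice_vec_add: "lattice_vec (k + l) = lattice_vec k + lattice_vec l"
 by (simp add: lattice_vec_def scaleR_left_distrib)

lemma lattice_vec_diff: "lattice_vec (k - l) = lattice_vec k - lattice_vec l"
 by (simp add: lattice_vec_def scaleR_left_diff_distrib)

lemma periodize_periodic: "periodic (periodize K psi)"
 unfolding periodic_def
proof (intro allI)
 fix z :: plane and i :: 2
 obtain l where l: "axis i 1 = lattice_vec l"
 proof (cases "i = 1")
  case True then show ?thesis using that[of "(1, 0)"] by (simp add: lattice_vec_def)
 next
  case False
  then have "i = 2" using exhaust_2 by blast
  then show ?thesis using that[of "(0, 1)"] by (simp add: lattice_vec_def)
 qed
 show "periodize K psi (z + axis i 1) = periodize K psi z"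
  unfolding periodize_def l
  by (rule sum.reindex_bij_witness[where i="%k. k - l" and j="%k. k + l"])
   (simp_all add: lattice_vec_add lattice_vec_diff algebra_simps)
qed

lemma periodize_borel:
 assumes [measurable]: "psi \<in> Borel" and K: "!!y. y \<notin> K ==> psi y = 0" "bounded K"
 shows "periodize K psi \<in> Borel"
proof (rule borel_measurable_LIMSEQ_real)
 let ?S = "%n::nat. {- int n..int n} \<times> {- int n..int n}"
 show "(%n. \<Sum>k\<in>?S n. psi (z + lattice_vec k)) \<longlonglongrightarrow> periodize K psi z" for z
 proof (rule tendsto_eventually)
  obtain S where S0: "finite S" "!!w k. norm w <= norm z ==> w + lattice_vec k \<in> K ==> k \<in> S"
   by (rule finite_lattice_hits[OF K(2)], rule that)
  have S: "finite S" "!!k. z + lattice_vec k \<in> K ==> k \<in> S" using S0(1) S0(2)[of z] by auto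
  define n0 where "n0 = Max (insert 0 ((%k. nat (\<bar>fst k\<bar> + \<bar>snd k\<bar>)) ` S))"
  have "k \<in> ?S n" if "k \<in> S" "n >= n0" for k n
  proof -
   have "nat (\<bar>fst k\<bar> + \<bar>snd k\<bar>) <= n0" unfolding n0_def using S(1) that(1) by (intro Max_ge) auto
   then have "\<bar>fst k\<bar> <= int n" "\<bar>snd k\<bar> <= int n" using that(2) by linarith+
   then show ?thesis by (auto simp: mem_Times_iff)
  qed
  then have "periodize K psi z = (\<Sum>k\<in>?S n. psi (z + lattice_vec k))" if "n >= n0" for n
   using that S(2) K(1) by (intro periodize_eq) auto
  then show "\<forall>\<^sub>F n in sequentially. (\<Sum>k\<in>?S n. psi (z + lattice_vec k)) = periodize K psi z"
   unfolding eventually_sequentially by metis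
 qed
qed measurable

lemma cell_norm: "z \<in> cellh ==> norm z <= 1"
proof -
 assume "z \<in> cellh"
 then have "\<bar>z $ 1\<bar> <= 1/2" "\<bar>z $ 2\<bar> <= 1/2" by (auto simp: cellh_def forall_2)
 then show ?thesis using norm_le_l1_cart[of z] by (simp add: sum_2)
qed

lemma periodize_L2:
 assumes [measurable]: "psi \<in> Borel" and K: "!!y. y \<notin> K ==> psi y = 0" "bounded K" and M: "!!y. \<bar>psi y\<bar> <= M"
 shows "L2per (periodize K psi)"
 unfolding L2per_def
proof (intro conjI periodize_periodic periodize_borel assms)
 have [measurable]: "periodize K psi \<in> Borel" by (rule periodize_borel[OF assms(1-3)])
 obtain S where S: "finite S" "!!z k. norm z <= 1 ==> z + lattice_vec k \<in> K ==> k \<in> S"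
  using finite_lattice_hits[OF K(2), of 1] by metis
 have b: "\<bar>periodize K psi z\<bar> <= real (card S) * M" if "z \<in> cell" for z
 proof -
  have "periodize K psi z = (\<Sum>k\<in>S. psi (z + lattice_vec k))"
   using S cell_norm[of z] cell_cellh that K(1) by (intro periodize_eq) auto
  also have "\<bar>\<dots>\<bar> <= (\<Sum>k\<in>S. M)" using M by (intro order_trans[OF sum_abs] sum_mono) auto
  finally show ?thesis by simp
 qed
 show "L1 (%z. ind cell z * (norm (periodize K psi z))^2)"
 proof (rule L1_bound[OF integrable_cell_const[of "(real (card S) * M)^2"]])
  show "AE z in lborel. norm (ind cell z * (norm (periodize K psi z))^2) <= norm (ind cell z * (real (card S) * M)^2)"
   using b by (intro AE_I2) (auto simp: indicator_def abs_le_square_iff[symmetric] intro: order_trans[OF _ abs_ge_self])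
 qed measurable
qed

text \<open>
  The periodization of a test function is a periodic Sobolev function, and unfolding the integral over
  the plane turns the identity into orthogonality to its gradient.
\<close>

theorem orthogonal_imp_divfree:
 fixes v :: "plane => plane"
 assumes v: "L2per v" and orth: "!!\<phi> \<Phi>. H1_per \<phi> \<Phi> ==> ip v \<Phi> = 0"
  and eta: "eta \<in> test_fun UNIV"
 shows "(LI z. v z \<bullet> grad eta z) = 0"
proof -
 obtain K where K: "smooth_fun eta" "compact K" "!!y. y \<notin> K ==> eta y = 0" "!!y v. y \<notin> K ==> dir_deriv v eta y = 0"
  using test_funD[OF eta] by metis
 have bK: "bounded K" by (rule compact_imp_bounded[OF K(2)])
 let ?d = "%i. dir_deriv (axis i 1) eta"
 have [measurable]: "eta \<in> Borel" "?d i \<in> Borel" "v \<in> Borel" for i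
  using eta test_fun_dir[OF eta] v by (auto intro: test_fun_borel simp: L2per_def)
 define \<phi> where "\<phi> = periodize K eta"
 define \<Phi> :: "plane => plane" where "\<Phi> z = (\<chi> i. periodize K (?d i) z)" for z
 have L2: "L2per (periodize K psi)" if ps: "psi \<in> test_fun UNIV" "!!y. y \<notin> K ==> psi y = 0" for psi
 proof -
  obtain K' M where M: "!!y. \<bar>psi y\<bar> <= M * ind K' y" "M >= 0" using test_fun_bound[OF ps(1)] by metis
  have bM: "\<bar>psi y\<bar> <= M" for y using M(1)[of y] M(2) by (cases "y \<in> K'") auto
  show ?thesis by (rule periodize_L2[OF test_fun_borel[OF ps(1)] ps(2) bK bM])
 qed
 have \<phi>2: "L2per \<phi>" unfolding \<phi>_def by (rule L2[OF eta K(3)])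
 have d2: "L2per (periodize K (?d i))" for i by (rule L2[OF test_fun_dir[OF eta] K(4)])
 have \<Phi>2: "L2per \<Phi>" by (rule L2per_vec2) (simp add: \<Phi>_def d2)
 have "weak_deriv UNIV (axis i 1) \<phi> (%z. \<Phi> z $ i)" for i
 proof (rule shift_weak_deriv)
  show "shift_deriv UNIV (axis i 1) \<tau> \<phi> (%z. \<Phi> z $ i)" if \<tau>: "\<tau> > 0" for \<tau>
   unfolding shift_deriv_def
  proof (intro AE_I2 impI)
   fix y :: plane
   let ?e = "axis i 1 :: real^2"
   obtain S where S: "finite S" "!!z k. norm z <= norm y + \<tau> ==> z + lattice_vec k \<in> K ==> k \<in> S"
    using finite_lattice_hits[OF bK, of "norm y + \<tau>"] by metis
   have n: "norm (y + r *r ?e) <= norm y + \<tau>" if "r \<in> {0..\<tau>}" for r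
    using norm_triangle_ineq[of y "r *r ?e"] that by (simp add: norm_axis_1)
   have P: "periodize K psi (y + r *r ?e) = (\<Sum>k\<in>S. psi ((y + lattice_vec k) + r *r ?e))"
    if "!!y. y \<notin> K ==> psi y = 0" "r \<in> {0..\<tau>}" for psi r
   proof -
    have "periodize K psi (y + r *r ?e) = (\<Sum>k\<in>S. psi ((y + r *r ?e) + lattice_vec k))"
     by (rule periodize_eq[OF that(1) S(1)]) (assumption, rule S(2)[OF n[OF that(2)]])
    then show ?thesis by (simp only: add_ac)
   qed
   have "\<phi> (y + \<tau> *r ?e) - \<phi> y = (\<Sum>k\<in>S. eta ((y + lattice_vec k) + \<tau> *r ?e) - eta (y + lattice_vec k))"
    using P[where psi=eta and r=\<tau>, OF K(3)] P[where psi=eta and r=0, OF K(3)] \<tau> by (simp add: \<phi>_def sum_subtractf)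
   also have "\<dots> = (\<Sum>k\<in>S. LINT r:{0..\<tau>}|lborel. ?d i ((y + lattice_vec k) + r *r ?e))"
    by (intro sum.cong refl smooth_line_FTC[OF K(1)]) (use \<tau> in simp)
   also have "\<dots> = (LINT r:{0..\<tau>}|lborel. (\<Sum>k\<in>S. ?d i ((y + lattice_vec k) + r *r ?e)))"
    unfolding set_LI_def scaleR_sum_right
   proof (rule Bochner_Integration.integral_sum[symmetric])
    fix k
    have "continuous_on {0..\<tau>} (%r. ?d i ((y + lattice_vec k) + r *r ?e))"
     by (intro continuous_on_compose2[OF smooth_continuous[OF smooth_funD(2)[OF K(1)], of UNIV]] continuous_intros) auto
    then show "L1 (%r. ind {0..\<tau>} r *r ?d i ((y + lattice_vec k) + r *r ?e))"
     using borel_integrable_atLeastAtMost' unfolding set_integrable_def by blast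
   qed
   also have "\<dots> = (LINT r:{0..\<tau>}|lborel. \<Phi> (y + r *r ?e) $ i)"
   proof (rule set_lebesgue_integral_cong)
    show "\<forall>r. r \<in> {0..\<tau>} --> (\<Sum>k\<in>S. ?d i ((y + lattice_vec k) + r *r ?e)) = \<Phi> (y + r *r ?e) $ i"
     using P[where psi="?d i", OF K(4)] by (simp add: \<Phi>_def)
   qed simp
   finally show "\<phi> (y + \<tau> *r ?e) - \<phi> y = (LINT r:{0..\<tau>}|lborel. \<Phi> (y + r *r ?e) $ i)" .
  qed
 qed (use \<phi>2 d2 L2per_locally_integrable in \<open>auto simp: \<Phi>_def L2per_def\<close>)
 then have H: "H1_per \<phi> \<Phi>" using \<phi>2 \<Phi>2 by (simp add: H1_per_iff weak_grad_def)
 obtain S where S: "finite S" "!!z k. norm z <= 1 ==> z + lattice_vec k \<in> K ==> k \<in> S"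
  using finite_lattice_hits[OF bK, of 1] by metis
 have ii: "L1 (%z. v z \<bullet> grad eta z)"
  unfolding grad_inner using test_L2_integrable[OF test_fun_dir[OF eta, of "axis 1 1"] L2per_component[OF v, of 1]]
   test_L2_integrable[OF test_fun_dir[OF eta, of "axis 2 1"] L2per_component[OF v, of 2]] by (simp add: mult.commute)
 have [measurable]: "grad eta \<in> Borel" by (rule borel_vec2) (simp add: grad_def)
 have one: "(\<Sum>k\<in>S. ind cellh (z - lattice_vec k)) * (v z \<bullet> grad eta z) = v z \<bullet> grad eta z" for z
 proof (cases "z \<in> K")
  case True
  obtain k0 where k0: "!!k. z - lattice_vec k \<in> cellh \<longleftrightarrow> k = k0" using cellh_unique by metis
  have "k0 \<in> S" using S(2)[of "z - lattice_vec k0" k0] cell_norm k0 True by simp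
  then have "(\<Sum>k\<in>S. ind cellh (z - lattice_vec k)) = (1::real)"
   using S(1) k0 by (simp add: indicator_def)
  then show ?thesis by simp
 next
  case False
  then show ?thesis by (simp add: grad_inner K(4))
 qed
 have "(LI z. v z \<bullet> grad eta z) = (LI z. (\<Sum>k\<in>S. ind cellh (z - lattice_vec k) * (v z \<bullet> grad eta z)))"
  by (simp only: one flip: sum_distrib_right)
 also have "\<dots> = (\<Sum>k\<in>S. LI z. ind cellh (z - lattice_vec k) * (v z \<bullet> grad eta z))"
 proof (rule Bochner_Integration.integral_sum)
  fix k show "L1 (%z. ind cellh (z - lattice_vec k) * (v z \<bullet> grad eta z))"
  proof (rule L1_bound[OF ii])
   show "AE z in lborel. norm (ind cellh (z - lattice_vec k) * (v z \<bullet> grad eta z)) <= norm (v z \<bullet> grad eta z)"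
    by (intro AE_I2) (auto simp: indicator_def)
  qed measurable
 qed
 also have "\<dots> = (\<Sum>k\<in>S. LI z. ind cellh z * (v z \<bullet> grad eta (z + lattice_vec k)))"
 proof (intro sum.cong refl)
  fix k
  have [measurable]: "(%z. v z \<bullet> grad eta z) \<in> Borel" using ii by auto
  show "(LI z. ind cellh (z - lattice_vec k) * (v z \<bullet> grad eta z)) = (LI z. ind cellh z * (v z \<bullet> grad eta (z + lattice_vec k)))"
   using integral_lborel_shift[of "%z. ind cellh (z - lattice_vec k) * (v z \<bullet> grad eta z)" "lattice_vec k"]
   by (simp add: periodic_lattice[OF L2per_D(2)[OF v]])
 qed
 also have "\<dots> = (LI z. (\<Sum>k\<in>S. ind cellh z * (v z \<bullet> grad eta (z + lattice_vec k))))"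
 proof (rule Bochner_Integration.integral_sum[symmetric])
  fix k
  have "L1 (%z. v (z + lattice_vec k) \<bullet> grad eta (z + lattice_vec k))" by (rule integrable_lborel_shift[OF ii])
  then have "L1 (%z. v z \<bullet> grad eta (z + lattice_vec k))" by (simp add: periodic_lattice[OF L2per_D(2)[OF v]])
  then show "L1 (%z. ind cellh z * (v z \<bullet> grad eta (z + lattice_vec k)))"
  proof (rule L1_bound)
   show "AE z in lborel. norm (ind cellh z * (v z \<bullet> grad eta (z + lattice_vec k))) <= norm (v z \<bullet> grad eta (z + lattice_vec k))"
    by (intro AE_I2) (auto simp: indicator_def)
  qed measurable
 qed
 also have "\<dots> = (LI z. ind cellh z * (v z \<bullet> \<Phi> z))"
 proof (intro LI_cong refl)
  fix z
  show "(\<Sum>k\<in>S. ind cellh z * (v z \<bullet> grad eta (z + lattice_vec k))) = ind cellh z * (v z \<bullet> \<Phi> z)"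
  proof (cases "z \<in> cellh")
   case True
   have "periodize K (?d i) z = (\<Sum>k\<in>S. ?d i (z + lattice_vec k))" for i
    by (rule periodize_eq[OF K(4) S(1)]) (use S(2) cell_norm[OF True] in auto)
   then have "\<Phi> z = (\<Sum>k\<in>S. grad eta (z + lattice_vec k))"
    by (simp add: \<Phi>_def vec_eq_iff grad_def)
   then show ?thesis using True by (simp add: inner_sum_right)
  qed simp
 qed
 also have "\<dots> = ip v \<Phi>"
  unfolding ip_def
 proof (rule integral_cong_AE)
  have [measurable]: "\<Phi> \<in> Borel" using \<Phi>2 by (simp add: L2per_def)
  show "(%z. ind cellh z * (v z \<bullet> \<Phi> z)) \<in> borel_measurable lborel" "(%z. ind cell z * (v z \<bullet> \<Phi> z)) \<in> borel_measurable lborel"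
   by measurable
  show "AE z in lborel. ind cellh z * (v z \<bullet> \<Phi> z) = ind cell z * (v z \<bullet> \<Phi> z)"
   using AE_cellh by eventually_elim (auto simp: indicator_def)
 qed
 also have "\<dots> = 0" by (rule orth[OF H])
 finally show ?thesis .
qed

text \<open>
  The weak form of the derivative passes to the limit in the \<open>L\<^sup>2\<close> norm over one
  period.
\<close>

lemma H1_per_limit:
 assumes n: "!!n. H1_per (gn n) (Gn n)" and g: "L2per g" and G: "!!i. L2per (%z. G z $ i)"
  and lg: "(%n. ip2 (%z. gn n z - g z)) \<longlonglongrightarrow> 0"
  and lG: "!!i. (%n. ip2 (%z. Gn n z $ i - G z $ i)) \<longlonglongrightarrow> 0"
 shows "H1_per g G"
proof (rule H1_perI[OF g L2per_vec2[OF G]])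
 fix i psi assume psi: "psi \<in> test_fun (UNIV :: plane set)"
 have "(%n. LI z. dir_deriv (axis i 1) psi z * gn n z) \<longlonglongrightarrow> (LI z. dir_deriv (axis i 1) psi z * g z)"
  by (rule L2per_limit_test[OF H1_perD(1)[OF n] g lg test_fun_dir[OF psi]])
 moreover have "(%n. LI z. psi z * Gn n z $ i) \<longlonglongrightarrow> (LI z. psi z * G z $ i)"
  by (rule L2per_limit_test[OF H1_perD(3)[OF n] G lG psi])
 then have "(%n. - (LI z. psi z * Gn n z $ i)) \<longlonglongrightarrow> - (LI z. psi z * G z $ i)" by (rule tendsto_minus)
 ultimately show "(LI z. dir_deriv (axis i 1) psi z * g z) = - (LI z. psi z * G z $ i)"
  using H1_perD(5)[OF n psi] LIMSEQ_unique by auto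
qed

locale cell_weight =
 fixes a :: "plane => real" and a0 a1 :: real
 assumes a_borel: "a \<in> Borel" and a_per: "periodic a" and a0: "a0 > 0" and a_bd: "a0 <= a z" "a z <= a1"
begin

definition wip :: "(plane => plane) => (plane => plane) => real" where
 "wip F G = ip (%z. a z *r F z) G"

lemma aF: "L2per F ==> L2per (%z. a z *r F z)"
proof (rule L2per_mult_bounded[OF _ a_borel a_per])
 show "\<bar>a z\<bar> <= a1" for z using a_bd[of z] a0 by linarith
qed

lemma wip_commute: "wip F G = wip G F"
 unfolding wip_def ip_def by (intro LI_cong) (auto simp: inner_commute)

lemma wip_add_right: "L2per F ==> L2per G ==> L2per H ==> wip F (%z. G z + H z) = wip F G + wip F H"
 unfolding wip_def by (rule ip_add_right) (auto intro: aF)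

lemma wip_diff_right: "L2per F ==> L2per G ==> L2per H ==> wip F (%z. G z - H z) = wip F G - wip F H"
 unfolding wip_def by (rule ip_diff_right) (auto intro: aF)

lemma wip_scale_right: "wip F (%z. c *r G z) = c * wip F G"
 unfolding wip_def by (rule ip_scale_right)

lemma wip_add_left: "L2per F ==> L2per G ==> L2per H ==> wip (%z. G z + H z) F = wip G F + wip H F"
 using wip_add_right by (simp add: wip_commute[of _ F])

lemma wip_diff_left: "L2per F ==> L2per G ==> L2per H ==> wip (%z. G z - H z) F = wip G F - wip H F"
 using wip_diff_right by (simp add: wip_commute[of _ F])

lemma wip_scale_left: "wip (%z. c *r G z) F = c * wip G F"
 using wip_scale_right by (simp add: wip_commute[of _ F])

lemma wip_ge: "L2per F ==> a0 * ip2 F <= wip F F"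
proof -
 assume F: "L2per F"
 have "a0 * ip2 F = (LI z. a0 * (ind cell z * (F z \<bullet> F z)))" by (simp add: ip_def)
 also have "\<dots> <= (LI z. ind cell z * ((a z *r F z) \<bullet> F z))"
 proof (rule integral_mono[OF integrable_mult_right[OF cell_integrable_inner[OF F F]] cell_integrable_inner[OF aF[OF F] F]])
  fix z
  have "a0 * (F z \<bullet> F z) <= a z * (F z \<bullet> F z)" by (rule mult_right_mono[OF a_bd(1)]) simp
  then show "a0 * (ind cell z * (F z \<bullet> F z)) <= ind cell z * ((a z *r F z) \<bullet> F z)"
   by (auto simp: indicator_def)
 qed
 finally show ?thesis by (simp add: wip_def ip_def)
qed

lemma wip_nonneg: "L2per F ==> wip F F >= 0"
 using wip_ge[of F] a0 ip_nonneg[of F] by (meson less_imp_le mult_nonneg_nonneg order_trans)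

lemma wip_zero: "L2per F ==> wip F F = 0 ==> AE z in lborel. F z = 0"
 using wip_ge[of F] a0 ip_nonneg[of F] by (intro ip_zero_imp) (auto simp: mult_le_0_iff)

text \<open>
  The direct method: by the parallelogram identity a minimizing sequence of the energy \<open>wip (e +
  G) (e + G)\<close> is Cauchy, by the Poincare inequality so are the normalized potentials, and the
  Euler equation follows because the energy is quadratic.
\<close>

theorem minimizer_exists:
 fixes e :: plane
 obtains \<pi> D\<pi> where "H1_per \<pi> D\<pi>" "!!\<phi> \<Phi>. H1_per \<phi> \<Phi> ==> wip (%z. e + D\<pi> z) \<Phi> = 0"
proof -
 define E where "E G = wip (%z. e + G z) (%z. e + G z)" for G
 define V where "V = {E G |g G. H1_per g G}"
 have eG: "L2per (%z. e + G z)" if "L2per G" for G by (intro L2per_add L2per_const that)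
 have bdd: "bdd_below V" unfolding V_def E_def by (rule bdd_belowI[of _ 0]) (auto intro!: wip_nonneg eG dest: H1_perD(2))
 have ne: "V ~= {}" unfolding V_def using H1_per_const by blast
 define m where "m = Inf V"
 have m_le: "m <= E G" if "H1_per g G" for g G unfolding m_def by (rule cInf_lower[OF _ bdd]) (use that in \<open>auto simp: V_def\<close>)
 have "\<exists>g G. H1_per g G & E G < m + (1/4)^n" for n :: nat
 proof -
  have "Inf V < m + (1/4)^n" by (simp add: m_def)
  then show ?thesis using cInf_less_iff[OF ne bdd] by (auto simp: V_def)
 qed
 then obtain g0 Gn where g0: "!!n. H1_per (g0 n) (Gn n)" "!!n. E (Gn n) < m + (1/4)^n" by metis
 define gn where "gn n = (%z. g0 n z - (LI z. ind cell z * g0 n z))" for n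
 have gn: "H1_per (gn n) (Gn n)" and gm: "(LI z. ind cell z * gn n z) = 0" for n
  unfolding gn_def using Poincare_per'(2,3)[OF g0(1)] by auto
 have Gn: "L2per (Gn n)" for n by (rule H1_perD(2)[OF gn])
 have diff: "H1_per (%z. gn n z - gn k z) (%z. Gn n z - Gn k z)" for n k
  using H1_per_lin[OF gn[of n] gn[of k], of "-1"] by simp
 have C1: "ip2 (%z. Gn n z - Gn k z) <= (4 / a0) * (1/4)^n" if "n <= k" for n k
 proof -
  let ?F = "%z. e + Gn n z" and ?H = "%z. e + Gn k z"
  have FH: "L2per ?F" "L2per ?H" by (intro eG Gn)+
  have mid: "H1_per (%z. (1/2) * gn n z + (1/2) * gn k z) (%z. (1/2) *r Gn n z + (1/2) *r Gn k z)"
  proof -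
   have "H1_per (%z. 0 + (1/2) * gn n z) (%z. 0 + (1/2) *r Gn n z)" by (rule H1_per_lin[OF H1_per_const gn])
   from H1_per_lin[OF this gn[of k], of "1/2"] show ?thesis by simp
  qed
  have "(%z. e + ((1/2) *r Gn n z + (1/2) *r Gn k z)) = (%z. (1/2) *r (?F z + ?H z))"
   by (simp add: fun_eq_iff vec_eq_iff field_simps)
  then have "E (%z. (1/2) *r Gn n z + (1/2) *r Gn k z) = (1/4) * wip (%z. ?F z + ?H z) (%z. ?F z + ?H z)"
   unfolding E_def by (simp add: wip_scale_left wip_scale_right)
  also have "wip (%z. ?F z + ?H z) (%z. ?F z + ?H z) = wip ?F ?F + 2 * wip ?F ?H + wip ?H ?H"
   by (simp only: wip_add_left wip_add_right FH L2per_add wip_commute[of ?H ?F])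
  finally have 1: "4 * m <= wip ?F ?F + 2 * wip ?F ?H + wip ?H ?H" using m_le[OF mid] by simp
  have p: "(1/4::real)^k <= (1/4)^n" using that by (intro power_decreasing) auto
  have 2: "wip ?F ?F < m + (1/4)^n" "wip ?H ?H < m + (1/4)^n"
   using g0(2)[of n] g0(2)[of k] p unfolding E_def by linarith+
  have "a0 * ip2 (%z. ?F z - ?H z) <= wip (%z. ?F z - ?H z) (%z. ?F z - ?H z)"
   by (rule wip_ge[OF L2per_diff[OF FH]])
  also have "\<dots> = wip ?F ?F - 2 * wip ?F ?H + wip ?H ?H"
   by (simp only: wip_diff_left wip_diff_right FH L2per_diff wip_commute[of ?H ?F])
  also have "\<dots> <= 4 * (1/4)^n" using 1 2 by linarith
  finally show ?thesis using a0 by (simp add: field_simps)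
 qed
 have C2: "ip2 (%z. gn n z - gn k z) <= (4 / a0) * (1/4)^n" if "n <= k" for n k
 proof -
  have ic: "L1 (%z. ind cell z * gn n z)" for n
   by (rule L2per_set_integrable(2)[OF H1_perD(1)[OF gn]]) (auto simp: cell_box)
  have "(LI z. ind cell z * (gn n z - gn k z)) = 0"
   using ic gm by (simp add: right_diff_distrib)
  from Poincare_per[OF diff this] C1[OF that] show ?thesis by linarith
 qed
 have C3: "ip2 (%z. Gn n z $ i - Gn k z $ i) <= (4 / a0) * (1/4)^n" if "n <= k" for n k i
 proof -
  note D = H1_perD(2)[OF diff[of n k]]
  have s: "ip2 (%z. Gn n z - Gn k z) = ip2 (%z. Gn n z $ 1 - Gn k z $ 1)
   + ip2 (%z. Gn n z $ 2 - Gn k z $ 2)"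
   using ip_vec2[OF D D] by simp
  have "i = 1 \<or> i = 2" by (rule exhaust_2)
  then have "ip2 (%z. Gn n z $ i - Gn k z $ i) <= ip2 (%z. Gn n z - Gn k z)"
   using ip_nonneg[of "%z. Gn n z $ 1 - Gn k z $ 1"] ip_nonneg[of "%z. Gn n z $ 2 - Gn k z $ 2"] by (auto simp: s)
  then show ?thesis using C1[OF that] by linarith
 qed
 obtain g where g: "L2per g" "(%n. ip2 (%z. gn n z - g z)) \<longlonglongrightarrow> 0"
  using L2per_complete[OF H1_perD(1)[OF gn] C2] by blast
 have ex: "\<exists>f. L2per f & (%n. ip2 (%z. Gn n z $ i - f z)) \<longlonglongrightarrow> 0" for i
 proof (rule L2per_complete[of "%n z. Gn n z $ i" "4 / a0"])
  show "L2per (%z. Gn n z $ i)" for n by (rule H1_perD(3)[OF gn])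
  show "ip2 (%z. Gn n z $ i - Gn k z $ i) <= (4 / a0) * (1/4)^n" if "n <= k" for n k
   by (rule C3[OF that])
 qed blast
 define f where "f i = (SOME f. L2per f & (%n. ip2 (%z. Gn n z $ i - f z)) \<longlonglongrightarrow> 0)" for i
 have f: "L2per (f i)" "(%n. ip2 (%z. Gn n z $ i - f i z)) \<longlonglongrightarrow> 0" for i
  using someI_ex[OF ex[of i]] unfolding f_def by auto
 define G :: "plane => plane" where "G z = (\<chi> i. f i z)" for z
 have Gf: "G z $ i = f i z" for z i by (simp add: G_def)
 have H: "H1_per g G" by (rule H1_per_limit[OF gn g(1) _ g(2)]) (simp_all add: Gf f)
 have G2: "L2per G" by (rule H1_perD(2)[OF H])
 have GG: "(%n. ip2 (%z. Gn n z - G z)) \<longlonglongrightarrow> 0"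
 proof -
  have "ip2 (%z. Gn n z - G z) = ip2 (%z. Gn n z $ 1 - f 1 z) + ip2 (%z. Gn n z $ 2 - f 2 z)" for n
   using ip_vec2[OF L2per_diff[OF Gn G2] L2per_diff[OF Gn G2]] by (simp add: Gf)
  then show ?thesis using tendsto_add[OF f(2)[of 1] f(2)[of 2]] by simp
 qed
 show thesis
 proof (rule that[OF H])
  fix \<phi> \<Phi> assume P: "H1_per \<phi> \<Phi>"
  have \<Phi>: "L2per \<Phi>" by (rule H1_perD(2)[OF P])
  have sq: "(wip (%z. e + Gn n z) \<Phi>)^2 <= (1/4)^n * wip \<Phi> \<Phi>" for n
  proof (rule nonneg_quadratic)
   fix t
   have "m <= E (%z. Gn n z + t *r \<Phi> z)" by (rule m_le[OF H1_per_lin[OF gn P]])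
   also have "E (%z. Gn n z + t *r \<Phi> z) = wip (%z. (e + Gn n z) + t *r \<Phi> z) (%z. (e + Gn n z) + t *r \<Phi> z)"
    by (simp add: E_def add.assoc)
   also have "\<dots> = wip (%z. e + Gn n z) (%z. e + Gn n z) + 2 * t * wip (%z. e + Gn n z) \<Phi> + t^2 * wip \<Phi> \<Phi>"
   proof -
    let ?F = "%z. e + Gn n z" and ?T = "%z. t *r \<Phi> z"
    have F: "L2per ?F" and T: "L2per ?T" by (rule eG[OF Gn], rule L2per_scale[OF \<Phi>])
    have "wip (%z. ?F z + ?T z) (%z. ?F z + ?T z) = wip ?F (%z. ?F z + ?T z) + wip ?T (%z. ?F z + ?T z)"
     by (rule wip_add_left[OF L2per_add[OF F T] F T])
    also have "\<dots> = (wip ?F ?F + t * wip ?F \<Phi>) + (t * wip \<Phi> ?F + t * (t * wip \<Phi> \<Phi>))"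
     by (simp only: wip_add_right[OF F F T] wip_add_right[OF T F T] wip_scale_left wip_scale_right)
    also have "wip \<Phi> ?F = wip ?F \<Phi>" by (rule wip_commute)
    finally show ?thesis by (simp add: power2_eq_square algebra_simps)
   qed
   finally show "0 <= (1/4)^n + 2 * t * wip (%z. e + Gn n z) \<Phi> + t^2 * wip \<Phi> \<Phi>"
    using g0(2)[of n] by (simp add: E_def)
  qed (auto intro: wip_nonneg \<Phi>)
  have a\<Phi>: "L2per (%z. a z *r \<Phi> z)" by (rule aF[OF \<Phi>])
  have d: "(wip (%z. e + Gn n z) \<Phi> - wip (%z. e + G z) \<Phi>)^2 <= ip2 (%z. Gn n z - G z) * ip2 (%z. a z *r \<Phi> z)" for n
  proof -
   have "wip (%z. e + Gn n z) \<Phi> - wip (%z. e + G z) \<Phi> = wip (%z. (e + Gn n z) - (e + G z)) \<Phi>"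
    by (rule wip_diff_left[symmetric, OF \<Phi> eG[OF Gn] eG[OF G2]])
   also have "\<dots> = wip \<Phi> (%z. Gn n z - G z)" by (simp add: wip_commute)
   also have "\<dots> = ip (%z. Gn n z - G z) (%z. a z *r \<Phi> z)" by (simp add: wip_def ip_commute)
   finally show ?thesis using ip_Cauchy_Schwarz[OF L2per_diff[OF Gn G2] a\<Phi>] by simp
  qed
  have "(%n. (wip (%z. e + Gn n z) \<Phi> - wip (%z. e + G z) \<Phi>)^2) \<longlonglongrightarrow> 0"
  proof (rule tendsto_sandwich[of "%n. 0"])
   show "\<forall>\<^sub>F n in sequentially. (wip (%z. e + Gn n z) \<Phi> - wip (%z. e + G z) \<Phi>)^2 <= ip2 (%z. Gn n z - G z) * ip2 (%z. a z *r \<Phi> z)"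
    using d by (intro always_eventually) auto
   show "(%n. ip2 (%z. Gn n z - G z) * ip2 (%z. a z *r \<Phi> z)) \<longlonglongrightarrow> 0"
    using tendsto_mult_right[OF GG] by simp
  qed auto
  moreover have "(%n. (wip (%z. e + Gn n z) \<Phi>)^2) \<longlonglongrightarrow> 0"
  proof (rule tendsto_sandwich[of "%n. 0"])
   show "\<forall>\<^sub>F n in sequentially. (wip (%z. e + Gn n z) \<Phi>)^2 <= (1/4)^n * wip \<Phi> \<Phi>"
    using sq by (intro always_eventually) auto
   have "(%n. (1/4::real)^n * wip \<Phi> \<Phi>) \<longlonglongrightarrow> 0 * wip \<Phi> \<Phi>" by (intro tendsto_intros LIMSEQ_power_zero) auto
   then show "(%n. (1/4::real)^n * wip \<Phi> \<Phi>) \<longlonglongrightarrow> 0" by simp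
  qed auto
  ultimately have "(%n. wip (%z. e + Gn n z) \<Phi> - wip (%z. e + G z) \<Phi>) \<longlonglongrightarrow> 0" "(%n. wip (%z. e + Gn n z) \<Phi>) \<longlonglongrightarrow> 0"
   by - (rule square_null, assumption)+
  from tendsto_diff[OF this(2,1)] have "(%n. wip (%z. e + G z) \<Phi>) \<longlonglongrightarrow> 0" by simp
  then show "wip (%z. e + G z) \<Phi> = 0" by (simp add: LIMSEQ_const_iff)
 qed
qed

text \<open>
  The gradient is orthogonal to itself in the weighted inner product.
\<close>

theorem weighted_unique:
 assumes H: "H1_per g E" and div: "!!eta. eta \<in> test_fun UNIV ==> (LI z. (a z *r E z) \<bullet> grad eta z) = 0"
 shows "AE z in lborel. E z = 0"
proof -
 have E: "L2per E" by (rule H1_perD(2)[OF H])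
 have "wip E E = 0" unfolding wip_def by (rule divfree_orthogonal[OF aF[OF E] div H])
 then show ?thesis by (rule wip_zero[OF E])
qed

end

section \<open>The periodic layer\<close>

lemma horiz_nth: "horiz v $ i = v $ (if i = 1 then 1 else 2)"
 using exhaust_2[of i] by (auto simp: horiz_def vector_2)

lemma horiz_nth12: "horiz v $ 1 = v $ 1" "horiz v $ 2 = v $ 2" by (simp_all add: horiz_def vector_2)

lemma nn_integral_triple:
 fixes F :: "plane \<times> plane \<times> real => ennreal"
 assumes [measurable]: "F \<in> Borel"
 shows "(NN y. F y) = (NN p. NN s. F (fst p, snd p, s))"
proof -
 have "(NN y. F y) = (\<integral>\<^sup>+q. F (assoc3 q) \<partial>(lborel \<Otimes>\<^sub>M lborel))"
  unfolding lborel_prod by (subst distr_assoc3[symmetric], subst nn_integral_distr) auto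
 also have "\<dots> = (NN p. NN s. F (assoc3 (p, s)))"
  by (rule lborel.nn_integral_fst[symmetric]) (simp add: lborel_prod)
 finally show ?thesis by (simp add: assoc3_def)
qed

lemma AE_triple:
 assumes "AE y in lborel. P (y :: plane \<times> plane \<times> real)"
 shows "AE p in lborel. AE s in lborel. P (fst p, snd p, s)"
proof -
 obtain N where N: "{y. \<not> P y} \<subseteq> N" "N \<in> null_sets lborel"
  using assms by (auto elim!: AE_E simp: null_sets_def)
 have [measurable]: "N \<in> sets borel" using N(2) by auto
 have "(NN p. NN s. ind N (fst p, snd p, s)) = 0"
  using N(2) by (subst nn_integral_triple[symmetric]) (auto simp: null_setsD1)
 then have "AE p in lborel. (NN s. ind N (fst p, snd p, s)) = 0"
  by (subst (asm) nn_integral_0_iff_AE) measurable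
 then show ?thesis
 proof eventually_elim
  case (elim p)
  then have "AE s in lborel. ind N (fst p, snd p, s) = (0::ennreal)"
   by (subst (asm) nn_integral_0_iff_AE) measurable
  then show ?case by eventually_elim (use N(1) in \<open>auto simp: indicator_def split: if_splits\<close>)
 qed
qed

lemma AE_triple_conv:
 assumes [measurable]: "Measurable.pred borel P" and "AE p in lborel. AE s in lborel. P (fst p, snd p, s)"
 shows "AE y in lborel. P (y :: plane \<times> plane \<times> real)"
proof -
 have "(NN p. NN s. ind {y. \<not> P y} (fst p, snd p, s)) = (\<integral>\<^sup>+p. 0 \<partial>(lborel :: (plane \<times> plane) measure))"
 proof (rule nn_integral_cong_AE, use assms(2) in eventually_elim)
  case (elim p)
  have "(NN s. ind {y. \<not> P y} (fst p, snd p, s)) = (\<integral>\<^sup>+s. 0 \<partial>(lborel :: real measure))"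
   by (rule nn_integral_cong_AE, use elim in eventually_elim) (auto simp: indicator_def)
  then show ?case by simp
 qed
 then have "emeasure lborel {y. \<not> P y} = 0"
  by (subst (asm) nn_integral_triple[symmetric]) (auto)
 then show ?thesis by (intro AE_I[of _ _ "{y. \<not> P y}"]) auto
qed

lemma nn_integral_pair_periodic:
 fixes F :: "plane \<times> plane => ennreal"
 assumes [measurable]: "F \<in> Borel" and per: "!!x. periodic (%z. F (x, z))"
  and B: "bounded B" and [measurable]: "B \<in> sets borel"
  and fin: "(NN p. ind cell (snd p) * F p) < \<infinity>"
 shows "(NN p. ind B (snd p) * F p) < \<infinity>"
proof -
 obtain c :: real where c0: "c >= 0" and c: "!!F. F \<in> Borel ==> periodic F ==> (NN z. ind B z * F z) <= c * (NN z. ind cell z * F z)"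
  using nn_integral_bounded_periodic[of "%_. 0" B] B by (auto simp: periodic_def)
 have f: "(NN p. K p) = (NN x. NN z. K (x, z))" if [measurable]: "K \<in> Borel" for K :: "plane \<times> plane => ennreal"
  unfolding lborel_prod[symmetric] by (rule lborel.nn_integral_fst[symmetric]) (simp add: lborel_prod)
 have "(NN p. ind B (snd p) * F p) = (NN x. NN z. ind B z * F (x, z))"
  by (subst f) simp_all
 also have "\<dots> <= (NN x. c * (NN z. ind cell z * F (x, z)))"
  by (intro nn_integral_mono c per) measurable
 also have "\<dots> = c * (NN p. ind cell (snd p) * F p)"
  by (subst nn_integral_cmult) (measurable, subst f, simp_all)
 also have "\<dots> < \<infinity>" using fin by (simp add: ennreal_mult_less_top)
 finally show ?thesis .
qed

lemma powr_ge_bound: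
 fixes a r :: real assumes "a >= 0" "r >= 1" shows "a <= 1 + a powr r"
proof (cases "a <= 1")
 case True then show ?thesis using powr_ge_zero[of a r] by linarith
next
 case False
 then have "a powr 1 <= a powr r" using assms by (intro powr_mono) auto
 then show ?thesis using False by simp
qed

lemma set_borel_cut: "set_borel_measurable lborel S f \<longleftrightarrow> (%y. ind S y *r f y) \<in> Borel"
 by (simp add: set_borel_measurable_def)

lemma Lp_loc_int_up:
 fixes k :: "plane \<times> plane \<times> real => 'b::euclidean_space"
 assumes \<omega>: "open \<omega>" and h: "continuous_on UNIV h" "!!z. 0 < h z" and hper: "periodic h"
  and loc: "L1loc (\<omega> \<times> Zper h) k" and per: "!!x s. periodic (%z. k (x, z, s))"
  and Lp: "Lp r (\<omega> \<times> Zcell h) k" and r: "r >= 1"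
 shows "loc_int_up \<omega> h k"
 unfolding loc_int_up_def
proof (intro allI impI)
 fix C :: "(plane \<times> plane \<times> real) set" assume C: "compact C"
 let ?S = "\<omega> \<times> Zper h"
 have oS: "open ?S" by (rule open_layer[OF \<omega> h(1)])
 have [measurable]: "?S \<in> sets borel" "C \<in> sets borel" "\<omega> \<in> sets borel" using oS C \<omega> by (auto intro: borel_compact)
 define k' where "k' = (%y. ind ?S y *r k y)"
 have [measurable]: "k' \<in> Borel" unfolding k'_def by (rule locally_integrable_borel[OF loc oS])
 define F where "F p = (NN s. ennreal (norm (k' (fst p, snd p, s)) powr r))" for p
 have [measurable]: "F \<in> Borel" unfolding F_def by measurable
 have Fper: "periodic (%z. F (x, z))" for x
  unfolding F_def k'_def using per hper by (simp add: periodic_def indicator_def Zper_def)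
 obtain N P where N: "N > 0" "compact P" "!!x z s. (x, z, s) \<in> C ==> (x, z) \<in> P & \<bar>s\<bar> < N" "P = (%y. (fst y, fst (snd y))) ` C"
  by (rule bounded_slab[OF C], rule that)
 define B where "B = snd ` P"
 have B: "compact B" unfolding B_def by (intro compact_continuous_image N continuous_intros)
 have [measurable]: "B \<in> sets borel" using B by (rule borel_compact)
 have "(NN p. ind cell (snd p) * F p) < \<infinity>"
 proof -
  have i: "L1 (%y. ind (\<omega> \<times> Zcell h) y * norm (k y) powr r)"
   using Lp by (simp add: Lp_def set_integrable_def)
  have "(NN p. ind cell (snd p) * F p) = (NN p. NN s. ind cell (snd p) * ennreal (norm (k' (fst p, snd p, s)) powr r))"
   unfolding F_def by (intro nn_integral_cong nn_integral_cmult[symmetric]) measurable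
  also have "\<dots> = (NN y. ind cell (fst (snd y)) * ennreal (norm (k' y) powr r))"
   by (subst nn_integral_triple) simp_all
  also have "\<dots> = (NN y. ennreal (norm (ind (\<omega> \<times> Zcell h) y * norm (k y) powr r)))"
   by (intro nn_integral_cong) (auto simp: k'_def indicator_def Zcell_def Zper_def)
  also have "\<dots> < \<infinity>" using i by (simp add: integrable_iff_bounded)
  finally show ?thesis .
 qed
 from nn_integral_pair_periodic[OF _ Fper compact_imp_bounded[OF B] _ this]
 have fB: "(NN p. ind B (snd p) * F p) < \<infinity>" by measurable
 have "(NN y. ind C y * ennreal (norm (k' y) powr r)) <= (NN y. ind B (fst (snd y)) * ennreal (norm (k' y) powr r))"
 proof (intro nn_integral_mono)
  fix y :: "plane \<times> plane \<times> real"
  obtain x z s where y: "y = (x, z, s)" by (metis prod.exhaust)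
  show "ind C y * ennreal (norm (k' y) powr r) <= ind B (fst (snd y)) * ennreal (norm (k' y) powr r)"
  proof (cases "y \<in> C")
   case True
   then have "z \<in> B" using N(3)[of x z s] unfolding B_def y by force
   then show ?thesis by (simp add: y True[unfolded y])
  qed simp
 qed
 also have "\<dots> = (NN p. ind B (snd p) * F p)"
  unfolding F_def by (subst nn_integral_triple) (auto simp: nn_integral_cmult)
 also note fB
 finally have i1: "L1 (%y. ind C y * (norm (k' y) powr r))"
  unfolding integrable_iff_bounded by (auto simp: ennreal_mult' ennreal_indicator)
 have i2: "L1 (%y. ind C y :: real)"
  using emeasure_compact_finite[OF C] by (intro integrable_real_indicator) auto
 have "L1 (%y. ind C y *r k' y)"
 proof (rule L1_bound[OF L1_add[OF i2 i1]])
  show "AE y in lborel. norm (ind C y *r k' y) <= norm (ind C y + ind C y * norm (k' y) powr r)"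
   using powr_ge_bound[OF norm_ge_zero r] by (intro AE_I2) (auto simp: indicator_def)
 qed measurable
 then show "set_integrable lborel (C \<inter> ?S) k"
  unfolding set_integrable_def
  by (rule Bochner_Integration.integrable_cong[THEN iffD1, OF refl, rotated]) (auto simp: indicator_def k'_def)
qed

lemma V_z3_loc_int_up:
 assumes V: "V_z3 r \<omega> h g D" and "r >= 1" and "open \<omega>" "continuous_on UNIV h" "!!z. 0 < h z" "periodic h"
 shows "loc_int_up \<omega> h g" "loc_int_up \<omega> h D"
 using V unfolding V_z3_def weak_deriv_def
 by (auto intro!: Lp_loc_int_up[OF assms(3-6)] assms(2))

lemma loc_int_up_component:
 fixes g :: "plane \<times> plane \<times> real => real^3"
 assumes "loc_int_up \<omega> h g" shows "loc_int_up \<omega> h (%y. g y $ j)"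
 unfolding loc_int_up_def set_integrable_def
proof (intro allI impI)
 fix C :: "(plane \<times> plane \<times> real) set" assume "compact C"
 then have i: "L1 (%y. ind (C \<inter> \<omega> \<times> Zper h) y *r g y)"
  using assms by (auto simp: loc_int_up_def set_integrable_def)
 from integrable_inner_left[OF i, of "axis j 1"]
 show "L1 (%y. ind (C \<inter> \<omega> \<times> Zper h) y *r g y $ j)"
  by (simp add: inner_axis)
qed

text \<open>
  The representative in the half-open cell. Composing with it makes a function that is Borel on the
  open cell Borel on the whole plane.
\<close>

definition wrap :: "plane => plane" where
 "wrap z = z - lattice_vec (\<lfloor>z $ 1 + 1/2\<rfloor>, \<lfloor>z $ 2 + 1/2\<rfloor>)"

text \<open>
  The boundaries of all lattice translates of the cell.
\<close>

definition faces :: "plane set" where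
 "faces = {z. \<exists>i. z $ i + 1/2 \<in> \<int>}"

lemma wrap_borel [measurable]: "wrap \<in> borel \<rightarrow>\<^sub>M borel"
proof (rule borel_vec2)
 fix i :: 2
 have "(%z. wrap z $ i) = (%z. z $ i - real_of_int \<lfloor>z $ i + 1/2\<rfloor>)"
  using exhaust_2[of i] by (auto simp: wrap_def)
 moreover have "(%z::real^2. z $ i - real_of_int \<lfloor>z $ i + 1/2\<rfloor>) \<in> Borel" by measurable
 ultimately show "(%z. wrap z $ i) \<in> Borel" by simp
qed

lemma wrap_nth: "wrap z $ i = z $ i - real_of_int \<lfloor>z $ i + 1/2\<rfloor>"
 using exhaust_2[of i] by (auto simp: wrap_def)

lemma wrap_periodic: "periodic wrap"
 unfolding periodic_def vec_eq_iff
proof (intro allI)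
 fix z :: plane and i j :: 2
 have f: "\<lfloor>x + 1 + 1/2\<rfloor> = \<lfloor>x + 1/2\<rfloor> + 1" for x :: real by linarith
 show "wrap (z + axis i 1) $ j = wrap z $ j"
 proof (cases "i = j")
  case True
  then have c: "(z + axis i 1) $ j = z $ j + 1" by (simp add: axis_def)
  show ?thesis unfolding wrap_nth c f by simp
 next
  case False
  then have c: "(z + axis i 1) $ j = z $ j" by (simp add: axis_def)
  show ?thesis unfolding wrap_nth c by simp
 qed
qed

lemma wrap_cell: "z \<in> cell ==> wrap z = z"
proof -
 assume z: "z \<in> cell"
 have "\<lfloor>z $ i + 1/2\<rfloor> = 0" for i
  by (rule floor_unique) (use z[unfolded cell_def mem_Collect_eq, rule_format, of i] in auto)
 then show ?thesis by (simp add: wrap_def lattice_vec_def)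
qed

lemma wrap_faces: "wrap z \<in> cell \<longleftrightarrow> z \<notin> faces"
proof -
 have "(- 1/2 < x - real_of_int \<lfloor>x + 1/2\<rfloor> & x - real_of_int \<lfloor>x + 1/2\<rfloor> < 1/2) \<longleftrightarrow> x + 1/2 \<notin> \<int>" for x :: real
 proof
  assume a: "- 1/2 < x - real_of_int \<lfloor>x + 1/2\<rfloor> & x - real_of_int \<lfloor>x + 1/2\<rfloor> < 1/2"
  show "x + 1/2 \<notin> \<int>"
  proof
   assume "x + 1/2 \<in> \<int>"
   then obtain n where "x + 1/2 = real_of_int n" by (auto elim: Ints_cases)
   then show False using a by simp
  qed
 next
  assume a: "x + 1/2 \<notin> \<int>"
  have "x + 1/2 ~= real_of_int \<lfloor>x + 1/2\<rfloor>" using a by (metis Ints_of_int)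
  moreover have "real_of_int \<lfloor>x + 1/2\<rfloor> <= x + 1/2" "x + 1/2 < real_of_int \<lfloor>x + 1/2\<rfloor> + 1" by linarith+
  ultimately show "- 1/2 < x - real_of_int \<lfloor>x + 1/2\<rfloor> & x - real_of_int \<lfloor>x + 1/2\<rfloor> < 1/2" by linarith
 qed
 then show ?thesis by (simp add: cell_def faces_def wrap_nth)
qed

lemma closed_faces: "closed faces"
proof -
 have c: "closed ((%z::real^2. z $ i + 1/2) -` \<int>)" for i
  by (rule closed_vimage[OF closed_Ints]) (intro continuous_intros)
 have eq: "faces = ((%z::real^2. z $ 1 + 1/2) -` \<int>) \<union> ((%z::real^2. z $ 2 + 1/2) -` \<int>)"
  by (auto simp: faces_def) (metis exhaust_2)
 show ?thesis unfolding eq by (intro closed_Un c)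
qed

lemma AE_not_faces: "AE z in lborel. z \<notin> faces"
proof -
 have [measurable]: "faces \<in> sets borel" using closed_faces by (rule borel_closed)
 have per: "z + lattice_vec k \<in> faces \<longleftrightarrow> z \<in> faces" for z k
  using periodic_lattice[OF wrap_periodic, of z k] wrap_faces[of z] wrap_faces[of "z + lattice_vec k"] by simp
 have "(NN z. ind faces z) = (NN z. ind cellh z * (\<integral>\<^sup>+k. ind faces (z + lattice_vec k) \<partial>count_space UNIV))"
  by (rule nn_integral_unfold) measurable
 also have "\<dots> = (\<integral>\<^sup>+z. 0 \<partial>(lborel :: (real^2) measure))"
 proof (rule nn_integral_cong_AE, use AE_cellh in eventually_elim)
  case (elim z)
  show ?case
  proof (cases "z \<in> cell")
   case True
   then have "z \<notin> faces" using wrap_cell wrap_faces by metis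
   then have "ind faces (z + lattice_vec k) = (0::ennreal)" for k by (simp add: per)
   then show ?thesis by simp
  qed (use elim in simp)
 qed
 finally have "emeasure lborel faces = 0" by simp
 then show ?thesis by (intro AE_I[of _ _ faces]) auto
qed

lemma dir_deriv_mult:
 assumes "smooth_fun f" "smooth_fun g"
 shows "dir_deriv v (%y. f y * g y) y = f y * dir_deriv v g y + dir_deriv v f y * g y"
 by (rule dir_deriv_eq) (rule has_derivative_mult[OF smooth_has_derivative[OF assms(1)] smooth_has_derivative[OF assms(2)]])

lemma linear_proj:
 "linear (%y::plane \<times> plane \<times> real. (fst y, fst (snd y)))"
 "linear (%y::plane \<times> plane \<times> real. snd (snd y))"
 "linear (%p::plane \<times> plane. (fst p, snd p, 0::real))"
 "linear (fst :: plane \<times> plane => plane)" "linear (snd :: plane \<times> plane => plane)"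
 by (auto simp: linear_iff)

lemma test_tensor:
 assumes \<Theta>: "\<Theta> \<in> test_fun (\<omega> \<times> UNIV)" and \<zeta>: "\<zeta> \<in> test_fun {a<..<b}" and ab: "!!z. 0 <= a & b <= h z"
 defines "psi \<equiv> %y. \<Theta> (fst y, fst (snd y)) * \<zeta> (snd (snd y))"
 shows "psi \<in> test_fun (\<omega> \<times> Zper h)"
  "dir_deriv e3 psi y = \<Theta> (fst y, fst (snd y)) * dir_deriv 1 \<zeta> (snd (snd y))"
  "dir_deriv (0, v, 0) psi y = dir_deriv (0, v) \<Theta> (fst y, fst (snd y)) * \<zeta> (snd (snd y))"
proof -
 obtain K where K: "smooth_fun \<Theta>" "compact K" "K \<subseteq> \<omega> \<times> UNIV" "!!y. y \<notin> K ==> \<Theta> y = 0" using test_funD[OF \<Theta>] by metis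
 obtain J where J: "smooth_fun \<zeta>" "compact J" "J \<subseteq> {a<..<b}" "!!y. y \<notin> J ==> \<zeta> y = 0" using test_funD[OF \<zeta>] by metis
 let ?A = "%y::plane \<times> plane \<times> real. \<Theta> (fst y, fst (snd y))" and ?B = "%y::plane \<times> plane \<times> real. \<zeta> (snd (snd y))"
 have sA: "smooth_fun ?A" using smooth_affine[OF K(1) linear_proj(1), of 0] by simp
 have sB: "smooth_fun ?B" using smooth_affine[OF J(1) linear_proj(2), of 0] by simp
 have dA: "dir_deriv v ?A y = dir_deriv (fst v, fst (snd v)) \<Theta> (fst y, fst (snd y))" for v y
  using dir_deriv_affine[OF K(1) linear_proj(1), of v 0 y] by simp
 have dB: "dir_deriv v ?B y = dir_deriv (snd (snd v)) \<zeta> (snd (snd y))" for v y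
  using dir_deriv_affine[OF J(1) linear_proj(2), of v 0 y] by simp
 have d0: "dir_deriv 0 \<Theta> p = 0" "dir_deriv 0 \<zeta> s = 0" for p s
  using linear_0[OF has_derivative_linear[OF smooth_has_derivative[OF K(1)]]] linear_0[OF has_derivative_linear[OF smooth_has_derivative[OF J(1)]]] by auto
 have cK: "compact ((%q. (fst (fst q), snd (fst q), snd q)) ` (K \<times> J))"
  by (intro compact_continuous_image compact_Times K J continuous_intros)
 show "psi \<in> test_fun (\<omega> \<times> Zper h)"
  unfolding psi_def
 proof (rule test_funI[OF smooth_mult[OF sA sB] cK])
  show "(%q. (fst (fst q), snd (fst q), snd q)) ` (K \<times> J) \<subseteq> \<omega> \<times> Zper h"
  proof
   fix y assume "y \<in> (%q. (fst (fst q), snd (fst q), snd q)) ` (K \<times> J)"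
   then obtain x z s where y: "y = (x, z, s)" "(x, z) \<in> K" "s \<in> J" by auto
   then have "x \<in> \<omega>" "a < s" "s < b" using K(3) J(3) by auto
   then show "y \<in> \<omega> \<times> Zper h" using ab[of z] y(1) by (auto simp: Zper_def)
  qed
  fix y assume "y \<notin> (%q. (fst (fst q), snd (fst q), snd q)) ` (K \<times> J)"
  then have "(fst y, fst (snd y)) \<notin> K \<or> snd (snd y) \<notin> J"
   by (force simp: image_iff)
  then show "?A y * ?B y = 0" using K(4) J(4) by auto
 qed
 show "dir_deriv e3 psi y = \<Theta> (fst y, fst (snd y)) * dir_deriv 1 \<zeta> (snd (snd y))"
  unfolding psi_def dir_deriv_mult[OF sA sB] dA dB by (simp add: e3_def d0 flip: zero_prod_def)
 show "dir_deriv (0, v, 0) psi y = dir_deriv (0, v) \<Theta> (fst y, fst (snd y)) * \<zeta> (snd (snd y))"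
  unfolding psi_def dir_deriv_mult[OF sA sB] dA dB by (simp add: d0)
qed

lemma test_slice:
 fixes psi :: "plane \<times> plane \<times> real => real"
 assumes psi: "psi \<in> test_fun \<Omega>" and "\<Omega> \<subseteq> \<omega> \<times> UNIV"
 shows "(%p. psi (fst p, snd p, s)) \<in> test_fun (\<omega> \<times> UNIV)"
  "dir_deriv (0, v) (%p. psi (fst p, snd p, s)) p = dir_deriv (0, v, 0) psi (fst p, snd p, s)"
proof -
 obtain K where K: "smooth_fun psi" "compact K" "K \<subseteq> \<Omega>" "!!y. y \<notin> K ==> psi y = 0" using test_funD[OF psi] by metis
 have e: "(0, 0, s) + (fst p, snd p, 0) = (fst p, snd p, s)" for p :: "plane \<times> plane" by simp
 have sm: "smooth_fun (%p. psi (fst p, snd p, s))" using smooth_affine[OF K(1) linear_proj(3), of "(0, 0, s)"] by (simp only: e)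
 show "dir_deriv (0, v) (%p. psi (fst p, snd p, s)) p = dir_deriv (0, v, 0) psi (fst p, snd p, s)"
  using dir_deriv_affine[OF K(1) linear_proj(3), of "(0, v)" "(0, 0, s)" p] by (simp only: e fst_conv snd_conv)
 have c: "compact ((%y. (fst y, fst (snd y))) ` K)" by (intro compact_continuous_image K continuous_intros)
 show "(%p. psi (fst p, snd p, s)) \<in> test_fun (\<omega> \<times> UNIV)"
 proof (rule test_funI[OF sm c])
  show "(%y. (fst y, fst (snd y))) ` K \<subseteq> \<omega> \<times> UNIV" using K(3) assms(2) by fastforce
  fix p assume "p \<notin> (%y. (fst y, fst (snd y))) ` K"
  then have "(fst p, snd p, s) \<notin> K" by force
  then show "psi (fst p, snd p, s) = 0" by (rule K(4))
 qed
qed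

lemma boxbump_Pair: "boxbump (a, b) (c, d) e (x, y) = boxbump a c e x * boxbump b d e y"
proof -
 have "boxbump (a, b) (c, d) e (x, y) = (\<Prod>j\<in>(%u. (u, 0)) ` Basis \<union> (%u. (0, u)) ` Basis. bump ((a, b) \<bullet> j) ((c, d) \<bullet> j) e ((x, y) \<bullet> j))"
  by (simp add: boxbump_def Basis_prod_def)
 also have "\<dots> = (\<Prod>j\<in>(%u. (u, 0)) ` Basis. bump ((a, b) \<bullet> j) ((c, d) \<bullet> j) e ((x, y) \<bullet> j)) * (\<Prod>j\<in>(%u. (0, u)) ` Basis. bump ((a, b) \<bullet> j) ((c, d) \<bullet> j) e ((x, y) \<bullet> j))"
  by (rule prod.union_disjoint) (auto simp: image_iff)
 also have "\<dots> = boxbump a c e x * boxbump b d e y"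
  by (simp add: boxbump_def prod.reindex inj_on_def)
 finally show ?thesis .
qed

section \<open>The velocity profile and square integrable pairs\<close>

lemma LINT_split:
 fixes k :: "real => real"
 assumes i: "L1 (%r. ind {a..c} r * k r)" and "a <= b" "b <= c"
 shows "(LINT r:{a..c}|lborel. k r) = (LINT r:{a..b}|lborel. k r) + (LINT r:{b..c}|lborel. k r)"
proof -
 have [measurable]: "(%r. ind {a..c} r * k r) \<in> Borel" using i by auto
 have si: "set_integrable lborel {a..c} k" using i by (simp add: set_integrable_def)
 have i1: "L1 (%r. ind {a..b} r * k r)"
  using set_integrable_subset[OF si, of "{a..b}"] assms(3) by (simp add: set_integrable_def)
 have i2: "L1 (%r. ind {b..c} r * k r)"
  using set_integrable_subset[OF si, of "{b..c}"] assms(2) by (simp add: set_integrable_def)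
 have "(LI r. ind {a..c} r * k r) = (LI r. ind {a..b} r * k r + ind {b..c} r * k r)"
 proof (rule integral_cong_AE)
  have "AE r in lborel. r ~= b" by (rule AE_lborel_singleton)
  then show "AE r in lborel. ind {a..c} r * k r = ind {a..b} r * k r + ind {b..c} r * k r"
   by eventually_elim (use assms in \<open>auto simp: indicator_def\<close>)
 qed (use i i1 i2 in auto)
 also have "\<dots> = (LI r. ind {a..b} r * k r) + (LI r. ind {b..c} r * k r)"
  using i1 i2 by simp
 finally show ?thesis by (simp add: set_LI_def)
qed

lemma AE_real_ex:
 assumes "AE s in lborel. P s" "a < (b::real)"
 shows "\<exists>s. a < s & s < b & P s"
 using AE_open_ex[OF assms(1), of "{a<..<b}"] assms(2) by auto

lemma AE_shift_imp_const:
 fixes k :: "real => real"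
 assumes h: "0 < h" and ae: "AE s in lborel. AE s' in lborel. 0 < s & s < s' & s' < h --> k s' = k s"
 shows "\<exists>c. AE s in lborel. 0 < s & s < h --> k s = c"
proof -
 obtain s0 where s0: "0 < s0" "s0 < h/2" "AE s' in lborel. 0 < s0 & s0 < s' & s' < h --> k s' = k s0"
  using AE_real_ex[OF ae, of 0 "h/2"] h by auto
 have "AE s in lborel. 0 < s & s < h --> k s = k s0"
  using ae s0(3)
 proof eventually_elim
  case (elim s)
  show ?case
  proof
   assume s: "0 < s & s < h"
   show "k s = k s0"
   proof (cases "s0 < s")
    case False
    have "AE s' in lborel. (0 < s & s < s' & s' < h --> k s' = k s) & (0 < s0 & s0 < s' & s' < h --> k s' = k s0)"
     using elim(1) s0(3) by eventually_elim auto
    from AE_real_ex[OF this, of "h/2" h] obtain s' where "h/2 < s'" "s' < h" "k s' = k s" "k s' = k s0"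
     using h s s0 False by auto
    then show ?thesis by simp
   qed (use elim s s0 in auto)
  qed
 qed
 then show ?thesis by blast
qed

lemma AE_increment_imp_antiderivative:
 fixes d \<kappa> :: "real => real"
 assumes h: "0 < h" and \<kappa>: "L1 \<kappa>"
  and ae: "AE s in lborel. AE \<tau> in lborel. 0 < \<tau> & 0 < s & s + \<tau> < h --> d (s + \<tau>) - d s = (LINT r:{0..\<tau>}|lborel. \<kappa> (s + r))"
 shows "\<exists>c. AE s in lborel. 0 < s & s < h --> d s = c + (LINT r:{0..s}|lborel. \<kappa> r)"
proof -
 have [measurable]: "\<kappa> \<in> Borel" using \<kappa> by auto
 define q where "q s = (LINT r:{0..s}|lborel. \<kappa> r)" for s
 have "AE s in lborel. AE s' in lborel. 0 < s & s < s' & s' < h --> d s' - q s' = d s - q s"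
  using ae
 proof eventually_elim
  case (elim s)
  from AE_lborel_shift[OF elim, of "- s"] show ?case
  proof eventually_elim
   case (elim s')
   show ?case
   proof
    assume s: "0 < s & s < s' & s' < h"
    then have "d s' - d s = (LINT r:{0..s' - s}|lborel. \<kappa> (s + r))" using elim by simp
    also have "\<dots> = (LINT r:{s..s'}|lborel. \<kappa> r)" using LINT_Icc_shift[of s s' \<kappa> s] by simp
    also have "\<dots> = q s' - q s"
    proof -
     have "L1 (%r. ind {0..s'} r * \<kappa> r)"
      by (rule L1_bound[OF \<kappa>]) (auto simp: indicator_def)
     from LINT_split[OF this, of s] s show ?thesis by (simp add: q_def)
    qed
    finally show "d s' - q s' = d s - q s" by simp
   qed
  qed
 qed
 from AE_shift_imp_const[OF h this] obtain c where "AE s in lborel. 0 < s & s < h --> d s - q s = c" by blast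
 then have "AE s in lborel. 0 < s & s < h --> d s = c + q s" by eventually_elim auto
 then show ?thesis unfolding q_def by blast
qed

definition profile :: "real => real => real => real" where
 "profile M t s = A1star M t * exp (M * s) + A2star M t * exp (- M * s) + 1"

lemma profile_ends:
 assumes "M > 0" "t > 0"
 shows "profile M t 0 = 0" "profile M t t = 0"
proof -
 have "- M * t < M * t" using mult_pos_pos[OF assms] by linarith
 then have "exp (M * t) - exp (- M * t) > 0" by (simp only: exp_less_cancel_iff diff_gt_0_iff_gt)
 then have ne: "exp (M * t) - exp (- M * t) ~= 0" by (metis less_irrefl)
 have e: "exp (M * t) * exp (- M * t) = 1" by (simp flip: exp_add)
 have q: "x / D * E + y / D * E' + 1 = (x * E + y * E' + D) / D" if "D ~= 0" for x y D E E' :: real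
  using that by (simp add: add_divide_distrib)
 have "(- (1 - exp (- M * t))) * 1 + (1 - exp (M * t)) * 1 + (exp (M * t) - exp (- M * t)) = 0" by simp
 then show "profile M t 0 = 0" using q[OF ne, of "- (1 - exp (- M * t))" 1 "1 - exp (M * t)" 1]
  unfolding profile_def A1star_def A2star_def by simp
 have "(- (1 - exp (- M * t))) * exp (M * t) + (1 - exp (M * t)) * exp (- M * t) + (exp (M * t) - exp (- M * t)) = 0"
  using e by (simp add: algebra_simps)
 then show "profile M t t = 0" using q[OF ne, of "- (1 - exp (- M * t))" "exp (M * t)" "1 - exp (M * t)" "exp (- M * t)"]
  unfolding profile_def A1star_def A2star_def by simp
qed

lemma ode_unique:
 fixes v e :: "real => real"
 assumes M: "M > 0" and h: "h > 0"
  and v: "!!s. s \<in> {0..h} ==> (v has_real_derivative e s) (at s within {0..h})"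
  and e: "!!s. s \<in> {0..h} ==> (e has_real_derivative M^2 * v s) (at s within {0..h})"
  and ends: "v 0 = 0" "v h = 0" and s: "s \<in> {0..h}"
 shows "v s = 0"
proof -
 have c: "\<exists>a. \<forall>s\<in>{0..h}. (e s + m * v s) * exp (- m * s) = a" if m: "m^2 = M^2" for m
 proof -
  have "((%s. (e s + m * v s) * exp (- m * s)) has_real_derivative 0) (at s within {0..h})" if "s \<in> {0..h}" for s
  proof -
   have "((%s. (e s + m * v s) * exp (- m * s)) has_real_derivative
    (e s + m * v s) * (exp (- m * s) * (- m)) + (M^2 * v s + m * e s) * exp (- m * s)) (at s within {0..h})"
    by (auto intro!: derivative_eq_intros v e that)
   also have "(e s + m * v s) * (exp (- m * s) * (- m)) + (M^2 * v s + m * e s) * exp (- m * s) = 0"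
    unfolding m[symmetric] by (simp add: algebra_simps power2_eq_square)
   finally show ?thesis .
  qed
  then show ?thesis
   using has_field_derivative_zero_constant[OF convex_real_interval(5), of 0 h] by blast
 qed
 obtain a where a: "!!s. s \<in> {0..h} ==> (e s + M * v s) * exp (- M * s) = a" using c[of M] by auto
 obtain b where b: "!!s. s \<in> {0..h} ==> (e s + (- M) * v s) * exp (- (- M) * s) = b" using c[of "- M"] by auto
 have a': "e s + M * v s = a * exp (M * s)" if "s \<in> {0..h}" for s
  using a[OF that] by (auto simp: exp_minus field_simps)
 have b': "e s - M * v s = b * exp (- M * s)" if "s \<in> {0..h}" for s
  using b[OF that] by (auto simp: exp_minus field_simps)
 have vs: "2 * M * v s = a * exp (M * s) - b * exp (- M * s)" if "s \<in> {0..h}" for s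
  using a'[OF that] b'[OF that] by linarith
 have "a = b" using vs[of 0] ends h by simp
 moreover have "a * (exp (M * h) - exp (- M * h)) = 0" using vs[of h] ends h \<open>a = b\<close> by (simp add: algebra_simps)
 moreover have "- M * h < M * h" using mult_pos_pos[OF M h] by linarith
 then have "exp (M * h) - exp (- M * h) > 0" by (simp only: exp_less_cancel_iff diff_gt_0_iff_gt)
 ultimately have "a = 0" "b = 0" by auto
 then show ?thesis using vs[OF s] M by simp
qed

text \<open>
  The difference of \<open>w\<close> and the multiple of the profile solves
  \<open>v\<^sup>\<prime>\<^sup>\<prime> = M\<^sup>2 v\<close> with zero boundary values. Only
  integrated forms of the equation are available, so \<open>w\<close> and \<open>d\<close> are first
  replaced by their continuous representatives.
\<close>

lemma profile_from_ode:
 fixes w d :: "real => real"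
 assumes M: "M > 0" and h: "h > 0" and d: "L1 (%r. ind {0..h} r * d r)"
  and w: "AE s in lborel. 0 < s & s < h --> w s = (LINT r:{0..s}|lborel. d r)"
  and z: "(LINT r:{0..h}|lborel. d r) = 0"
  and \<kappa>: "!!r. 0 < r & r < h ==> \<kappa> r = M^2 * w r - g0" and \<kappa>i: "L1 \<kappa>"
  and dd: "AE s in lborel. 0 < s & s < h --> d s = c + (LINT r:{0..s}|lborel. \<kappa> r)"
 shows "AE s in lborel. 0 < s & s < h --> w s = (g0 / M^2) * profile M h s"
proof -
 have hk: "(LINT r:{0..s}|lborel. k r) = integral {0..s} k" "k integrable_on {0..s}"
  if "L1 (%r. ind {0..h} r * k r)" "s <= h" for k :: "real => real" and s
 proof -
  have "set_integrable lborel {0..s} k"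
   by (rule set_integrable_subset[of _ "{0..h}"]) (use that in \<open>auto simp: set_integrable_def\<close>)
  then show "(LINT r:{0..s}|lborel. k r) = integral {0..s} k" "k integrable_on {0..s}"
   using set_borel_integral_eq_integral by blast+
 qed
 define W where "W s = integral {0..s} d" for s
 have cW: "continuous_on {0..h} W" unfolding W_def by (rule indefinite_integral_continuous_1) (use hk(2)[OF d] in auto)
 define \<kappa>2 where "\<kappa>2 r = M^2 * W r - g0" for r
 have c\<kappa>: "continuous_on {0..h} \<kappa>2" unfolding \<kappa>2_def by (intro continuous_intros cW)
 have i\<kappa>2: "L1 (%r. ind {0..h} r * \<kappa>2 r)"
  using borel_integrable_atLeastAtMost'[OF c\<kappa>] by (simp add: set_integrable_def)
 have i\<kappa>: "L1 (%r. ind {0..h} r * \<kappa> r)"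
  by (rule L1_bound[OF \<kappa>i]) (use \<kappa>i in \<open>auto simp: indicator_def\<close>)
 have wW: "AE s in lborel. 0 < s & s < h --> w s = W s"
  using w by eventually_elim (auto simp: W_def hk(1)[OF d])
 have ends: "AE r in lborel. r ~= 0 & r ~= h" using AE_lborel_singleton[of 0] AE_lborel_singleton[of h] by eventually_elim auto
 have ae\<kappa>: "AE r in lborel. ind {0..h} r * \<kappa> r = ind {0..h} r * \<kappa>2 r"
  using wW ends by eventually_elim (auto simp: \<kappa> \<kappa>2_def indicator_def)
 define D2 where "D2 s = c + integral {0..s} \<kappa>2" for s
 have e\<kappa>: "(LINT r:{0..s}|lborel. \<kappa> r) = integral {0..s} \<kappa>2" if "s <= h" for s
 proof -
  have "(LINT r:{0..s}|lborel. \<kappa> r) = (LINT r:{0..s}|lborel. \<kappa>2 r)"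
   unfolding set_LI_def
  proof (rule integral_cong_AE)
   show "(%r. ind {0..s} r *r \<kappa> r) \<in> borel_measurable lborel" using \<kappa>i by measurable
   have "set_integrable lborel {0..s} \<kappa>2"
    by (rule set_integrable_subset[of _ "{0..h}"]) (use that i\<kappa>2 in \<open>auto simp: set_integrable_def\<close>)
   then show "(%r. ind {0..s} r *r \<kappa>2 r) \<in> borel_measurable lborel" by (auto simp: set_integrable_def)
   show "AE r in lborel. ind {0..s} r *r \<kappa> r = ind {0..s} r *r \<kappa>2 r"
    using ae\<kappa> by eventually_elim (use that in \<open>auto simp: indicator_def split: if_splits\<close>)
  qed
  then show ?thesis using hk(1)[OF i\<kappa>2 that] by simp
 qed
 have dD: "AE s in lborel. 0 < s & s < h --> d s = D2 s"
  using dd by eventually_elim (auto simp: D2_def e\<kappa>)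
 have D2': "(D2 has_real_derivative \<kappa>2 s) (at s within {0..h})" if "s \<in> {0..h}" for s
 proof -
  have "((%u. integral {0..u} \<kappa>2) has_vector_derivative \<kappa>2 s) (at s within {0..h})"
   by (rule integral_has_vector_derivative[OF c\<kappa> that])
  then have "((%u. c + integral {0..u} \<kappa>2) has_real_derivative 0 + \<kappa>2 s) (at s within {0..h})"
   unfolding has_real_derivative_iff_has_vector_derivative by (intro has_vector_derivative_add has_vector_derivative_const)
  then show ?thesis unfolding D2_def[abs_def] by simp
 qed
 have cD2: "continuous_on {0..h} D2"
  using D2' by (meson DERIV_continuous continuous_on_eq_continuous_within)
 have WD: "W s = integral {0..s} D2" if "s \<in> {0..h}" for s
 proof -
  have s: "s <= h" using that by simp
  have iD: "L1 (%r. ind {0..h} r * D2 r)"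
   using borel_integrable_atLeastAtMost'[OF cD2] by (simp add: set_integrable_def)
  have "(LINT r:{0..s}|lborel. d r) = (LINT r:{0..s}|lborel. D2 r)"
   unfolding set_LI_def
  proof (rule integral_cong_AE)
   have "set_integrable lborel {0..s} d" "set_integrable lborel {0..s} D2"
    by (rule set_integrable_subset[of _ "{0..h}"]; use s d iD in \<open>auto simp: set_integrable_def\<close>)+
   then show "(%r. ind {0..s} r *r d r) \<in> borel_measurable lborel" "(%r. ind {0..s} r *r D2 r) \<in> borel_measurable lborel"
    by (auto simp: set_integrable_def)
   show "AE r in lborel. ind {0..s} r *r d r = ind {0..s} r *r D2 r"
    using dD ends by eventually_elim (use s in \<open>auto simp: indicator_def\<close>)
  qed
  then show ?thesis using hk(1)[OF d s] hk(1)[OF iD s] by (simp add: W_def)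
 qed
 have W': "(W has_real_derivative D2 s) (at s within {0..h})" if "s \<in> {0..h}" for s
 proof -
  have "((%u. integral {0..u} D2) has_real_derivative D2 s) (at s within {0..h})"
   unfolding has_real_derivative_iff_has_vector_derivative by (rule integral_has_vector_derivative[OF cD2 that])
  then show ?thesis
   by (rule has_field_derivative_transform_within[of _ _ _ _ 1]) (use that WD in auto)
 qed
 define g where "g = g0 / M^2"
 define pd where "pd s = A1star M h * (M * exp (M * s)) - A2star M h * (M * exp (- M * s))" for s
 have p1: "(profile M h has_real_derivative pd s) (at s within {0..h})" for s
  unfolding profile_def[abs_def] pd_def by (auto intro!: derivative_eq_intros)
 have p2: "(pd has_real_derivative M^2 * (profile M h s - 1)) (at s within {0..h})" for s
  unfolding profile_def pd_def[abs_def] by (auto intro!: derivative_eq_intros simp: power2_eq_square algebra_simps)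
 have gM: "M^2 * g = g0" using M by (simp add: g_def)
 have fin: "W s - g * profile M h s = 0" if "s \<in> {0..h}" for s
 proof (rule ode_unique[OF M h, where v="%s. W s - g * profile M h s" and e="%s. D2 s - g * pd s" and s=s])
  fix s assume s: "s \<in> {0..h}"
  show "((%s. W s - g * profile M h s) has_real_derivative D2 s - g * pd s) (at s within {0..h})"
   by (intro DERIV_diff DERIV_cmult W' p1 s)
  have "((%s. D2 s - g * pd s) has_real_derivative \<kappa>2 s - g * (M^2 * (profile M h s - 1))) (at s within {0..h})"
   by (intro DERIV_diff DERIV_cmult D2' p2 s)
  also have "\<kappa>2 s - g * (M^2 * (profile M h s - 1)) = M^2 * (W s - g * profile M h s)"
   unfolding \<kappa>2_def gM[symmetric] by (simp add: algebra_simps)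
  finally show "((%s. D2 s - g * pd s) has_real_derivative M^2 * (W s - g * profile M h s)) (at s within {0..h})" .
 next
  show "W 0 - g * profile M h 0 = 0" by (simp add: W_def profile_ends[OF M h])
  show "W h - g * profile M h h = 0" using z hk(1)[OF d, of h] by (simp add: W_def profile_ends[OF M h])
 qed (rule that)
 from wW show ?thesis
 proof eventually_elim
  case (elim s)
  show ?case
  proof
   assume s: "0 < s & s < h"
   then have "W s = g * profile M h s" using fin[of s] by simp
   then show "w s = (g0 / M^2) * profile M h s" using elim s by (simp add: g_def)
  qed
 qed
qed

lemma integrable_pair_product:
 fixes k :: "'a::euclidean_space => real" and v :: "'b::euclidean_space => real"
 assumes k: "L1 k" and v: "L1 v"
 shows "L1 (%p. k (fst p) * v (snd p))"
proof -
 have [measurable]: "k \<in> Borel" "v \<in> Borel" using k v by auto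
 have "integrable (lborel \<Otimes>\<^sub>M lborel) (%(p, s). k p * v s)"
 proof (rule lborel_pair.Fubini_integrable)
  show "L1 (%x. LI y. norm (case (x, y) of (p, s) => k p * v s))"
   using k by (simp add: abs_mult)
 qed (use v in auto)
 then show ?thesis by (simp add: lborel_prod split_beta')
qed

lemma AE_snd:
 assumes "AE z in lborel. P z"
 shows "AE p in lborel. P (snd (p :: 'a::euclidean_space \<times> 'b::euclidean_space))"
proof -
 obtain N where N: "{y. \<not> P y} \<subseteq> N" "N \<in> null_sets lborel"
  using assms by (auto elim!: AE_E simp: null_sets_def)
 have "UNIV \<times> N \<in> null_sets (lborel \<Otimes>\<^sub>M lborel)"
  using N(2) by (auto simp: null_sets_def lborel.emeasure_pair_measure_Times)
 then have "UNIV \<times> N \<in> null_sets (lborel :: ('a \<times> 'b) measure)" by (simp add: lborel_prod)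
 then show ?thesis by (rule AE_I') (use N(1) in auto)
qed

lemma integrable_sq_imp_locally:
 fixes k :: "'a::euclidean_space => real"
 assumes [measurable]: "k \<in> Borel" and "!!C. compact C ==> L1 (%y. ind C y * (k y)^2)"
 shows "L1loc S k"
 unfolding locally_integrable_def set_integrable_def
proof (intro allI impI)
 fix C assume C: "compact C & C \<subseteq> S"
 then have [measurable]: "C \<in> sets borel" by (auto intro: borel_compact)
 have i2: "L1 (%y. ind C y :: real)"
  using emeasure_compact_finite C by (intro integrable_real_indicator) auto
 show "L1 (%y. ind C y *r k y)"
 proof (rule L1_bound[OF L1_add[OF i2 assms(2)[OF conjunct1[OF C]]]])
  show "AE y in lborel. norm (ind C y *r k y) <= norm (ind C y + ind C y * (k y)^2)" (is "AE y in _. ?P y")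
  proof (intro AE_I2)
   fix y have "\<bar>k y\<bar> <= 1 + (k y)^2" using sum_squares_bound[of 1 "\<bar>k y\<bar>"] by auto
   then show "?P y"
    by (auto simp: indicator_def)
  qed
 qed measurable
qed

lemma triple_integral_swap:
 fixes F :: "plane \<times> plane \<times> real => real"
 assumes "L1 F"
 shows "(LI y. F y) = (LI s. LI p. F (fst p, snd p, s))"
proof -
 have [measurable]: "F \<in> Borel" using assms by auto
 have i: "integrable (lborel \<Otimes>\<^sub>M lborel) (%(p, s). F (assoc3 (p, s)))"
  using assms integrable_assoc3[of F] by (simp add: split_beta')
 show ?thesis
  unfolding triple_integral(1)[OF assms] using lborel_pair.Fubini_integral[OF i] by (simp add: assoc3_def)
qed

lemma integrable_vec2:
 fixes V :: "'a => plane"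
 assumes "!!i. integrable M (%y. V y $ i)" shows "integrable M V"
proof -
 have "V = (%y. \<Sum>i\<in>UNIV. V y $ i *r axis i 1)"
  by (auto simp: fun_eq_iff vec_eq_iff axis_def sum_2 forall_2)
 moreover have "integrable M (%y. \<Sum>i\<in>UNIV. V y $ i *r axis i (1::real))" using assms by auto
 ultimately show ?thesis by simp
qed

lemma integral_nth:
 fixes V :: "'a => real^'n"
 assumes "integrable M V" shows "(LINT y|M. V y) $ i = (LINT y|M. V y $ i)"
 using integral_inner_left[OF assms, of "axis i 1"] by (simp add: inner_axis)

text \<open>
  Functions of the slow and the fast variable that are periodic in the fast one and square integrable
  over \<open>UNIV \<times> cell\<close>.
\<close>

definition PL2 :: "(plane \<times> plane => real) => bool" where
 "PL2 k \<longleftrightarrow> k \<in> Borel & (\<forall>x. periodic (%z. k (x, z))) &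
  (NN p. ind cell (snd p) * ennreal ((k p)^2)) < \<infinity>"

lemma PL2_D: "PL2 k ==> k \<in> Borel" by (simp add: PL2_def)

lemma PL2_bound:
 assumes k: "PL2 k" and l: "PL2 l" and [measurable]: "m \<in> Borel" and per: "!!x. periodic (%z. m (x, z))"
  and b: "AE p in lborel. (m p)^2 <= C * (k p)^2 + D * (l p)^2" and CD: "C >= 0" "D >= 0"
 shows "PL2 m"
proof -
 have [measurable]: "k \<in> Borel" "l \<in> Borel" using k l by (auto simp: PL2_def)
 have "(NN p. ind cell (snd p) * ennreal ((m p)^2))
   <= (NN p. ennreal C * (ind cell (snd p) * ennreal ((k p)^2)) + ennreal D * (ind cell (snd p) * ennreal ((l p)^2)))"
 proof (rule nn_integral_mono_AE, use b in eventually_elim)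
  case (elim p)
  have "ennreal ((m p)^2) <= ennreal C * ennreal ((k p)^2) + ennreal D * ennreal ((l p)^2)"
   using ennreal_leI[OF elim] CD by (simp add: ennreal_mult)
  then show ?case by (auto simp: indicator_def)
 qed
 also have "\<dots> = ennreal C * (NN p. ind cell (snd p) * ennreal ((k p)^2)) + ennreal D * (NN p. ind cell (snd p) * ennreal ((l p)^2))"
  by (simp add: nn_integral_add nn_integral_cmult)
 also have "\<dots> < \<infinity>" using k l by (auto simp: PL2_def ennreal_mult_less_top)
 finally show ?thesis using per by (simp add: PL2_def)
qed

lemma PL2_lin:
 assumes "PL2 k" "PL2 l" shows "PL2 (%p. k p + c * l p)"
proof (rule PL2_bound[OF assms])
 have [measurable]: "k \<in> Borel" "l \<in> Borel" using assms by (auto simp: PL2_def)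
 show "(%p. k p + c * l p) \<in> Borel" by measurable
 show "periodic (%z. k (x, z) + c * l (x, z))" for x
  using assms by (simp add: PL2_def periodic_def)
 show "AE p in lborel. (k p + c * l p)^2 <= 2 * (k p)^2 + 2 * c^2 * (l p)^2" (is "AE p in _. ?P p")
 proof (intro AE_I2)
  fix p
  have "(x + y)^2 <= 2 * x^2 + 2 * y^2" for x y :: real using sum_squares_bound[of x y] by (simp add: power2_sum)
  from this[of "k p" "c * l p"] show "?P p" by (simp add: power_mult_distrib)
 qed
qed simp_all

lemma PL2_mult:
 assumes k: "PL2 k" and [measurable]: "a \<in> Borel" and a: "periodic a" "!!z. \<bar>a z\<bar> <= C"
 shows "PL2 (%p. a (snd p) * k p)"
proof (rule PL2_bound[OF k k])
 have [measurable]: "k \<in> Borel" using k by (auto simp: PL2_def)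
 show "(%p. a (snd p) * k p) \<in> Borel" by measurable
 show "periodic (%z. a (snd (x, z)) * k (x, z))" for x
  using k a(1) by (simp add: PL2_def periodic_def)
 show "AE p in lborel. (a (snd p) * k p)^2 <= C^2 * (k p)^2 + 0 * (k p)^2" (is "AE p in _. ?P p")
 proof (intro AE_I2)
  fix p :: "plane \<times> plane"
  have "\<bar>a (snd p)\<bar>^2 <= C^2" by (rule power_mono) (use a(2) in auto)
  then show "?P p" by (simp add: power_mult_distrib mult_right_mono)
 qed
qed simp_all

lemma PL2_product:
 assumes [measurable]: "f \<in> Borel" and f: "L1 (%x. (f x)^2)" and g: "L2per g"
 shows "PL2 (%p. f (fst p) * g (snd p) :: real)"
proof -
 have [measurable]: "g \<in> Borel" using g by (simp add: L2per_def)
 have i: "L1 (%z. ind cell z * (g z)^2)" using g by (simp add: L2per_def)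
 have "(NN p. ind cell (snd p) * ennreal ((f (fst p) * g (snd p))^2)) = (NN p. ennreal (norm ((f (fst p))^2 * (ind cell (snd p) * (g (snd p))^2))))"
  by (intro nn_integral_cong) (simp add: power_mult_distrib indicator_def)
 also have "\<dots> < \<infinity>" using integrable_pair_product[OF f i] by (simp add: integrable_iff_bounded)
 finally have "(NN p. ind cell (snd p) * ennreal ((f (fst p) * g (snd p))^2)) < \<infinity>" .
 moreover have "periodic (%z. f (fst (x, z)) * g (snd (x, z)))" for x using g by (auto simp: L2per_def periodic_def)
 ultimately show ?thesis unfolding PL2_def by simp
qed

lemma PL2_loc: "PL2 k ==> L1loc S k"
proof -
 assume k: "PL2 k"
 then have [measurable]: "k \<in> Borel" by (simp add: PL2_def)
 show ?thesis
 proof (rule integrable_sq_imp_locally)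
  fix C :: "(plane \<times> plane) set" assume C: "compact C"
  have [measurable]: "C \<in> sets borel" by (rule borel_compact[OF C])
  have cB: "compact (snd ` C)" by (intro compact_continuous_image C continuous_intros)
  have [measurable]: "snd ` C \<in> sets borel" by (rule borel_compact[OF cB])
  have "(NN p. ind C p * ennreal ((k p)^2)) <= (NN p. ind (snd ` C) (snd p) * ennreal ((k p)^2))"
   by (intro nn_integral_mono) (auto simp: indicator_def)
  also have "\<dots> < \<infinity>"
   by (rule nn_integral_pair_periodic[OF _ _ compact_imp_bounded[OF cB]])
    (use k in \<open>auto intro: periodic_comp simp: PL2_def\<close>)
  finally show "L1 (%p. ind C p * (k p)^2)"
   unfolding integrable_iff_bounded by (auto simp: ennreal_mult' ennreal_indicator)
 qed measurable
qed

lemma test_sq_integrable: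
 fixes \<alpha> :: "'a::euclidean_space => real" assumes "\<alpha> \<in> test_fun \<omega>" shows "L1 (%x. (\<alpha> x)^2)"
proof -
 have t: "\<alpha> \<in> test_fun UNIV" by (rule test_fun_mono[OF assms]) simp
 have [measurable]: "\<alpha> \<in> Borel" by (rule test_fun_borel[OF t])
 obtain K M where K: "!!y. \<bar>\<alpha> y\<bar> <= M * ind K y" using test_fun_bound[OF t] by metis
 have "\<bar>\<alpha> y\<bar> <= \<bar>M\<bar>" for y using K[of y] by (cases "y \<in> K") auto
 have "L1 (%x. \<bar>M\<bar> * \<alpha> x)" using test_integrable[OF t] by simp
 then show ?thesis
 proof (rule L1_bound)
  show "AE x in lborel. norm ((\<alpha> x)^2) <= norm (\<bar>M\<bar> * \<alpha> x)"
   using mult_right_mono[OF \<open>!!y. \<bar>\<alpha> y\<bar> <= \<bar>M\<bar>\<close> abs_ge_zero] by (intro AE_I2) (simp add: power2_eq_square abs_mult del: abs_mult_self_eq)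
 qed measurable
qed

section \<open>The momentum equation\<close>

text \<open>
  The part of the limit system that determines the velocity.
\<close>

locale limit_flow =
 fixes \<omega> :: "plane set" and h :: "plane => real" and h_min h_max \<mu> \<mu>eff K M :: real
  and f :: "plane => plane" and u Du :: "plane \<times> plane \<times> real => real^3"
  and Dp :: "plane => plane" and \<pi> :: "plane \<times> plane => real"
 assumes \<omega>: "open \<omega>" and hc: "continuous_on UNIV h" and hper: "periodic h" and hmin: "0 < h_min"
  and hbd: "!!z. h_min <= h z & h z <= h_max"
  and pos: "\<mu> > 0" "\<mu>eff > 0" "K > 0" and M_eq: "M = sqrt (\<mu> / (K * \<mu>eff))"
  and V: "V_z3 2 \<omega> h u Du" and fL: "Lp 2 \<omega> f" and DpL: "Lp 2 \<omega> Dp"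
  and pres: "pressure_L2_0_per \<omega> \<pi>" and mom: "momentum_eq \<mu> \<mu>eff K \<omega> h u Du \<pi> f Dp"
  and cdiv: "cell_div_eq \<omega> h u"
  and tb: "trace_bottom \<omega> h (%y. horiz (u y)) (%y. horiz (Du y)) (%_. 0)"
  and tt: "trace_top \<omega> h (%y. horiz (u y)) (%y. horiz (Du y)) (%_. 0)"
begin

lemma hpos: "0 < h z" using hbd[of z] hmin by linarith

lemma h_borel [measurable]: "h \<in> Borel" by (rule borel_measurable_continuous_onI[OF hc])

lemma M_pos: "M > 0" unfolding M_eq using pos by simp

lemma M_sq: "M^2 = \<mu> / (K * \<mu>eff)" unfolding M_eq using pos by simp

abbreviation S :: "(plane \<times> plane \<times> real) set" where "S \<equiv> \<omega> \<times> Zper h"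

lemma S_open: "open S" by (rule open_layer[OF \<omega> hc])
lemma S_borel [measurable]: "S \<in> sets borel" by (rule borel_open[OF S_open])
lemma \<omega>_borel [measurable]: "\<omega> \<in> sets borel" by (rule borel_open[OF \<omega>])

definition w :: "2 => plane \<times> plane \<times> real => real" where "w i y = ind S y * horiz (u y) $ i"
definition d :: "2 => plane \<times> plane \<times> real => real" where "d i y = ind S y * horiz (Du y) $ i"
definition F :: "2 => plane => real" where "F i x = ind \<omega> x * (f x $ i - Dp x $ i)"
text \<open>
  A representative of the local pressure that is Borel everywhere; it agrees with \<open>\<pi>\<close>
  off the faces.
\<close>

definition pt :: "plane \<times> plane => real" where
 "pt p = ind (\<omega> \<times> cell) (fst p, wrap (snd p)) * \<pi> (fst p, wrap (snd p))"

lemma u_up: "loc_int_up \<omega> h (%y. horiz (u y) $ i)" and Du_up: "loc_int_up \<omega> h (%y. horiz (Du y) $ i)"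
 using V_z3_loc_int_up[OF V _ \<omega> hc hpos hper] loc_int_up_component unfolding horiz_nth by auto

lemma w_borel [measurable]: "w i \<in> Borel" and d_borel [measurable]: "d i \<in> Borel"
 and w_loc: "L1loc UNIV (w i)" and d_loc: "L1loc UNIV (d i)"
 using loc_int_up_cut[OF u_up \<omega> hc] loc_int_up_cut[OF Du_up \<omega> hc] by (auto simp: w_def[abs_def] d_def[abs_def])

lemma loc_mono: "L1loc UNIV k ==> L1loc T k"
 by (auto simp: locally_integrable_def)

lemma L2_comp:
 assumes "Lp 2 \<omega> g"
 shows "(%x. ind \<omega> x * g x $ i) \<in> Borel" "L1 (%x. (ind \<omega> x * (g x :: real^2) $ i)^2)"
proof -
 have [measurable]: "(%x. ind \<omega> x *r g x) \<in> Borel" using assms by (simp add: Lp_def set_borel_cut)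
 have "(%x. (ind \<omega> x *r g x) $ i) \<in> Borel" by measurable
 then show m [measurable]: "(%x. ind \<omega> x * g x $ i) \<in> Borel" by simp
 have i: "L1 (%x. ind \<omega> x * (norm (g x))^2)" using assms by (simp add: Lp2_iff set_integrable_def)
 show "L1 (%x. (ind \<omega> x * g x $ i)^2)"
 proof (rule L1_bound[OF i])
  show "AE x in lborel. norm ((ind \<omega> x * g x $ i)^2) <= norm (ind \<omega> x * (norm (g x))^2)" (is "AE x in _. ?P x")
  proof (intro AE_I2)
   fix x
   have "\<bar>g x $ i\<bar>^2 <= (norm (g x))^2" by (rule power_mono) (auto simp: component_le_norm_cart)
   then show "?P x"
    by (auto simp: indicator_def)
  qed
 qed measurable
qed

lemma F_borel [measurable]: "F i \<in> Borel"
 and F_L2: "L1 (%x. (F i x)^2)"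
proof -
 have eq: "F i = (%x. ind \<omega> x * f x $ i - ind \<omega> x * Dp x $ i)" by (auto simp: F_def fun_eq_iff algebra_simps)
 note m [measurable] = L2_comp(1)[OF fL, of i] L2_comp(1)[OF DpL, of i]
 show b: "F i \<in> Borel" unfolding eq by measurable
 have i: "L1 (%x. 2 * (ind \<omega> x * f x $ i)^2 + 2 * (ind \<omega> x * Dp x $ i)^2)"
  using L2_comp(2)[OF fL, of i] L2_comp(2)[OF DpL, of i] by simp
 show "L1 (%x. (F i x)^2)"
 proof (rule L1_bound[OF i])
  show "AE x in lborel. norm ((F i x)^2) <= norm (2 * (ind \<omega> x * f x $ i)^2 + 2 * (ind \<omega> x * Dp x $ i)^2)" (is "AE x in _. ?P x")
  proof (intro AE_I2)
   fix x
   have "(a - b)^2 <= 2 * a^2 + 2 * b^2" for a b :: real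
    using sum_squares_bound[of a "- b"] by (simp add: power2_diff)
   then show "?P x"
    unfolding eq by simp
  qed
 qed (use b in measurable)
qed

lemma F_PL2: "PL2 (%p. F i (fst p))" using PL2_product[OF F_borel F_L2 L2per_const[of "1::real"]] by simp
lemma F_loc: "L1loc UNIV (%p :: plane \<times> plane. F i (fst p))" by (rule PL2_loc[OF F_PL2])

lemma pt_periodic: "periodic (%z. pt (x, z))"
 unfolding pt_def using wrap_periodic by (simp add: periodic_def)

lemma pt_eq: "x \<in> \<omega> ==> z \<notin> faces ==> pt (x, z) = \<pi> (x, z)"
proof -
 assume a: "x \<in> \<omega>" "z \<notin> faces"
 have "periodic (%z. \<pi> (x, z))" using pres by (simp add: pressure_L2_0_per_def)
 from periodic_lattice[OF this, of "wrap z" "(\<lfloor>z $ 1 + 1/2\<rfloor>, \<lfloor>z $ 2 + 1/2\<rfloor>)"]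
 have "\<pi> (x, wrap z) = \<pi> (x, z)" by (simp add: wrap_def)
 then show ?thesis using a wrap_faces by (simp add: pt_def)
qed

lemma pt_borel [measurable]: "pt \<in> Borel"
proof -
 have [measurable]: "(%p. ind (\<omega> \<times> cell) p * \<pi> p) \<in> Borel"
  using pres by (simp add: pressure_L2_0_per_def Lp_def set_borel_cut)
 have "(%p. (%p. ind (\<omega> \<times> cell) p * \<pi> p) (fst p, wrap (snd p))) \<in> Borel" by measurable
 then show ?thesis by (simp add: pt_def[abs_def])
qed

lemma pt_L2: "(NN p. ind cell (snd p) * ennreal ((pt p)^2)) < \<infinity>"
proof -
 have i: "L1 (%p. ind (\<omega> \<times> cell) p * (norm (\<pi> p))^2)"
  using pres by (simp add: pressure_L2_0_per_def Lp2_iff set_integrable_def)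
 have "(NN p. ind cell (snd p) * ennreal ((pt p)^2)) = (NN p. ennreal (norm (ind (\<omega> \<times> cell) p * (norm (\<pi> p))^2)))"
 proof (intro nn_integral_cong)
  fix p :: "plane \<times> plane"
  show "ind cell (snd p) * ennreal ((pt p)^2) = ennreal (norm (ind (\<omega> \<times> cell) p * (norm (\<pi> p))^2))"
   by (cases p) (auto simp: pt_def indicator_def wrap_cell)
 qed
 then show ?thesis using i by (simp add: integrable_iff_bounded)
qed

lemma pt_PL2: "PL2 pt" using pt_periodic pt_L2 by (simp add: PL2_def)
lemma pt_loc: "L1loc UNIV pt" by (rule PL2_loc[OF pt_PL2])

lemma lift_loc: "L1loc UNIV k ==> k \<in> Borel ==>
 L1loc UNIV (%y :: plane \<times> plane \<times> real. (k (fst y, fst (snd y)) :: real))"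
 using outer_integral(1)[OF open_UNIV _ _ loc_mono, of k UNIV UNIV] by simp

definition \<zeta>c :: real where "\<zeta>c = (LI s. bump (h_min/3) (2*h_min/3) 1 s)"
text \<open>
  Supported strictly between \<open>0\<close> and \<open>h_min\<close>, hence inside every fibre of
  the layer, and of mass one.
\<close>

definition \<zeta> :: "real => real" where "\<zeta> s = (1 / \<zeta>c) * bump (h_min/3) (2*h_min/3) 1 s"
definition \<zeta>' :: "real => real" where "\<zeta>' = dir_deriv 1 \<zeta>"

lemma \<zeta>_test: "\<zeta> \<in> test_fun {0<..<h_min}"
proof (rule test_funI)
 show "smooth_fun \<zeta>" unfolding \<zeta>_def[abs_def] by (intro smooth_cmult smooth_bump) simp
 show "compact {h_min/3..2*h_min/3}" by simp
 show "{h_min/3..2*h_min/3} \<subseteq> {0<..<h_min}" using hmin by auto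
 show "\<zeta> y = 0" if "y \<notin> {h_min/3..2*h_min/3}" for y using that by (auto simp: \<zeta>_def intro: bump_zero)
qed

lemma \<zeta>_int: "(LI s. \<zeta> s) = 1"
proof -
 let ?b = "bump (h_min/3) (2*h_min/3) 1"
 have t: "?b \<in> test_fun UNIV"
  by (rule test_funI[of _ "{h_min/3..2*h_min/3}"]) (auto intro: smooth_bump bump_zero)
 have i: "L1 ?b" by (rule test_integrable[OF t])
 have nn: "0 <= ?b s" for s using bump_bounds[of 1] by simp
 have "\<zeta>c ~= 0"
 proof
  assume "\<zeta>c = 0"
  then have "AE s in lborel. ?b s = 0" using integral_nonneg_eq_0_iff_AE[OF i] nn by (simp add: \<zeta>c_def)
  from AE_real_ex[OF this, of "h_min/3" "2*h_min/3"] obtain s where "h_min/3 < s" "s < 2*h_min/3" "?b s = 0" using hmin by auto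
  then show False using bump_pos[of "h_min/3" s "2*h_min/3" 1] by simp
 qed
 then show ?thesis by (simp add: \<zeta>_def[abs_def] \<zeta>c_def)
qed

lemma \<zeta>_borel [measurable]: "\<zeta> \<in> Borel" and \<zeta>'_borel [measurable]: "\<zeta>' \<in> Borel"
 using test_fun_borel[OF \<zeta>_test] test_fun_borel[OF test_fun_dir[OF \<zeta>_test]] by (auto simp: \<zeta>'_def)

lemma w_periodic: "w i (x, z + axis j 1, s) = w i (x, z, s)" and d_periodic: "d i (x, z + axis j 1, s) = d i (x, z, s)"
proof -
 have "h (z + axis j 1) = h z" using hper by (simp add: periodic_def)
 moreover have "u (x, z + axis j 1, s) = u (x, z, s)" "Du (x, z + axis j 1, s) = Du (x, z, s)"
  using V by (auto simp: V_z3_def periodic_def)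
 ultimately show "w i (x, z + axis j 1, s) = w i (x, z, s)" "d i (x, z + axis j 1, s) = d i (x, z, s)"
  by (simp_all add: w_def d_def indicator_def Zper_def)
qed

text \<open>
  Vertical averages against a square integrable weight stay square integrable, by Cauchy-Schwarz on
  the fibre.
\<close>

lemma vertical_L2:
 fixes k :: "plane \<times> plane \<times> real => real"
 assumes [measurable]: "k \<in> Borel" "\<xi> \<in> Borel" and \<xi>: "L1 (%s. (\<xi> s)^2)"
  and per: "!!x z j s. k (x, z + axis j 1, s) = k (x, z, s)"
  and fin: "(NN y. ind cell (fst (snd y)) * ennreal ((k y)^2)) < \<infinity>"
 shows "PL2 (%p. LI s. \<xi> s * k (fst p, snd p, s))"
proof -
 let ?C = "(LI s. (\<xi> s)^2) + 1"
 have "0 <= (LI s. (\<xi> s)^2)" by (rule LI_nonneg) simp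
 then have C: "?C > 0" by linarith
 have "(NN p. ind cell (snd p) * ennreal ((LI s. \<xi> s * k (fst p, snd p, s))^2))
  <= (NN p. ind cell (snd p) * (ennreal ?C * (NN s. ennreal ((k (fst p, snd p, s))^2))))"
  by (intro nn_integral_mono mult_left_mono nn_Cauchy_Schwarz \<xi>) (use C in auto)
 also have "\<dots> = ennreal ?C * (NN p. NN s. ind cell (snd p) * ennreal ((k (fst p, snd p, s))^2))"
  unfolding mult.left_commute[of "ind cell _"] by (simp add: nn_integral_cmult del: ennreal_plus)
 also have "(NN p. NN s. ind cell (snd p) * ennreal ((k (fst p, snd p, s))^2)) = (NN y. ind cell (fst (snd y)) * ennreal ((k y)^2))"
  by (subst nn_integral_triple) auto
 also have "ennreal ?C * \<dots> < \<infinity>" using fin by (simp add: ennreal_mult_less_top)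
 finally show ?thesis by (simp add: PL2_def periodic_def per)
qed

lemma wd_L2: "(NN y. ind cell (fst (snd y)) * ennreal ((w i y)^2)) < \<infinity>" "(NN y. ind cell (fst (snd y)) * ennreal ((d i y)^2)) < \<infinity>"
proof -
 have one: "(NN y. ind cell (fst (snd y)) * ennreal ((ind S y * horiz (g y) $ i)^2)) < \<infinity>"
  if g: "Lp 2 (\<omega> \<times> Zcell h) g" for g :: "_ => real^3"
 proof -
  have i: "L1 (%y. ind (\<omega> \<times> Zcell h) y * (norm (g y))^2)" using g by (simp add: Lp2_iff set_integrable_def)
  have "(NN y. ind cell (fst (snd y)) * ennreal ((ind S y * horiz (g y) $ i)^2)) <= (NN y. ennreal (norm (ind (\<omega> \<times> Zcell h) y * (norm (g y))^2)))"
  proof (intro nn_integral_mono)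
   fix y :: "plane \<times> plane \<times> real"
   have "\<bar>horiz (g y) $ i\<bar>^2 <= (norm (g y))^2" unfolding horiz_nth by (rule power_mono) (auto simp: component_le_norm_cart)
   then show "ind cell (fst (snd y)) * ennreal ((ind S y * horiz (g y) $ i)^2) <= ennreal (norm (ind (\<omega> \<times> Zcell h) y * (norm (g y))^2))"
    by (cases y) (auto simp: indicator_def Zper_def Zcell_def intro!: ennreal_leI)
  qed
  also have "\<dots> < \<infinity>" using i by (simp add: integrable_iff_bounded)
  finally show ?thesis .
 qed
 show "(NN y. ind cell (fst (snd y)) * ennreal ((w i y)^2)) < \<infinity>" "(NN y. ind cell (fst (snd y)) * ennreal ((d i y)^2)) < \<infinity>"
  using one[of u] one[of Du] V by (auto simp: w_def d_def V_z3_def)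
qed

text \<open>
  The force that drives the flow, averaged vertically with the weight \<open>\<zeta>\<close>, and the
  remaining part \<open>R\<close> of \<open>f - Dp\<close>, which turns out to be the gradient of the
  local pressure. For a solution \<open>- \<mu>eff d\<^sup>\<prime> + \<mu> / K w = G\<close> with
  \<open>d\<close> the derivative of \<open>w\<close>, and testing this with \<open>\<zeta>\<close>
  gives the formula.
\<close>

definition G :: "2 => plane \<times> plane => real" where
 "G i p = \<mu>eff * (LI s. \<zeta>' s * d i (fst p, snd p, s)) + \<mu> / K * (LI s. \<zeta> s * w i (fst p, snd p, s))"
definition R :: "2 => plane \<times> plane => real" where "R i p = F i (fst p) - G i p"

lemma G_L2: "PL2 (G i)"
proof -
 have "PL2 (%p. 0 * F i (fst p) + \<mu>eff * (LI s. \<zeta>' s * d i (fst p, snd p, s)))"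
  using PL2_lin[OF PL2_mult[OF F_PL2, of "%_. 0" 0] vertical_L2[OF d_borel \<zeta>'_borel _ d_periodic wd_L2(2)], of i \<mu>eff i]
   test_sq_integrable[OF test_fun_dir[OF \<zeta>_test], of 1] by (simp add: \<zeta>'_def periodic_def)
 from PL2_lin[OF this vertical_L2[OF w_borel \<zeta>_borel test_sq_integrable[OF \<zeta>_test] w_periodic wd_L2(1)], of "\<mu> / K" i]
 show ?thesis by (simp add: G_def[abs_def])
qed

lemma R_PL2: "PL2 (R i)" using PL2_lin[OF F_PL2 G_L2, of i "-1" i] by (simp add: R_def[abs_def])
lemma G_borel [measurable]: "G i \<in> Borel" by (rule PL2_D[OF G_L2])
lemma R_borel [measurable]: "R i \<in> Borel" by (rule PL2_D[OF R_PL2])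
lemma G_loc: "L1loc UNIV (G i)" by (rule PL2_loc[OF G_L2])
lemma R_loc: "L1loc UNIV (R i)" by (rule PL2_loc[OF R_PL2])
lemma G_off: "fst p \<notin> \<omega> ==> G i p = 0" by (simp add: G_def w_def d_def)

lemma momentum_clean:
 assumes psi: "psi \<in> test_fun S" and off: "!!x z s. z \<in> faces ==> dir_deriv (0, axis i 1, 0) psi (x, z, s) = 0"
 shows "(LI y. \<mu>eff * (dir_deriv e3 psi y * d i y) + \<mu> / K * (psi y * w i y))
  - (LI y. dir_deriv (0, axis i 1, 0) psi y * pt (fst y, fst (snd y))) = (LI y. psi y * F i (fst y))"
  and "L1 (%y. dir_deriv e3 psi y * d i y)" "L1 (%y. psi y * w i y)"
   "L1 (%y. dir_deriv (0, axis i 1, 0) psi y * pt (fst y, fst (snd y)))"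
   "L1 (%y. psi y * F i (fst y))"
proof -
 obtain C where C: "C \<subseteq> S" "!!y. y \<notin> C ==> psi y = 0" "!!y v. y \<notin> C ==> dir_deriv v psi y = 0" using test_funD[OF psi] by metis
 have z: "psi y = 0" "dir_deriv v psi y = 0" if "y \<notin> S" for y v using C that by blast+
 show i1: "L1 (%y. dir_deriv e3 psi y * d i y)" "L1 (%y. psi y * w i y)"
  by (rule test_times_integrable[OF test_fun_dir[OF psi] d_borel loc_mono[OF d_loc]], rule test_times_integrable[OF psi w_borel loc_mono[OF w_loc]])
 show i2: "L1 (%y. dir_deriv (0, axis i 1, 0) psi y * pt (fst y, fst (snd y)))"
  by (rule test_times_integrable[OF test_fun_dir[OF psi] _ loc_mono[OF lift_loc[OF pt_loc pt_borel]]]) measurable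
 show i3: "L1 (%y. psi y * F i (fst y))"
  using test_times_integrable[OF psi _ loc_mono[OF lift_loc[OF F_loc[of i]]]] by simp
 have m: "(LINT (x, z, s):S|lborel.
      \<mu>eff * (horiz (Du (x, z, s)) $ i * dir_deriv e3 psi (x, z, s))
     + \<mu> / K * (horiz (u (x, z, s)) $ i * psi (x, z, s))
     - \<pi> (x, z) * dir_deriv (0, axis i 1, 0) psi (x, z, s))
   = (LINT (x, z, s):S|lborel. (f x $ i - Dp x $ i) * psi (x, z, s))"
  using mom psi unfolding momentum_eq_def by blast
 have "(LINT (x, z, s):S|lborel.
      \<mu>eff * (horiz (Du (x, z, s)) $ i * dir_deriv e3 psi (x, z, s))
     + \<mu> / K * (horiz (u (x, z, s)) $ i * psi (x, z, s))
     - \<pi> (x, z) * dir_deriv (0, axis i 1, 0) psi (x, z, s))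
   = (LI y. \<mu>eff * (dir_deriv e3 psi y * d i y) + \<mu> / K * (psi y * w i y) - dir_deriv (0, axis i 1, 0) psi y * pt (fst y, fst (snd y)))"
  unfolding set_LI_def
 proof (intro LI_cong refl)
  fix y :: "plane \<times> plane \<times> real"
  obtain x z' s where y: "y = (x, z', s)" by (metis prod.exhaust)
  show "ind S y *r (case y of (x, z, s) => \<mu>eff * (horiz (Du (x, z, s)) $ i * dir_deriv e3 psi (x, z, s))
     + \<mu> / K * (horiz (u (x, z, s)) $ i * psi (x, z, s)) - \<pi> (x, z) * dir_deriv (0, axis i 1, 0) psi (x, z, s))
   = \<mu>eff * (dir_deriv e3 psi y * d i y) + \<mu> / K * (psi y * w i y) - dir_deriv (0, axis i 1, 0) psi y * pt (fst y, fst (snd y))"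
  proof (cases "y \<in> S")
   case True
   then consider "dir_deriv (0, axis i 1, 0) psi (x, z', s) = 0" | "\<pi> (x, z') = pt (x, z')"
    using off[of z' x s] pt_eq[of x z'] by (cases "z' \<in> faces") (auto simp: y)
   then show ?thesis using True by cases (simp_all add: y d_def w_def mult.commute)
  qed (simp add: z)
 qed
 also have "\<dots> = (LI y. \<mu>eff * (dir_deriv e3 psi y * d i y) + \<mu> / K * (psi y * w i y)) - (LI y. dir_deriv (0, axis i 1, 0) psi y * pt (fst y, fst (snd y)))"
  using i1 i2 by (intro LI_diff) auto
 finally have l: "(LINT (x, z, s):S|lborel.
      \<mu>eff * (horiz (Du (x, z, s)) $ i * dir_deriv e3 psi (x, z, s))
     + \<mu> / K * (horiz (u (x, z, s)) $ i * psi (x, z, s))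
     - \<pi> (x, z) * dir_deriv (0, axis i 1, 0) psi (x, z, s)) = \<dots>" .
 have r: "(LINT (x, z, s):S|lborel. (f x $ i - Dp x $ i) * psi (x, z, s)) = (LI y. psi y * F i (fst y))"
  unfolding set_LI_def
 proof (intro LI_cong refl)
  fix y :: "plane \<times> plane \<times> real"
  obtain x z' s where y: "y = (x, z', s)" by (metis prod.exhaust)
  show "ind S y *r (case y of (x, z, s) => (f x $ i - Dp x $ i) * psi (x, z, s)) = psi y * F i (fst y)"
  proof (cases "y \<in> S")
   case True
   then show ?thesis by (auto simp: y F_def)
  qed (simp add: z)
 qed
 show "(LI y. \<mu>eff * (dir_deriv e3 psi y * d i y) + \<mu> / K * (psi y * w i y))
  - (LI y. dir_deriv (0, axis i 1, 0) psi y * pt (fst y, fst (snd y))) = (LI y. psi y * F i (fst y))"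
  using l r m by simp
qed

text \<open>
  The momentum equation is tested with \<open>\<Theta> (x, z) * \<zeta> s\<close>. The pressure and
  its representative \<open>pt\<close> may differ on the faces, so the derivative of
  \<open>\<Theta>\<close> is required to vanish there.
\<close>

lemma pressure_weak_off:
 assumes \<Theta>: "\<Theta> \<in> test_fun (\<omega> \<times> UNIV)" and off: "!!p. p \<in> UNIV \<times> faces ==> dir_deriv (0, axis i 1) \<Theta> p = 0"
 shows "(LI p. dir_deriv (0, axis i 1) \<Theta> p * pt p) = - (LI p. \<Theta> p * R i p)"
proof -
 define psi where "psi = (%y. \<Theta> (fst y, fst (snd y)) * \<zeta> (snd (snd y)))"
 note T = test_tensor[OF \<Theta> \<zeta>_test, where h=h, folded psi_def \<zeta>'_def]
 have hz: "!!z. 0 <= (0::real) & h_min <= h z" using hbd by auto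
 have psi: "psi \<in> test_fun S" by (rule T(1)[OF hz])
 have d3: "dir_deriv e3 psi y = \<Theta> (fst y, fst (snd y)) * \<zeta>' (snd (snd y))" for y by (rule T(2)[OF hz])
 have dv: "dir_deriv (0, v, 0) psi y = dir_deriv (0, v) \<Theta> (fst y, fst (snd y)) * \<zeta> (snd (snd y))" for y v by (rule T(3)[OF hz])
 have off': "dir_deriv (0, axis i 1, 0) psi (x, z, s) = 0" if "z \<in> faces" for x z s
  using off[of "(x, z)"] that by (simp add: dv)
 note mc = momentum_clean[OF psi off']
 have A: "(LI y. \<mu>eff * (dir_deriv e3 psi y * d i y) + \<mu> / K * (psi y * w i y)) = (LI p. \<Theta> p * G i p)"
 proof -
  have 1: "(%p. LI s. dir_deriv e3 psi (fst p, snd p, s) * d i (fst p, snd p, s)) = (%p. \<Theta> p * (LI s. \<zeta>' s * d i (fst p, snd p, s)))"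
   and 2: "(%p. LI s. psi (fst p, snd p, s) * w i (fst p, snd p, s)) = (%p. \<Theta> p * (LI s. \<zeta> s * w i (fst p, snd p, s)))"
   by (simp add: d3 fun_eq_iff mult.assoc, simp add: psi_def fun_eq_iff mult.assoc)
  have "(LI y. \<mu>eff * (dir_deriv e3 psi y * d i y) + \<mu> / K * (psi y * w i y))
   = \<mu>eff * (LI p. \<Theta> p * (LI s. \<zeta>' s * d i (fst p, snd p, s))) + \<mu> / K * (LI p. \<Theta> p * (LI s. \<zeta> s * w i (fst p, snd p, s)))"
   using mc(2,3) triple_integral(1)[OF mc(2)] triple_integral(1)[OF mc(3)] unfolding 1 2 by simp
  also have "\<dots> = (LI p. \<mu>eff * (\<Theta> p * (LI s. \<zeta>' s * d i (fst p, snd p, s))) + \<mu> / K * (\<Theta> p * (LI s. \<zeta> s * w i (fst p, snd p, s))))"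
   using triple_integral(2)[OF mc(2)] triple_integral(2)[OF mc(3)] unfolding 1 2 by simp
  also have "\<dots> = (LI p. \<Theta> p * G i p)"
   by (intro LI_cong refl) (simp add: G_def algebra_simps)
  finally show ?thesis .
 qed
 have B: "(LI y. dir_deriv (0, axis i 1, 0) psi y * pt (fst y, fst (snd y))) = (LI p. dir_deriv (0, axis i 1) \<Theta> p * pt p)"
 proof -
  have "(LI s. dir_deriv (0, axis i 1, 0) psi (fst p, snd p, s) * pt (fst (fst p, snd p, s), fst (snd (fst p, snd p, s)))) = dir_deriv (0, axis i 1) \<Theta> p * pt p" for p
  proof -
   have "(%s. dir_deriv (0, axis i 1, 0) psi (fst p, snd p, s) * pt (fst (fst p, snd p, s), fst (snd (fst p, snd p, s)))) = (%s. \<zeta> s * (dir_deriv (0, axis i 1) \<Theta> p * pt p))"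
    by (simp add: dv fun_eq_iff)
   then show ?thesis using \<zeta>_int by simp
  qed
  then show ?thesis using triple_integral(1)[OF mc(4)] by presburger
 qed
 have C: "(LI y. psi y * F i (fst y)) = (LI p. \<Theta> p * F i (fst p))"
 proof -
  have "(LI s. psi (fst p, snd p, s) * F i (fst (fst p, snd p, s))) = \<Theta> p * F i (fst p)" for p
  proof -
   have "(%s. psi (fst p, snd p, s) * F i (fst (fst p, snd p, s))) = (%s. \<zeta> s * (\<Theta> p * F i (fst p)))"
    by (simp add: psi_def fun_eq_iff)
   then show ?thesis using \<zeta>_int by simp
  qed
  then show ?thesis using triple_integral(1)[OF mc(5)] by presburger
 qed
 have iQ: "L1 (%p. \<Theta> p * G i p)" by (rule test_times_integrable[OF \<Theta> G_borel loc_mono[OF G_loc]])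
 have iF: "L1 (%p. \<Theta> p * F i (fst p))" by (rule test_times_integrable[OF \<Theta> _ loc_mono[OF F_loc]]) measurable
 have "(LI p. \<Theta> p * R i p) = (LI p. \<Theta> p * F i (fst p)) - (LI p. \<Theta> p * G i p)"
  unfolding R_def right_diff_distrib by (rule LI_diff[OF iF iQ])
 then show ?thesis using mc(1) A B C by simp
qed

lemma pressure_shift:
 assumes \<tau>: "\<tau> >= 0"
 shows "shift_deriv (\<omega> \<times> UNIV) (0, axis i 1) \<tau> pt (R i)"
proof -
 let ?e = "(0, axis i 1) :: plane \<times> plane"
 have e: "?e \<in> Basis" by (auto simp: Basis_prod_def axis_Basis2)
 have "AE p in lborel. (\<forall>r\<in>{0..\<tau>}. p + r *r ?e \<in> \<omega> \<times> UNIV) & p \<notin> UNIV \<times> faces & p + \<tau> *r ?e \<notin> UNIV \<times> faces -->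
   pt (p + \<tau> *r ?e) - pt p = (LINT r:{0..\<tau>}|lborel. R i (p + r *r ?e))"
  by (rule shift_identity_off[OF e \<tau> _ _ pt_borel R_borel loc_mono[OF pt_loc] loc_mono[OF R_loc] pressure_weak_off])
   (auto intro: open_Times \<omega> closed_Times closed_faces)
 moreover have nf: "AE p in lborel. p \<notin> UNIV \<times> faces"
  using AE_snd[OF AE_not_faces] by (auto simp: mem_Times_iff)
 moreover have "AE p in lborel. p + \<tau> *r ?e \<notin> UNIV \<times> faces" by (rule AE_lborel_shift[OF nf])
 ultimately show ?thesis unfolding shift_deriv_def by eventually_elim auto
qed

text \<open>
  The restriction to test functions with vanishing derivative on the faces disappears in the increment
  form.
\<close>

lemma pressure_weak:
 assumes "\<Theta> \<in> test_fun (\<omega> \<times> UNIV)"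
 shows "(LI p. dir_deriv (0, axis i 1) \<Theta> p * pt p) = - (LI p. \<Theta> p * R i p)"
 by (rule shift_imp_weak[OF _ pt_borel R_borel loc_mono[OF pt_loc] loc_mono[OF R_loc] pressure_shift assms])
  (auto intro: open_Times \<omega>)

definition \<kappa> :: "2 => plane \<times> plane \<times> real => real" where
 "\<kappa> i y = (\<mu> / K * w i y - ind S y * G i (fst y, fst (snd y))) / \<mu>eff"

lemma \<kappa>_borel [measurable]: "\<kappa> i \<in> Borel" unfolding \<kappa>_def by measurable

lemma SG_loc: "L1loc UNIV (%y. ind S y * G i (fst y, fst (snd y)))"
 unfolding locally_integrable_def set_integrable_def
proof (intro allI impI)
 fix C :: "(plane \<times> plane \<times> real) set" assume C: "compact C & C \<subseteq> UNIV"
 then have [measurable]: "C \<in> sets borel" by (auto intro: borel_compact)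
 have "L1 (%y. ind C y *r G i (fst y, fst (snd y)))"
  using lift_loc[OF G_loc G_borel] C unfolding locally_integrable_def set_integrable_def by auto
 then show "L1 (%y. ind C y *r (ind S y * G i (fst y, fst (snd y))))"
 proof (rule L1_bound)
  show "AE y in lborel. norm (ind C y *r (ind S y * G i (fst y, fst (snd y)))) <= norm (ind C y *r G i (fst y, fst (snd y)))"
   by (intro AE_I2) (auto simp: indicator_def)
 qed measurable
qed

lemma \<kappa>_loc: "L1loc UNIV (\<kappa> i)"
 using w_loc[of i] SG_loc[of i] unfolding locally_integrable_def \<kappa>_def
 by (auto intro!: set_integral_diff set_integrable_divide set_integrable_mult_right)

text \<open>
  Off the faces the pressure agrees with its representative, so there the momentum equation involves
  \<open>pt\<close> alone.
\<close>

definition Soff :: "(plane \<times> plane \<times> real) set" where "Soff = {y \<in> S. fst (snd y) \<notin> faces}"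

lemma Soff_open: "open Soff"
proof -
 have "open (S \<inter> (%y. fst (snd y)) -` (- faces))"
  by (intro open_Int S_open open_vimage open_Compl closed_faces continuous_intros)
 moreover have "S \<inter> (%y. fst (snd y)) -` (- faces) = Soff" by (auto simp: Soff_def)
 ultimately show ?thesis by simp
qed

text \<open>
  With the gradient of the pressure known, the momentum equation contains only vertical derivatives.
\<close>

lemma vertical_weak:
 assumes psi: "psi \<in> test_fun Soff"
 shows "(LI y. dir_deriv e3 psi y * d i y) = - (LI y. psi y * \<kappa> i y)"
proof -
 have psiS: "psi \<in> test_fun S" by (rule test_fun_mono[OF psi]) (auto simp: Soff_def)
 obtain C where C: "C \<subseteq> Soff" "!!y. y \<notin> C ==> psi y = 0" "!!y v. y \<notin> C ==> dir_deriv v psi y = 0" using test_funD[OF psi] by metis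
 have off: "dir_deriv (0, axis i 1, 0) psi (x, z, s) = 0" if "z \<in> faces" for x z s
  using C(1) that by (intro C(3)) (auto simp: Soff_def)
 note mc = momentum_clean[OF psiS off]
 have iR: "L1 (%y. psi y * R i (fst y, fst (snd y)))"
  by (rule test_times_integrable[OF psi _ loc_mono[OF lift_loc[OF R_loc R_borel]]]) measurable
 have SS: "Soff \<subseteq> \<omega> \<times> UNIV" by (auto simp: Soff_def)
 have P: "(LI y. dir_deriv (0, axis i 1, 0) psi y * pt (fst y, fst (snd y))) = - (LI y. psi y * R i (fst y, fst (snd y)))"
 proof -
  have "(LI p. dir_deriv (0, axis i 1, 0) psi (fst p, snd p, s) * pt p) = - (LI p. psi (fst p, snd p, s) * R i p)" for s
   using pressure_weak[OF test_slice(1)[OF psi SS, where s=s], where i=i] by (simp only: test_slice(2)[OF psi SS])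
  moreover have "(LI y. dir_deriv (0, axis i 1, 0) psi y * pt (fst y, fst (snd y))) = (LI s. LI p. dir_deriv (0, axis i 1, 0) psi (fst p, snd p, s) * pt p)"
   using triple_integral_swap[OF mc(4)] by simp
  moreover have "(LI y. psi y * R i (fst y, fst (snd y))) = (LI s. LI p. psi (fst p, snd p, s) * R i p)"
   using triple_integral_swap[OF iR] by simp
  ultimately show ?thesis by simp
 qed
 have Gpsi: "psi y * (ind S y * G i (fst y, fst (snd y))) = psi y * F i (fst y) - psi y * R i (fst y, fst (snd y))" for y
  using C(1) C(2)[of y] by (cases "y \<in> S") (auto simp: Soff_def R_def algebra_simps)
 have iG: "L1 (%y. psi y * (ind S y * G i (fst y, fst (snd y))))"
  unfolding Gpsi using mc(5) iR by simp
 have "(LI y. psi y * (ind S y * G i (fst y, fst (snd y)))) = (LI y. psi y * F i (fst y)) - (LI y. psi y * R i (fst y, fst (snd y)))"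
  unfolding Gpsi using mc(5) iR by simp
 then have 1: "(LI y. \<mu>eff * (dir_deriv e3 psi y * d i y) + \<mu> / K * (psi y * w i y)) = (LI y. psi y * (ind S y * G i (fst y, fst (snd y))))"
  using mc(1) P by simp
 have "(LI y. psi y * \<kappa> i y) = (LI y. (\<mu> / K * (psi y * w i y) - psi y * (ind S y * G i (fst y, fst (snd y)))) / \<mu>eff)"
  by (intro LI_cong refl) (simp add: \<kappa>_def algebra_simps)
 also have "\<dots> = (\<mu> / K * (LI y. psi y * w i y) - (LI y. psi y * (ind S y * G i (fst y, fst (snd y))))) / \<mu>eff"
  using mc(3) iG by simp
 also have "\<dots> = - (LI y. dir_deriv e3 psi y * d i y)"
  using 1 mc(2,3) pos by (simp add: field_simps)
 finally show ?thesis by simp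
qed

lemma AE_vertical_integrable:
 fixes k :: "plane \<times> plane \<times> real => real"
 assumes k: "L1loc UNIV k" and out: "!!y. y \<notin> S ==> k y = 0"
 shows "AE p in lborel. L1 (%s. k (fst p, snd p, s))"
proof -
 let ?C = "%n::nat. cbox (- real n *r One, - real n *r One, - h_max) (real n *r One, real n *r One, h_max) :: (plane \<times> plane \<times> real) set"
 have "AE p in lborel. \<forall>n. L1 (%s. ind (?C n) (fst p, snd p, s) * k (fst p, snd p, s))"
  unfolding AE_all_countable
 proof
  fix n
  have "L1 (%y. ind (?C n) y * k y)"
  proof -
   have "set_integrable lborel (?C n) k" using k compact_cbox unfolding locally_integrable_def by blast
   then show ?thesis by (simp add: set_integrable_def)
  qed
  from triple_integral(3)[OF this]
  show "AE p in lborel. L1 (%s. ind (?C n) (fst p, snd p, s) * k (fst p, snd p, s))" by simp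
 qed
 then show ?thesis
 proof eventually_elim
  case (elim p)
  obtain n :: nat where n: "norm (fst p) <= real n" "norm (snd p) <= real n"
   using real_arch_simple[of "max (norm (fst p)) (norm (snd p))"] by auto
  have eq: "ind (?C n) (fst p, snd p, s) * k (fst p, snd p, s) = k (fst p, snd p, s)" for s
  proof (cases "(fst p, snd p, s) \<in> S")
   case True
   then have "0 < s" "s < h_max" using hbd[of "snd p"] by (auto simp: Zper_def)
   moreover have "v \<in> cbox (- real n *r One) (real n *r One)" if "norm v <= real n" for v :: plane
   proof -
    have "\<bar>v \<bullet> j\<bar> <= real n" if "j \<in> Basis" for j
     using Basis_le_norm[OF that, of v] \<open>norm v <= real n\<close> by linarith
    then have "- real n <= v \<bullet> j & v \<bullet> j <= real n" if "j \<in> Basis" for j using that by (meson abs_le_D1 abs_le_D2 minus_le_iff)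
    then show ?thesis by (simp add: mem_box)
   qed
   ultimately have "(fst p, snd p, s) \<in> ?C n" using n by (simp add: cbox_Pair_eq)
   then show ?thesis by simp
  qed (simp add: out)
  show ?case using elim[rule_format, of n] unfolding eq .
 qed
qed

lemma w_vert: "AE p in lborel. L1 (%s. w i (fst p, snd p, s))"
 and d_vert: "AE p in lborel. L1 (%s. d i (fst p, snd p, s))"
 and \<kappa>_vert: "AE p in lborel. L1 (%s. \<kappa> i (fst p, snd p, s))"
 by (rule AE_vertical_integrable[OF w_loc] AE_vertical_integrable[OF d_loc] AE_vertical_integrable[OF \<kappa>_loc],
   simp add: w_def d_def \<kappa>_def)+

text \<open>
  Increments of almost every length over almost every point, reordered by Fubini, say that almost
  every vertical line carries an antiderivative.
\<close>

lemma d_antiderivative: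
 "AE p in lborel. p \<in> \<omega> \<times> UNIV --> (\<exists>c. AE s in lborel. 0 < s & s < h (snd p) -->
   d i (fst p, snd p, s) = c + (LINT r:{0..s}|lborel. \<kappa> i (fst p, snd p, r)))"
proof -
 define Iv where "Iv \<tau> y = (LI r. (if 0 <= r & r <= \<tau> then \<kappa> i (y + r *r e3) else 0))" for \<tau> y
 have Iv: "Iv \<tau> y = (LINT r:{0..\<tau>}|lborel. \<kappa> i (y + r *r e3))" for \<tau> y
  unfolding Iv_def set_LI_def by (intro LI_cong) auto
 have [measurable]: "(%x. Iv (fst x) (snd x)) \<in> borel_measurable (borel \<Otimes>\<^sub>M borel)"
  unfolding Iv_def by measurable
 define P where "P \<tau> y \<longleftrightarrow> (0 < \<tau> & fst y \<in> \<omega> & fst (snd y) \<notin> faces & 0 < snd (snd y) & snd (snd y) + \<tau> < h (fst (snd y)) -->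
   d i (y + \<tau> *r e3) - d i y = Iv \<tau> y)" for \<tau> y
 have [measurable]: "faces \<in> sets borel" by (rule borel_closed[OF closed_faces])
 have ae: "AE y in lborel. P \<tau> y" for \<tau>
 proof (cases "\<tau> > 0")
  case True
  have "AE y in lborel. (\<forall>r\<in>{0..\<tau>}. y + r *r e3 \<in> Soff) & y \<notin> {} & y + \<tau> *r e3 \<notin> {} -->
   d i (y + \<tau> *r e3) - d i y = (LINT r:{0..\<tau>}|lborel. \<kappa> i (y + r *r e3))"
   by (rule shift_identity_off[OF e3_Basis _ Soff_open closed_empty d_borel \<kappa>_borel loc_mono[OF d_loc] loc_mono[OF \<kappa>_loc] vertical_weak])
    (use True in auto)
  then show ?thesis
  proof eventually_elim
   case (elim y)
   show ?case unfolding P_def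
   proof
    assume a: "0 < \<tau> & fst y \<in> \<omega> & fst (snd y) \<notin> faces & 0 < snd (snd y) & snd (snd y) + \<tau> < h (fst (snd y))"
    have "\<forall>r\<in>{0..\<tau>}. y + r *r e3 \<in> Soff"
     using a by (cases y) (auto simp: e3_def Soff_def Zper_def)
    then show "d i (y + \<tau> *r e3) - d i y = Iv \<tau> y"
     using elim by (simp add: Iv)
   qed
  qed
 qed (simp add: P_def)
 have "(AE \<tau> in lborel. AE y in lborel. P \<tau> y) \<longleftrightarrow> (AE y in lborel. AE \<tau> in lborel. P \<tau> y)"
 proof (rule lborel_pair.AE_commute)
  show "{x \<in> space (lborel \<Otimes>\<^sub>M lborel). P (fst x) (snd x)} \<in> sets (lborel \<Otimes>\<^sub>M lborel)"
   unfolding P_def by measurable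
 qed
 then have "AE y in lborel. AE \<tau> in lborel. P \<tau> y" using ae by simp
 from AE_triple[OF this] AE_snd[OF AE_not_faces] \<kappa>_vert[of i] show ?thesis
 proof eventually_elim
  case (elim p)
  show ?case
  proof
   assume p: "p \<in> \<omega> \<times> UNIV"
   show "\<exists>c. AE s in lborel. 0 < s & s < h (snd p) --> d i (fst p, snd p, s) = c + (LINT r:{0..s}|lborel. \<kappa> i (fst p, snd p, r))"
   proof (rule AE_increment_imp_antiderivative[OF hpos elim(3)])
    show "AE s in lborel. AE \<tau> in lborel. 0 < \<tau> & 0 < s & s + \<tau> < h (snd p) -->
     d i (fst p, snd p, s + \<tau>) - d i (fst p, snd p, s) = (LINT r:{0..\<tau>}|lborel. \<kappa> i (fst p, snd p, s + r))"
     using elim(1)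
    proof eventually_elim
     case (elim s)
     then show ?case by eventually_elim (use p \<open>snd p \<notin> faces\<close> in \<open>auto simp: P_def Iv e3_add\<close>)
    qed
   qed
  qed
 qed
qed

lemma trace_component:
 assumes "psi \<in> test_fun UNIV"
  and vec: "(LINT y:S|lborel. dir_deriv e3 psi y *r horiz (u y) + psi y *r horiz (Du y)) = 0"
 shows "(LINT y:S|lborel. dir_deriv e3 psi y * horiz (u y) $ i + psi y * horiz (Du y) $ i) = 0"
proof -
 have i: "L1 (%y. dir_deriv e3 psi y * w j y + psi y * d j y)" for j
  using test_times_integrable[OF test_fun_dir[OF assms(1)] w_borel w_loc] test_times_integrable[OF assms(1) d_borel d_loc] by simp
 have eq: "(ind S y *r (dir_deriv e3 psi y *r horiz (u y) + psi y *r horiz (Du y))) $ j = dir_deriv e3 psi y * w j y + psi y * d j y" for y j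
  by (simp add: w_def d_def algebra_simps)
 have "L1 (%y. ind S y *r (dir_deriv e3 psi y *r horiz (u y) + psi y *r horiz (Du y)))"
  by (rule integrable_vec2) (simp only: eq i)
 from integral_nth[OF this, of i] vec
 show ?thesis unfolding set_LI_def by (simp add: eq w_def d_def algebra_simps)
qed

lemma zero_loc: "L1loc T (%_::'a::euclidean_space. 0::real)"
 by (simp add: locally_integrable_def set_integrable_def)

lemma w_bottom: "AE y in lborel. y \<in> S --> w i y = (LINT r:{0..snd (snd y)}|lborel. d i (fst y, fst (snd y), r))"
proof -
 have "AE y in lborel. y \<in> S --> horiz (u y) $ i = 0 +
  (LINT r:{0..snd (snd y)}|lborel. ind S (fst y, fst (snd y), r) * horiz (Du (fst y, fst (snd y), r)) $ i)"
 proof (rule bottom_FTC[OF \<omega> hc hpos _ u_up Du_up zero_loc])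
  fix psi assume psi: "psi \<in> test_fun {(x, z, s). x \<in> \<omega> & s < h z}"
  have "(LINT y:S|lborel. dir_deriv e3 psi y *r horiz (u y) + psi y *r horiz (Du y)) = 0"
   using tb psi by (auto simp: trace_bottom_def set_LI_def split_beta')
  from trace_component[OF test_fun_mono[OF psi subset_UNIV] this]
  show "(LINT y:S|lborel. dir_deriv e3 psi y * horiz (u y) $ i + psi y * horiz (Du y) $ i) = - (LINT (x, z):\<omega> \<times> UNIV|lborel. psi (x, z, 0) * 0)"
   by (simp add: set_LI_def split_beta')
 qed (use hbd in auto)
 then show ?thesis by eventually_elim (simp add: w_def d_def)
qed

lemma w_top: "AE y in lborel. y \<in> S --> w i y = - (LINT r:{snd (snd y)..h (fst (snd y))}|lborel. d i (fst y, fst (snd y), r))"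
proof -
 have "AE y in lborel. y \<in> S --> horiz (u y) $ i = 0 -
  (LINT r:{snd (snd y)..h (fst (snd y))}|lborel. ind S (fst y, fst (snd y), r) * horiz (Du (fst y, fst (snd y), r)) $ i)"
 proof (rule top_FTC[OF \<omega> hc hpos _ u_up Du_up zero_loc])
  fix psi assume psi: "psi \<in> test_fun {(x, z :: real^2, s :: real). x \<in> \<omega> & 0 < s}"
  have "(LINT y:S|lborel. dir_deriv e3 psi y *r horiz (u y) + psi y *r horiz (Du y)) = 0"
   using tt psi by (auto simp: trace_top_def set_LI_def split_beta')
  from trace_component[OF test_fun_mono[OF psi subset_UNIV] this]
  show "(LINT y:S|lborel. dir_deriv e3 psi y * horiz (u y) $ i + psi y * horiz (Du y) $ i) = (LINT (x, z):\<omega> \<times> UNIV|lborel. psi (x, z, h z) * 0)"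
   by (simp add: set_LI_def split_beta')
 qed (use hbd in auto)
 then show ?thesis by eventually_elim (simp add: w_def d_def)
qed

text \<open>
  The two trace conditions give \<open>w\<close> as integrals of \<open>d\<close> from either face;
  together they say that \<open>d\<close> has integral zero over the fibre, which fixes the constant
  in \<open>d\<close>.
\<close>

theorem velocity_profile:
 "AE p in lborel. p \<in> \<omega> \<times> UNIV --> (AE s in lborel. 0 < s & s < h (snd p) -->
   w i (fst p, snd p, s) = (K / \<mu>) * G i p * profile M (h (snd p)) s)"
 using AE_triple[OF w_bottom[of i]] AE_triple[OF w_top[of i]] d_antiderivative[of i] d_vert[of i] \<kappa>_vert[of i]
proof eventually_elim
 case (elim p)
 show ?case
 proof
  assume p: "p \<in> \<omega> \<times> UNIV"
  let ?h = "h (snd p)" and ?w = "%s. w i (fst p, snd p, s)" and ?d = "%s. d i (fst p, snd p, s)" and ?k = "%s. \<kappa> i (fst p, snd p, s)"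
  have inS: "(fst p, snd p, s) \<in> S" if "0 < s" "s < ?h" for s using p that by (auto simp: Zper_def mem_Times_iff)
  have id: "L1 (%r. ind {0..?h} r * ?d r)"
   by (rule L1_bound[OF elim(4)]) (use elim(4) in \<open>auto simp: indicator_def\<close>)
  have wb: "AE s in lborel. 0 < s & s < ?h --> ?w s = (LINT r:{0..s}|lborel. ?d r)"
   using elim(1) by eventually_elim (use inS in auto)
  have wt: "AE s in lborel. 0 < s & s < ?h --> ?w s = - (LINT r:{s..?h}|lborel. ?d r)"
   using elim(2) by eventually_elim (use inS in auto)
  have "AE s in lborel. (0 < s & s < ?h --> ?w s = (LINT r:{0..s}|lborel. ?d r)) & (0 < s & s < ?h --> ?w s = - (LINT r:{s..?h}|lborel. ?d r))"
   using wb wt by eventually_elim auto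
  from AE_real_ex[OF this hpos[of "snd p"]] obtain s where s: "0 < s" "s < ?h" "?w s = (LINT r:{0..s}|lborel. ?d r)" "?w s = - (LINT r:{s..?h}|lborel. ?d r)" by blast
  have z: "(LINT r:{0..?h}|lborel. ?d r) = 0" using LINT_split[OF id, of s] s by simp
  obtain c where c: "AE s in lborel. 0 < s & s < ?h --> ?d s = c + (LINT r:{0..s}|lborel. ?k r)" using elim(3) p by blast
  have k: "?k r = M^2 * ?w r - G i p / \<mu>eff" if "0 < r & r < ?h" for r
   using inS[of r] that pos by (simp add: \<kappa>_def M_sq field_simps)
  have "AE s in lborel. 0 < s & s < ?h --> ?w s = ((G i p / \<mu>eff) / M^2) * profile M ?h s"
   by (rule profile_from_ode[OF M_pos hpos id wb z k elim(5) c])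
  then show "AE s in lborel. 0 < s & s < ?h --> ?w s = (K / \<mu>) * G i p * profile M ?h s"
  proof eventually_elim
   case (elim s)
   have "(G i p / \<mu>eff) / M^2 = (K / \<mu>) * G i p" unfolding M_sq using pos by (simp add: field_simps)
   then show ?case using elim by simp
  qed
 qed
qed

end

section \<open>The cell problem and the effective matrix\<close>

lemma profile_factor:
 assumes "M > 0" "t > 0"
 shows "profile M t s = (exp (M * t) - 1) * (exp (M * s) - 1) * (exp (M * t) - exp (M * s))
     / (exp (M * t) * exp (M * s) * (exp (M * t) - exp (- M * t)))"
proof -
 define x y where "x = exp (M * s)" and "y = exp (M * t)"
 have xy: "x > 0" "y > 1" using assms by (auto simp: x_def y_def)
 have e: "exp (- (M * s)) = 1 / x" "exp (- (M * t)) = 1 / y" by (auto simp: x_def y_def exp_minus inverse_eq_divide)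
 have "y * y > 1" using xy by (simp add: less_1_mult)
 then have "y - 1 / y ~= 0" using xy by (simp add: field_simps)
 then show ?thesis using xy
  by (simp add: profile_def A1star_def A2star_def e flip: x_def y_def) (simp add: divide_simps, simp add: algebra_simps)
qed

lemma profile_pos:
 assumes "M > 0" "0 < s" "s < t" shows "0 < profile M t s"
proof -
 have "0 < t" using assms by simp
 have "M * s < M * t" using assms by simp
 then have "exp (M * s) < exp (M * t)" by simp
 moreover have "1 < exp (M * s)" "1 < exp (M * t)" "exp (- M * t) < exp (M * t)" using assms by auto
 ultimately show ?thesis unfolding profile_factor[OF assms(1) \<open>0 < t\<close>] by simp
qed

lemma profile_integral:
 assumes "M > 0" "t > 0"
 shows "(LINT s:{0..t}|lborel. profile M t s) = - mobility M t" "set_integrable lborel {0..t} (profile M t)"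
proof -
 let ?A = "%s. A1star M t / M * exp (M * s) - A2star M t / M * exp (- M * s) + s"
 have c: "continuous_on S (profile M t)" for S unfolding profile_def by (intro continuous_intros)
 show "set_integrable lborel {0..t} (profile M t)" by (rule borel_integrable_atLeastAtMost') (rule c)
 have "(LINT s:{0..t}|lborel. profile M t s) = ?A t - ?A 0"
 proof (rule LINT_FTC)
  show "(?A has_real_derivative profile M t x) (at x)" for x
   using assms by (auto intro!: derivative_eq_intros simp: profile_def)
 qed (use assms c in auto)
 also have "\<dots> = - mobility M t"
 proof -
  define y where "y = exp (M * t)"
  have y: "y > 1" using assms by (auto simp: y_def)
  have e: "exp (- (M * t)) = 1 / y" by (auto simp: y_def exp_minus inverse_eq_divide)
  have "y * y > 1" using y by (simp add: less_1_mult)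
  then have "y - 1 / y ~= 0" using y by (simp add: field_simps)
  then show ?thesis using y assms
   by (simp add: mobility_def A1star_def A2star_def e flip: y_def) (simp add: divide_simps, simp add: algebra_simps)
 qed
 finally show "(LINT s:{0..t}|lborel. profile M t s) = - mobility M t" .
qed

text \<open>
  Minus the mobility is the integral of the profile, which is positive between its two zeros.
\<close>

lemma mobility_neg:
 assumes "M > 0" "t > 0" shows "0 < - mobility M t"
proof -
 have i: "L1 (%s. ind {0..t} s * profile M t s)"
  using profile_integral(2)[OF assms] by (simp add: set_integrable_def)
 have nn: "0 <= ind {0..t} s * profile M t s" for s
  using profile_pos[of M s t] profile_ends[OF assms] assms(1)
  by (cases "s = 0"; cases "s = t") (auto simp: indicator_def intro: less_imp_le)
 have "(LI s. ind {0..t} s * profile M t s) ~= 0"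
 proof
  assume "(LI s. ind {0..t} s * profile M t s) = 0"
  then have "AE s in lborel. ind {0..t} s * profile M t s = 0"
   using integral_nonneg_eq_0_iff_AE[OF i] nn by auto
  from AE_real_ex[OF this assms(2)] obtain s where "0 < s" "s < t" "ind {0..t} s * profile M t s = 0" by blast
  then show False using profile_pos[OF assms(1), of s t] by simp
 qed
 moreover have "(LI s. ind {0..t} s * profile M t s) >= 0"
  by (rule LI_nonneg) (rule nn)
 ultimately show ?thesis using profile_integral(1)[OF assms] by (simp add: set_LI_def)
qed

lemma mobility_bounds:
 assumes "M > 0" "0 < h_min" "h_min <= h_max"
 obtains a0 a1 where "a0 > 0" "!!t. h_min <= t ==> t <= h_max ==> a0 <= - mobility M t & - mobility M t <= a1"
proof -
 have c: "continuous_on {h_min..h_max} (%t. - mobility M t)"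
 proof -
  have "exp (M * t) - exp (- M * t) ~= 0" if "t \<in> {h_min..h_max}" for t
   using that assms by auto
  then show ?thesis unfolding mobility_def by (intro continuous_intros) (use assms in auto)
 qed
 obtain t0 where t0: "t0 \<in> {h_min..h_max}" "!!t. t \<in> {h_min..h_max} ==> - mobility M t0 <= - mobility M t"
  using continuous_attains_inf[OF compact_Icc _ c] assms by auto
 obtain t1 where t1: "t1 \<in> {h_min..h_max}" "!!t. t \<in> {h_min..h_max} ==> - mobility M t <= - mobility M t1"
  using continuous_attains_sup[OF compact_Icc _ c] assms by auto
 show ?thesis
 proof (rule that)
  show "0 < - mobility M t0" using mobility_neg[of M t0] t0(1) assms by auto
  show "- mobility M t0 <= - mobility M t & - mobility M t <= - mobility M t1" if "h_min <= t" "t <= h_max" for t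
   using t0(2)[of t] t1(2)[of t] that by simp
 qed
qed

lemma weak_div_iff:
 fixes v :: "plane => plane"
 shows "weak_div \<Omega> v (%_. 0) \<longleftrightarrow> L1loc \<Omega> v & (\<forall>psi\<in>test_fun \<Omega>. (LI x. v x \<bullet> grad psi x) = 0)"
proof -
 have "(LINT x:\<Omega>|lborel. v x \<bullet> grad psi x) = (LI x. v x \<bullet> grad psi x)" if psi: "psi \<in> test_fun \<Omega>" for psi
  unfolding set_LI_def
 proof (intro LI_cong refl)
  fix x
  obtain C where "C \<subseteq> \<Omega>" "!!y v. y \<notin> C ==> dir_deriv v psi y = 0" using test_funD[OF psi] by metis
  then have "x \<notin> \<Omega> ==> v x \<bullet> grad psi x = 0" by (simp add: grad_inner subset_iff) (metis mult_zero_right add_0)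
  then show "ind \<Omega> x *r (v x \<bullet> grad psi x) = v x \<bullet> grad psi x" by (auto simp: indicator_def)
 qed
 moreover have "L1loc \<Omega> (%_. 0 :: real)" by (simp add: locally_integrable_def set_integrable_def)
 ultimately show ?thesis by (simp add: weak_div_def set_LI_def)
qed

lemma L2per_locally_integrable2:
 assumes "L2per (F :: plane => plane)" shows "L1loc S F"
 unfolding locally_integrable_def set_integrable_def
proof (intro allI impI integrable_vec2)
 fix C i assume "compact C & C \<subseteq> S"
 then show "L1 (%y. (ind C y *r F y) $ i)"
  using L2per_locally_integrable[OF L2per_component[OF assms, of i], of S]
  by (simp add: locally_integrable_def set_integrable_def)
qed

locale rough_cell =
 fixes h :: "plane => real" and h_min h_max M :: real
 assumes hc: "continuous_on UNIV h" and hper: "periodic h" and hmin: "0 < h_min"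
  and hbd: "!!z. h_min <= h z & h z <= h_max" and Mpos: "M > 0"
begin

definition a :: "plane => real" where "a z = - mobility M (h z)"

lemma weight: obtains a0 a1 where "cell_weight a a0 a1"
proof -
 have "h_min <= h_max" using hbd[of 0] by linarith
 from mobility_bounds[OF Mpos hmin this] obtain a0 a1 where b: "a0 > 0" "!!t. h_min <= t ==> t <= h_max ==> a0 <= - mobility M t & - mobility M t <= a1"
  by blast
 have [measurable]: "h \<in> Borel" by (rule borel_measurable_continuous_onI[OF hc])
 show ?thesis
 proof (rule that, unfold_locales)
  show "a \<in> Borel" unfolding a_def mobility_def by measurable
  show "periodic a" unfolding a_def by (rule periodic_comp[OF hper])
 qed (use b hbd in \<open>auto simp: a_def\<close>)
qed

lemma cell_problem_iff:
 "cell_problem h M i \<pi> D\<pi> \<longleftrightarrow> H1_per \<pi> D\<pi> &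
  (\<forall>eta\<in>test_fun UNIV. (LI z. (a z *r (axis i 1 + D\<pi> z)) \<bullet> grad eta z) = 0)"
proof (cases "H1_per \<pi> D\<pi>")
 case True
 obtain a0 a1 where "cell_weight a a0 a1" by (rule weight)
 then interpret cell_weight a a0 a1 .
 have L: "L2per (%z. a z *r (axis i 1 + D\<pi> z))" by (intro aF L2per_add L2per_const H1_perD(2)[OF True])
 have eq: "(%z. mobility M (h z) *r (axis i 1 + D\<pi> z)) = (%z. - (a z *r (axis i 1 + D\<pi> z)))" by (simp add: a_def fun_eq_iff)
 have "L1loc UNIV (%z. - (a z *r (axis i 1 + D\<pi> z)))"
  using L2per_locally_integrable2[OF L2per_scale[OF L, of "-1"], of UNIV] by simp
 then show ?thesis using True unfolding cell_problem_def weak_div_iff eq by (simp add: inner_minus_left)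
qed (simp add: cell_problem_def)

lemma cell_orthogonal:
 assumes "cell_problem h M i \<pi> D\<pi>" "H1_per \<phi> \<Phi>"
 shows "ip (%z. a z *r (axis i 1 + D\<pi> z)) \<Phi> = 0"
proof -
 obtain a0 a1 where "cell_weight a a0 a1" by (rule weight)
 then interpret cell_weight a a0 a1 .
 have H: "H1_per \<pi> D\<pi>" using assms(1) by (simp add: cell_problem_def)
 show ?thesis
  by (rule divfree_orthogonal[OF aF[OF L2per_add[OF L2per_const H1_perD(2)[OF H]]] _ assms(2)])
   (use assms(1) cell_problem_iff in blast)
qed

theorem cell_problem_exists: "\<exists>\<pi> D\<pi>. cell_problem h M i \<pi> D\<pi>"
proof -
 obtain a0 a1 where "cell_weight a a0 a1" by (rule weight)
 then interpret cell_weight a a0 a1 .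
 obtain \<pi> D\<pi> where H: "H1_per \<pi> D\<pi>" and o: "!!\<phi> \<Phi>. H1_per \<phi> \<Phi> ==> wip (%z. axis i 1 + D\<pi> z) \<Phi> = 0"
  by (rule minimizer_exists[where e="axis i 1"]) (rule that)
 have "(LI z. (a z *r (axis i 1 + D\<pi> z)) \<bullet> grad eta z) = 0" if "eta \<in> test_fun UNIV" for eta
  by (rule orthogonal_imp_divfree[OF aF[OF L2per_add[OF L2per_const H1_perD(2)[OF H]]] _ that]) (use o in \<open>simp add: wip_def\<close>)
 then show ?thesis using H cell_problem_iff by blast
qed

theorem cell_problem_unique:
 assumes p: "cell_problem h M i \<pi> D\<pi>" and r: "cell_problem h M i \<rho> D\<rho>"
 shows "\<exists>c. AE z in lborel. \<rho> z = \<pi> z + c"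
proof -
 obtain a0 a1 where "cell_weight a a0 a1" by (rule weight)
 then interpret cell_weight a a0 a1 .
 have Hp: "H1_per \<pi> D\<pi>" and Hr: "H1_per \<rho> D\<rho>" using p r by (auto simp: cell_problem_def)
 have H: "H1_per (%z. \<rho> z - \<pi> z) (%z. D\<rho> z - D\<pi> z)" using H1_per_lin[OF Hr Hp, of "-1"] by simp
 let ?E = "%z. D\<rho> z - D\<pi> z"
 have Lp: "L2per (%z. axis i 1 + D\<pi> z)" and Lr: "L2per (%z. axis i 1 + D\<rho> z)"
  by (intro L2per_add L2per_const H1_perD(2)[OF Hp] H1_perD(2)[OF Hr])+
 have "wip (%z. (axis i 1 + D\<rho> z) - (axis i 1 + D\<pi> z)) ?E = 0"
  using cell_orthogonal[OF p H] cell_orthogonal[OF r H] wip_diff_left[OF H1_perD(2)[OF H] Lr Lp] by (simp add: wip_def)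
 then have "AE z in lborel. ?E z = 0" by (intro wip_zero H1_perD(2)[OF H]) simp
 from H1_per_zero_grad[OF H this] obtain c where "AE z in lborel. \<rho> z - \<pi> z = c" by blast
 then have "AE z in lborel. \<rho> z = \<pi> z + c" by eventually_elim simp
 then show ?thesis ..
qed

end

locale cell_solution = rough_cell +
 fixes \<pi>s :: "2 => plane => real" and D\<pi> :: "2 => plane => plane"
 assumes cell: "!!i. cell_problem h M i (\<pi>s i) (D\<pi> i)"
begin

abbreviation A :: "real^2^2" where "A \<equiv> A_mat h M D\<pi>"

lemma corrector: "H1_per (\<pi>s i) (D\<pi> i)" using cell by (simp add: cell_problem_def)
lemma corrected_L2: "L2per (%z. axis i 1 + D\<pi> i z)" by (intro L2per_add L2per_const H1_perD(2)[OF corrector])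

text \<open>
  The corrected constant field: \<open>\<xi>\<close> plus the gradient of the corrector that makes its
  flux divergence free.
\<close>

definition X :: "plane => plane => plane" where "X \<xi> z = (\<Sum>i\<in>UNIV. \<xi> $ i *r (axis i 1 + D\<pi> i z))"

lemma X_eq: "X \<xi> z = \<xi> + (\<xi> $ 1 *r D\<pi> 1 z + \<xi> $ 2 *r D\<pi> 2 z)"
proof -
 have "\<xi> = \<xi> $ 1 *r axis 1 1 + \<xi> $ 2 *r axis 2 1" by (auto simp: vec_eq_iff forall_2 axis_def)
 then show ?thesis by (simp add: X_def sum_2 algebra_simps)
qed

lemma X_corrector: "H1_per (%z. \<xi> $ 1 * \<pi>s 1 z + \<xi> $ 2 * \<pi>s 2 z) (%z. \<xi> $ 1 *r D\<pi> 1 z + \<xi> $ 2 *r D\<pi> 2 z)"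
 using H1_per_lin[OF H1_per_lin[OF H1_per_const[of 0] corrector[of 1], of "\<xi> $ 1"] corrector[of 2], of "\<xi> $ 2"] by simp

lemma X_L2: "L2per (X \<xi>)"
 unfolding X_eq[abs_def] by (intro L2per_add L2per_const H1_perD(2)[OF X_corrector])

lemma A_entry: "A $ i $ j = ip (%z. a z *r (axis i 1 + D\<pi> i z)) (%z. axis j 1)"
proof -
 have "ip (%z. a z *r (axis i 1 + D\<pi> i z)) (%z. axis j 1) = (LI z. - (ind cell z * (mobility M (h z) * ((axis i 1 + D\<pi> i z) \<bullet> axis j 1))))"
  unfolding ip_def by (intro LI_cong refl) (simp add: a_def)
 then show ?thesis by (simp add: A_mat_def set_LI_def)
qed

lemma X_orthogonal: "H1_per \<phi> \<Phi> ==> ip (%z. a z *r X \<xi> z) \<Phi> = 0"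
proof -
 assume H: "H1_per \<phi> \<Phi>"
 obtain a0 a1 where "cell_weight a a0 a1" by (rule weight)
 then interpret cell_weight a a0 a1 .
 have e: "X \<xi> = (%z. \<xi> $ 1 *r (axis 1 1 + D\<pi> 1 z) + \<xi> $ 2 *r (axis 2 1 + D\<pi> 2 z))" by (simp add: X_def sum_2 fun_eq_iff)
 have "wip (X \<xi>) \<Phi> = 0"
  unfolding e wip_add_left[OF H1_perD(2)[OF H] L2per_scale[OF corrected_L2] L2per_scale[OF corrected_L2]] wip_scale_left
  using cell_orthogonal[OF cell H] by (simp add: wip_def)
 then show ?thesis by (simp add: wip_def)
qed

text \<open>
  The definition of \<open>A_mat\<close> pairs a corrected field with a constant one; completing the
  constant field by its corrector does not change the pairing, because fluxes of corrected fields are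
  orthogonal to gradients.
\<close>

lemma A_bilinear: "eta \<bullet> (A *v \<xi>) = ip (%z. a z *r X eta z) (X \<xi>)"
proof -
 obtain a0 a1 where "cell_weight a a0 a1" by (rule weight)
 then interpret cell_weight a a0 a1 .
 have c: "L2per (%z. axis j 1 :: real^2)" for j by (rule L2per_const)
 have entry: "wip (X eta) (%z. axis j 1) = eta $ 1 * A $ 1 $ j + eta $ 2 * A $ 2 $ j" for j
 proof -
  have e: "X eta = (%z. eta $ 1 *r (axis 1 1 + D\<pi> 1 z) + eta $ 2 *r (axis 2 1 + D\<pi> 2 z))" by (simp add: X_def sum_2 fun_eq_iff)
  show ?thesis unfolding e wip_add_left[OF c L2per_scale[OF corrected_L2] L2per_scale[OF corrected_L2]] wip_scale_left
   by (simp add: A_entry wip_def)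
 qed
 have "ip (%z. a z *r X eta z) (X \<xi>) = wip (X eta) (%z. \<xi>)"
  using wip_add_right[OF X_L2 L2per_const H1_perD(2)[OF X_corrector], of eta \<xi> \<xi>] X_orthogonal[OF X_corrector, of eta \<xi>]
  by (simp add: X_eq[of \<xi>, abs_def] wip_def)
 also have "\<dots> = wip (X eta) (%z::real^2. \<xi> $ 1 *r axis 1 1 + \<xi> $ 2 *r axis 2 1)"
  by (rule arg_cong[of _ _ "wip (X eta)"]) (auto simp: fun_eq_iff vec_eq_iff forall_2 axis_def)
 also have "\<dots> = \<xi> $ 1 * wip (X eta) (%z. axis 1 1) + \<xi> $ 2 * wip (X eta) (%z. axis 2 1)"
  unfolding wip_add_right[OF X_L2 L2per_scale[OF c] L2per_scale[OF c]] wip_scale_right ..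
 also have "\<dots> = \<xi> $ 1 * (eta $ 1 * A $ 1 $ 1 + eta $ 2 * A $ 2 $ 1) + \<xi> $ 2 * (eta $ 1 * A $ 1 $ 2 + eta $ 2 * A $ 2 $ 2)"
  unfolding entry ..
 finally show ?thesis by (simp add: inner_vec_def sum_2 matrix_vector_mult_def algebra_simps)
qed

lemma A_apply: "(A *v \<xi>) $ j = (LI z. ind cell z * (a z * X \<xi> z $ j))"
proof -
 obtain a0 a1 where "cell_weight a a0 a1" by (rule weight)
 then interpret cell_weight a a0 a1 .
 have "(A *v \<xi>) $ j = wip (X \<xi>) (X (axis j 1))"
  using A_bilinear[of "axis j 1" \<xi>] wip_commute[of "X (axis j 1)" "X \<xi>"] by (simp add: inner_axis' wip_def)
 also have "\<dots> = wip (X \<xi>) (%z. axis j 1)"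
  using wip_add_right[OF X_L2 L2per_const H1_perD(2)[OF X_corrector], of \<xi> "axis j 1" "axis j 1"] X_orthogonal[OF X_corrector, of \<xi> "axis j 1"]
  by (simp add: X_eq[of "axis j 1", abs_def] wip_def)
 finally show ?thesis by (simp add: wip_def ip_def inner_axis)
qed

lemma A_nonneg: "0 <= \<xi> \<bullet> (A *v \<xi>)"
proof -
 obtain a0 a1 where "cell_weight a a0 a1" by (rule weight)
 then interpret cell_weight a a0 a1 .
 show ?thesis unfolding A_bilinear using wip_nonneg[OF X_L2] by (simp add: wip_def)
qed

text \<open>
  If the energy vanishes, the constant \<open>\<xi>\<close> is a gradient of a periodic function;
  gradients have mean zero.
\<close>

lemma A_definite:
 assumes "\<xi> \<bullet> (A *v \<xi>) = 0" shows "\<xi> = 0"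
proof -
 obtain a0 a1 where "cell_weight a a0 a1" by (rule weight)
 then interpret cell_weight a a0 a1 .
 let ?D = "%z. \<xi> $ 1 *r D\<pi> 1 z + \<xi> $ 2 *r D\<pi> 2 z"
 have "AE z in lborel. X \<xi> z = 0" using assms unfolding A_bilinear by (intro wip_zero X_L2) (simp add: wip_def)
 then have "AE z in lborel. ind cell z * (\<xi> \<bullet> X \<xi> z) = 0" by eventually_elim simp
 then have "ip (%_. \<xi>) (X \<xi>) = 0"
  unfolding ip_def by (rule integral_eq_zero_AE)
 moreover have "ip (%_. \<xi>) (X \<xi>) = ip2 (%_. \<xi>)"
  using ip_add_right[OF L2per_const H1_perD(2)[OF X_corrector] L2per_const, of \<xi> \<xi> \<xi>] mean_grad_zero[OF X_corrector, of \<xi> \<xi>]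
  by (simp add: X_eq[abs_def])
 ultimately have "\<xi> \<bullet> \<xi> = 0" by (simp add: ip_def measure_cell)
 then show ?thesis by simp
qed

end

section \<open>Averages over the slow variable\<close>

lemma pair_integral:
 fixes F :: "plane \<times> plane => real"
 assumes "L1 F"
 shows "(LI p. F p) = (LI z. LI x. F (x, z))" "L1 (%z. LI x. F (x, z))"
  "AE z in lborel. L1 (%x. F (x, z))" "(LI p. F p) = (LI x. LI z. F (x, z))"
  "AE x in lborel. L1 (%z. F (x, z))"
proof -
 have i: "integrable (lborel \<Otimes>\<^sub>M lborel) (%(x, z). F (x, z))" using assms by (simp add: lborel_prod)
 show "(LI p. F p) = (LI z. LI x. F (x, z))" "(LI p. F p) = (LI x. LI z. F (x, z))"
  using lborel_pair.integral_snd[OF i] lborel_pair.integral_fst[OF i] by (simp_all add: lborel_prod)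
 show "L1 (%z. LI x. F (x, z))" by (rule lborel_pair.integrable_snd[OF i])
 show "AE z in lborel. L1 (%x. F (x, z))" by (rule lborel_pair.AE_integrable_snd[OF i])
 show "AE x in lborel. L1 (%z. F (x, z))" by (rule lborel_pair.AE_integrable_fst[OF i])
qed

lemma nn_integral_pair:
 fixes F :: "plane \<times> plane => ennreal"
 assumes [measurable]: "F \<in> Borel"
 shows "(NN p. F p) = (NN z. NN x. F (x, z))"
proof -
 have "F \<in> borel_measurable (lborel \<Otimes>\<^sub>M lborel)" by (simp add: lborel_prod)
 from lborel_pair.nn_integral_snd[OF this] show ?thesis by (simp add: lborel_prod)
qed

lemma AE_pair:
 fixes P :: "plane \<times> plane => bool"
 assumes "AE p in lborel. P p" shows "AE x in lborel. AE z in lborel. P (x, z)"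
proof -
 have "AE p in lborel \<Otimes>\<^sub>M lborel. P p" using assms unfolding lborel_prod .
 then show ?thesis by (rule lborel_pair.AE_pair)
qed

lemma tensor_test:
 fixes \<alpha> eta :: "plane => real"
 assumes \<alpha>: "\<alpha> \<in> test_fun \<omega>" and eta: "eta \<in> test_fun UNIV"
 shows "(%p. \<alpha> (fst p) * eta (snd p)) \<in> test_fun (\<omega> \<times> UNIV)"
  "dir_deriv (0, v) (%p. \<alpha> (fst p) * eta (snd p)) p = \<alpha> (fst p) * dir_deriv v eta (snd p)"
proof -
 obtain K where K: "smooth_fun \<alpha>" "compact K" "K \<subseteq> \<omega>" "!!y. y \<notin> K ==> \<alpha> y = 0" using test_funD[OF \<alpha>] by metis
 obtain J where J: "smooth_fun eta" "compact J" "!!y. y \<notin> J ==> eta y = 0" using test_funD[OF eta] by metis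
 have sA: "smooth_fun (%p::plane \<times> plane. \<alpha> (fst p))" and sB: "smooth_fun (%p::plane \<times> plane. eta (snd p))"
  using smooth_affine[OF K(1) linear_proj(4), of 0] smooth_affine[OF J(1) linear_proj(5), of 0] by auto
 have dA: "dir_deriv v (%p::plane \<times> plane. \<alpha> (fst p)) p = dir_deriv (fst v) \<alpha> (fst p)" for v p
  using dir_deriv_affine[OF K(1) linear_proj(4), of v 0 p] by simp
 have dB: "dir_deriv v (%p::plane \<times> plane. eta (snd p)) p = dir_deriv (snd v) eta (snd p)" for v p
  using dir_deriv_affine[OF J(1) linear_proj(5), of v 0 p] by simp
 have d0: "dir_deriv 0 \<alpha> x = 0" for x using linear_0[OF has_derivative_linear[OF smooth_has_derivative[OF K(1)]]] by auto
 show "(%p. \<alpha> (fst p) * eta (snd p)) \<in> test_fun (\<omega> \<times> UNIV)"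
  by (rule test_funI[OF smooth_mult[OF sA sB] compact_Times[OF K(2) J(2)]]) (use K(3,4) J(3) in \<open>auto simp: mem_Times_iff\<close>)
 show "dir_deriv (0, v) (%p. \<alpha> (fst p) * eta (snd p)) p = \<alpha> (fst p) * dir_deriv v eta (snd p)"
  unfolding dir_deriv_mult[OF sA sB] dA dB by (simp add: d0)
qed

text \<open>
  Averaging against a test function of the slow variable, which leaves an identity in the cell alone.
\<close>

definition slice :: "(plane => real) => (plane \<times> plane => real) => plane => real" where
 "slice \<alpha> k z = (LI x. \<alpha> x * k (x, z))"

lemma slice_L2:
 assumes \<alpha>: "\<alpha> \<in> test_fun \<omega>" and k: "PL2 k"
 shows "L2per (slice \<alpha> k)"
proof -
 have [measurable]: "\<alpha> \<in> Borel" "k \<in> Borel" using test_fun_borel[OF \<alpha>] k by (auto simp: PL2_def)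
 let ?C = "(LI x. (\<alpha> x)^2) + 1"
 have "0 <= (LI x. (\<alpha> x)^2)" by (rule LI_nonneg) simp
 then have C: "?C > 0" by linarith
 have m [measurable]: "slice \<alpha> k \<in> Borel" unfolding slice_def by measurable
 have "(NN z. ind cell z * ennreal ((slice \<alpha> k z)^2)) <= (NN z. ind cell z * (ennreal ?C * (NN x. ennreal ((k (x, z))^2))))"
  unfolding slice_def by (intro nn_integral_mono mult_left_mono nn_Cauchy_Schwarz test_sq_integrable[OF \<alpha>]) (use C in auto)
 also have "\<dots> = ennreal ?C * (NN z. NN x. ind cell z * ennreal ((k (x, z))^2))"
  unfolding mult.left_commute[of "ind cell _"] by (simp add: nn_integral_cmult del: ennreal_plus)
 also have "(NN z. NN x. ind cell z * ennreal ((k (x, z))^2)) = (NN p. ind cell (snd p) * ennreal ((k p)^2))"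
  by (subst nn_integral_pair) auto
 also have "ennreal ?C * \<dots> < \<infinity>" using k by (simp add: PL2_def ennreal_mult_less_top)
 finally have "(NN z. ind cell z * ennreal ((slice \<alpha> k z)^2)) < \<infinity>" .
 moreover have "periodic (slice \<alpha> k)" using k by (simp add: slice_def PL2_def periodic_def)
 ultimately show ?thesis by (simp add: L2per_iff)
qed

lemma slice_test:
 assumes \<alpha>: "\<alpha> \<in> test_fun \<omega>" and k: "PL2 k" and eta: "eta \<in> test_fun UNIV"
 shows "L1 (%p. \<alpha> (fst p) * eta (snd p) * k p)"
  and "(LI z. eta z * slice \<alpha> k z) = (LI p. \<alpha> (fst p) * eta (snd p) * k p)"
proof -
 show i: "L1 (%p. \<alpha> (fst p) * eta (snd p) * k p)"
  by (rule test_times_integrable[OF tensor_test(1)[OF \<alpha> eta] PL2_D[OF k] PL2_loc[OF k]])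
 have "(LI x. \<alpha> x * eta z * k (x, z)) = eta z * slice \<alpha> k z" for z
 proof -
  have "(%x. \<alpha> x * eta z * k (x, z)) = (%x. eta z * (\<alpha> x * k (x, z)))" by (simp add: fun_eq_iff)
  then show ?thesis by (simp add: slice_def)
 qed
 then show "(LI z. eta z * slice \<alpha> k z) = (LI p. \<alpha> (fst p) * eta (snd p) * k p)"
  using pair_integral(1)[OF i] by simp
qed

text \<open>
  The bumps on \<open>\<omega> \<times> UNIV\<close> are products, so tensor products of test
  functions suffice.
\<close>

lemma PL2_zero:
 assumes k: "PL2 k" and \<omega>: "open \<omega>"
  and z: "!!\<alpha> eta. \<alpha> \<in> test_fun \<omega> ==> eta \<in> test_fun UNIV ==> (LI p. \<alpha> (fst p) * eta (snd p) * k p) = 0"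
 shows "AE p in lborel. p \<in> \<omega> \<times> UNIV --> k p = 0"
proof (rule fundamental_lemma[OF PL2_D[OF k]])
 show "open (\<omega> \<times> (UNIV :: plane set))" using \<omega> by (simp add: open_Times)
 show "set_integrable lborel (cbox a b) k" for a b using PL2_loc[OF k, of UNIV] compact_cbox unfolding locally_integrable_def by blast
 fix a b :: "plane \<times> plane" and c :: real
 assume c: "c > 0" and sub: "cbox a b \<subseteq> \<omega> \<times> UNIV"
 obtain a1 a2 b1 b2 where ab: "a = (a1, a2)" "b = (b1, b2)" by (metis prod.exhaust)
 let ?\<alpha> = "boxbump a1 b1 c" and ?eta = "boxbump a2 b2 c"
 have bb: "boxbump a b c p = ?\<alpha> (fst p) * ?eta (snd p)" for p by (cases p) (simp add: ab boxbump_Pair)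
 show "(LI y. boxbump a b c y * k y) = 0"
 proof (cases "cbox a2 b2 = {}")
  case True
  then have "?eta y = 0" for y by (intro boxbump_zero) (use box_subset_cbox in auto)
  then show ?thesis by (simp add: bb)
 next
  case False
  then have "cbox a1 b1 \<subseteq> \<omega>" using sub unfolding ab cbox_Pair_eq by auto
  then have \<alpha>: "?\<alpha> \<in> test_fun \<omega>" by (rule boxbump_test[OF c])
  have eta: "?eta \<in> test_fun UNIV" by (rule boxbump_test[OF c]) simp
  show ?thesis using z[OF \<alpha> eta] by (simp add: bb)
 qed
qed

section \<open>The structure of the local pressure\<close>

lemma (in cell_solution) X_divfree:
 assumes "eta \<in> test_fun UNIV" shows "(LI z. (a z *r X \<xi> z) \<bullet> grad eta z) = 0"
proof -
 obtain a0 a1 where "cell_weight a a0 a1" by (rule weight)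
 then interpret cell_weight a a0 a1 .
 show ?thesis by (rule orthogonal_imp_divfree[OF aF[OF X_L2] X_orthogonal assms])
qed

locale homogenized_flow = limit_flow + cell_solution h h_min h_max M
begin

lemma a_borel [measurable]: "a \<in> Borel" unfolding a_def mobility_def by measurable

lemma a_per: "periodic a" unfolding a_def by (rule periodic_comp[OF hper])

definition W :: "2 => plane \<times> plane => real" where "W i p = (LI s. w i (fst p, snd p, s))"

lemma W_borel [measurable]: "W i \<in> Borel" unfolding W_def by measurable

text \<open>
  The flux through the fibre: integrating the profile gives minus the mobility.
\<close>

lemma W_G: "AE p in lborel. W i p = (K / \<mu>) * (a (snd p) * G i p)"
 using velocity_profile[of i]
proof eventually_elim
 case (elim p)
 show ?case
 proof (cases "fst p \<in> \<omega>")
  case True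
  let ?h = "h (snd p)"
  have "AE s in lborel. 0 < s & s < ?h --> w i (fst p, snd p, s) = (K / \<mu>) * G i p * profile M ?h s"
   using elim True by (simp add: mem_Times_iff)
  moreover have "AE s in lborel. s ~= 0" "AE s in lborel. s ~= ?h" by (rule AE_lborel_singleton)+
  ultimately have ae: "AE s in lborel. w i (fst p, snd p, s) = ind {0..?h} s * ((K / \<mu>) * G i p * profile M ?h s)"
  proof eventually_elim
   case (elim s)
   then show ?case using True by (cases "0 < s & s < ?h") (auto simp: w_def Zper_def indicator_def)
  qed
  have "(%s. profile M ?h s) \<in> Borel" unfolding profile_def by measurable
  then have "W i p = (LI s. ind {0..?h} s * ((K / \<mu>) * G i p * profile M ?h s))"
   unfolding W_def by (intro integral_cong_AE ae) auto
  also have "\<dots> = (LI s. ((K / \<mu>) * G i p) * (ind {0..?h} s * profile M ?h s))"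
   by (intro LI_cong refl) simp
  also have "\<dots> = (K / \<mu>) * G i p * a (snd p)"
   using profile_integral(1)[OF Mpos hpos, of "snd p"] by (simp add: set_LI_def a_def)
  finally show ?thesis by simp
 next
  case False
  then show ?thesis by (simp add: W_def w_def G_off)
 qed
qed

lemma a_bounded: "\<exists>C. \<forall>z. \<bar>a z\<bar> <= C"
proof -
 obtain a0 a1 where "cell_weight a a0 a1" by (rule weight)
 then interpret cw: cell_weight a a0 a1 .
 have "\<bar>a z\<bar> <= a1" for z using cw.a_bd[of z] cw.a0 by simp
 then show ?thesis by blast
qed

lemma a_PL2: "PL2 k ==> PL2 (%p. a (snd p) * k p)"
proof -
 assume k: "PL2 k"
 obtain C where C: "!!z. \<bar>a z\<bar> <= C" using a_bounded by blast
 show ?thesis by (rule PL2_mult[OF k a_borel a_per C])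
qed

definition Vv :: "plane \<times> plane \<times> real => plane" where "Vv y = ind S y *r horiz (u y)"

lemma Vv_nth: "Vv y $ i = w i y" by (simp add: Vv_def w_def)

lemma Vv_integral: "AE p in lborel. (\<forall>i. (LI s. Vv (fst p, snd p, s)) $ i = W i p) & L1 (%s. Vv (fst p, snd p, s))"
 using w_vert[of 1] w_vert[of 2]
proof eventually_elim
 case (elim p)
 have "\<forall>i. L1 (%s. w i (fst p, snd p, s))" using elim by (simp add: forall_2)
 then have i: "L1 (%s. Vv (fst p, snd p, s))" by (intro integrable_vec2) (simp add: Vv_nth)
 then show ?case by (simp add: integral_nth Vv_nth W_def)
qed

lemma flux_divfree:
 assumes \<alpha>: "\<alpha> \<in> test_fun \<omega>" and eta: "eta \<in> test_fun UNIV"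
 shows "(LI p. \<alpha> (fst p) * dir_deriv (axis 1 1) eta (snd p) * (a (snd p) * G 1 p))
   + (LI p. \<alpha> (fst p) * dir_deriv (axis 2 1) eta (snd p) * (a (snd p) * G 2 p)) = 0"
proof -
 note T = tensor_test[OF \<alpha> eta]
 have [measurable]: "\<alpha> \<in> Borel" "dir_deriv v eta \<in> Borel" for v
  using test_fun_borel[OF \<alpha>] test_fun_borel[OF test_fun_dir[OF eta]] by auto
 have [measurable]: "Vv \<in> Borel" by (rule borel_vec2) (simp add: Vv_nth)
 have [measurable]: "grad eta \<in> Borel" by (rule borel_vec2) (simp add: grad_def)
 have i: "L1 (%p. \<alpha> (fst p) * dir_deriv (axis i 1) eta (snd p) * (a (snd p) * G i p))" for i
  by (rule slice_test(1)[OF \<alpha> a_PL2[OF G_L2] test_fun_dir[OF eta]])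
 have "0 = (LINT (x, z):\<omega> \<times> UNIV|lborel. (LINT s:{0<..<h z}|lborel. horiz (u (x, z, s))) \<bullet>
      (\<chi> i. dir_deriv (0, axis i 1) (%p. \<alpha> (fst p) * eta (snd p)) (x, z)))"
  using cdiv T(1) unfolding cell_div_eq_def by simp
 also have "\<dots> = (LI p. (LI s. Vv (fst p, snd p, s)) \<bullet> (\<alpha> (fst p) *r grad eta (snd p)))"
  unfolding set_LI_def
 proof (intro LI_cong refl)
  fix p :: "plane \<times> plane"
  obtain x z where p: "p = (x, z)" by (cases p)
  have e: "(\<chi> i. dir_deriv (0, axis i 1) (%p. \<alpha> (fst p) * eta (snd p)) (x, z)) = \<alpha> x *r grad eta z"
   by (simp add: vec_eq_iff T(2) grad_def)
  show "ind (\<omega> \<times> UNIV) p *r (case p of (x, z) => (LI s. ind {0<..<h z} s *r horiz (u (x, z, s))) \<bullet>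
      (\<chi> i. dir_deriv (0, axis i 1) (%p. \<alpha> (fst p) * eta (snd p)) (x, z))) = (LI s. Vv (fst p, snd p, s)) \<bullet> (\<alpha> (fst p) *r grad eta (snd p))"
  proof (cases "x \<in> \<omega>")
   case True
   then have "(%s. ind {0<..<h z} s *r horiz (u (x, z, s))) = (%s. Vv (x, z, s))"
    by (auto simp: fun_eq_iff Vv_def Zper_def indicator_def)
   then show ?thesis using True by (simp only: p e split fst_conv snd_conv) simp
  qed (simp add: p Vv_def)
 qed
 also have "\<dots> = (LI p. (K / \<mu>) * (\<alpha> (fst p) * dir_deriv (axis 1 1) eta (snd p) * (a (snd p) * G 1 p) + \<alpha> (fst p) * dir_deriv (axis 2 1) eta (snd p) * (a (snd p) * G 2 p)))"
 proof (rule integral_cong_AE)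
  show "AE p in lborel. (LI s. Vv (fst p, snd p, s)) \<bullet> (\<alpha> (fst p) *r grad eta (snd p))
   = (K / \<mu>) * (\<alpha> (fst p) * dir_deriv (axis 1 1) eta (snd p) * (a (snd p) * G 1 p) + \<alpha> (fst p) * dir_deriv (axis 2 1) eta (snd p) * (a (snd p) * G 2 p))"
   using Vv_integral W_G[of 1] W_G[of 2]
  proof eventually_elim
   case (elim p)
   then show ?case by (simp add: grad_inner algebra_simps)
  qed
 qed measurable
 also have "\<dots> = (K / \<mu>) * ((LI p. \<alpha> (fst p) * dir_deriv (axis 1 1) eta (snd p) * (a (snd p) * G 1 p))
   + (LI p. \<alpha> (fst p) * dir_deriv (axis 2 1) eta (snd p) * (a (snd p) * G 2 p)))"
  using i by (simp only: integral_mult_right_zero LI_add)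
 finally show ?thesis using pos by simp
qed

definition F\<alpha> :: "(plane => real) => plane" where "F\<alpha> \<alpha> = (\<chi> i. LI x. \<alpha> x * F i x)"

lemma slice_product: "slice \<alpha> (%p. F i (fst p) * g (snd p)) z = F\<alpha> \<alpha> $ i * g z"
proof -
 have "(%x. \<alpha> x * (F i x * g z)) = (%x. (\<alpha> x * F i x) * g z)" by (simp add: fun_eq_iff)
 then show ?thesis by (simp add: slice_def F\<alpha>_def)
qed

lemma slice_a: "slice \<alpha> (%p. a (snd p) * k p) z = a z * slice \<alpha> k z"
proof -
 have "(%x. \<alpha> x * (a z * k (x, z))) = (%x. a z * (\<alpha> x * k (x, z)))" by (simp add: fun_eq_iff)
 then show ?thesis by (simp add: slice_def)
qed

text \<open>
  The averaged pressure plus the corrector of the averaged force has gradient \<open>E = slice R +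
  \<Sum>i. F\<alpha> $ i *\<^sub>R D\<pi> i\<close>, which is minus the difference of the averaged
  force \<open>G\<close> and the corrected field. Both of these have divergence-free fluxes, so
  \<open>E\<close> vanishes by uniqueness.
\<close>

lemma pressure_slice:
 assumes \<alpha>: "\<alpha> \<in> test_fun \<omega>"
 shows "AE z in lborel. slice \<alpha> (R j) z = - (F\<alpha> \<alpha> $ 1 * D\<pi> 1 z $ j + F\<alpha> \<alpha> $ 2 * D\<pi> 2 z $ j)"
proof -
 obtain a0 a1 where "cell_weight a a0 a1" by (rule weight)
 then interpret cw: cell_weight a a0 a1 .
 let ?R = "%z. (\<chi> i. slice \<alpha> (R i) z) :: real^2" and ?\<xi> = "F\<alpha> \<alpha>"
 let ?D = "%z. ?\<xi> $ 1 *r D\<pi> 1 z + ?\<xi> $ 2 *r D\<pi> 2 z"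
 have RL: "L2per ?R" by (rule L2per_vec2) (simp add: slice_L2[OF \<alpha> R_PL2])
 have H1: "H1_per (slice \<alpha> pt) ?R"
 proof (rule H1_perI[OF slice_L2[OF \<alpha> pt_PL2] RL])
  fix i psi assume psi: "psi \<in> test_fun (UNIV :: plane set)"
  note T = tensor_test[OF \<alpha> psi]
  show "(LI z. dir_deriv (axis i 1) psi z * slice \<alpha> pt z) = - (LI z. psi z * ?R z $ i)"
   using pressure_weak[OF T(1), of i] slice_test(2)[OF \<alpha> pt_PL2 test_fun_dir[OF psi]] slice_test(2)[OF \<alpha> R_PL2 psi, of i]
   by (simp add: T(2))
 qed
 have HE: "H1_per (%z. slice \<alpha> pt z + 1 * (?\<xi> $ 1 * \<pi>s 1 z + ?\<xi> $ 2 * \<pi>s 2 z)) (%z. ?R z + 1 *r ?D z)"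
  by (rule H1_per_lin[OF H1 X_corrector])
 have "AE z in lborel. ?R z + 1 *r ?D z = 0"
 proof (rule cw.weighted_unique[OF HE])
  fix eta assume eta: "eta \<in> test_fun (UNIV :: plane set)"
  let ?d = "%i. dir_deriv (axis i 1) eta"
  have eta': "?d i \<in> test_fun UNIV" for i by (rule test_fun_dir[OF eta])
  have iR: "L1 (%z. ?d i z * (a z * slice \<alpha> (R i) z))" for i
   using test_L2_integrable[OF eta' slice_L2[OF \<alpha> a_PL2[OF R_PL2]]] by (simp add: slice_a)
  have iF: "L1 (%z. ?d i z * (a z * ?\<xi> $ i))" for i
   using test_L2_integrable[OF eta'[of i] slice_L2[OF \<alpha> a_PL2[OF F_PL2[of i]]]] slice_product[of \<alpha> i "%_. 1"] by (simp add: slice_a)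
  have one: "(LI z. ?d i z * (a z * slice \<alpha> (R i) z)) - (LI z. ?d i z * (a z * ?\<xi> $ i))
    = - (LI p. \<alpha> (fst p) * ?d i (snd p) * (a (snd p) * G i p))" for i
  proof -
   note i = slice_test(1)[OF \<alpha> a_PL2[OF F_PL2] eta', of i i] slice_test(1)[OF \<alpha> a_PL2[OF R_PL2] eta', of i i]
   have "(LI p. \<alpha> (fst p) * ?d i (snd p) * (a (snd p) * G i p))
    = (LI p. \<alpha> (fst p) * ?d i (snd p) * (a (snd p) * F i (fst p)) - \<alpha> (fst p) * ?d i (snd p) * (a (snd p) * R i p))"
    by (intro LI_cong refl) (simp add: R_def algebra_simps)
   also have "\<dots> = (LI p. \<alpha> (fst p) * ?d i (snd p) * (a (snd p) * F i (fst p))) - (LI p. \<alpha> (fst p) * ?d i (snd p) * (a (snd p) * R i p))"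
    by (rule LI_diff[OF i])
   also have "(LI p. \<alpha> (fst p) * ?d i (snd p) * (a (snd p) * F i (fst p))) = (LI z. ?d i z * (a z * ?\<xi> $ i))"
    using slice_test(2)[OF \<alpha> a_PL2[OF F_PL2] eta', of i i] slice_product[of \<alpha> i "%_. 1"] by (simp add: slice_a)
   also have "(LI p. \<alpha> (fst p) * ?d i (snd p) * (a (snd p) * R i p)) = (LI z. ?d i z * (a z * slice \<alpha> (R i) z))"
    using slice_test(2)[OF \<alpha> a_PL2[OF R_PL2] eta', of i i] by (simp add: slice_a)
   finally show ?thesis by simp
  qed
  have iX: "L1 (%z. (a z *r X ?\<xi> z) \<bullet> grad eta z)"
  proof -
   have "L1 (%z. ?d i z * (a z *r X ?\<xi> z) $ i)" for i
    by (rule test_L2_integrable[OF eta' L2per_component[OF cw.aF[OF X_L2]]])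
   from L1_add[OF this[of 1] this[of 2]] show ?thesis
    by (rule Bochner_Integration.integrable_cong[OF refl, THEN iffD1, rotated]) (simp add: grad_inner algebra_simps)
  qed
  have "(LI z. (a z *r (?R z + 1 *r ?D z)) \<bullet> grad eta z)
   = (LI z. (?d 1 z * (a z * slice \<alpha> (R 1) z) - ?d 1 z * (a z * ?\<xi> $ 1)) + (?d 2 z * (a z * slice \<alpha> (R 2) z) - ?d 2 z * (a z * ?\<xi> $ 2)) + (a z *r X ?\<xi> z) \<bullet> grad eta z)"
   by (intro LI_cong refl) (simp add: grad_inner X_eq algebra_simps)
  also have "\<dots> = ((LI z. ?d 1 z * (a z * slice \<alpha> (R 1) z)) - (LI z. ?d 1 z * (a z * ?\<xi> $ 1)))
    + ((LI z. ?d 2 z * (a z * slice \<alpha> (R 2) z)) - (LI z. ?d 2 z * (a z * ?\<xi> $ 2))) + (LI z. (a z *r X ?\<xi> z) \<bullet> grad eta z)"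
   by (simp only: LI_add LI_diff L1_add L1_diff iR iF iX)
  also have "\<dots> = 0" unfolding one X_divfree[OF eta] using flux_divfree[OF \<alpha> eta] by simp
  finally show "(LI z. (a z *r (?R z + 1 *r ?D z)) \<bullet> grad eta z) = 0" .
 qed
 then show ?thesis
 proof eventually_elim
  case (elim z)
  from arg_cong[OF elim, of "%v. v $ j"] show ?case by simp
 qed
qed

theorem pressure_structure:
 "AE p in lborel. p \<in> \<omega> \<times> UNIV --> G j p = X (\<chi> i. F i (fst p)) (snd p) $ j"
proof -
 let ?k = "%p. R j p + 1 * (F 1 (fst p) * (D\<pi> 1 (snd p) $ j)) + 1 * (F 2 (fst p) * (D\<pi> 2 (snd p) $ j))"
 have P: "PL2 (%p. F i (fst p) * (D\<pi> i (snd p) $ j))" for i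
  by (rule PL2_product[OF F_borel F_L2 L2per_component[OF H1_perD(2)[OF corrector]]])
 have k: "PL2 ?k" by (intro PL2_lin P R_PL2)
 have "AE p in lborel. p \<in> \<omega> \<times> UNIV --> ?k p = 0"
 proof (rule PL2_zero[OF k \<omega>])
  fix \<alpha> eta assume \<alpha>: "\<alpha> \<in> test_fun \<omega>" and eta: "eta \<in> test_fun (UNIV :: plane set)"
  let ?t = "%k p. \<alpha> (fst p) * eta (snd p) * k p"
  note s = slice_test[OF \<alpha> R_PL2 eta, of j] slice_test[OF \<alpha> P eta]
  have "(LI p. ?t ?k p) = (LI p. ?t (R j) p + ?t (%p. F 1 (fst p) * (D\<pi> 1 (snd p) $ j)) p + ?t (%p. F 2 (fst p) * (D\<pi> 2 (snd p) $ j)) p)"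
   by (intro LI_cong refl) (simp add: algebra_simps)
  also have "\<dots> = (LI p. ?t (R j) p) + (LI p. ?t (%p. F 1 (fst p) * (D\<pi> 1 (snd p) $ j)) p) + (LI p. ?t (%p. F 2 (fst p) * (D\<pi> 2 (snd p) $ j)) p)"
   by (simp only: LI_add L1_add s(1,3))
  also have "\<dots> = (LI z. eta z * slice \<alpha> (R j) z) + (LI z. eta z * (F\<alpha> \<alpha> $ 1 * D\<pi> 1 z $ j)) + (LI z. eta z * (F\<alpha> \<alpha> $ 2 * D\<pi> 2 z $ j))"
   unfolding s(2,4)[symmetric] slice_product[where g="%z. D\<pi> _ z $ j"] ..
  also have "(LI z. eta z * slice \<alpha> (R j) z) = (LI z. - (eta z * (F\<alpha> \<alpha> $ 1 * D\<pi> 1 z $ j) + eta z * (F\<alpha> \<alpha> $ 2 * D\<pi> 2 z $ j)))"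
  proof (rule integral_cong_AE)
   have [measurable]: "eta \<in> Borel" "slice \<alpha> (R j) \<in> Borel" "D\<pi> i \<in> Borel" for i
    using test_fun_borel[OF eta] L2per_D(1)[OF slice_L2[OF \<alpha> R_PL2]] L2per_D(1)[OF H1_perD(2)[OF corrector]] by auto
   show "(%z. eta z * slice \<alpha> (R j) z) \<in> borel_measurable lborel" by measurable
   show "(%z. - (eta z * (F\<alpha> \<alpha> $ 1 * D\<pi> 1 z $ j) + eta z * (F\<alpha> \<alpha> $ 2 * D\<pi> 2 z $ j))) \<in> borel_measurable lborel" by measurable
   show "AE z in lborel. eta z * slice \<alpha> (R j) z = - (eta z * (F\<alpha> \<alpha> $ 1 * D\<pi> 1 z $ j) + eta z * (F\<alpha> \<alpha> $ 2 * D\<pi> 2 z $ j))"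
    using pressure_slice[OF \<alpha>, of j] by eventually_elim (simp only: distrib_left mult_minus_right)
  qed
  also have "\<dots> = - ((LI z. eta z * (F\<alpha> \<alpha> $ 1 * D\<pi> 1 z $ j)) + (LI z. eta z * (F\<alpha> \<alpha> $ 2 * D\<pi> 2 z $ j)))"
  proof -
   have "L1 (%z. eta z * (c * D\<pi> i z $ j))" for i c
    using test_L2_integrable[OF eta L2per_scale[OF L2per_component[OF H1_perD(2)[OF corrector]]], of c i j] by simp
   then show ?thesis by (simp only: Bochner_Integration.integral_minus LI_add)
  qed
  finally show "(LI p. ?t ?k p) = 0" by simp
 qed
 then show ?thesis
 proof eventually_elim
  case (elim p)
  show ?case
  proof
   assume "p \<in> \<omega> \<times> UNIV"
   then have "?k p = 0" using elim by blast
   moreover have "(j = 1 \<or> j = 2)" using exhaust_2 by blast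
   ultimately show "G j p = X (\<chi> i. F i (fst p)) (snd p) $ j" by (auto simp: R_def X_eq)
  qed
 qed
qed

end

section \<open>Vanishing gradients and fields that agree almost everywhere\<close>

lemma AE_nonempty_box:
 assumes "AE y in lborel. P y" "box a b ~= {}" shows "\<exists>y\<in>box a (b::'a::euclidean_space). P y"
 by (rule AE_open_ex[OF assms(1) open_box assms(2)])

lemma zero_grad_shift:
 fixes \<phi> :: "plane => real"
 assumes \<omega>: "open \<omega>" and w: "weak_grad \<omega> \<phi> G" and z: "AE x in lborel. x \<in> \<omega> --> G x = 0" and b: "box a b \<subseteq> \<omega>"
 shows "AE y in lborel. y \<in> box a b & y + \<tau> *r axis i 1 \<in> box a b --> \<phi> (y + \<tau> *r axis i 1) = \<phi> y"
proof -
 let ?e = "axis i 1 :: real^2"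
 have "(LINT x:\<omega>|lborel. psi x *r G x $ i) = 0" for psi
  unfolding set_LI_def
 proof (rule integral_eq_zero_AE, use z in eventually_elim)
  case (elim x) then show ?case by (cases "x \<in> \<omega>") auto
 qed
 then have wd: "weak_deriv \<omega> ?e \<phi> (%_. 0)"
  using w by (auto simp: weak_grad_def weak_deriv_def locally_integrable_def set_integrable_def set_LI_def)
 have pos: "AE y in lborel. y \<in> box a b & y + \<tau> *r ?e \<in> box a b --> \<phi> (y + \<tau> *r ?e) = \<phi> y" if \<tau>: "\<tau> >= 0" for \<tau>
 proof -
  have "shift_deriv \<omega> ?e \<tau> \<phi> (%_. 0)" by (rule weak_deriv_shift[OF wd \<omega> axis_Basis2 \<tau>])
  then show ?thesis unfolding shift_deriv_def
  proof eventually_elim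
   case (elim y)
   have "y + r *r ?e \<in> \<omega>" if yb: "y \<in> box a b" "y + \<tau> *r ?e \<in> box a b" and r: "r \<in> {0..\<tau>}" for r
   proof -
    have "y + r *r ?e \<in> box a b"
    proof (cases "\<tau> = 0")
     case False
     have "(1 - r / \<tau>) *r y + (r / \<tau>) *r (y + \<tau> *r ?e) \<in> box a b"
      by (rule convexD[OF convex_box(2) yb]) (use r \<tau> False in auto)
     then show ?thesis using False by (simp add: algebra_simps)
    qed (use yb r in auto)
    then show ?thesis using b by auto
   qed
   then show ?case using elim by (simp add: set_LI_def)
  qed
 qed
 show ?thesis
 proof (cases "\<tau> >= 0")
  case False
  from AE_lborel_shift[OF pos[of "- \<tau>"], of "\<tau> *r ?e"] False show ?thesis
   by (auto simp: algebra_simps elim!: eventually_mono)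
 qed (rule pos)
qed

text \<open>
  In a box two coordinate steps connect any two points without leaving it, so almost every increment
  is zero.
\<close>

lemma zero_grad_box:
 fixes \<phi> :: "plane => real"
 assumes \<omega>: "open \<omega>" and w: "weak_grad \<omega> \<phi> G" and z: "AE x in lborel. x \<in> \<omega> --> G x = 0" and b: "box a b \<subseteq> \<omega>"
 shows "\<exists>c. AE y in lborel. y \<in> box a b --> \<phi> y = c"
proof (cases "box a b = {}")
 case False
 have li: "L1loc \<omega> \<phi>" using w by (auto simp: weak_grad_def weak_deriv_def)
 define g where "g x = ind \<omega> x * \<phi> x" for x
 have [measurable]: "g \<in> Borel" using locally_integrable_borel[OF li \<omega>] by (simp add: g_def[abs_def])
 have g\<phi>: "y \<in> box a b ==> g y = \<phi> y" for y using b by (auto simp: g_def)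
 have t: "AE y in lborel. y \<in> box a b & y + t \<in> box a b --> g (y + t) = g y" for t
 proof -
  have "AE y in lborel. y + t $ 1 *r axis 1 1 \<in> box a b & (y + t $ 1 *r axis 1 1) + t $ 2 *r axis 2 1 \<in> box a b -->
    \<phi> ((y + t $ 1 *r axis 1 1) + t $ 2 *r axis 2 1) = \<phi> (y + t $ 1 *r axis 1 1)"
   by (rule AE_lborel_shift[OF zero_grad_shift[OF \<omega> w z b]])
  with zero_grad_shift[OF \<omega> w z b, of "t $ 1" 1] show ?thesis
  proof eventually_elim
   case (elim y)
   have e: "(y + t $ 1 *r axis 1 1) + t $ 2 *r axis 2 1 = y + t" by (simp add: vec_eq_iff forall_2 axis_def)
   have "y + t $ 1 *r axis 1 1 \<in> box a b" if "y \<in> box a b" "y + t \<in> box a b"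
    using that by (auto simp: mem_box_cart forall_2 axis_def)
   then show ?case using elim unfolding e by (auto simp: g\<phi>)
  qed
 qed
 let ?Q = "%t y. y \<in> box a b & y + t \<in> box a b --> g (y + t) = g y"
 have "(AE t in lborel. AE y in lborel. ?Q t y) \<longleftrightarrow> (AE y in lborel. AE t in lborel. ?Q t y)"
  by (rule lborel_pair.AE_commute) measurable
 then have "AE y in lborel. AE t in lborel. ?Q t y" using t by simp
 from AE_nonempty_box[OF this False] obtain y0 where y0: "y0 \<in> box a b" "AE t in lborel. ?Q t y0" by blast
 from AE_lborel_shift[OF y0(2), of "- y0"] have "AE y in lborel. y \<in> box a b --> \<phi> y = g y0"
  by eventually_elim (use y0(1) g\<phi> in auto)
 then show ?thesis by blast
qed simp

text \<open>
  The almost everywhere value near a point is a locally constant function on the connected set, and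
  countably many boxes cover the set.
\<close>

theorem zero_grad_imp_const:
 fixes \<phi> :: "plane => real"
 assumes \<omega>: "open \<omega>" "connected \<omega>" and w: "weak_grad \<omega> \<phi> G" and z: "AE x in lborel. x \<in> \<omega> --> G x = 0"
 shows "\<exists>c. AE x in lborel. x \<in> \<omega> --> \<phi> x = c"
proof -
 let ?at = "%x c. \<exists>U. open U & x \<in> U & U \<subseteq> \<omega> & (AE y in lborel. y \<in> U --> \<phi> y = c)"
 define \<kappa> where "\<kappa> x = (SOME c. ?at x c)" for x
 have uniq: "c = c'" if p1: "?at x c" and p2: "?at x c'" for x c c'
 proof -
  from p1 obtain U where U: "open U" "x \<in> U" "AE y in lborel. y \<in> U --> \<phi> y = c" by (elim exE conjE) (rule that)
  from p2 obtain U' where U': "open U'" "x \<in> U'" "AE y in lborel. y \<in> U' --> \<phi> y = c'" by (elim exE conjE) (rule that)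
  have "AE y in lborel. (y \<in> U --> \<phi> y = c) & (y \<in> U' --> \<phi> y = c')" using U(3) U'(3) by eventually_elim simp
  then have "\<exists>y\<in>U \<inter> U'. (y \<in> U --> \<phi> y = c) & (y \<in> U' --> \<phi> y = c')"
   by (rule AE_open_ex) (use U(1,2) U'(1,2) in auto)
  then show ?thesis by auto
 qed
 have \<kappa>: "\<kappa> x = c" if "?at x c" for x c
  unfolding \<kappa>_def by (rule some_equality[where P="?at x", OF that]) (rule uniq[OF _ that])
 have box: "\<exists>c. (AE y in lborel. y \<in> box a b --> \<phi> y = c) & (\<forall>x\<in>box a b. \<kappa> x = c)" if ab: "box a b \<subseteq> \<omega>" for a b
 proof -
  obtain c where c: "AE y in lborel. y \<in> box a b --> \<phi> y = c" using zero_grad_box[OF \<omega>(1) w z ab] by blast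
  have "\<kappa> x = c" if "x \<in> box a b" for x by (rule \<kappa>) (intro exI[of _ "box a b"] conjI open_box that ab c)
  then show ?thesis using c by blast
 qed
 have loc: "\<forall>x\<in>\<omega>. eventually (%y. \<kappa> x = \<kappa> y) (at x within \<omega>)"
 proof
  fix x assume "x \<in> \<omega>"
  then obtain a b where ab: "x \<in> box a b" "box a b \<subseteq> \<omega>" using \<omega>(1) by (meson open_contains_box)
  then have "!!y. y \<in> box a b ==> \<kappa> x = \<kappa> y" using box[OF ab(2)] by metis
  then show "eventually (%y. \<kappa> x = \<kappa> y) (at x within \<omega>)" unfolding eventually_at_topological using ab(1) open_box by blast
 qed
 have const: "\<kappa> x = \<kappa> y" if "x \<in> \<omega>" "y \<in> \<omega>" for x y by (rule connected_local_const[OF \<omega>(2) that loc])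
 obtain D where D: "countable D" "D \<subseteq> Pow \<omega>" "!!X. X \<in> D ==> \<exists>a b. X = box a b" "\<Union>D = \<omega>"
  using open_countable_Union_open_box[OF \<omega>(1)] by metis
 obtain c where c: "!!x. x \<in> \<omega> ==> \<kappa> x = c" using const by blast
 have "AE y in lborel. \<forall>X\<in>D. y \<in> X --> \<phi> y = c"
 proof (rule AE_ball_countable'[OF _ D(1)])
  fix X assume X: "X \<in> D"
  then obtain a b where ab: "X = box a b" "box a b \<subseteq> \<omega>" using D by blast
  obtain c' where c': "AE y in lborel. y \<in> box a b --> \<phi> y = c'" "!!x. x \<in> box a b ==> \<kappa> x = c'" using box[OF ab(2)] by blast
  have cc: "c' = c" if "y \<in> box a b" for y using c'(2)[OF that] c[of y] ab(2) that by auto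
  from c'(1) show "AE y in lborel. y \<in> X --> \<phi> y = c" by eventually_elim (use ab(1) cc in auto)
 qed
 then have "AE x in lborel. x \<in> \<omega> --> \<phi> x = c" by eventually_elim (use D(4) in blast)
 then show ?thesis by blast
qed

lemma loc_int_AE:
 fixes v V :: "plane => 'b::euclidean_space"
 assumes V: "L1loc \<Omega> V" and v: "(%x. ind \<Omega> x *r v x) \<in> Borel"
  and eq: "AE x in lborel. x \<in> \<Omega> --> v x = c *r V x"
 shows "L1loc \<Omega> v"
 unfolding locally_integrable_def set_integrable_def
proof (intro allI impI)
 fix C assume C: "compact C & C \<subseteq> \<Omega>"
 then have [measurable]: "C \<in> sets borel" by (auto intro: borel_compact)
 have "L1 (%x. ind C x *r V x)" using V C by (auto simp: locally_integrable_def set_integrable_def)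
 then have "L1 (%x. c *r (ind C x *r V x))" by (rule integrable_scaleR_right)
 then have i: "L1 (%x. ind C x *r (c *r V x))" by (simp add: mult.commute)
 have e: "ind C x *r v x = ind C x *r (ind \<Omega> x *r v x)" for x using C by (auto simp: indicator_def)
 show "L1 (%x. ind C x *r v x)"
 proof (rule integrable_cong_AE[THEN iffD2, OF _ _ _ i])
  note [measurable] = v
  have "(%x. ind C x *r (ind \<Omega> x *r v x)) \<in> Borel" 
   by (rule borel_measurable_scaleR[OF _ v]) measurable
  then show "(%x. ind C x *r v x) \<in> borel_measurable lborel" unfolding e[symmetric] by simp
  show "(%x. ind C x *r (c *r V x)) \<in> borel_measurable lborel" by (rule borel_measurable_integrable[OF i])
  show "AE x in lborel. ind C x *r v x = ind C x *r (c *r V x)"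
   using eq
  proof eventually_elim
   case (elim x) then show ?case using C by (cases "x \<in> C") auto
  qed
 qed
qed

lemma Lp2_AE:
 fixes v V :: "plane => 'b::euclidean_space"
 assumes V: "Lp 2 \<Omega> V" and v: "(%x. ind \<Omega> x *r v x) \<in> Borel"
  and eq: "AE x in lborel. x \<in> \<Omega> --> v x = c *r V x"
 shows "Lp 2 \<Omega> v"
 unfolding Lp2_iff set_integrable_def
proof
 show "set_borel_measurable lborel \<Omega> v" using v by (simp add: set_borel_cut)
 have i: "L1 (%x. c^2 * (ind \<Omega> x *r (norm (V x))^2))" using V by (simp add: Lp2_iff set_integrable_def)
 have e: "ind \<Omega> x *r (norm (v x))^2 = (norm (ind \<Omega> x *r v x))^2" for x by (auto simp: indicator_def)
 show "L1 (%x. ind \<Omega> x *r (norm (v x))^2)"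
 proof (rule integrable_cong_AE[THEN iffD2, OF _ _ _ i])
  note [measurable] = v
  have "(%x. (norm (ind \<Omega> x *r v x))^2) \<in> Borel" by measurable
  then show "(%x. ind \<Omega> x *r (norm (v x))^2) \<in> borel_measurable lborel" unfolding e by simp
  show "(%x. c^2 * (ind \<Omega> x *r (norm (V x))^2)) \<in> borel_measurable lborel" by (rule borel_measurable_integrable[OF i])
  show "AE x in lborel. ind \<Omega> x *r (norm (v x))^2 = c^2 * (ind \<Omega> x *r (norm (V x))^2)"
   using eq by eventually_elim (auto simp: indicator_def power_mult_distrib)
 qed
qed

lemma weak_div_AE:
 assumes V: "weak_div \<Omega> V d" and v: "(%x. ind \<Omega> x *r v x) \<in> Borel" and \<Omega>: "open \<Omega>"
  and eq: "AE x in lborel. x \<in> \<Omega> --> v x = c *r V x"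
 shows "weak_div \<Omega> v (%x. c * d x)"
 unfolding weak_div_def
proof (intro conjI ballI)
 have l: "L1loc \<Omega> V" "L1loc \<Omega> d" using V by (auto simp: weak_div_def)
 show "L1loc \<Omega> v" by (rule loc_int_AE[OF l(1) v eq])
 show "L1loc \<Omega> (%x. c * d x)" using l(2) by (auto simp: locally_integrable_def)
 fix psi assume psi: "psi \<in> test_fun \<Omega>"
 have [measurable]: "(%x. ind \<Omega> x *r V x) \<in> Borel" by (rule locally_integrable_borel[OF l(1) \<Omega>])
 note [measurable] = v
 have [measurable]: "grad psi \<in> Borel"
  by (rule borel_vec2) (simp add: grad_def test_fun_borel[OF test_fun_dir[OF psi]])
 have "(LI x. (ind \<Omega> x *r v x) \<bullet> grad psi x) = (LI x. c * ((ind \<Omega> x *r V x) \<bullet> grad psi x))"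
 proof (rule integral_cong_AE)
  show "AE x in lborel. (ind \<Omega> x *r v x) \<bullet> grad psi x = c * ((ind \<Omega> x *r V x) \<bullet> grad psi x)"
   using eq by eventually_elim (auto simp: indicator_def)
 qed measurable
 also have "\<dots> = c * (LINT x:\<Omega>|lborel. V x \<bullet> grad psi x)" by (simp add: set_LI_def)
 also have "\<dots> = - (LINT x:\<Omega>|lborel. c * d x * psi x)"
  using V psi unfolding weak_div_def set_LI_def by (simp add: mult.assoc mult.left_commute[of _ c])
 finally show "(LINT x:\<Omega>|lborel. v x \<bullet> grad psi x) = - (LINT x:\<Omega>|lborel. c * d x * psi x)" by (simp add: set_LI_def)
qed

lemma normal_trace_zero_AE:
 assumes V: "normal_trace_zero \<Omega> V" and v: "(%x. ind \<Omega> x *r v x) \<in> Borel" and \<Omega>: "open \<Omega>"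
  and eq: "AE x in lborel. x \<in> \<Omega> --> v x = c *r V x"
 shows "normal_trace_zero \<Omega> v"
proof -
 obtain d where VL: "Lp 2 \<Omega> V" and d: "Lp 2 \<Omega> d" "weak_div \<Omega> V d"
  and tr: "!!\<phi> G. H1 \<Omega> \<phi> G ==> (LINT x:\<Omega>|lborel. V x \<bullet> G x + d x * \<phi> x) = 0"
  using V unfolding normal_trace_zero_def by blast
 have [measurable]: "(%x. ind \<Omega> x *r V x) \<in> Borel" "(%x. ind \<Omega> x *r d x) \<in> Borel"
  using VL d(1) by (auto simp: Lp2_iff set_borel_cut)
 note [measurable] = v
 have "Lp 2 \<Omega> (%x. c * d x)"
 proof (rule Lp2_AE[OF d(1)])
  have "(%x. c * (ind \<Omega> x *r d x)) \<in> Borel" by measurable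
  then show "(%x. ind \<Omega> x *r (c * d x)) \<in> Borel" by (simp add: mult.left_commute)
  show "AE x in lborel. x \<in> \<Omega> --> c * d x = c *r d x" by simp
 qed
 moreover have "(LINT x:\<Omega>|lborel. v x \<bullet> G x + c * d x * \<phi> x) = 0" if H: "H1 \<Omega> \<phi> G" for \<phi> G
 proof -
  have [measurable]: "(%x. ind \<Omega> x *r G x) \<in> Borel" "(%x. ind \<Omega> x *r \<phi> x) \<in> Borel"
   using H by (auto simp: H1_def Lp2_iff set_borel_cut)
  have e: "ind \<Omega> x *r (p \<bullet> q + r * s) = (ind \<Omega> x *r p) \<bullet> (ind \<Omega> x *r q) + (ind \<Omega> x *r r) * (ind \<Omega> x *r s)"
   for x and p q :: plane and r s :: real by (simp add: indicator_def)
  have "(LINT x:\<Omega>|lborel. v x \<bullet> G x + c * d x * \<phi> x) = (LI x. c * (ind \<Omega> x *r (V x \<bullet> G x + d x * \<phi> x)))"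
   unfolding set_LI_def
  proof (rule integral_cong_AE)
   have "(%x. c * (ind \<Omega> x *r d x)) \<in> Borel" by measurable
   then have [measurable]: "(%x. ind \<Omega> x *r (c * d x)) \<in> Borel" by (simp add: mult.left_commute)
   show "(%x. ind \<Omega> x *r (v x \<bullet> G x + c * d x * \<phi> x)) \<in> borel_measurable lborel" unfolding e by measurable
   show "(%x. c * ind \<Omega> x *r (V x \<bullet> G x + d x * \<phi> x)) \<in> borel_measurable lborel" unfolding e by measurable
   show "AE x in lborel. ind \<Omega> x *r (v x \<bullet> G x + c * d x * \<phi> x) = c * ind \<Omega> x *r (V x \<bullet> G x + d x * \<phi> x)"
    using eq by eventually_elim (auto simp: indicator_def algebra_simps)
  qed
  also have "\<dots> = 0" using tr[OF H] by (simp add: set_LI_def)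
  finally show ?thesis .
 qed
 ultimately show ?thesis unfolding normal_trace_zero_def
  using Lp2_AE[OF VL v eq] weak_div_AE[OF d(2) v \<Omega> eq] by blast
qed

lemma weak_div_unique:
 assumes d: "weak_div \<Omega> V d" and z: "weak_div \<Omega> V (%_. 0)" and \<Omega>: "open \<Omega>"
 shows "AE x in lborel. x \<in> \<Omega> --> d x = 0"
proof -
 have l: "L1loc \<Omega> d" using d by (simp add: weak_div_def)
 let ?d = "%x. ind \<Omega> x *r d x"
 have "AE x in lborel. x \<in> \<Omega> --> ?d x = 0"
 proof (rule fundamental_lemma[OF locally_integrable_borel[OF l \<Omega>] \<Omega>])
  show "set_integrable lborel (cbox a b) ?d" if "cbox a b \<subseteq> \<Omega>" for a b
   using locally_integrable_cut[OF l] that compact_cbox unfolding locally_integrable_def by blast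
  fix a b :: plane and c :: real assume "c > 0" "cbox a b \<subseteq> \<Omega>"
  then have "boxbump a b c \<in> test_fun \<Omega>" by (rule boxbump_test)
  then have "(LINT x:\<Omega>|lborel. d x * boxbump a b c x) = 0" using d z by (simp add: weak_div_def set_LI_def)
  then show "(LI y. boxbump a b c y * ?d y) = 0" by (simp add: set_LI_def mult_ac)
 qed
 then show ?thesis by eventually_elim auto
qed

section \<open>Average velocity and the Reynolds equation\<close>

text \<open>
  The fibre \<open>Z\<close> has finite measure, so the power \<open>r\<close> controls the first
  power.
\<close>

lemma section_integrable:
 fixes g :: "plane \<times> plane \<times> real => 'b::euclidean_space"
 assumes g: "Lp r (\<omega> \<times> Z) g" and r: "r >= 1" and [measurable]: "Z \<in> sets borel" and fin: "emeasure lborel Z < \<infinity>"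
 shows "AE x in lborel. x \<in> \<omega> --> L1 (%y. ind Z y *r g (x, y))"
proof -
 have m: "(%p. ind (\<omega> \<times> Z) p *r g p) \<in> Borel" using g by (simp add: Lp_def set_borel_cut)
 have "L1 (%p. ind (\<omega> \<times> Z) p *r (norm (g p) powr r))" using g by (simp add: Lp_def set_integrable_def)
 then have "integrable (lborel \<Otimes>\<^sub>M lborel) (%(x, y). ind (\<omega> \<times> Z) (x, y) *r (norm (g (x, y)) powr r))"
  unfolding lborel_prod by (simp add: split_beta')
 from lborel_pair.AE_integrable_fst[OF this] show ?thesis
 proof eventually_elim
  case (elim x)
  show ?case
  proof
   assume x: "x \<in> \<omega>"
   have e: "(%y. ind Z y *r g (x, y)) = (%y. ind (\<omega> \<times> Z) (x, y) *r g (x, y))"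
    using x by (auto simp: indicator_def fun_eq_iff)
   have "(%y. (x, y)) \<in> borel \<rightarrow>\<^sub>M borel" by (intro borel_measurable_continuous_onI continuous_intros)
   from measurable_compose[OF this m]
   have m': "(%y. ind Z y *r g (x, y)) \<in> borel_measurable lborel" unfolding e by simp
   have "L1 (%y. ind Z y + ind (\<omega> \<times> Z) (x, y) *r (norm (g (x, y)) powr r))"
    using elim fin by (intro L1_add integrable_real_indicator) auto
   then show "L1 (%y. ind Z y *r g (x, y))"
   proof (rule L1_bound[OF _ m'])
    show "AE y in lborel. norm (ind Z y *r g (x, y)) <= norm (ind Z y + ind (\<omega> \<times> Z) (x, y) *r (norm (g (x, y)) powr r))" (is "AE y in _. ?P y")
    proof (intro AE_I2)
     fix y
     show "?P y"
      using powr_ge_bound[of "norm (g (x, y))" r] r x by (cases "y \<in> Z") auto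
    qed
   qed
  qed
 qed
qed

text \<open>
  Fubini over the cell layer; the interval of heights is open, but no height outside it meets the
  layer.
\<close>

lemma macroscopic_average:
 fixes g :: "plane \<times> plane \<times> real => 'b::euclidean_space"
 assumes i: "L1 (%y. ind (Zcell h) y *r g (x, y))" and H: "!!z. h z <= H"
 shows "(LINT s:{0<..<H}|lborel. macroscopic h g x s) = (LINT y:Zcell h|lborel. g (x, y))"
proof -
 have "integrable (lborel \<Otimes>\<^sub>M lborel) (%(z, s). ind (Zcell h) (z, s) *r g (x, z, s))"
  using i unfolding lborel_prod by (simp add: split_beta')
 from lborel_pair.integral_snd[OF this]
 have "(LINT y:Zcell h|lborel. g (x, y)) = (LI s. LI z. ind (Zcell h) (z, s) *r g (x, z, s))"
  unfolding set_LI_def lborel_prod by (simp add: split_beta')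
 moreover have "ind {0<..<H} s *r macroscopic h g x s = (LI z. ind (Zcell h) (z, s) *r g (x, z, s))" for s
 proof (cases "s \<in> {0<..<H}")
  case True
  then have "macroscopic h g x s = (LI z. ind (Zcell h) (z, s) *r g (x, z, s))"
   unfolding macroscopic_def set_LI_def
   by (intro LI_cong refl) (auto simp: indicator_def Zcell_def)
  then show ?thesis using True by simp
 next
  case False
  have "(z, s) \<notin> Zcell h" for z using False H[of z] by (auto simp: Zcell_def)
  then show ?thesis using False by simp
 qed
 ultimately show ?thesis by (simp add: set_LI_def)
qed

lemma Zcell_borel: "h \<in> Borel ==> Zcell h \<in> sets borel"
proof -
 assume [measurable]: "h \<in> Borel"
 have "Zcell h = {y \<in> space borel. fst y \<in> cell & 0 < snd y & snd y < h (fst y)}" by (auto simp: Zcell_def)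
 also have "\<dots> \<in> sets borel" by measurable
 finally show ?thesis .
qed

lemma Zcell_finite: "(!!z. h z <= H) ==> emeasure lborel (Zcell h) < \<infinity>"
proof -
 assume H: "!!z. h z <= H"
 have "Zcell h \<subseteq> cell \<times> {0..H}" using H by (force simp: Zcell_def dest: less_le_trans[OF _ H])
 moreover have "bounded (cell \<times> {0..H})" by (intro bounded_Times) (auto simp: cell_box)
 ultimately show ?thesis using emeasure_bounded_finite bounded_subset by blast
qed

lemma Lp2_diff:
 fixes F G :: "plane => 'b::euclidean_space"
 assumes "Lp 2 \<Omega> F" "Lp 2 \<Omega> G" shows "Lp 2 \<Omega> (%x. F x - G x)"
proof -
 have [measurable]: "(%x. ind \<Omega> x *r F x) \<in> Borel" "(%x. ind \<Omega> x *r G x) \<in> Borel"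
  using assms by (auto simp: Lp_def set_borel_cut)
 have m [measurable]: "(%x. ind \<Omega> x *r (F x - G x)) \<in> Borel" unfolding scaleR_diff_right by measurable
 have e: "ind \<Omega> x *r (norm (F x - G x))^2 = (norm (ind \<Omega> x *r (F x - G x)))^2" for x by (auto simp: indicator_def)
 have "L1 (%x. 2 * (ind \<Omega> x *r (norm (F x))^2) + 2 * (ind \<Omega> x *r (norm (G x))^2))"
  using assms by (simp add: Lp2_iff set_integrable_def)
 then have "L1 (%x. ind \<Omega> x *r (norm (F x - G x))^2)"
 proof (rule L1_bound)
  show "(%x. ind \<Omega> x *r (norm (F x - G x))^2) \<in> borel_measurable lborel" unfolding e by measurable
  show "AE x in lborel. norm (ind \<Omega> x *r (norm (F x - G x))^2) <= norm (2 * (ind \<Omega> x *r (norm (F x))^2) + 2 * (ind \<Omega> x *r (norm (G x))^2))" (is "AE x in _. ?P x")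
  proof (intro AE_I2)
   fix x
   have "(norm (F x - G x))^2 <= (norm (F x) + norm (G x))^2" by (rule power_mono) (auto simp: norm_triangle_ineq4)
   also have "\<dots> <= 2 * (norm (F x))^2 + 2 * (norm (G x))^2" using sum_squares_bound[of "norm (F x)" "norm (G x)"] by (simp add: power2_sum)
   finally show "?P x"
    by (simp add: indicator_def)
  qed
 qed
 then show ?thesis using m by (simp add: Lp2_iff set_borel_cut set_integrable_def)
qed

lemma Lp2_inner:
 fixes F G :: "plane => 'b::euclidean_space"
 assumes "Lp 2 \<Omega> F" "Lp 2 \<Omega> G" shows "L1 (%x. ind \<Omega> x * (F x \<bullet> G x))"
proof -
 have [measurable]: "(%x. ind \<Omega> x *r F x) \<in> Borel" "(%x. ind \<Omega> x *r G x) \<in> Borel"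
  using assms by (auto simp: Lp_def set_borel_cut)
 have e: "ind \<Omega> x * (F x \<bullet> G x) = (ind \<Omega> x *r F x) \<bullet> (ind \<Omega> x *r G x)" for x by (auto simp: indicator_def)
 have "L1 (%x. ind \<Omega> x *r (norm (F x))^2 + ind \<Omega> x *r (norm (G x))^2)"
  using assms by (simp add: Lp2_iff set_integrable_def)
 then show ?thesis
 proof (rule L1_bound)
  show "(%x. ind \<Omega> x * (F x \<bullet> G x)) \<in> borel_measurable lborel" unfolding e by measurable
  show "AE x in lborel. norm (ind \<Omega> x * (F x \<bullet> G x)) <= norm (ind \<Omega> x *r (norm (F x))^2 + ind \<Omega> x *r (norm (G x))^2)" (is "AE x in _. ?P x")
  proof (intro AE_I2)
   fix x
   have "\<bar>F x \<bullet> G x\<bar> <= norm (F x) * norm (G x)" by (rule Cauchy_Schwarz_ineq2)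
   moreover have "2 * (norm (F x) * norm (G x)) <= (norm (F x))^2 + (norm (G x))^2" using sum_squares_bound[of "norm (F x)" "norm (G x)"] by simp
   moreover have "0 <= norm (F x) * norm (G x)" by simp
   ultimately have "\<bar>F x \<bullet> G x\<bar> <= (norm (F x))^2 + (norm (G x))^2" by linarith
   then show "?P x"
    by (simp add: indicator_def)
  qed
 qed
qed

lemma H1_diff:
 assumes \<Omega>: "open \<Omega>" and r: "H1 \<Omega> r Dr" and p: "H1 \<Omega> p Dp"
 shows "H1 \<Omega> (%x. r x - p x) (%x. Dr x - Dp x)"
proof -
 have i: "L1 (%x. ind \<Omega> x *r (psi x *r g x))" if psi: "psi \<in> test_fun \<Omega>" and g: "L1loc \<Omega> g"
  for psi and g :: "plane => real"
  using test_times_integrable[OF psi locally_integrable_borel[OF g \<Omega>] locally_integrable_cut[OF g]] by (simp add: mult.left_commute)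
 have "weak_deriv \<Omega> e (%x. g x - k x) (%x. D x - E x)" if g: "weak_deriv \<Omega> e g D" and k: "weak_deriv \<Omega> e k E"
  for e :: plane and g k D E :: "plane => real"
  unfolding weak_deriv_def
 proof (intro conjI ballI)
  have l: "L1loc \<Omega> g" "L1loc \<Omega> k" "L1loc \<Omega> D" "L1loc \<Omega> E" using g k by (auto simp: weak_deriv_def)
  show "L1loc \<Omega> (%x. g x - k x)" "L1loc \<Omega> (%x. D x - E x)"
   using l by (auto simp: locally_integrable_def intro!: set_integral_diff)
  fix psi assume psi: "psi \<in> test_fun \<Omega>"
  show "(LINT x:\<Omega>|lborel. dir_deriv e psi x *r (g x - k x)) = - (LINT x:\<Omega>|lborel. psi x *r (D x - E x))"
   using g k psi unfolding weak_deriv_def set_LI_def scaleR_diff_right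
   by (simp add: LI_diff[OF i[OF test_fun_dir[OF psi] l(1)] i[OF test_fun_dir[OF psi] l(2)], unfolded real_scaleR_def]
     LI_diff[OF i[OF psi l(3)] i[OF psi l(4)], unfolded real_scaleR_def])
 qed
 then show ?thesis using r p by (simp add: H1_def Lp2_diff weak_grad_def)
qed

context cell_solution
begin

lemma flux_L2:
 assumes "Lp 2 \<omega> F" shows "Lp 2 \<omega> (%x. c *r (A *v F x))"
proof -
 have [measurable]: "(%x. ind \<omega> x *r F x) \<in> Borel" using assms by (simp add: Lp_def set_borel_cut)
 have e: "ind \<omega> x *r (c *r (A *v F x)) = c *r (A *v (ind \<omega> x *r F x))" for x
  by (simp add: indicator_def)
 have "(%v. A *v v) \<in> Borel"
  by (intro borel_measurable_continuous_onI linear_continuous_on matrix_vector_mul_bounded_linear)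
 from measurable_compose[OF \<open>(%x. ind \<omega> x *r F x) \<in> Borel\<close> this]
 have m [measurable]: "(%x. A *v (ind \<omega> x *r F x)) \<in> Borel" .
 obtain B where B: "!!v. norm (A *v v) <= B * norm v"
  using bounded_linear.bounded[OF matrix_vector_mul_bounded_linear[of A]] by (auto simp: mult.commute)
 have n: "ind \<omega> x *r (norm (c *r (A *v F x)))^2 = (norm (c *r (A *v (ind \<omega> x *r F x))))^2" for x
  by (simp add: indicator_def)
 have "L1 (%x. (c * B)^2 * (ind \<omega> x *r (norm (F x))^2))" using assms by (simp add: Lp2_iff set_integrable_def)
 then have "L1 (%x. ind \<omega> x *r (norm (c *r (A *v F x)))^2)"
 proof (rule L1_bound)
  show "(%x. ind \<omega> x *r (norm (c *r (A *v F x)))^2) \<in> borel_measurable lborel" unfolding n by measurable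
  show "AE x in lborel. norm (ind \<omega> x *r (norm (c *r (A *v F x)))^2) <= norm ((c * B)^2 * (ind \<omega> x *r (norm (F x))^2))" (is "AE x in _. ?P x")
  proof (intro AE_I2)
   fix x
   have "(norm (A *v F x))^2 <= (B * norm (F x))^2" by (rule power_mono[OF B]) simp
   then have "c^2 * (norm (A *v F x))^2 <= c^2 * (B * norm (F x))^2" by (rule mult_left_mono) simp
   then show "?P x"
    by (auto simp: indicator_def power_mult_distrib abs_mult mult.assoc)
  qed
 qed
 moreover have "(%x. ind \<omega> x *r (c *r (A *v F x))) \<in> Borel" unfolding e by measurable
 ultimately show ?thesis by (simp add: Lp2_iff set_borel_cut set_integrable_def)
qed

text \<open>
  Testing the normal trace condition of both fluxes with the difference of the pressures gives that
  the energy of the gradient of this difference vanishes. The divergence that occurs in the trace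
  functional is zero because the flux is divergence free.
\<close>

theorem reynolds_unique:
 assumes \<omega>: "open \<omega>" "connected \<omega>" and c: "\<mu> > 0" "K > 0" and f: "Lp 2 \<omega> f"
  and r: "reynolds \<mu> K \<omega> A f r Dr" and p: "reynolds \<mu> K \<omega> A f p Dp"
 shows "AE x in lborel. x \<in> \<omega> --> r x = p x"
proof -
 let ?\<phi> = "%x. r x - p x" and ?G = "%x. Dr x - Dp x"
 have H: "H1 \<omega> ?\<phi> ?G" by (rule H1_diff[OF \<omega>(1)]) (use r p in \<open>auto simp: reynolds_def\<close>)
 have weak: "(LI x. ind \<omega> x * (((K / \<mu>) *r (A *v (Ds x - f x))) \<bullet> ?G x)) = 0
   & L1 (%x. ind \<omega> x * (((K / \<mu>) *r (A *v (Ds x - f x))) \<bullet> ?G x))"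
  if s: "reynolds \<mu> K \<omega> A f s Ds" for s Ds
 proof -
  let ?v = "%x. (K / \<mu>) *r (A *v (Ds x - f x))"
  have wz: "weak_div \<omega> ?v (%_. 0)" and nt: "normal_trace_zero \<omega> ?v" and vL: "Lp 2 \<omega> ?v"
   using s by (auto simp: reynolds_def normal_trace_zero_def)
  obtain d where d: "weak_div \<omega> ?v d" "Lp 2 \<omega> d" "(LINT x:\<omega>|lborel. ?v x \<bullet> ?G x + d x * ?\<phi> x) = 0"
   using nt H unfolding normal_trace_zero_def by blast
  have GL: "Lp 2 \<omega> ?G" and pL: "Lp 2 \<omega> ?\<phi>" using H by (auto simp: H1_def)
  have i: "L1 (%x. ind \<omega> x * (?v x \<bullet> ?G x))" by (rule Lp2_inner[OF vL GL])
  have i2: "L1 (%x. ind \<omega> x * (d x * ?\<phi> x))" using Lp2_inner[OF d(2) pL] by simp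
  have "AE x in lborel. ind \<omega> x * (d x * ?\<phi> x) = 0"
   using weak_div_unique[OF d(1) wz \<omega>(1)] by eventually_elim (auto simp: indicator_def)
  then have "(LI x. ind \<omega> x * (d x * ?\<phi> x)) = 0" by (rule integral_eq_zero_AE)
  then show ?thesis using d(3) LI_add[OF i i2] i
   by (simp add: set_LI_def distrib_left)
 qed
 have e: "ind \<omega> x * (((K / \<mu>) *r (A *v (Dr x - f x))) \<bullet> ?G x) - ind \<omega> x * (((K / \<mu>) *r (A *v (Dp x - f x))) \<bullet> ?G x)
  = ind \<omega> x * ((K / \<mu>) * (?G x \<bullet> (A *v ?G x)))" for x
  by (simp add: indicator_def matrix_vector_mult_diff_distrib inner_diff_left inner_diff_right inner_commute right_diff_distrib)
 have i: "L1 (%x. ind \<omega> x * ((K / \<mu>) * (?G x \<bullet> (A *v ?G x))))"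
  using L1_diff[OF weak[OF r, THEN conjunct2] weak[OF p, THEN conjunct2]] unfolding e .
 have z: "(LI x. ind \<omega> x * ((K / \<mu>) * (?G x \<bullet> (A *v ?G x)))) = 0"
  using LI_diff[OF weak[OF r, THEN conjunct2] weak[OF p, THEN conjunct2]]
  unfolding e weak[OF r, THEN conjunct1] weak[OF p, THEN conjunct1] by (rule trans) simp
 have "0 <= ind \<omega> x * ((K / \<mu>) * (?G x \<bullet> (A *v ?G x)))" for x using A_nonneg c by (simp add: indicator_def)
 then have "AE x in lborel. ind \<omega> x * ((K / \<mu>) * (?G x \<bullet> (A *v ?G x))) = 0"
  using integral_nonneg_eq_0_iff_AE[OF i] z by auto
 then have "AE x in lborel. x \<in> \<omega> --> ?G x = 0"
 proof eventually_elim
  case (elim x) then show ?case using A_definite[of "?G x"] c by (cases "x \<in> \<omega>") auto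
 qed
 moreover have "weak_grad \<omega> ?\<phi> ?G" using H by (simp add: H1_def)
 ultimately obtain k where k: "AE x in lborel. x \<in> \<omega> --> ?\<phi> x = k" using zero_grad_imp_const[OF \<omega>] by blast
 have ir: "L1 (%x. ind \<omega> x * r x)" "L1 (%x. ind \<omega> x * p x)"
  and zr: "(LI x. ind \<omega> x * r x) = 0" "(LI x. ind \<omega> x * p x) = 0"
  using r p by (auto simp: reynolds_def L2_0_def set_integrable_def set_LI_def)
 let ?s = "%x. k * (ind \<omega> x * r x - ind \<omega> x * p x)"
 have si: "L1 ?s" and zs: "(LI x. ?s x) = 0" using ir zr by simp_all
 have "AE x in lborel. 0 <= ?s x" using k by eventually_elim (auto simp: indicator_def)
 then have "AE x in lborel. ?s x = 0" using integral_nonneg_eq_0_iff_AE[OF si] zs by blast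
 with k show ?thesis by eventually_elim (auto simp: indicator_def)
qed

end

context homogenized_flow
begin

definition Fv :: "plane => plane" where "Fv x = (\<chi> i. F i x)"

lemma Fv_eq: "x \<in> \<omega> ==> Fv x = f x - Dp x" by (simp add: Fv_def F_def vec_eq_iff)

lemma D\<pi>_borel [measurable]: "D\<pi> i \<in> Borel" using L2per_D(1)[OF H1_perD(2)[OF corrector]] .

theorem velocity_formula:
 "AE y in lborel. y \<in> S --> horiz (u y) = (K / \<mu>) *r (profile M (h (fst (snd y))) (snd (snd y)) *r X (Fv (fst y)) (fst (snd y)))"
proof -
 define E where "E j y = (K / \<mu>) * (F 1 (fst y) * (axis 1 1 + D\<pi> 1 (fst (snd y))) $ j + F 2 (fst y) * (axis 2 1 + D\<pi> 2 (fst (snd y))) $ j)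
   * profile M (h (fst (snd y))) (snd (snd y))" for j and y :: "plane \<times> plane \<times> real"
 have XE: "E j y = (K / \<mu>) * (profile M (h (fst (snd y))) (snd (snd y)) * X (Fv (fst y)) (fst (snd y)) $ j)" for j y
  by (simp add: E_def X_def Fv_def sum_2)
 have [measurable]: "E j \<in> Borel" for j
  unfolding E_def profile_def A1star_def A2star_def by measurable
 have one: "AE y in lborel. y \<in> S --> w j y = E j y" for j
 proof (rule AE_triple_conv)
  show "Measurable.pred borel (%y. y \<in> S --> w j y = E j y)" by measurable
  show "AE p in lborel. AE s in lborel. (fst p, snd p, s) \<in> S --> w j (fst p, snd p, s) = E j (fst p, snd p, s)"
   using velocity_profile[of j] pressure_structure[of j]
  proof eventually_elim
   case (elim p)
   show ?case
   proof (cases "fst p \<in> \<omega>")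
    case True
    then have G: "G j p = X (Fv (fst p)) (snd p) $ j" using elim(2) by (simp add: mem_Times_iff Fv_def)
    have "AE s in lborel. 0 < s & s < h (snd p) --> w j (fst p, snd p, s) = (K / \<mu>) * G j p * profile M (h (snd p)) s"
     using elim(1) True by (simp add: mem_Times_iff)
    then show ?thesis by eventually_elim (auto simp: XE G Zper_def)
   qed simp
  qed
 qed
 from one[of 1] one[of 2] show ?thesis
  by eventually_elim (auto simp: vec_eq_iff forall_2 w_def XE)
qed

theorem average_velocity:
 "AE x in lborel. x \<in> \<omega> --> L1 (%y. ind (Zcell h) y *r u (x, y)) &
  horiz (LINT y:Zcell h|lborel. u (x, y)) = (K / \<mu>) *r (A *v Fv x)"
proof -
 have "Lp 2 (\<omega> \<times> Zcell h) u" using V by (simp add: V_z3_def)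
 then have int: "AE x in lborel. x \<in> \<omega> --> L1 (%y. ind (Zcell h) y *r u (x, y))"
  by (rule section_integrable) (use Zcell_borel[OF h_borel] Zcell_finite[of h h_max] hbd in auto)
 show ?thesis
  using int AE_pair[OF W_G[of 1]] AE_pair[OF W_G[of 2]] AE_pair[OF pressure_structure[of 1]] AE_pair[OF pressure_structure[of 2]]
 proof eventually_elim
  case (elim x)
  show ?case
  proof
   assume x: "x \<in> \<omega>"
   with elim(1) have i: "L1 (%y. ind (Zcell h) y *r u (x, y))" by blast
   have "horiz (LINT y:Zcell h|lborel. u (x, y)) $ j = ((K / \<mu>) *r (A *v Fv x)) $ j" for j
   proof -
    let ?j = "if j = 1 then 1 else 2 :: 3"
    have W: "AE z in lborel. W j (x, z) = (K / \<mu>) * (a z * G j (x, z))" and P: "AE z in lborel. (x, z) \<in> \<omega> \<times> UNIV --> G j (x, z) = X (Fv x) z $ j"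
     using elim(2-5) exhaust_2[of j] by (auto simp: Fv_def)
    have ij: "L1 (%y. ind (Zcell h) y * u (x, y) $ ?j)"
     using integrable_inner_left[OF i, of "axis ?j 1"] by (simp add: inner_axis)
    have e: "ind (Zcell h) y * u (x, y) $ ?j = ind cell (fst y) * w j (x, y)" for y
     using x by (cases y) (auto simp: w_def indicator_def Zcell_def Zper_def horiz_nth)
    have ip: "integrable (lborel \<Otimes>\<^sub>M lborel) (%(z, s). ind cell z * w j (x, z, s))"
     using ij unfolding e lborel_prod by (simp add: split_beta')
    have "horiz (LINT y:Zcell h|lborel. u (x, y)) $ j = (LI y. ind (Zcell h) y * u (x, y) $ ?j)"
     using integral_nth[OF i, of ?j] unfolding horiz_nth set_LI_def by simp
    also have "\<dots> = (LI z. ind cell z * W j (x, z))"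
     unfolding e using lborel_pair.integral_fst[OF ip] unfolding lborel_prod by (simp add: split_beta' W_def)
    also have "\<dots> = (LI z. (K / \<mu>) * (ind cell z * (a z * X (Fv x) z $ j)))"
    proof (rule integral_cong_AE)
     have [measurable]: "X (Fv x) \<in> Borel" by (rule L2per_D(1)[OF X_L2])
     show "(%z. ind cell z * W j (x, z)) \<in> borel_measurable lborel" by measurable
     show "(%z. (K / \<mu>) * (ind cell z * (a z * X (Fv x) z $ j))) \<in> borel_measurable lborel" by measurable
     show "AE z in lborel. ind cell z * W j (x, z) = (K / \<mu>) * (ind cell z * (a z * X (Fv x) z $ j))"
      using W P by eventually_elim (use x in simp)
    qed
    also have "\<dots> = ((K / \<mu>) *r (A *v Fv x)) $ j" by (simp add: A_apply)
    finally show ?thesis .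
   qed
   with i show "L1 (%y. ind (Zcell h) y *r u (x, y)) & horiz (LINT y:Zcell h|lborel. u (x, y)) = (K / \<mu>) *r (A *v Fv x)"
    by (simp add: vec_eq_iff)
  qed
 qed
qed

end

section \<open>The temperature\<close>

lemma AE_triple_fst:
 assumes "AE p in lborel. P p"
 shows "AE y in lborel. P (fst y, fst (snd (y :: plane \<times> plane \<times> real)))"
proof -
 obtain N where N: "{p. \<not> P p} \<subseteq> N" "N \<in> null_sets lborel"
  using assms by (auto elim!: AE_E simp: null_sets_def)
 have [measurable]: "N \<in> sets borel" using N(2) by auto
 have "AE y in lborel. (fst y, fst (snd (y :: plane \<times> plane \<times> real))) \<notin> N"
 proof (rule AE_triple_conv)
  show "AE p in lborel. AE s in lborel. (fst (fst p, snd p, s), fst (snd (fst p, snd p, s::real))) \<notin> N"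
   using AE_not_in[OF N(2)] by eventually_elim simp
 qed measurable
 then show ?thesis by eventually_elim (use N(1) in auto)
qed

lemma AE_section:
 assumes "AE y in lborel. P (y :: plane \<times> plane \<times> real)"
 shows "AE x in lborel. AE y in lborel. P (x, y)"
proof -
 have "AE p in lborel \<Otimes>\<^sub>M lborel. P p" using assms unfolding lborel_prod .
 then show ?thesis by (rule lborel_pair.AE_pair)
qed

lemma LINT_endpoints:
 fixes k m :: "real => real"
 assumes m: "m \<in> Borel" and eq: "!!\<tau>. \<tau> ~= a ==> \<tau> ~= b ==> k \<tau> = m \<tau>"
 shows "(LI \<tau>. k \<tau>) = (LI \<tau>. m \<tau>)"
proof (rule integral_cong_AE)
 have "k = (%\<tau>. if \<tau> = a then k a else if \<tau> = b then k b else m \<tau>)" using eq by auto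
 moreover have "(%\<tau>. if \<tau> = a then k a else if \<tau> = b then k b else m \<tau>) \<in> Borel" using m by measurable
 ultimately show "k \<in> borel_measurable lborel" by simp
 show "AE \<tau> in lborel. k \<tau> = m \<tau>" using AE_lborel_singleton[of a] AE_lborel_singleton[of b] by eventually_elim (rule eq)
qed (use m in simp)

lemma primitive_integrable:
 fixes \<phi> :: "real => real"
 assumes \<phi>: "L1 \<phi>"
 shows "L1 (%r. ind {s..H} r * (LINT \<tau>:{0..r}|lborel. \<phi> \<tau>))"
  and "(%r. LINT \<tau>:{0..r}|lborel. \<phi> \<tau>) \<in> Borel"
proof -
 have [measurable]: "\<phi> \<in> Borel" using \<phi> by auto
 have e: "(LINT \<tau>:{0..r}|lborel. \<phi> \<tau>) = (LI \<tau>. (if 0 <= \<tau> & \<tau> <= r then \<phi> \<tau> else 0))" for r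
  unfolding set_LI_def by (intro LI_cong) auto
 show m [measurable]: "(%r. LINT \<tau>:{0..r}|lborel. \<phi> \<tau>) \<in> Borel" unfolding e by measurable
 have "L1 (%r. ind {s..H} r * (LI \<tau>. \<bar>\<phi> \<tau>\<bar>))"
  using emeasure_compact_finite[OF compact_Icc, of s H] by (intro integrable_mult_left integrable_real_indicator) auto
 then show "L1 (%r. ind {s..H} r * (LINT \<tau>:{0..r}|lborel. \<phi> \<tau>))"
 proof (rule L1_bound)
  show "AE r in lborel. norm (ind {s..H} r * (LINT \<tau>:{0..r}|lborel. \<phi> \<tau>)) <= norm (ind {s..H} r * (LI \<tau>. \<bar>\<phi> \<tau>\<bar>))" (is "AE r in _. ?P r")
  proof (intro AE_I2)
   fix r
   have "\<bar>LINT \<tau>:{0..r}|lborel. \<phi> \<tau>\<bar> <= (LI \<tau>. \<bar>\<phi> \<tau>\<bar>)"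
    unfolding set_LI_def
    by (rule order_trans[OF integral_abs_bound], rule integral_mono_AE')
     (use \<phi> in \<open>auto simp: indicator_def\<close>)
   then show "?P r"
    by (simp add: indicator_def)
  qed
 qed measurable
qed

text \<open>
  Both inner integrals are differences of the primitive \<open>r \<mapsto> \<integral>{0..r}
  \<phi>\<close>. The function \<open>\<rho>\<close> is prescribed on the open interval only; two
  points do not matter.
\<close>

lemma double_integral_identity:
 fixes \<phi> \<rho> :: "real => real"
 assumes \<phi>: "L1 \<phi>" and s: "0 < s" "s < H" and eq: "!!\<tau>. 0 < \<tau> ==> \<tau> < H ==> \<rho> \<tau> = \<phi> \<tau>"
 shows "(LINT \<xi>:{s..H}|lborel. LINT \<tau>:{\<xi>..H}|lborel. \<rho> \<tau>) - (H - s) * (LINT \<xi>:{0..H}|lborel. \<rho> \<xi>)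
  = - (LINT r:{s..H}|lborel. LINT \<tau>:{0..r}|lborel. \<phi> \<tau>)"
proof -
 have [measurable]: "\<phi> \<in> Borel" using \<phi> by auto
 let ?I = "%r. LINT \<tau>:{0..r}|lborel. \<phi> \<tau>"
 have i: "L1 (%r. ind {a..b} r * \<phi> r)" for a b
  by (rule L1_bound[OF \<phi>]) (auto simp: indicator_def)
 have r: "(LINT \<tau>:{\<xi>..H}|lborel. \<rho> \<tau>) = (LINT \<tau>:{\<xi>..H}|lborel. \<phi> \<tau>)" if "0 <= \<xi>" for \<xi>
  unfolding set_LI_def
  by (rule LINT_endpoints[where a=0 and b=H]) (use that in \<open>auto simp: indicator_def eq\<close>)
 have "(LINT \<xi>:{s..H}|lborel. LINT \<tau>:{\<xi>..H}|lborel. \<rho> \<tau>) = (LI \<xi>. ind {s..H} \<xi> * ?I H - ind {s..H} \<xi> * ?I \<xi>)"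
  unfolding set_LI_def[of _ "{s..H}"]
 proof (intro LI_cong refl)
  fix \<xi>
  show "ind {s..H} \<xi> *r (LINT \<tau>:{\<xi>..H}|lborel. \<rho> \<tau>) = ind {s..H} \<xi> * ?I H - ind {s..H} \<xi> * ?I \<xi>"
   using r[of \<xi>] LINT_split[OF i, of 0 \<xi> H] s by (cases "\<xi> \<in> {s..H}") auto
 qed
 also have "\<dots> = (H - s) * ?I H - (LINT r:{s..H}|lborel. ?I r)"
  using s primitive_integrable(1)[OF \<phi>, of s H] unfolding set_LI_def[of _ "{s..H}"] by (subst LI_diff) auto
 finally show ?thesis using r[of 0] by simp
qed

lemma norm2_sq: "(norm v)^2 = (v $ 1)^2 + (v $ 2)^2" for v :: plane
 unfolding power2_norm_eq_inner by (simp add: inner_vec_def sum_2 power2_eq_square)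

context limit_flow
begin

definition \<Theta> :: "plane \<times> plane \<times> real => real" where
 "\<Theta> y = \<mu> / K * ((w 1 y)^2 + (w 2 y)^2) + \<mu>eff * ((d 1 y)^2 + (d 2 y)^2)"

lemma \<Theta>_borel [measurable]: "\<Theta> \<in> Borel" unfolding \<Theta>_def by measurable

lemma \<Theta>_eq: "\<Theta> y = ind S y * dissipation \<mu> \<mu>eff K (u y) (Du y)"
 by (simp add: \<Theta>_def w_def d_def dissipation_def norm2_sq indicator_def)

lemma dissipation_up:
 assumes loc: "L1loc S (%y. dissipation \<mu> \<mu>eff K (u y) (Du y))"
 shows "loc_int_up \<omega> h (%y. dissipation \<mu> \<mu>eff K (u y) (Du y))"
proof (rule Lp_loc_int_up[OF \<omega> hc hpos hper loc])
 let ?\<Phi> = "%y. dissipation \<mu> \<mu>eff K (u y) (Du y)" and ?Z = "\<omega> \<times> Zcell h"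
 show "periodic (%z. ?\<Phi> (x, z, s))" for x s
  using V by (simp add: V_z3_def periodic_def)
 have [measurable]: "?Z \<in> sets borel" by (rule borel_Times[OF \<omega>_borel Zcell_borel[OF h_borel]])
 have cut: "ind ?Z y * ?\<Phi> y = ind ?Z y * \<Theta> y" for y
  unfolding \<Theta>_eq by (auto simp: indicator_def Zcell_def Zper_def)
 have m: "(%y. ind ?Z y * ?\<Phi> y) \<in> Borel" unfolding cut by measurable
 have "L1 (%y. \<mu> / K * (ind ?Z y * (norm (u y))^2) + \<mu>eff * (ind ?Z y * (norm (Du y))^2))"
  using V by (simp add: V_z3_def Lp2_iff set_integrable_def)
 then have "L1 (%y. ind ?Z y * ?\<Phi> y)"
 proof (rule L1_bound)
  show "AE y in lborel. norm (ind ?Z y * ?\<Phi> y) <= norm (\<mu> / K * (ind ?Z y * (norm (u y))^2) + \<mu>eff * (ind ?Z y * (norm (Du y))^2))" (is "AE y in _. ?P y")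
  proof (intro AE_I2)
   fix y
   have hn: "(norm (horiz v))^2 <= (norm v)^2" for v :: "real^3"
    unfolding norm2_sq power2_norm_eq_inner by (simp add: horiz_nth12 inner_vec_def sum_3 power2_eq_square)
   have b: "\<mu> / K * (norm (horiz (u y)))^2 <= \<mu> / K * (norm (u y))^2" "\<mu>eff * (norm (horiz (Du y)))^2 <= \<mu>eff * (norm (Du y))^2"
    by (rule mult_left_mono[OF hn], use pos in simp)+
   have "0 <= ?\<Phi> y" using pos unfolding dissipation_def by simp
   moreover have "?\<Phi> y <= \<mu> / K * (norm (u y))^2 + \<mu>eff * (norm (Du y))^2"
    unfolding dissipation_def by (rule add_mono[OF b])
   ultimately show "?P y"
    by (simp add: indicator_def)
  qed
 qed (use m in simp)
 then have "L1 (%y. norm (ind ?Z y * ?\<Phi> y))" by (rule integrable_norm)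
 then show "Lp 1 ?Z ?\<Phi>" using m by (simp add: Lp_def set_borel_cut set_integrable_def abs_mult)
qed simp

text \<open>
  The bottom condition gives \<open>DT\<close> as \<open>- 1 / k\<close> times the sum of
  \<open>b\<close> and the dissipation below, and the top condition gives \<open>T\<close> as minus
  the integral of \<open>DT\<close> above. To pass from almost every fibre to almost every point, the
  resulting right-hand side is first written as a Borel function \<open>E\<close>.
\<close>

theorem temperature_formula:
 assumes k: "k > 0" and q: "1 < q" and VT: "V_z3 q \<omega> h T DT"
  and wd: "weak_deriv (\<omega> \<times> Zper h) e3 DT (%y. - (1 / k) * dissipation \<mu> \<mu>eff K (u y) (Du y))"
  and top: "trace_top \<omega> h T DT (%_. 0)"
  and bot: "trace_bottom \<omega> h (%y. - k * DT y) (%y. dissipation \<mu> \<mu>eff K (u y) (Du y)) (%(x, z). b x)"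
 shows "AE (x, z, s) in lborel. (x, z, s) \<in> S -->
     T (x, z, s) =
      - (b x / k) * (s - h z)
      - \<mu> / (k * K) *
        ((LINT \<xi>:{s..h z}|lborel. LINT \<tau>:{\<xi>..h z}|lborel. (norm (horiz (u (x, z, \<tau>))))^2)
        - (h z - s) * (LINT \<xi>:{0..h z}|lborel. (norm (horiz (u (x, z, \<xi>))))^2))
      - \<mu>eff / k *
        ((LINT \<xi>:{s..h z}|lborel. LINT \<tau>:{\<xi>..h z}|lborel. (norm (horiz (Du (x, z, \<tau>))))^2)
        - (h z - s) * (LINT \<xi>:{0..h z}|lborel. (norm (horiz (Du (x, z, \<xi>))))^2))"
proof -
 let ?\<Phi> = "%y. dissipation \<mu> \<mu>eff K (u y) (Du y)"
 have hM: "!!z. h z <= h_max" using hbd by auto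
 have "L1loc S (%y. - (1 / k) * ?\<Phi> y)" using wd by (simp add: weak_deriv_def)
 then have loc: "L1loc S ?\<Phi>"
  unfolding locally_integrable_def
 proof (intro allI impI)
  fix C assume "\<forall>C. compact C & C \<subseteq> S --> set_integrable lborel C (%y. - (1 / k) * ?\<Phi> y)" "compact C & C \<subseteq> S"
  then have "set_integrable lborel C (%y. - (1 / k) * ?\<Phi> y)" by blast
  then have "set_integrable lborel C (%y. (- k) * (- (1 / k) * ?\<Phi> y))" by (rule set_integrable_mult_right)
  then show "set_integrable lborel C ?\<Phi>" using k by simp
 qed
 have up: "loc_int_up \<omega> h T" "loc_int_up \<omega> h DT" using V_z3_loc_int_up[OF VT _ \<omega> hc hpos hper] q by auto
 have up\<Phi>: "loc_int_up \<omega> h ?\<Phi>" by (rule dissipation_up[OF loc])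
 have upk: "loc_int_up \<omega> h (%y. - k * DT y)"
  using up(2) unfolding loc_int_up_def by (intro allI impI set_integrable_mult_right) auto
 have \<Theta>_loc: "L1loc UNIV \<Theta>" using loc_int_up_cut[OF up\<Phi> \<omega> hc] unfolding \<Theta>_eq[abs_def] by simp
 have \<Theta>_vert: "AE p in lborel. L1 (%s. \<Theta> (fst p, snd p, s))"
  by (rule AE_vertical_integrable[OF \<Theta>_loc]) (simp add: \<Theta>_eq)
 define T' DT' where "T' y = ind S y * T y" and "DT' y = ind S y * DT y" for y
 have [measurable]: "T' \<in> Borel" "DT' \<in> Borel"
  using loc_int_up_cut[OF up(1) \<omega> hc] loc_int_up_cut[OF up(2) \<omega> hc] by (auto simp: T'_def[abs_def] DT'_def[abs_def])
 have tl: "L1loc (\<omega> \<times> UNIV) (%(x, z::real^2). b x)" using bot by (simp add: trace_bottom_def)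
 define b' where "b' p = ind (\<omega> \<times> UNIV) p * b (fst p)" for p :: "plane \<times> plane"
 have [measurable]: "b' \<in> Borel"
  using locally_integrable_borel[OF tl open_Times[OF \<omega> open_UNIV]] by (simp add: b'_def[abs_def] split_beta')
 have bF: "AE y in lborel. y \<in> S --> - k * DT y = (case (fst y, fst (snd y)) of (x, z) => b x) +
  (LINT r:{0..snd (snd y)}|lborel. ind S (fst y, fst (snd y), r) * ?\<Phi> (fst y, fst (snd y), r))"
 proof (rule bottom_FTC[OF \<omega> hc hpos hM upk up\<Phi> tl])
  fix psi :: "plane \<times> plane \<times> real => real" assume psi: "psi \<in> test_fun {(x, z, s). x \<in> \<omega> & s < h z}"
  then show "(LINT y:S|lborel. dir_deriv e3 psi y * (- k * DT y) + psi y * ?\<Phi> y) = - (LINT (x, z):\<omega> \<times> UNIV|lborel. psi (x, z, 0) * (case (x, z) of (x, z) => b x))"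
   using bot unfolding trace_bottom_def by simp
 qed
 have tF: "AE y in lborel. y \<in> S --> T y = 0 -
  (LINT r:{snd (snd y)..h (fst (snd y))}|lborel. ind S (fst y, fst (snd y), r) * DT (fst y, fst (snd y), r))"
 proof (rule top_FTC[OF \<omega> hc hpos hM up(1,2) zero_loc])
  fix psi :: "plane \<times> plane \<times> real => real" assume psi: "psi \<in> test_fun {(x, z, s). x \<in> \<omega> & 0 < s}"
  then show "(LINT y:S|lborel. dir_deriv e3 psi y * T y + psi y * DT y) = (LINT (x, z):\<omega> \<times> UNIV|lborel. psi (x, z, h z) * 0)"
   using top unfolding trace_top_def by simp
 qed
 define E where "E y = (1 / k) * (b' (fst y, fst (snd y)) * (h (fst (snd y)) - snd (snd y)) +
  (LI r. (if snd (snd y) <= r & r <= h (fst (snd y)) then (LI \<tau>. (if 0 <= \<tau> & \<tau> <= r then \<Theta> (fst y, fst (snd y), \<tau>) else 0)) else 0)))"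
  for y :: "plane \<times> plane \<times> real"
 have [measurable]: "E \<in> Borel" unfolding E_def by measurable
 have E_eq: "E (x, z, s) = (1 / k) * (b' (x, z) * (h z - s) + (LINT r:{s..h z}|lborel. LINT \<tau>:{0..r}|lborel. \<Theta> (x, z, \<tau>)))" for x z s
 proof -
  have 1: "(LINT \<tau>:{0..r}|lborel. \<Theta> (x, z, \<tau>)) = (LI \<tau>. (if 0 <= \<tau> & \<tau> <= r then \<Theta> (x, z, \<tau>) else 0))" for r
   unfolding set_LI_def by (intro LI_cong) auto
  have "(LINT r:{s..h z}|lborel. LINT \<tau>:{0..r}|lborel. \<Theta> (x, z, \<tau>)) = (LI r. (if s <= r & r <= h z then (LI \<tau>. (if 0 <= \<tau> & \<tau> <= r then \<Theta> (x, z, \<tau>) else 0)) else 0))"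
   unfolding 1 unfolding set_LI_def by (intro LI_cong) auto
  then show ?thesis unfolding E_def fst_conv snd_conv by simp
 qed
 have TE: "AE y in lborel. y \<in> S --> T' y = E y"
 proof (rule AE_triple_conv)
  show "Measurable.pred borel (%y. y \<in> S --> T' y = E y)" by measurable
  show "AE p in lborel. AE s in lborel. (fst p, snd p, s) \<in> S --> T' (fst p, snd p, s) = E (fst p, snd p, s)"
   using AE_triple[OF bF] AE_triple[OF tF] \<Theta>_vert
  proof eventually_elim
   case (elim p)
   obtain x z where p: "p = (x, z)" by (cases p)
   let ?I = "%r. LINT \<tau>:{0..r}|lborel. \<Theta> (x, z, \<tau>)"
   have iT: "L1 (%s. \<Theta> (x, z, s))" using elim(3) by (simp add: p)
   note I = primitive_integrable[OF iT]
   show ?case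
   proof (cases "x \<in> \<omega>")
    case True
    have b: "b' (x, z) = b x" using True by (simp add: b'_def)
    have D: "AE r in lborel. 0 < r & r < h z --> DT' (x, z, r) = - (1 / k) * (b x + ?I r)"
     using elim(1)
    proof eventually_elim
     case (elim r)
     then show ?case using True k by (auto simp: p DT'_def Zper_def \<Theta>_eq field_simps)
    qed
    show ?thesis using elim(2)
    proof eventually_elim
     case (elim s)
     show ?case
     proof
      assume "(fst p, snd p, s) \<in> S"
      then have s: "0 < s" "s < h z" and inS: "(x, z, s) \<in> S" by (auto simp: p Zper_def)
      have Ds: "T' (x, z, s) = - (LI r. ind {s..h z} r * DT' (x, z, r))"
       using elim inS by (simp add: p T'_def DT'_def set_LI_def)
      have "(LI r. ind {s..h z} r * DT' (x, z, r)) = (LI r. - (1 / k) * (ind {s..h z} r * b x + ind {s..h z} r * ?I r))"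
      proof (rule integral_cong_AE)
       show "(%r. ind {s..h z} r * DT' (x, z, r)) \<in> borel_measurable lborel" by measurable
       show "(%r. - (1 / k) * (ind {s..h z} r * b x + ind {s..h z} r * ?I r)) \<in> borel_measurable lborel"
        using I(2) by measurable
       show "AE r in lborel. ind {s..h z} r * DT' (x, z, r) = - (1 / k) * (ind {s..h z} r * b x + ind {s..h z} r * ?I r)"
        using D AE_lborel_singleton[of "h z"]
       proof eventually_elim
        case (elim r) then show ?case using s by (cases "r \<in> {s..h z}") auto
       qed
      qed
      also have "\<dots> = - (1 / k) * (LI r. ind {s..h z} r * b x + ind {s..h z} r * ?I r)"
       by (rule integral_mult_right_zero)
      also have "(LI r. ind {s..h z} r * b x + ind {s..h z} r * ?I r) = b x * (h z - s) + (LINT r:{s..h z}|lborel. ?I r)"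
       using s I(1)[of s "h z"] unfolding set_LI_def[of _ "{s..h z}"]
       by (subst LI_add) (auto simp: mult.commute)
      finally have "T' (x, z, s) = (1 / k) * (b x * (h z - s) + (LINT r:{s..h z}|lborel. ?I r))" unfolding Ds by simp
      then show "T' (fst p, snd p, s) = E (fst p, snd p, s)" by (simp only: p fst_conv snd_conv E_eq b)
     qed
    qed
   qed (simp add: p)
  qed
 qed
 from TE AE_triple_fst[OF \<Theta>_vert] show ?thesis
 proof eventually_elim
  case (elim y)
  obtain x z s where y: "y = (x, z, s)" by (metis prod.exhaust)
  let ?U = "%\<tau>. (norm (horiz (u (x, z, \<tau>))))^2" and ?D = "%\<tau>. (norm (horiz (Du (x, z, \<tau>))))^2"
  let ?\<phi> = "%\<tau>. (w 1 (x, z, \<tau>))^2 + (w 2 (x, z, \<tau>))^2" and ?\<delta> = "%\<tau>. (d 1 (x, z, \<tau>))^2 + (d 2 (x, z, \<tau>))^2"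
  show ?case unfolding y split
  proof
   assume inS: "(x, z, s) \<in> S"
   then have x: "x \<in> \<omega>" and s: "0 < s" "s < h z" by (auto simp: Zper_def)
   have iT: "L1 (%\<tau>. \<Theta> (x, z, \<tau>))" using elim(2) by (simp add: y)
   have nn: "0 <= ?\<phi> \<tau>" "0 <= ?\<delta> \<tau>" for \<tau> by auto
   have le: "\<mu> / K * ?\<phi> \<tau> <= \<Theta> (x, z, \<tau>)" "\<mu>eff * ?\<delta> \<tau> <= \<Theta> (x, z, \<tau>)" for \<tau>
    using mult_nonneg_nonneg[OF less_imp_le[OF pos(2)] nn(2)[of \<tau>]] mult_nonneg_nonneg[OF less_imp_le[OF divide_pos_pos[OF pos(1,3)]] nn(1)[of \<tau>]] unfolding \<Theta>_def by linarith+
   have bd: "L1 g" if [measurable]: "g \<in> Borel" and g: "!!\<tau>. 0 <= g \<tau>" "!!\<tau>. g \<tau> <= \<Theta> (x, z, \<tau>)" for g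
   proof (rule L1_bound[OF iT])
    show "AE \<tau> in lborel. norm (g \<tau>) <= norm (\<Theta> (x, z, \<tau>))" (is "AE \<tau> in _. ?P \<tau>")
    proof (intro AE_I2)
     fix \<tau> show "?P \<tau>" using g[of \<tau>] by simp
    qed
   qed measurable
   have i1: "L1 (%\<tau>. \<mu> / K * ?\<phi> \<tau>)" by (rule bd[OF _ _ le(1)]) (use pos in auto)
   have i2: "L1 (%\<tau>. \<mu>eff * ?\<delta> \<tau>)" by (rule bd[OF _ _ le(2)]) (use pos in auto)
   have i\<phi>: "L1 ?\<phi>" and i\<delta>: "L1 ?\<delta>"
    using integrable_mult_right[OF i1, of "K / \<mu>"] integrable_mult_right[OF i2, of "1 / \<mu>eff"] pos by simp_all
   have U: "?U \<tau> = ?\<phi> \<tau>" and D: "?D \<tau> = ?\<delta> \<tau>" if "0 < \<tau>" "\<tau> < h z" for \<tau>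
    using x that by (simp_all add: w_def d_def norm2_sq Zper_def)
   have id1: "(LINT \<xi>:{s..h z}|lborel. LINT \<tau>:{\<xi>..h z}|lborel. ?U \<tau>) - (h z - s) * (LINT \<xi>:{0..h z}|lborel. ?U \<xi>)
     = - (LINT r:{s..h z}|lborel. LINT \<tau>:{0..r}|lborel. ?\<phi> \<tau>)"
    by (rule double_integral_identity[OF i\<phi> s]) (rule U)
   have id2: "(LINT \<xi>:{s..h z}|lborel. LINT \<tau>:{\<xi>..h z}|lborel. ?D \<tau>) - (h z - s) * (LINT \<xi>:{0..h z}|lborel. ?D \<xi>)
     = - (LINT r:{s..h z}|lborel. LINT \<tau>:{0..r}|lborel. ?\<delta> \<tau>)"
    by (rule double_integral_identity[OF i\<delta> s]) (rule D)
   have "(LINT \<tau>:{0..r}|lborel. \<Theta> (x, z, \<tau>)) = \<mu> / K * (LINT \<tau>:{0..r}|lborel. ?\<phi> \<tau>) + \<mu>eff * (LINT \<tau>:{0..r}|lborel. ?\<delta> \<tau>)" for r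
   proof -
    have c: "set_integrable lborel {0..r} g" if "L1 g" for g :: "real => real"
     unfolding set_integrable_def by (rule integrable_mult_indicator[OF _ that]) simp
    show ?thesis unfolding \<Theta>_def set_integral_add(2)[OF c[OF i1] c[OF i2]] by simp
   qed
   then have "(LINT r:{s..h z}|lborel. LINT \<tau>:{0..r}|lborel. \<Theta> (x, z, \<tau>))
    = (LINT r:{s..h z}|lborel. \<mu> / K * (LINT \<tau>:{0..r}|lborel. ?\<phi> \<tau>) + \<mu>eff * (LINT \<tau>:{0..r}|lborel. ?\<delta> \<tau>))" by simp
   also have "\<dots> = \<mu> / K * (LINT r:{s..h z}|lborel. LINT \<tau>:{0..r}|lborel. ?\<phi> \<tau>) + \<mu>eff * (LINT r:{s..h z}|lborel. LINT \<tau>:{0..r}|lborel. ?\<delta> \<tau>)"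
   proof -
    have c: "set_integrable lborel {s..h z} (%r. c * (LINT \<tau>:{0..r}|lborel. g \<tau>))" if "L1 g" for c and g :: "real => real"
     by (rule set_integrable_mult_right) (use primitive_integrable(1)[OF that, of s "h z"] in \<open>simp add: set_integrable_def\<close>)
    show ?thesis unfolding set_integral_add(2)[OF c[OF i\<phi>] c[OF i\<delta>]] by simp
   qed
   finally have "T (x, z, s) = (1 / k) * (b x * (h z - s) + (\<mu> / K * (LINT r:{s..h z}|lborel. LINT \<tau>:{0..r}|lborel. ?\<phi> \<tau>) + \<mu>eff * (LINT r:{s..h z}|lborel. LINT \<tau>:{0..r}|lborel. ?\<delta> \<tau>)))"
    using elim(1) inS x by (simp add: y T'_def b'_def E_eq)
   also have "\<dots> = - (b x / k) * (s - h z) - \<mu> / (k * K) * (- (LINT r:{s..h z}|lborel. LINT \<tau>:{0..r}|lborel. ?\<phi> \<tau>)) - \<mu>eff / k * (- (LINT r:{s..h z}|lborel. LINT \<tau>:{0..r}|lborel. ?\<delta> \<tau>))"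
    using k pos by (simp add: field_simps)
   finally show "T (x, z, s) = - (b x / k) * (s - h z)
      - \<mu> / (k * K) * ((LINT \<xi>:{s..h z}|lborel. LINT \<tau>:{\<xi>..h z}|lborel. ?U \<tau>) - (h z - s) * (LINT \<xi>:{0..h z}|lborel. ?U \<xi>))
      - \<mu>eff / k * ((LINT \<xi>:{s..h z}|lborel. LINT \<tau>:{\<xi>..h z}|lborel. ?D \<tau>) - (h z - s) * (LINT \<xi>:{0..h z}|lborel. ?D \<xi>))"
    by (simp only: id1 id2)
  qed
 qed
qed

end

section \<open>The homogenized flow\<close>

theorem corollary5p2:
  fixes \<omega> :: "(real^2) set" and h :: "real^2 \<Rightarrow> real"
    and h_min h_max \<mu> \<mu>eff K k q M :: real
    and f :: "real^2 \<Rightarrow> real^2" and b :: "real^2 \<Rightarrow> real"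
    and u Du :: "(real^2) \<times> (real^2) \<times> real \<Rightarrow> real^3"
    and p :: "real^2 \<Rightarrow> real" and Dp :: "real^2 \<Rightarrow> real^2"
    and T DT :: "(real^2) \<times> (real^2) \<times> real \<Rightarrow> real"
    and V_av :: "real^2 \<Rightarrow> real^3" and T_av :: "real^2 \<Rightarrow> real"
  assumes "open \<omega>" and "connected \<omega>" and "lipschitz_boundary \<omega>"
    and "W1inf h" and "periodic h"
    and "0 < h_min" and "h_min \<in> range h" and "h_max \<in> range h"
    and "\<And>z. h_min \<le> h z \<and> h z \<le> h_max"
    and "\<mu> > 0" and "\<mu>eff > 0" and "K > 0" and "k > 0"
    and "1 < q" and "q < 3/2"
    and "Lp 2 \<omega> f"
    and "limit_system \<mu> \<mu>eff K k q \<omega> h f b u Du p Dp T DT"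
    and V_av_eq: "\<And>x. V_av x = (LINT s:{0<..<h_max}|lborel. macroscopic h u x s)"
    and T_av_eq: "\<And>x. T_av x = (LINT s:{0<..<h_max}|lborel. macroscopic h T x s)"
    and "weak_div \<omega> (\<lambda>x. horiz (V_av x)) (\<lambda>_. 0)"
    and "normal_trace_zero \<omega> (\<lambda>x. horiz (V_av x))"
    and M_eq: "M = sqrt (\<mu> / (K * \<mu>eff))"
  shows "(\<forall>i. \<exists>\<pi> D\<pi>. cell_problem h M i \<pi> D\<pi> \<and>
            (\<forall>\<rho> D\<rho>. cell_problem h M i \<rho> D\<rho> \<longrightarrow> (\<exists>c. AE z in lborel. \<rho> z = \<pi> z + c))) \<and>
    (\<forall>\<pi> D\<pi>. (\<forall>i. cell_problem h M i (\<pi> i) (D\<pi> i)) \<longrightarrow>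
       (AE x\<in>\<omega> in lborel.
          horiz (V_av x) = - (K / \<mu>) *\<^sub>R (A_mat h M D\<pi> *v (Dp x - f x)) \<and> V_av x $ 3 = 0) \<and>
       (reynolds \<mu> K \<omega> (A_mat h M D\<pi>) f p Dp \<and>
        (\<forall>r Dr. reynolds \<mu> K \<omega> (A_mat h M D\<pi>) f r Dr \<longrightarrow> (AE x\<in>\<omega> in lborel. r x = p x))) \<and>
       (AE x\<in>\<omega> in lborel. T_av x = (LINT y:Zcell h|lborel. T (x, y))) \<and>
       (AE (x, z, s) in lborel. (x, z, s) \<in> \<omega> \<times> Zcell h \<longrightarrow>
          T (x, z, s) =
            - (b x / k) * (s - h z)
            - \<mu> / (k * K) *
                ((LINT \<xi>:{s..h z}|lborel. LINT \<tau>:{\<xi>..h z}|lborel. (norm (horiz (u (x, z, \<tau>))))\<^sup>2)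
                 - (h z - s) * (LINT \<xi>:{0..h z}|lborel. (norm (horiz (u (x, z, \<xi>))))\<^sup>2))
            - \<mu>eff / k *
                ((LINT \<xi>:{s..h z}|lborel. LINT \<tau>:{\<xi>..h z}|lborel. (norm (horiz (Du (x, z, \<tau>))))\<^sup>2)
                 - (h z - s) * (LINT \<xi>:{0..h z}|lborel. (norm (horiz (Du (x, z, \<xi>))))\<^sup>2))) \<and>
       (AE (x, z, s) in lborel. (x, z, s) \<in> \<omega> \<times> Zcell h \<longrightarrow>
          horiz (u (x, z, s)) =
            (K / \<mu>) *\<^sub>R (\<Sum>i\<in>UNIV. ((f x $ i - Dp x $ i) *
               (A1star M (h z) * exp (M * s) + A2star M (h z) * exp (- M * s) + 1)) *\<^sub>R
                 (axis i 1 + D\<pi> i z))))"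
proof -
 obtain \<pi> where pres: "pressure_L2_0_per \<omega> \<pi>" and mom: "momentum_eq \<mu> \<mu>eff K \<omega> h u Du \<pi> f Dp"
  using assms(17) unfolding limit_system_def by blast
 have sys: "V_z3 2 \<omega> h u Du" "AE y\<in>\<omega> \<times> Zcell h in lborel. u y $ 3 = 0" "L2_0 \<omega> p" "H1 \<omega> p Dp" "V_z3 q \<omega> h T DT"
  "cell_div_eq \<omega> h u" "weak_deriv (\<omega> \<times> Zper h) e3 DT (%y. - (1 / k) * dissipation \<mu> \<mu>eff K (u y) (Du y))"
  "trace_bottom \<omega> h (%y. horiz (u y)) (%y. horiz (Du y)) (%_. 0)"
  "trace_top \<omega> h (%y. horiz (u y)) (%y. horiz (Du y)) (%_. 0)"
  "trace_top \<omega> h T DT (%_. 0)"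
  "trace_bottom \<omega> h (%y. - k * DT y) (%y. dissipation \<mu> \<mu>eff K (u y) (Du y)) (%(x, z). b x)"
  using assms(17) unfolding limit_system_def by blast+
 have hc: "continuous_on UNIV h" using assms(4) by (simp add: W1inf_def)
 interpret flow: limit_flow \<omega> h h_min h_max \<mu> \<mu>eff K M f u Du Dp \<pi>
  by unfold_locales (use assms sys pres mom hc in \<open>auto simp: H1_def\<close>)
 interpret rough: rough_cell h h_min h_max M
  by unfold_locales (use assms hc flow.M_pos in auto)
 have cellp: "\<forall>i. \<exists>\<pi> D\<pi>. cell_problem h M i \<pi> D\<pi> &
      (\<forall>\<rho> D\<rho>. cell_problem h M i \<rho> D\<rho> --> (\<exists>c. AE z in lborel. \<rho> z = \<pi> z + c))"
  using rough.cell_problem_exists rough.cell_problem_unique by meson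
 have Z: "Zcell h \<in> sets borel" "emeasure lborel (Zcell h) < \<infinity>"
  using Zcell_borel[OF flow.h_borel] Zcell_finite[of h h_max] assms(9) by auto
 have hM: "!!z. h z <= h_max" using assms(9) by auto
 have T_av: "AE x\<in>\<omega> in lborel. T_av x = (LINT y:Zcell h|lborel. T (x, y))"
 proof -
  have "AE x in lborel. x \<in> \<omega> --> L1 (%y. ind (Zcell h) y *r T (x, y))"
   by (rule section_integrable[OF _ _ Z]) (use sys(5) assms(14) in \<open>auto simp: V_z3_def\<close>)
  then show ?thesis
  proof eventually_elim
   case (elim x)
   show ?case unfolding T_av_eq using macroscopic_average[where h=h and g=T and x=x, OF _ hM] elim by blast
  qed
 qed
 have inS: "(x, z, s) \<in> \<omega> \<times> Zper h" if "(x, z, s) \<in> \<omega> \<times> Zcell h" for x z s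
  using that by (auto simp: Zcell_def Zper_def)
 note temp = flow.temperature_formula[OF assms(13,14) sys(5,7,10,11)]
 have main: "(AE x\<in>\<omega> in lborel. horiz (V_av x) = - (K / \<mu>) *r (A_mat h M D\<pi> *v (Dp x - f x)) & V_av x $ 3 = 0) &
   (reynolds \<mu> K \<omega> (A_mat h M D\<pi>) f p Dp &
    (\<forall>r Dr. reynolds \<mu> K \<omega> (A_mat h M D\<pi>) f r Dr --> (AE x\<in>\<omega> in lborel. r x = p x))) &
   (AE (x, z, s) in lborel. (x, z, s) \<in> \<omega> \<times> Zcell h -->
     horiz (u (x, z, s)) =
      (K / \<mu>) *r (\<Sum>i\<in>UNIV. ((f x $ i - Dp x $ i) *
       (A1star M (h z) * exp (M * s) + A2star M (h z) * exp (- M * s) + 1)) *r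
        (axis i 1 + D\<pi> i z)))"
  if cell: "\<forall>i. cell_problem h M i (\<pi>s i) (D\<pi> i)" for \<pi>s D\<pi>
 proof -
  interpret homogenized_flow \<omega> h h_min h_max \<mu> \<mu>eff K M f u Du Dp \<pi> \<pi>s D\<pi>
   by unfold_locales (use cell in blast)
  let ?v = "%x. (K / \<mu>) *r (A *v (Dp x - f x))"
  have "AE x in lborel. AE y in lborel. (x, y) \<in> \<omega> \<times> Zcell h --> u (x, y) $ 3 = 0" by (rule AE_section[OF sys(2)])
  with average_velocity have av: "AE x in lborel. x \<in> \<omega> --> horiz (V_av x) = - ?v x & V_av x $ 3 = 0"
  proof eventually_elim
   case (elim x)
   show ?case
   proof
    assume x: "x \<in> \<omega>"
    then have i: "L1 (%y. ind (Zcell h) y *r u (x, y))" using elim(1) by blast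
    have Va: "V_av x = (LINT y:Zcell h|lborel. u (x, y))" unfolding V_av_eq by (rule macroscopic_average[OF i hM])
    have "AE y in lborel. (ind (Zcell h) y *r u (x, y)) $ 3 = 0"
     using elim(2) by eventually_elim (use x in \<open>auto simp: indicator_def\<close>)
    then have "V_av x $ 3 = 0" unfolding Va set_LI_def integral_nth[OF i] by (rule integral_eq_zero_AE)
    moreover have "horiz (V_av x) = - ?v x"
     using elim(1) x unfolding Va by (simp add: Fv_eq matrix_vector_mult_diff_distrib algebra_simps)
    ultimately show "horiz (V_av x) = - ?v x & V_av x $ 3 = 0" by blast
   qed
  qed
  have v: "(%x. ind \<omega> x *r ?v x) \<in> Borel"
   using flux_L2[OF Lp2_diff[OF flow.DpL flow.fL], of "K / \<mu>"] by (simp add: Lp_def set_borel_cut)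
  have eq: "AE x in lborel. x \<in> \<omega> --> ?v x = (- 1) *r horiz (V_av x)" using av by eventually_elim auto
  have rey: "reynolds \<mu> K \<omega> A f p Dp"
   using weak_div_AE[OF assms(20) v assms(1) eq] normal_trace_zero_AE[OF assms(21) v assms(1) eq] sys(3,4)
   by (simp add: reynolds_def)
  have un: "AE x\<in>\<omega> in lborel. r x = p x" if "reynolds \<mu> K \<omega> A f r Dr" for r Dr
   by (rule reynolds_unique[OF assms(1,2,10,12,16) that rey])
  have vel: "AE (x, z, s) in lborel. (x, z, s) \<in> \<omega> \<times> Zcell h -->
     horiz (u (x, z, s)) =
      (K / \<mu>) *r (\<Sum>i\<in>UNIV. ((f x $ i - Dp x $ i) *
       (A1star M (h z) * exp (M * s) + A2star M (h z) * exp (- M * s) + 1)) *r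
        (axis i 1 + D\<pi> i z))"
   using velocity_formula
  proof eventually_elim
   case (elim y)
   obtain x z s where y: "y = (x, z, s)" by (metis prod.exhaust)
   show ?case unfolding y split
   proof
    assume a: "(x, z, s) \<in> \<omega> \<times> Zcell h"
    then have "x \<in> \<omega>" by simp
    have "horiz (u (x, z, s)) = (K / \<mu>) *r (profile M (h z) s *r X (Fv x) z)" using elim inS[OF a] by (simp add: y)
    also have "profile M (h z) s *r X (Fv x) z = (\<Sum>i\<in>UNIV. ((f x $ i - Dp x $ i) * profile M (h z) s) *r (axis i 1 + D\<pi> i z))"
     unfolding X_def scaleR_sum_right Fv_eq[OF \<open>x \<in> \<omega>\<close>] by (intro sum.cong refl) (simp add: mult.commute)
    finally show "horiz (u (x, z, s)) =
      (K / \<mu>) *r (\<Sum>i\<in>UNIV. ((f x $ i - Dp x $ i) *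
       (A1star M (h z) * exp (M * s) + A2star M (h z) * exp (- M * s) + 1)) *r
        (axis i 1 + D\<pi> i z))" unfolding profile_def .
   qed
  qed
  show ?thesis using av rey un vel by auto
 qed
 have temp': "AE (x, z, s) in lborel. (x, z, s) \<in> \<omega> \<times> Zcell h -->
     T (x, z, s) =
      - (b x / k) * (s - h z)
      - \<mu> / (k * K) *
        ((LINT \<xi>:{s..h z}|lborel. LINT \<tau>:{\<xi>..h z}|lborel. (norm (horiz (u (x, z, \<tau>))))^2)
        - (h z - s) * (LINT \<xi>:{0..h z}|lborel. (norm (horiz (u (x, z, \<xi>))))^2))
      - \<mu>eff / k *
        ((LINT \<xi>:{s..h z}|lborel. LINT \<tau>:{\<xi>..h z}|lborel. (norm (horiz (Du (x, z, \<tau>))))^2)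
        - (h z - s) * (LINT \<xi>:{0..h z}|lborel. (norm (horiz (Du (x, z, \<xi>))))^2))"
  using temp by eventually_elim (use inS in \<open>auto split: prod.splits\<close>)
 show ?thesis using cellp main T_av temp' by blast
qed

end
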